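(* Let $n\ge 5$, $N\ge 2$, let $\mathbf{A}\in\mathbb{S}(N\times n)$ be a rank-one positive tensor and let $f\in L^2(\mathbb{R}^n)^N$. Then the problem $$\mathbf{A}:D^2u=f\quad\text{a.e. on }\mathbb{R}^n$$ has a unique solution $u$ in the space $W^{2,2}_\ast(\mathbb{R}^n)^N$, which satisfies $$\|u\|_{L^{2^{**}}(\mathbb{R}^n)}+\|Du\|_{L^{2^{*}}(\mathbb{R}^n)}+\|D^2u\|_{L^{2}(\mathbb{R}^n)}\le C\|f\|_{L^2(\mathbb{R}^n)}$$ for some $C>0$ depending only on $\mathbf{A}$, $n$ and $N$, and also satisfies $$\|D^2u\|_{L^2(\mathbb{R}^n)}\le\frac{1}{\nu(\mathbf{A})}\|\mathbf{A}:D^2u\|_{L^2(\mathbb{R}^n)}.$$ Moreover, the solution is represented by $$u=-\frac{1}{4\pi^2}\lim_{m\to\infty}\left\{\widehat{h_m}\ast\left[\frac{\operatorname{cof}(\mathbf{A}:\operatorname{sgn}\otimes\operatorname{sgn})^\top}{\det(\mathbf{A}:\operatorname{sgn}\otimes\operatorname{sgn})}\,\overset{\vee}{f}\right]^{\wedge}\right\},$$ where $(h_m)_{m=1}^\infty\subseteq\mathcal{S}(\mathbb{R}^n)$ is any sequence of even functions in the Schwartz class such that $0\le h_m(x)\le\frac{1}{|x|^2}$ and $h_m(x)\to\frac{1}{|x|^2}$ as $m\to\infty$, for a.e. $x\in\mathbb{R}^n$. The limit is meant in the weak $L^{2^{**}}$ sense as well as a.e. on $\mathbb{R}^n$, and $u$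 is independent of the choice of the sequence $(h_m)_{m=1}^\infty$.
   Context: Notation. Repeated indices are summed ($i,j$ over $1,\dots,n$; $\alpha,\beta$ over $1,\dots,N$). $\mathbb{S}(N\times n)$ is the set of real tensors $\mathbf{A}=(\mathbf{A}_{\alpha\beta ij})$ with $\mathbf{A}_{\alpha\beta ij}=\mathbf{A}_{\beta\alpha ji}$. $\mathbf{A}:D^2u$ is the $\mathbb{R}^N$-valued map with components $(\mathbf{A}:D^2u)_\alpha=\mathbf{A}_{\alpha\beta ij}D^2_{ij}u_\beta$. The ellipticity constant is $$\nu(\mathbf{A}):=\min\{\mathbf{A}_{\alpha\beta ij}\eta_\alpha a_i\eta_\beta a_j:\ \eta\in\mathbb{R}^N,\ a\in\mathbb{R}^n,\ |\eta|=|a|=1\},$$ and $\mathbf{A}$ is called rank-one positive if $\nu(\mathbf{A})>0$. Norms $|\cdot|$ are Euclidean. For $a\in\mathbb{R}^n$, $\mathbf{A}:a\otimes a$ is the symmetric $N\times N$ matrix with entries $(\mathbf{A}:a\otimes a)_{\alpha\beta}=\mathbf{A}_{\alpha\beta ij}a_ia_j$. $\operatorname{sgn}:\mathbb{R}^n\to\mathbb{R}^n$ is $\operatorname{sgn}(x)=x/|x|$ for $x\ne0$, $\operatorname{sgn}(0)=0$. $\operatorname{cof}(X)$ is the cofactor matrix of $X\in\mathbb{R}^{N\times N}$, so that $X\operatorname{cof}(X)^\top=\operatorname{cof}(X)^\top X=\det(X)I$. The expression in square brackets is the function $z\mapsto\frac{\operatorname{cof}(\mathbf{A}:\operatorname{sgn}(z)\otimes\operatorname{sgn}(z))^\top}{\det(\mathbf{A}:\operatorname{sgn}(z)\otimes\operatorname{sgn}(z))}\overset{\vee}{f}(z)$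 (matrix acting on a vector, defined for a.e. $z$); the convolution with the scalar function $\widehat{h_m}$ is componentwise. Fourier conventions: $\widehat{u}(z)=\int_{\mathbb{R}^n}u(x)e^{-2\pi i x\cdot z}\,dx$, $\overset{\vee}{u}(x)=\int_{\mathbb{R}^n}u(z)e^{2\pi i x\cdot z}\,dz$, extended to $L^2$ as usual; $[\cdot]^\wedge$ denotes the Fourier transform. Function space: with $2^*=\frac{2n}{n-2}$ and $2^{**}=\frac{2n}{n-4}$, $$W^{2,2}_\ast(\mathbb{R}^n)^N:=\big\{u\in L^{2^{**}}(\mathbb{R}^n)^N\ \big|\ Du\in L^{2^*}(\mathbb{R}^n)^{Nn},\ D^2u\in L^2(\mathbb{R}^n)^{Nn^2}\big\}$$ (weak derivatives).
   Formalization: The limit a.e. on R^n is stated up to subsequences: every subsequence of the approximations has a further subsequence converging a.e. to u. Convergence a.e. of the full sequence fails for some f and some admissible (h_m). The weak L^{2**} limit is for the full sequence. *)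

theory Defs
  imports "HOL-Analysis.Analysis"
begin

section \<open>Tensors and ellipticity\<close>

text \<open>A tensor of type \<open>real^'n^'n^'N^'N\<close> has entries \<open>A $ \<alpha> $ \<beta> $ i $ j\<close>. The Jacobian
  matrix \<open>Du\<close> of a map from \<open>real^'n\<close> to \<open>real^'N\<close> has entries \<open>Du $ \<alpha> $ i\<close> and its Hessian
  has entries \<open>D2u $ \<alpha> $ i $ j\<close>; the library norm on these iterated vector types is the
  Euclidean (Frobenius) norm.\<close>

definition sym_tensors :: "(real^'n^'n^'N^'N) set" where
  "sym_tensors = {A. \<forall>\<alpha> \<beta> i j. A $ \<alpha> $ \<beta> $ i $ j = A $ \<beta> $ \<alpha> $ j $ i}"

definition contract2 :: "real^'n^'n^'N^'N \<Rightarrow> real^'n^'n^'N \<Rightarrow> real^'N" where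
  "contract2 A H =
    (\<chi> \<alpha>. \<Sum>\<beta>\<in>UNIV. \<Sum>i\<in>UNIV. \<Sum>j\<in>UNIV. A $ \<alpha> $ \<beta> $ i $ j * H $ \<beta> $ i $ j)"

definition rank_one_form :: "real^'n^'n^'N^'N \<Rightarrow> real^'N \<Rightarrow> real^'n \<Rightarrow> real" where
  "rank_one_form A \<eta> a =
    (\<Sum>\<alpha>\<in>UNIV. \<Sum>\<beta>\<in>UNIV. \<Sum>i\<in>UNIV. \<Sum>j\<in>UNIV.
       A $ \<alpha> $ \<beta> $ i $ j * \<eta> $ \<alpha> * a $ i * \<eta> $ \<beta> * a $ j)"

definition ellipticity :: "real^'n^'n^'N^'N \<Rightarrow> real" where
  "ellipticity A = Inf {rank_one_form A \<eta> a | \<eta> a. norm \<eta> = 1 \<and> norm a = 1}"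

text \<open>The infimum is a minimum.\<close>

lemma ellipticity_attained:
  fixes A :: "real^'n^'n^'N^'N"
  shows "(\<exists>\<eta> a. norm \<eta> = 1 \<and> norm a = 1 \<and> ellipticity A = rank_one_form A \<eta> a) \<and>
    (\<forall>\<eta> a. norm \<eta> = 1 \<longrightarrow> norm a = 1 \<longrightarrow> ellipticity A \<le> rank_one_form A \<eta> a)"
proof -
  let ?S = "sphere (0::real^'N) 1 \<times> sphere (0::real^'n) 1"
  let ?q = "\<lambda>p. rank_one_form A (fst p) (snd p)"
  let ?V = "{rank_one_form A \<eta> a | \<eta> a. norm \<eta> = 1 \<and> norm a = 1}"
  have V: "?V = ?q ` ?S"
    by (force simp: image_iff)
  have "continuous_on ?S ?q"
    unfolding rank_one_form_def by (intro continuous_intros)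
  moreover have "compact ?S"
    by (intro compact_Times compact_sphere)
  ultimately have cpt: "compact ?V"
    unfolding V by (rule compact_continuous_image)
  obtain \<eta>0 :: "real^'N" where \<eta>0: "norm \<eta>0 = 1"
    using vector_choose_size[of 1] by auto
  obtain a0 :: "real^'n" where a0: "norm a0 = 1"
    using vector_choose_size[of 1] by auto
  have ne: "?V \<noteq> {}"
    using \<eta>0 a0 by blast
  have bdd: "bdd_below ?V"
    by (rule bounded_imp_bdd_below[OF compact_imp_bounded[OF cpt]])
  have "ellipticity A \<in> ?V"
    unfolding ellipticity_def by (rule closed_contains_Inf[OF ne bdd compact_imp_closed[OF cpt]])
  then have "\<exists>\<eta> a. norm \<eta> = 1 \<and> norm a = 1 \<and> ellipticity A = rank_one_form A \<eta> a"
    by (elim CollectE exE conjE) (intro exI conjI)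
  moreover have "ellipticity A \<le> rank_one_form A \<eta> a" if "norm \<eta> = 1" "norm a = 1" for \<eta> a
    unfolding ellipticity_def
    by (rule cInf_lower[OF _ bdd], rule CollectI, intro exI conjI, rule refl) (use that in auto)
  ultimately show ?thesis by (intro conjI allI impI)
qed

definition rank_one_positive :: "real^'n^'n^'N^'N \<Rightarrow> bool" where
  "rank_one_positive A \<longleftrightarrow> ellipticity A > 0"

definition symbol_matrix :: "real^'n^'n^'N^'N \<Rightarrow> real^'n \<Rightarrow> real^'N^'N" where
  "symbol_matrix A a = (\<chi> \<alpha> \<beta>. \<Sum>i\<in>UNIV. \<Sum>j\<in>UNIV. A $ \<alpha> $ \<beta> $ i $ j * a $ i * a $ j)"

text \<open>The index type carries no order, so the cofactor \<open>(i, j)\<close> is written as the determinant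
  of \<open>X\<close> with row \<open>i\<close> replaced by the \<open>j\<close>-th unit vector; by expansion along that row this is
  the usual signed minor.\<close>

definition cof :: "real^'N^'N \<Rightarrow> real^'N^'N" where
  "cof X = (\<chi> i j. det (\<chi> k. if k = i then axis j 1 else X $ k))"

lemma cof_identity: "X ** transpose (cof X) = mat (det X)"
proof -
  have "(X ** transpose (cof X)) $ k $ i = mat (det X) $ k $ i" for k i
  proof -
    have "(X ** transpose (cof X)) $ k $ i =
        (\<Sum>j\<in>UNIV. X $ k $ j * det (\<chi> l. if l = i then axis j 1 else X $ l))"
      by (simp add: matrix_matrix_mult_def transpose_def cof_def)
    also have "\<dots> = (\<Sum>j\<in>UNIV. det (\<chi> l. if l = i then X $ k $ j *s axis j 1 else X $ l))"
      by (intro sum.cong[OF refl]) (subst det_row_mul, rule refl)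
    also have "\<dots> = det (\<chi> l. if l = i then (\<Sum>j\<in>UNIV. X $ k $ j *s axis j 1) else X $ l)"
      by (rule det_linear_row_sum[OF finite, symmetric])
    also have "(\<Sum>j\<in>UNIV. X $ k $ j *s axis j 1) = X $ k"
      by (rule basis_expansion)
    also have "det (\<chi> l. if l = i then X $ k else X $ l) = mat (det X) $ k $ i"
    proof (cases "k = i")
      case True
      then have "(\<chi> l. if l = i then X $ k else X $ l) = X"
        by (simp add: vec_eq_iff)
      with True show ?thesis by (simp add: mat_def)
    next
      case False
      then have "det (\<chi> l. if l = i then X $ k else X $ l) = 0"
        by (intro det_identical_rows[of k i]) (auto simp: row_def vec_eq_iff)
      with False show ?thesis by (simp add: mat_def)
    qed
    finally show ?thesis .
  qed
  then show ?thesis by (simp add: vec_eq_iff)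
qed


section \<open>Lebesgue spaces\<close>

definition Lp :: "real \<Rightarrow> (real^'n \<Rightarrow> 'b::euclidean_space) set" where
  "Lp p = {f. f \<in> borel_measurable lebesgue \<and> integrable lebesgue (\<lambda>x. norm (f x) powr p)}"

definition Lp_norm :: "real \<Rightarrow> (real^'n \<Rightarrow> 'b::euclidean_space) \<Rightarrow> real" where
  "Lp_norm p f = (LINT x|lebesgue. norm (f x) powr p) powr (1 / p)"

text \<open>Weak convergence in \<open>L\<^sup>p\<close> for complex vector-valued maps, \<open>1 < p < \<infinity>\<close>, tested against
  the dual space \<open>L\<^sup>q\<close> with \<open>q = p / (p - 1)\<close>.\<close>

definition weakly_converges_Lp ::
    "real \<Rightarrow> (nat \<Rightarrow> real^'n \<Rightarrow> complex^'N) \<Rightarrow> (real^'n \<Rightarrow> complex^'N) \<Rightarrow> bool" where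
  "weakly_converges_Lp p U v \<longleftrightarrow>
     (\<forall>m. U m \<in> Lp p) \<and> v \<in> Lp p \<and>
     (\<forall>\<phi>\<in>Lp (p / (p - 1)).
        (\<lambda>m. LINT x|lebesgue. (\<Sum>\<alpha>\<in>UNIV. U m x $ \<alpha> * \<phi> x $ \<alpha>))
          \<longlonglongrightarrow> (LINT x|lebesgue. (\<Sum>\<alpha>\<in>UNIV. v x $ \<alpha> * \<phi> x $ \<alpha>)))"

text \<open>Almost everywhere convergence up to subsequences: every subsequence has a further
  subsequence converging a.e. to the same limit. For the approximations \<open>approx_solution\<close> below,
  a.e. convergence of the full sequence fails for some admissible multipliers: \<open>1 / |x|\<^sup>2 - h m\<close>
  may be supported in a far-away shell on a set adapted to the phase of \<open>exp (2 \<pi> i x \<bullet> y)\<close>, with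
  every point \<open>y\<close> being treated infinitely often.\<close>

definition ae_converges_subseq ::
    "(nat \<Rightarrow> real^'n \<Rightarrow> 'b::euclidean_space) \<Rightarrow> (real^'n \<Rightarrow> 'b) \<Rightarrow> bool" where
  "ae_converges_subseq U v \<longleftrightarrow>
     (\<forall>r::nat\<Rightarrow>nat. strict_mono r \<longrightarrow>
        (\<exists>s::nat\<Rightarrow>nat. strict_mono s \<and> (AE x in lebesgue. (\<lambda>m. U (r (s m)) x) \<longlonglongrightarrow> v x)))"


section \<open>Smooth functions, test functions and weak derivatives\<close>

definition partial_deriv :: "'n \<Rightarrow> (real^'n \<Rightarrow> real) \<Rightarrow> real^'n \<Rightarrow> real" where
  "partial_deriv i f x = frechet_derivative f (at x) (axis i 1)"

definition smooth :: "(real^'n \<Rightarrow> real) \<Rightarrow> bool" where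
  "smooth f \<longleftrightarrow> (\<forall>is x. foldr partial_deriv is f differentiable (at x))"

definition test_function :: "(real^'n \<Rightarrow> real) \<Rightarrow> bool" where
  "test_function \<phi> \<longleftrightarrow> smooth \<phi> \<and> compact (closure {x. \<phi> x \<noteq> 0})"

definition schwartz :: "(real^'n \<Rightarrow> real) \<Rightarrow> bool" where
  "schwartz f \<longleftrightarrow>
     smooth f \<and> (\<forall>k is. bounded (range (\<lambda>x. norm x ^ k * foldr partial_deriv is f x)))"

definition locally_integrable :: "(real^'n \<Rightarrow> real) \<Rightarrow> bool" where
  "locally_integrable f \<longleftrightarrow> (\<forall>K. compact K \<longrightarrow> f absolutely_integrable_on K)"

definition has_weak_partial :: "'n \<Rightarrow> (real^'n \<Rightarrow> real) \<Rightarrow> (real^'n \<Rightarrow> real) \<Rightarrow> bool" where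
  "has_weak_partial i v w \<longleftrightarrow>
     locally_integrable v \<and> locally_integrable w \<and>
     (\<forall>\<phi>. test_function \<phi> \<longrightarrow>
        (LINT x|lebesgue. v x * partial_deriv i \<phi> x) = - (LINT x|lebesgue. w x * \<phi> x))"

text \<open>A representative of the weak derivative, which is determined up to null sets.\<close>

definition weak_partial :: "'n \<Rightarrow> (real^'n \<Rightarrow> real) \<Rightarrow> real^'n \<Rightarrow> real" where
  "weak_partial i v = (SOME w. has_weak_partial i v w)"

definition weakly_differentiable :: "(real^'n \<Rightarrow> real) \<Rightarrow> bool" where
  "weakly_differentiable v \<longleftrightarrow> (\<forall>i. \<exists>w. has_weak_partial i v w)"

definition weak_grad :: "(real^'n \<Rightarrow> real^'N) \<Rightarrow> real^'n \<Rightarrow> real^'n^'N" where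
  "weak_grad u x = (\<chi> \<alpha> i. weak_partial i (\<lambda>y. u y $ \<alpha>) x)"

definition weak_hess :: "(real^'n \<Rightarrow> real^'N) \<Rightarrow> real^'n \<Rightarrow> real^'n^'n^'N" where
  "weak_hess u x = (\<chi> \<alpha> i j. weak_partial i (weak_partial j (\<lambda>y. u y $ \<alpha>)) x)"

definition crit_exp1 :: "('n::finite) itself \<Rightarrow> real" where
  "crit_exp1 _ = 2 * real CARD('n) / (real CARD('n) - 2)"

definition crit_exp2 :: "('n::finite) itself \<Rightarrow> real" where
  "crit_exp2 _ = 2 * real CARD('n) / (real CARD('n) - 4)"

definition W22_star :: "(real^'n \<Rightarrow> real^'N) set" where
  "W22_star = {u.
     u \<in> Lp (crit_exp2 TYPE('n)) \<and>
     (\<forall>\<alpha>. weakly_differentiable (\<lambda>x. u x $ \<alpha>)) \<and>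
     weak_grad u \<in> Lp (crit_exp1 TYPE('n)) \<and>
     (\<forall>\<alpha> j. weakly_differentiable (weak_partial j (\<lambda>x. u x $ \<alpha>))) \<and>
     weak_hess u \<in> Lp 2}"


section \<open>Fourier transform\<close>

definition fourier_L1 :: "(real^'n \<Rightarrow> complex) \<Rightarrow> real^'n \<Rightarrow> complex" where
  "fourier_L1 u z = (LINT x|lebesgue. u x * exp (- 2 * of_real pi * \<i> * of_real (x \<bullet> z)))"

definition inv_fourier_L1 :: "(real^'n \<Rightarrow> complex) \<Rightarrow> real^'n \<Rightarrow> complex" where
  "inv_fourier_L1 u x = (LINT z|lebesgue. u z * exp (2 * of_real pi * \<i> * of_real (x \<bullet> z)))"

text \<open>The continuous extension to \<open>L\<^sup>2\<close> of an operator given on \<open>L\<^sup>1 \<inter> L\<^sup>2\<close>: a representative of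
  the \<open>L\<^sup>2\<close>-limit along arbitrary \<open>L\<^sup>2\<close>-approximations from \<open>L\<^sup>1 \<inter> L\<^sup>2\<close>.\<close>

definition L2_extension ::
    "((real^'n \<Rightarrow> complex) \<Rightarrow> real^'n \<Rightarrow> complex) \<Rightarrow> (real^'n \<Rightarrow> complex) \<Rightarrow> real^'n \<Rightarrow> complex" where
  "L2_extension T f = (SOME g. g \<in> Lp 2 \<and>
     (\<forall>\<phi>::nat \<Rightarrow> real^'n \<Rightarrow> complex.
        (\<forall>k. \<phi> k \<in> Lp 1 \<inter> Lp 2) \<longrightarrow> (\<lambda>k. Lp_norm 2 (\<lambda>x. \<phi> k x - f x)) \<longlonglongrightarrow> 0 \<longrightarrow>
        (\<forall>k. T (\<phi> k) \<in> Lp 2) \<and> (\<lambda>k. Lp_norm 2 (\<lambda>x. T (\<phi> k) x - g x)) \<longlonglongrightarrow> 0))"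

definition fourier_L2 :: "(real^'n \<Rightarrow> complex^'N) \<Rightarrow> real^'n \<Rightarrow> complex^'N" where
  "fourier_L2 u z = (\<chi> \<alpha>. L2_extension fourier_L1 (\<lambda>x. u x $ \<alpha>) z)"

definition inv_fourier_L2 :: "(real^'n \<Rightarrow> complex^'N) \<Rightarrow> real^'n \<Rightarrow> complex^'N" where
  "inv_fourier_L2 u x = (\<chi> \<alpha>. L2_extension inv_fourier_L1 (\<lambda>z. u z $ \<alpha>) x)"


section \<open>The representation formula\<close>

definition cvec :: "real^'N \<Rightarrow> complex^'N" where
  "cvec v = (\<chi> \<alpha>. of_real (v $ \<alpha>))"

definition cmat :: "real^'N^'M \<Rightarrow> complex^'N^'M" where
  "cmat X = (\<chi> \<alpha> \<beta>. of_real (X $ \<alpha> $ \<beta>))"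

definition repr_symbol ::
    "real^'n^'n^'N^'N \<Rightarrow> (real^'n \<Rightarrow> real^'N) \<Rightarrow> real^'n \<Rightarrow> complex^'N" where
  "repr_symbol A f z =
     (let X = symbol_matrix A (sgn z)
      in cmat ((1 / det X) *\<^sub>R transpose (cof X)) *v inv_fourier_L2 (\<lambda>x. cvec (f x)) z)"

definition convolution ::
    "(real^'n \<Rightarrow> complex) \<Rightarrow> (real^'n \<Rightarrow> complex^'N) \<Rightarrow> real^'n \<Rightarrow> complex^'N" where
  "convolution k g x = (\<chi> \<alpha>. LINT y|lebesgue. k (x - y) * g y $ \<alpha>)"

definition approx_solution ::
    "real^'n^'n^'N^'N \<Rightarrow> (real^'n \<Rightarrow> real^'N) \<Rightarrow> (real^'n \<Rightarrow> real) \<Rightarrow> real^'n \<Rightarrow> complex^'N" where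
  "approx_solution A f h x =
     (- 1 / (4 * pi\<^sup>2)) *\<^sub>R
       convolution (fourier_L1 (\<lambda>y. of_real (h y))) (fourier_L2 (repr_symbol A f)) x"

definition admissible_multipliers :: "(nat \<Rightarrow> real^'n \<Rightarrow> real) \<Rightarrow> bool" where
  "admissible_multipliers h \<longleftrightarrow>
     (\<forall>m. schwartz (h m)) \<and>
     (\<forall>m x. h m (- x) = h m x) \<and>
     (AE x in lebesgue. (\<forall>m. 0 \<le> h m x \<and> h m x \<le> 1 / (norm x)\<^sup>2) \<and>
        (\<lambda>m. h m x) \<longlonglongrightarrow> 1 / (norm x)\<^sup>2)"

end

theory Submission
  imports Defs "HOL-Probability.Characteristic_Functions" "HOL-Probability.Sinc_Integral"
begin

text \<open>On the Fourier side the equation is multiplication of \<open>u\<close> with \<open>- 4 \<pi>\<^sup>2 |z|\<^sup>2\<close> times the symbol at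
  \<open>sgn z\<close>, whose inverse is bounded by \<open>1 / \<nu>\<close>, so the solution is the Fourier transform of a function
  \<open>g\<close> with \<open>|z|\<^sup>2 g\<close> in L2. Plancherel's theorem is obtained by Gaussian regularization of the inversion
  formula. The Sobolev inequality needed for the \<open>L\<^sup>p\<close> bounds follows by splitting, at each height, \<open>g\<close> into
  a low frequency part that is bounded by half the height and a high frequency part in L2 (the argument
  of Chemin and Xu). Applied to \<open>|z|\<^sup>2 (g\<^sub>m - g)\<close>, which tends to zero in L2 by dominated convergence,
  it even gives strong convergence of the approximations. Conversely, the Fourier transform of a weak
  Hessian in L2 is \<open>z\<^sub>i z\<^sub>j\<close> times a vector, hence a rank-one tensor almost everywhere, and
  ellipticity gives the Hessian estimate and therewith uniqueness.\<close>

section \<open>The space L2\<close>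

text \<open>The obstacle is that \<open>u\<close> need not lie in L2 and that its frequency
  function, an L2 function times \<open>|z|^-2\<close>, need not be square integrable at the origin,
  so Plancherel applies to neither. The condition \<open>2 * s < CARD('n)\<close>, which for
  \<open>s = 2\<close> means dimension at least five, makes \<open>|z|^(- 2 s)\<close> integrable at
  the origin. Hence the low frequencies are in L1, and the transform is defined by cutting at an
  arbitrary radius. For a general competitor only the Hessian can be transformed, and its algebraic
  structure has to be recovered from weak identities between third derivatives. Testing uses
  products of one-dimensional bump functions: this class is closed under partial derivatives and
  translations, its derivatives are explicit, and the indicators of open boxes are limits of such
  products, so it determines locally integrable functions. The L2 transforms are chosen
  representatives; therefore their algebra, including linearity, holds almost everywhere and is
  proved by duality with test functions.\<close>

lemma Lp2_iff:
  "f \<in> Lp 2 \<longleftrightarrow> f \<in> borel_measurable lebesgue \<and> integrable lebesgue (\<lambda>x. (norm (f x))\<^sup>2)"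
proof -
  have "norm (f x) powr 2 = (norm (f x))\<^sup>2" for x
    by (cases "f x = 0") auto
  then show ?thesis
    unfolding Lp_def by simp
qed

lemma Lp_norm_2: "Lp_norm 2 f = sqrt (LINT x|lebesgue. (norm (f x))\<^sup>2)"
proof -
  have "norm (f x) powr 2 = (norm (f x))\<^sup>2" for x
    by (cases "f x = 0") auto
  then show ?thesis
    unfolding Lp_norm_def by (simp add: powr_half_sqrt)
qed

lemma Lp1_iff: "f \<in> Lp 1 \<longleftrightarrow> integrable lebesgue f"
  unfolding Lp_def by (auto simp: integrable_norm_iff)

lemma Lp_norm_nonneg: "0 \<le> Lp_norm p f"
  unfolding Lp_norm_def by simp

lemma Lp_norm_2_power2: "(Lp_norm 2 f)\<^sup>2 = (LINT x|lebesgue. (norm (f x))\<^sup>2)"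
  unfolding Lp_norm_2 by simp

lemma Lp2_measurable: "f \<in> Lp 2 \<Longrightarrow> f \<in> borel_measurable lebesgue"
  by (simp add: Lp2_iff)

lemma Lp2_dominated:
  assumes "f \<in> Lp 2" "g \<in> borel_measurable lebesgue" "AE x in lebesgue. norm (g x) \<le> B * norm (f x)"
  shows "g \<in> Lp 2"
proof -
  have "integrable lebesgue (\<lambda>x. B\<^sup>2 * (norm (f x))\<^sup>2)"
    using assms(1) by (simp add: Lp2_iff)
  then have "integrable lebesgue (\<lambda>x. (norm (g x))\<^sup>2)"
  proof (rule Bochner_Integration.integrable_bound)
    show "AE x in lebesgue. norm ((norm (g x))\<^sup>2) \<le> norm (B\<^sup>2 * (norm (f x))\<^sup>2)"
      using assms(3)
    proof eventually_elim
      case (elim x)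
      then have "(norm (g x))\<^sup>2 \<le> (B * norm (f x))\<^sup>2"
        by (rule power_mono) simp
      then show ?case by (simp add: power_mult_distrib)
    qed
  qed (use assms(2) in measurable)
  then show ?thesis using assms(2) by (simp add: Lp2_iff)
qed

lemma Lp2_norm_dominated:
  assumes "f \<in> Lp 2" "g \<in> borel_measurable lebesgue"
    and "AE x in lebesgue. norm (g x) \<le> B * norm (f x)" "0 \<le> B"
  shows "Lp_norm 2 g \<le> B * Lp_norm 2 f"
proof -
  have g: "g \<in> Lp 2" by (rule Lp2_dominated[OF assms(1-3)])
  have "(LINT x|lebesgue. (norm (g x))\<^sup>2) \<le> (LINT x|lebesgue. B\<^sup>2 * (norm (f x))\<^sup>2)"
  proof (rule integral_mono_AE)
    show "AE x in lebesgue. (norm (g x))\<^sup>2 \<le> B\<^sup>2 * (norm (f x))\<^sup>2"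
      using assms(3)
      by eventually_elim (use power_mono[OF _ norm_ge_zero, of _ _ 2] in \<open>force simp flip: power_mult_distrib\<close>)
  qed (use g assms(1) in \<open>auto simp: Lp2_iff\<close>)
  then have "(Lp_norm 2 g)\<^sup>2 \<le> (B * Lp_norm 2 f)\<^sup>2"
    by (simp add: Lp_norm_2_power2 power_mult_distrib)
  then show ?thesis
    by (rule power2_le_imp_le) (simp add: assms(4) Lp_norm_nonneg)
qed

lemma Lp_norm_2_cong_AE:
  assumes "f \<in> borel_measurable lebesgue" "g \<in> borel_measurable lebesgue"
    and "AE x in lebesgue. g x = f x"
  shows "Lp_norm 2 g = Lp_norm 2 f"
proof -
  have "(LINT x|lebesgue. (norm (g x))\<^sup>2) = (LINT x|lebesgue. (norm (f x))\<^sup>2)"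
    by (rule integral_cong_AE) (use assms in auto)
  then show ?thesis by (simp add: Lp_norm_2)
qed

lemma Lp2_scale:
  fixes f :: "real^'n \<Rightarrow> complex"
  assumes "f \<in> Lp 2"
  shows "(\<lambda>x. c * f x) \<in> Lp 2"
  using assms by (intro Lp2_dominated[OF assms, of _ "norm c"])
    (auto simp: norm_mult Lp2_iff)

lemma borel_measurable_cnj [measurable (raw)]:
  assumes "f \<in> borel_measurable M"
  shows "(\<lambda>x. cnj (f x)) \<in> borel_measurable M"
  by (rule measurable_compose[OF assms])
    (intro borel_measurable_continuous_onI continuous_intros)

lemma Lp2_cnj:
  assumes "f \<in> Lp 2"
  shows "(\<lambda>x. cnj (f x)) \<in> Lp 2"
  using assms by (auto simp: Lp2_iff)

lemma Lp2_norm_product_integrable: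
  assumes "f \<in> Lp 2" "g \<in> Lp 2"
  shows "integrable lebesgue (\<lambda>x. norm (f x) * norm (g x))"
proof (rule Bochner_Integration.integrable_bound)
  show "integrable lebesgue (\<lambda>x. (norm (f x))\<^sup>2 + (norm (g x))\<^sup>2)"
    using assms by (simp add: Lp2_iff)
  have "norm (f x) * norm (g x) \<le> (norm (f x))\<^sup>2 + (norm (g x))\<^sup>2" for x
    using sum_squares_bound[of "norm (f x)" "norm (g x)"]
      mult_nonneg_nonneg[OF norm_ge_zero[of "f x"] norm_ge_zero[of "g x"]] by linarith
  then show "AE x in lebesgue. norm (norm (f x) * norm (g x)) \<le> norm ((norm (f x))\<^sup>2 + (norm (g x))\<^sup>2)"
    by simp
qed (use assms in \<open>auto simp: Lp2_iff\<close>)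

lemma Lp2_product_integrable:
  fixes f g :: "real^'n \<Rightarrow> complex"
  assumes "f \<in> Lp 2" "g \<in> Lp 2"
  shows "integrable lebesgue (\<lambda>x. f x * g x)"
  by (rule Bochner_Integration.integrable_bound[OF Lp2_norm_product_integrable[OF assms]])
     (use assms in \<open>auto simp: Lp2_iff norm_mult\<close>)

lemma Cauchy_Schwarz_Lp2:
  assumes "f \<in> Lp 2" "g \<in> Lp 2"
  shows "(LINT x|lebesgue. norm (f x) * norm (g x)) \<le> Lp_norm 2 f * Lp_norm 2 g"
proof -
  have [measurable]: "f \<in> borel_measurable lebesgue" "g \<in> borel_measurable lebesgue"
    using assms by (auto simp: Lp2_iff)
  have "(\<integral>\<^sup>+x. ennreal (norm (f x)) * ennreal (norm (g x)) \<partial>lebesgue)\<^sup>2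
     \<le> (\<integral>\<^sup>+x. ennreal (norm (f x)) ^ 2 \<partial>lebesgue) * (\<integral>\<^sup>+x. ennreal (norm (g x)) ^ 2 \<partial>lebesgue)"
    by (rule Cauchy_Schwarz_nn_integral) auto
  moreover have "(\<integral>\<^sup>+x. ennreal (norm (f x)) * ennreal (norm (g x)) \<partial>lebesgue)
      = ennreal (LINT x|lebesgue. norm (f x) * norm (g x))"
    using nn_integral_eq_integral[OF Lp2_norm_product_integrable[OF assms]]
    by (simp add: ennreal_mult)
  moreover have "(\<integral>\<^sup>+x. ennreal (norm (f x)) ^ 2 \<partial>lebesgue) = ennreal ((Lp_norm 2 f)\<^sup>2)"
    using nn_integral_eq_integral[of lebesgue "\<lambda>x. (norm (f x))\<^sup>2"] assms(1)
    by (simp add: ennreal_power Lp2_iff Lp_norm_2_power2)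
  moreover have "(\<integral>\<^sup>+x. ennreal (norm (g x)) ^ 2 \<partial>lebesgue) = ennreal ((Lp_norm 2 g)\<^sup>2)"
    using nn_integral_eq_integral[of lebesgue "\<lambda>x. (norm (g x))\<^sup>2"] assms(2)
    by (simp add: ennreal_power Lp2_iff Lp_norm_2_power2)
  ultimately have "ennreal ((LINT x|lebesgue. norm (f x) * norm (g x))\<^sup>2)
      \<le> ennreal ((Lp_norm 2 f)\<^sup>2 * (Lp_norm 2 g)\<^sup>2)"
    by (simp add: ennreal_power ennreal_mult)
  then have "(LINT x|lebesgue. norm (f x) * norm (g x))\<^sup>2 \<le> (Lp_norm 2 f * Lp_norm 2 g)\<^sup>2"
    by (simp add: power_mult_distrib)
  then show ?thesis
    by (rule power2_le_imp_le) (simp add: Lp_norm_nonneg)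
qed

lemma Lp2_add:
  assumes "f \<in> Lp 2" "g \<in> Lp 2"
  shows "(\<lambda>x. f x + g x) \<in> Lp 2"
proof -
  have [measurable]: "f \<in> borel_measurable lebesgue" "g \<in> borel_measurable lebesgue"
    using assms by (auto simp: Lp2_iff)
  have "integrable lebesgue (\<lambda>x. (norm (f x + g x))\<^sup>2)"
  proof (rule Bochner_Integration.integrable_bound)
    show "integrable lebesgue (\<lambda>x. (norm (f x))\<^sup>2 + 2 * (norm (f x) * norm (g x)) + (norm (g x))\<^sup>2)"
      using Lp2_norm_product_integrable[OF assms] assms by (auto simp: Lp2_iff)
    have "(norm (f x + g x))\<^sup>2 \<le> (norm (f x) + norm (g x))\<^sup>2" for x
      by (intro power_mono norm_triangle_ineq) auto
    then show "AE x in lebesgue. norm ((norm (f x + g x))\<^sup>2) \<le>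
        norm ((norm (f x))\<^sup>2 + 2 * (norm (f x) * norm (g x)) + (norm (g x))\<^sup>2)"
      by (intro AE_I2) (simp add: power2_sum mult.assoc add.commute add.left_commute)
  qed auto
  then show ?thesis by (auto simp: Lp2_iff)
qed

lemma Lp2_uminus: "f \<in> Lp 2 \<Longrightarrow> (\<lambda>x. - f x) \<in> Lp 2"
  by (auto simp: Lp2_iff)

lemma Lp2_diff:
  assumes "f \<in> Lp 2" "g \<in> Lp 2"
  shows "(\<lambda>x. f x - g x) \<in> Lp 2"
  using Lp2_add[OF assms(1) Lp2_uminus[OF assms(2)]] by simp

lemma Lp2_sum:
  assumes "\<And>i. i \<in> I \<Longrightarrow> f i \<in> Lp 2"
  shows "(\<lambda>x. \<Sum>i\<in>I. f i x) \<in> Lp 2"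
  using assms
proof (induction I rule: infinite_finite_induct)
  case (insert i I)
  then show ?case using Lp2_add[of "f i" "\<lambda>x. \<Sum>i\<in>I. f i x"] by simp
qed (auto simp: Lp2_iff)

lemma Lp_norm_2_triangle:
  assumes "f \<in> Lp 2" "g \<in> Lp 2"
  shows "Lp_norm 2 (\<lambda>x. f x + g x) \<le> Lp_norm 2 f + Lp_norm 2 g"
proof -
  have "(Lp_norm 2 (\<lambda>x. f x + g x))\<^sup>2 \<le>
     (LINT x|lebesgue. (norm (f x))\<^sup>2 + 2 * (norm (f x) * norm (g x)) + (norm (g x))\<^sup>2)"
    unfolding Lp_norm_2_power2
  proof (rule integral_mono)
    show "integrable lebesgue (\<lambda>x. (norm (f x + g x))\<^sup>2)"
      using Lp2_add[OF assms] by (simp add: Lp2_iff)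
    show "integrable lebesgue (\<lambda>x. (norm (f x))\<^sup>2 + 2 * (norm (f x) * norm (g x)) + (norm (g x))\<^sup>2)"
      using Lp2_norm_product_integrable[OF assms] assms by (auto simp: Lp2_iff)
    show "(norm (f x + g x))\<^sup>2 \<le> (norm (f x))\<^sup>2 + 2 * (norm (f x) * norm (g x)) + (norm (g x))\<^sup>2" for x
      using power_mono[OF norm_triangle_ineq[of "f x" "g x"] norm_ge_zero, of 2]
      by (simp add: power2_sum algebra_simps)
  qed
  also have "\<dots> = (Lp_norm 2 f)\<^sup>2 + 2 * (LINT x|lebesgue. norm (f x) * norm (g x)) + (Lp_norm 2 g)\<^sup>2"
    using Lp2_norm_product_integrable[OF assms] assms
    by (simp add: Lp2_iff Lp_norm_2_power2)
  also have "\<dots> \<le> (Lp_norm 2 f + Lp_norm 2 g)\<^sup>2"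
    using Cauchy_Schwarz_Lp2[OF assms] by (simp add: power2_sum)
  finally show ?thesis
    by (rule power2_le_imp_le) (simp add: Lp_norm_nonneg)
qed

lemma Lp_norm_2_triangle_diff:
  assumes "f \<in> Lp 2" "g \<in> Lp 2" "h \<in> Lp 2"
  shows "Lp_norm 2 (\<lambda>x. f x - h x) \<le> Lp_norm 2 (\<lambda>x. f x - g x) + Lp_norm 2 (\<lambda>x. g x - h x)"
  using Lp_norm_2_triangle[OF Lp2_diff[OF assms(1,2)] Lp2_diff[OF assms(2,3)]] by simp

lemma Lp_norm_2_minus_commute: "Lp_norm 2 (\<lambda>x. f x - g x) = Lp_norm 2 (\<lambda>x. g x - f x)"
  by (simp add: Lp_norm_2 norm_minus_commute)

lemma Lp_norm_2_eq_0:
  assumes "f \<in> Lp 2" "Lp_norm 2 f = 0"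
  shows "AE x in lebesgue. f x = 0"
proof -
  have "(LINT x|lebesgue. (norm (f x))\<^sup>2) = 0"
    using assms(2) Lp_norm_2_power2[of f] by simp
  then show ?thesis
    using integral_nonneg_eq_0_iff_AE[of lebesgue "\<lambda>x. (norm (f x))\<^sup>2"] assms(1)
    by (auto simp: Lp2_iff)
qed

lemma Lp2_tendsto_dominated:
  assumes "w \<in> Lp 2" "\<And>k. u k \<in> borel_measurable lebesgue" "v \<in> borel_measurable lebesgue"
    and "\<And>k. AE x in lebesgue. norm (u k x - v x) \<le> norm (w x)"
    and "AE x in lebesgue. (\<lambda>k. u k x) \<longlonglongrightarrow> v x"
  shows "(\<lambda>k. Lp_norm 2 (\<lambda>x. u k x - v x)) \<longlonglongrightarrow> 0"
proof -
  note [measurable] = assms(2,3)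
  have "(\<lambda>k. LINT x|lebesgue. (norm (u k x - v x))\<^sup>2) \<longlonglongrightarrow> (LINT (x::real^'a)|lebesgue. 0)"
  proof (rule integral_dominated_convergence[where w = "\<lambda>x. (norm (w x))\<^sup>2"])
    show "integrable lebesgue (\<lambda>x. (norm (w x))\<^sup>2)"
      using assms(1) by (simp add: Lp2_iff)
    show "AE x in lebesgue. (\<lambda>k. (norm (u k x - v x))\<^sup>2) \<longlonglongrightarrow> 0"
      using assms(5)
    proof eventually_elim
      case (elim x)
      then have "(\<lambda>k. (norm (u k x - v x))\<^sup>2) \<longlonglongrightarrow> (norm (v x - v x))\<^sup>2"
        by (intro tendsto_intros)
      then show ?case by simp
    qed
    show "AE x in lebesgue. norm ((norm (u k x - v x))\<^sup>2) \<le> (norm (w x))\<^sup>2" for k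
      using assms(4)[of k] by eventually_elim (simp add: power_mono)
  qed auto
  then have "(\<lambda>k. sqrt (LINT x|lebesgue. (norm (u k x - v x))\<^sup>2)) \<longlonglongrightarrow> sqrt 0"
    by (intro tendsto_real_sqrt) simp
  then show ?thesis by (simp add: Lp_norm_2)
qed

text \<open>From \<open>a b - u v = (a - u) b + u (b - v)\<close> by Cauchy-Schwarz; the norm of
  \<open>b k\<close> is controlled through its distance to \<open>v\<close>. This continuity carries
  bilinear identities from L1 \<inter> L2 to L2.\<close>

lemma Lp2_tendsto_product:
  fixes a b :: "nat \<Rightarrow> real^'n \<Rightarrow> complex"
  assumes "\<And>k. a k \<in> Lp 2" "\<And>k. b k \<in> Lp 2" "u \<in> Lp 2" "v \<in> Lp 2"
    and a: "(\<lambda>k. Lp_norm 2 (\<lambda>x. a k x - u x)) \<longlonglongrightarrow> 0"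
    and b: "(\<lambda>k. Lp_norm 2 (\<lambda>x. b k x - v x)) \<longlonglongrightarrow> 0"
  shows "(\<lambda>k. LINT x|lebesgue. a k x * b k x) \<longlonglongrightarrow> (LINT x|lebesgue. u x * v x)"
proof -
  let ?A = "\<lambda>k. Lp_norm 2 (\<lambda>x. a k x - u x)"
  let ?B = "\<lambda>k. Lp_norm 2 (\<lambda>x. b k x - v x)"
  have le: "norm ((LINT x|lebesgue. a k x * b k x) - (LINT x|lebesgue. u x * v x))
      \<le> ?A k * (?B k + Lp_norm 2 v) + Lp_norm 2 u * ?B k" for k
  proof -
    have bk: "Lp_norm 2 (b k) \<le> ?B k + Lp_norm 2 v"
      using Lp_norm_2_triangle[OF Lp2_diff[OF assms(2)[of k] assms(4)] assms(4)] by simp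
    have i1: "integrable lebesgue (\<lambda>x. (a k x - u x) * b k x)" "integrable lebesgue (\<lambda>x. u x * (b k x - v x))"
      "integrable lebesgue (\<lambda>x. a k x * b k x)" "integrable lebesgue (\<lambda>x. u x * v x)"
      by (intro Lp2_product_integrable Lp2_diff assms)+
    have "(LINT x|lebesgue. a k x * b k x) - (LINT x|lebesgue. u x * v x)
        = (LINT x|lebesgue. (a k x - u x) * b k x) + (LINT x|lebesgue. u x * (b k x - v x))"
      using i1 by (subst Bochner_Integration.integral_add[symmetric], simp, simp)
        (subst Bochner_Integration.integral_diff[symmetric], simp, simp, simp add: algebra_simps)
    also have "norm \<dots> \<le> norm (LINT x|lebesgue. (a k x - u x) * b k x) + norm (LINT x|lebesgue. u x * (b k x - v x))"
      by (rule norm_triangle_ineq)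
    also have "\<dots> \<le> (LINT x|lebesgue. norm (a k x - u x) * norm (b k x)) + (LINT x|lebesgue. norm (u x) * norm (b k x - v x))"
      using integral_norm_bound[of lebesgue "\<lambda>x. (a k x - u x) * b k x"]
        integral_norm_bound[of lebesgue "\<lambda>x. u x * (b k x - v x)"]
      by (simp add: norm_mult)
    also have "\<dots> \<le> ?A k * Lp_norm 2 (b k) + Lp_norm 2 u * ?B k"
      by (intro add_mono Cauchy_Schwarz_Lp2 Lp2_diff assms)
    also have "\<dots> \<le> ?A k * (?B k + Lp_norm 2 v) + Lp_norm 2 u * ?B k"
      using bk by (intro add_mono mult_left_mono Lp_norm_nonneg) auto
    finally show ?thesis .
  qed
  have "(\<lambda>k. ?A k * (?B k + Lp_norm 2 v) + Lp_norm 2 u * ?B k) \<longlonglongrightarrow> 0 * (0 + Lp_norm 2 v) + Lp_norm 2 u * 0"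
    by (intro tendsto_intros a b)
  then have "(\<lambda>k. (LINT x|lebesgue. a k x * b k x) - (LINT x|lebesgue. u x * v x)) \<longlonglongrightarrow> 0"
    by (intro Lim_null_comparison[OF always_eventually[OF allI[OF le]]]) simp
  then show ?thesis by (rule LIM_zero_cancel)
qed

lemma Lp2_indicator:
  assumes "f \<in> Lp 2" "S \<in> sets lebesgue"
  shows "(\<lambda>x. indicator S x *\<^sub>R f x) \<in> Lp 2"
  by (rule Lp2_dominated[OF assms(1), of _ 1])
    (use assms in \<open>auto simp: Lp2_iff indicator_def intro!: borel_measurable_scaleR\<close>)

lemma indicator_Lp2:
  assumes "S \<in> lmeasurable"
  shows "(\<lambda>x. indicator S x :: real) \<in> Lp 2"
proof -
  have "(norm (indicator S x :: real))\<^sup>2 = indicator S x" for x :: "real^'a"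
    by (simp add: indicator_def)
  then show ?thesis
    using assms by (auto simp: Lp2_iff fmeasurable_def)
qed

lemma Lp2_indicator_integrable:
  assumes "f \<in> Lp 2" "S \<in> lmeasurable"
  shows "integrable lebesgue (\<lambda>x. indicator S x *\<^sub>R f x)"
  by (rule Bochner_Integration.integrable_bound[OF Lp2_norm_product_integrable[OF indicator_Lp2[OF assms(2)] assms(1)]])
     (use assms in \<open>auto simp: Lp2_iff fmeasurableD\<close>)

text \<open>Supplies a concrete approximating sequence from L1 \<inter> L2, so that the condition
  defining \<open>L2_extension\<close> is never satisfied vacuously.\<close>

lemma Lp2_truncation:
  fixes f :: "real^'n \<Rightarrow> 'b::euclidean_space"
  assumes "f \<in> Lp 2"
  defines "t \<equiv> \<lambda>k x. indicator (ball 0 (real k)) x *\<^sub>R f x"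
  shows "t k \<in> Lp 1 \<inter> Lp 2" "(\<lambda>k. Lp_norm 2 (\<lambda>x. t k x - f x)) \<longlonglongrightarrow> 0"
proof -
  show "t k \<in> Lp 1 \<inter> Lp 2"
    unfolding t_def Lp1_iff Int_iff
    by (intro conjI Lp2_indicator Lp2_indicator_integrable assms) auto
  show "(\<lambda>k. Lp_norm 2 (\<lambda>x. t k x - f x)) \<longlonglongrightarrow> 0"
  proof (rule Lp2_tendsto_dominated[OF assms(1)])
    show "t k \<in> borel_measurable lebesgue" for k
      unfolding t_def by (intro Lp2_measurable Lp2_indicator assms) auto
    show "AE x in lebesgue. norm (t k x - f x) \<le> norm (f x)" for k
      by (auto simp: t_def indicator_def)
    have "(\<lambda>k. t k x) \<longlonglongrightarrow> f x" for x
    proof (rule tendsto_eventually)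
      obtain K where "norm x < real K" using reals_Archimedean2 by blast
      then show "\<forall>\<^sub>F k in sequentially. t k x = f x"
        by (intro eventually_sequentiallyI[of K]) (auto simp: t_def)
    qed
    then show "AE x in lebesgue. (\<lambda>k. t k x) \<longlonglongrightarrow> f x" by simp
  qed (use assms in \<open>auto simp: Lp2_iff\<close>)
qed

text \<open>Multiplication with a positive weight in L2 reduces this to the pointwise a.e. Cauchy
  subsequence of an L1-Cauchy sequence.\<close>

lemma Lp2_complete:
  fixes a :: "nat \<Rightarrow> real^'n \<Rightarrow> complex"
  assumes a: "\<And>k. a k \<in> Lp 2" and w: "w \<in> Lp 2" "\<And>x::real^'n. w x > (0::real)"
    and Cauchy: "\<And>e. e > 0 \<Longrightarrow> \<exists>N. \<forall>i\<ge>N. \<forall>j\<ge>N. Lp_norm 2 (\<lambda>x. a i x - a j x) < e"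
  obtains g where "g \<in> Lp 2" "(\<lambda>k. Lp_norm 2 (\<lambda>x. a k x - g x)) \<longlonglongrightarrow> 0"
proof -
  have [measurable]: "a k \<in> borel_measurable lebesgue" for k
    using a by (simp add: Lp2_iff)
  let ?W = "Lp_norm 2 w + 1"
  have W: "?W > 0" using Lp_norm_nonneg[of 2 w] by simp
  have int: "integrable lebesgue (\<lambda>x. of_real (w x) * a k x)" for k
    by (rule Lp2_product_integrable[OF _ a]) (use w in \<open>auto simp: Lp2_iff\<close>)
  obtain r where r: "strict_mono r" "AE x in lebesgue. Cauchy (\<lambda>i. of_real (w x) * a (r i) x)"
  proof (rule cauchy_L1_AE_cauchy_subseq[OF int])
    fix e :: real assume "e > 0"
    then obtain N where N: "\<forall>i\<ge>N. \<forall>j\<ge>N. Lp_norm 2 (\<lambda>x. a i x - a j x) < e / ?W"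
      using Cauchy[of "e / ?W"] W by auto
    have "(LINT x|lebesgue. norm (of_real (w x) * a i x - of_real (w x) * a j x)) < e"
      if "i \<ge> N" "j \<ge> N" for i j
    proof -
      have "norm (of_real (w x) * a i x - of_real (w x) * a j x) = norm (w x) * norm (a i x - a j x)" for x
        by (simp flip: right_diff_distrib add: norm_mult)
      then have "(LINT x|lebesgue. norm (of_real (w x) * a i x - of_real (w x) * a j x))
          \<le> Lp_norm 2 w * Lp_norm 2 (\<lambda>x. a i x - a j x)"
        using Cauchy_Schwarz_Lp2[OF w(1) Lp2_diff[OF a a], of i j] by simp
      also have "\<dots> \<le> ?W * Lp_norm 2 (\<lambda>x. a i x - a j x)"
        by (intro mult_right_mono Lp_norm_nonneg) simp
      also have "\<dots> < ?W * (e / ?W)"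
        using N that W by (intro mult_strict_left_mono) auto
      finally show ?thesis using W by simp
    qed
    then show "\<exists>N. \<forall>i\<ge>N. \<forall>j\<ge>N. (LINT x|lebesgue. norm (of_real (w x) * a i x - of_real (w x) * a j x)) < e"
      by blast
  qed
  \<comment> \<open>\<open>lim\<close> is total and preserves measurability, so no exceptional set
    has to be removed; where the subsequence diverges the value is irrelevant.\<close>
  define g where "g x = lim (\<lambda>i. a (r i) x)" for x
  have [measurable]: "g \<in> borel_measurable lebesgue"
    unfolding g_def by measurable
  have conv: "AE x in lebesgue. (\<lambda>i. a (r i) x) \<longlonglongrightarrow> g x"
    using r(2)
  proof eventually_elim
    case (elim x)
    then obtain l where "(\<lambda>i. of_real (w x) * a (r i) x) \<longlonglongrightarrow> l"
      using Cauchy_convergent_iff convergent_def by blast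
    then have "(\<lambda>i. of_real (w x) * a (r i) x / of_real (w x)) \<longlonglongrightarrow> l / of_real (w x)"
      using w(2)[of x] by (intro tendsto_intros) auto
    then have "convergent (\<lambda>i. a (r i) x)"
      using w(2)[of x] by (auto simp: convergent_def)
    then show ?case by (simp add: g_def convergent_LIMSEQ_iff)
  qed
  \<comment> \<open>Fatou's lemma along the subsequence \<open>r\<close>: the L2 Cauchy bound for
    \<open>a k - a (r i)\<close> survives the limit in \<open>i\<close>, since \<open>r i\<close> is
    at least \<open>i\<close>.\<close>
  have fatou: "(\<integral>\<^sup>+x. ennreal ((norm (a k x - g x))\<^sup>2) \<partial>lebesgue) \<le> ennreal (e\<^sup>2)"
    if "0 < e" "\<forall>i\<ge>N. \<forall>j\<ge>N. Lp_norm 2 (\<lambda>x. a i x - a j x) < e" "k \<ge> N" for e N k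
  proof -
    have "(\<integral>\<^sup>+x. ennreal ((norm (a k x - g x))\<^sup>2) \<partial>lebesgue)
        = (\<integral>\<^sup>+x. liminf (\<lambda>i. ennreal ((norm (a k x - a (r i) x))\<^sup>2)) \<partial>lebesgue)"
    proof (rule nn_integral_cong_AE)
      show "AE x in lebesgue. ennreal ((norm (a k x - g x))\<^sup>2) = liminf (\<lambda>i. ennreal ((norm (a k x - a (r i) x))\<^sup>2))"
        using conv
      proof eventually_elim
        case (elim x)
        then have "(\<lambda>i. ennreal ((norm (a k x - a (r i) x))\<^sup>2)) \<longlonglongrightarrow> ennreal ((norm (a k x - g x))\<^sup>2)"
          by (intro tendsto_ennrealI tendsto_intros)
        then show ?case by (rule lim_imp_Liminf[OF sequentially_bot, symmetric])
      qed
    qed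
    also have "\<dots> \<le> liminf (\<lambda>i. \<integral>\<^sup>+x. ennreal ((norm (a k x - a (r i) x))\<^sup>2) \<partial>lebesgue)"
      by (rule nn_integral_liminf) auto
    also have "\<dots> \<le> ennreal (e\<^sup>2)"
    proof (rule Liminf_le)
      show "sequentially \<noteq> bot" by simp
      show "\<forall>\<^sub>F i in sequentially. (\<integral>\<^sup>+x. ennreal ((norm (a k x - a (r i) x))\<^sup>2) \<partial>lebesgue) \<le> ennreal (e\<^sup>2)"
      proof (intro eventually_sequentiallyI[of N])
        fix i assume "i \<ge> N"
        then have "r i \<ge> N" using seq_suble[OF r(1), of i] by linarith
        then have "Lp_norm 2 (\<lambda>x. a k x - a (r i) x) < e" using that by auto
        then have "(Lp_norm 2 (\<lambda>x. a k x - a (r i) x))\<^sup>2 \<le> e\<^sup>2"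
          by (intro power_mono Lp_norm_nonneg) simp
        then show "(\<integral>\<^sup>+x. ennreal ((norm (a k x - a (r i) x))\<^sup>2) \<partial>lebesgue) \<le> ennreal (e\<^sup>2)"
          using Lp2_diff[OF a[of k] a[of "r i"]]
          by (subst nn_integral_eq_integral) (auto simp: Lp2_iff Lp_norm_2_power2)
      qed
    qed
    finally show ?thesis .
  qed
  have diff: "(\<lambda>x. a k x - g x) \<in> Lp 2" if "0 < e" "\<forall>i\<ge>N. \<forall>j\<ge>N. Lp_norm 2 (\<lambda>x. a i x - a j x) < e" "k \<ge> N" for e N k
  proof -
    have "(\<integral>\<^sup>+x. ennreal ((norm (a k x - g x))\<^sup>2) \<partial>lebesgue) < \<infinity>"
      using fatou[OF that] by (rule le_less_trans) simp
    then have "integrable lebesgue (\<lambda>x. (norm (a k x - g x))\<^sup>2)"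
      by (intro integrableI_bounded) auto
    then show ?thesis by (simp add: Lp2_iff)
  qed
  obtain N1 where N1: "\<forall>i\<ge>N1. \<forall>j\<ge>N1. Lp_norm 2 (\<lambda>x. a i x - a j x) < 1"
    using Cauchy[of 1] by auto
  have gL: "g \<in> Lp 2"
    using Lp2_diff[OF a[of N1] diff[OF _ N1, of N1]] by simp
  have "(\<lambda>k. Lp_norm 2 (\<lambda>x. a k x - g x)) \<longlonglongrightarrow> 0"
  proof (rule LIMSEQ_I)
    fix e :: real assume "e > 0"
    then have e2: "e / 2 > 0" by simp
    obtain N where N: "\<forall>i\<ge>N. \<forall>j\<ge>N. Lp_norm 2 (\<lambda>x. a i x - a j x) < e / 2"
      using Cauchy[OF e2] by auto
    have "norm (Lp_norm 2 (\<lambda>x. a k x - g x) - 0) < e" if "k \<ge> N" for k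
    proof -
      have "ennreal ((Lp_norm 2 (\<lambda>x. a k x - g x))\<^sup>2) \<le> ennreal ((e / 2)\<^sup>2)"
        using fatou[OF e2 N that] nn_integral_eq_integral[of lebesgue "\<lambda>x. (norm (a k x - g x))\<^sup>2"]
          diff[OF e2 N that] by (simp add: Lp2_iff Lp_norm_2_power2)
      then have "(Lp_norm 2 (\<lambda>x. a k x - g x))\<^sup>2 \<le> (e / 2)\<^sup>2" by simp
      then have "Lp_norm 2 (\<lambda>x. a k x - g x) \<le> e / 2"
        by (rule power2_le_imp_le) (use e2 in simp)
      then show ?thesis using \<open>e > 0\<close> Lp_norm_nonneg[of 2 "\<lambda>x. a k x - g x"] by simp
    qed
    then show "\<exists>N. \<forall>k\<ge>N. norm (Lp_norm 2 (\<lambda>x. a k x - g x) - 0) < e" by blast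
  qed
  with gL that show ?thesis by blast
qed

section \<open>Test functions of product form\<close>

text \<open>Each level asks for the existence of a derivative function instead of iterating
  \<open>deriv\<close>, which is a total operator with a value also where no derivative exists.
  Inductions over \<open>k\<close> then carry no side conditions.\<close>

primrec nth_differentiable :: "nat \<Rightarrow> (real \<Rightarrow> real) \<Rightarrow> bool" where
  "nth_differentiable 0 f \<longleftrightarrow> True"
| "nth_differentiable (Suc k) f \<longleftrightarrow>
     (\<exists>f'. (\<forall>x. (f has_real_derivative f' x) (at x)) \<and> nth_differentiable k f')"

definition smooth1 :: "(real \<Rightarrow> real) \<Rightarrow> bool" where
  "smooth1 f \<longleftrightarrow> (\<forall>k. nth_differentiable k f)"

lemma nth_differentiable_Suc_D: "nth_differentiable (Suc k) f \<Longrightarrow> nth_differentiable k f"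
  by (induction k arbitrary: f) auto

lemma nth_differentiable_add:
  "nth_differentiable k f \<Longrightarrow> nth_differentiable k g \<Longrightarrow> nth_differentiable k (\<lambda>x. f x + g x)"
proof (induction k arbitrary: f g)
  case (Suc k)
  then obtain f' g' where "\<forall>x. (f has_real_derivative f' x) (at x)" "nth_differentiable k f'"
    "\<forall>x. (g has_real_derivative g' x) (at x)" "nth_differentiable k g'"
    by auto
  then show ?case
    using Suc.IH by (auto intro!: exI[of _ "\<lambda>x. f' x + g' x"] derivative_eq_intros)
qed simp

lemma nth_differentiable_mult:
  "nth_differentiable k f \<Longrightarrow> nth_differentiable k g \<Longrightarrow> nth_differentiable k (\<lambda>x. f x * g x)"
proof (induction k arbitrary: f g)
  case (Suc k)
  then obtain f' g' where *: "\<forall>x. (f has_real_derivative f' x) (at x)" "nth_differentiable k f'"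
    "\<forall>x. (g has_real_derivative g' x) (at x)" "nth_differentiable k g'"
    by auto
  have "nth_differentiable k (\<lambda>x. f' x * g x + f x * g' x)"
    using * Suc nth_differentiable_Suc_D by (intro nth_differentiable_add Suc.IH) blast+
  then show ?case
    using * by (auto intro!: exI[of _ "\<lambda>x. f' x * g x + f x * g' x"] derivative_eq_intros)
qed simp

lemma nth_differentiable_const: "nth_differentiable k (\<lambda>x. c)"
  by (induction k arbitrary: c) (auto intro!: exI[of _ "\<lambda>x. 0"])

lemma nth_differentiable_affine:
  "nth_differentiable k f \<Longrightarrow> nth_differentiable k (\<lambda>x. f (c + a * x))"
proof (induction k arbitrary: f)
  case (Suc k)
  then obtain f' where *: "\<forall>x. (f has_real_derivative f' x) (at x)" "nth_differentiable k f'"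
    by auto
  have "nth_differentiable k (\<lambda>x. f' (c + a * x) * a)"
    using * Suc by (intro nth_differentiable_mult nth_differentiable_const) auto
  moreover have "((\<lambda>x. f (c + a * x)) has_real_derivative f' (c + a * x) * a) (at x)" for x
    by (rule DERIV_chain2[OF *(1)[rule_format]]) (auto intro!: derivative_eq_intros)
  ultimately show ?case
    unfolding nth_differentiable.simps by (intro exI[of _ "\<lambda>x. f' (c + a * x) * a"] conjI allI)
qed simp

lemma smooth1_mult: "smooth1 f \<Longrightarrow> smooth1 g \<Longrightarrow> smooth1 (\<lambda>x. f x * g x)"
  and smooth1_add: "smooth1 f \<Longrightarrow> smooth1 g \<Longrightarrow> smooth1 (\<lambda>x. f x + g x)"
  and smooth1_const: "smooth1 (\<lambda>x. c)"
  and smooth1_affine: "smooth1 f \<Longrightarrow> smooth1 (\<lambda>x. f (c + a * x))"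
  unfolding smooth1_def
  by (auto intro: nth_differentiable_mult nth_differentiable_add nth_differentiable_const
      nth_differentiable_affine)

lemma smooth1_antiderivative:
  assumes "\<And>x. (f has_real_derivative f' x) (at x)" "smooth1 f'"
  shows "smooth1 f"
  unfolding smooth1_def
proof
  fix k show "nth_differentiable k f"
    using assms by (cases k) (auto simp: smooth1_def)
qed

lemma smooth1_deriv:
  assumes "smooth1 f"
  shows "(f has_real_derivative deriv f x) (at x)" "smooth1 (deriv f)"
proof -
  have *: "\<exists>f'. (\<forall>x. (f has_real_derivative f' x) (at x)) \<and> nth_differentiable k f'" for k
    using assms unfolding smooth1_def by (metis nth_differentiable.simps(2))
  then show "(f has_real_derivative deriv f x) (at x)"
    by (metis DERIV_imp_deriv)
  have "nth_differentiable k (deriv f)" for k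
  proof -
    obtain f' where f': "\<forall>x. (f has_real_derivative f' x) (at x)" "nth_differentiable k f'"
      using * by blast
    then have "deriv f = f'" by (auto intro: DERIV_imp_deriv)
    with f' show ?thesis by simp
  qed
  then show "smooth1 (deriv f)" by (simp add: smooth1_def)
qed

lemma smooth1_continuous: "smooth1 f \<Longrightarrow> continuous_on S f"
  using smooth1_deriv(1) by (meson DERIV_continuous continuous_at_imp_continuous_on)

section \<open>Infinitely flat functions on the line\<close>

definition flat :: "real poly \<Rightarrow> real \<Rightarrow> real" where
  "flat p t = (if t \<le> 0 then 0 else poly p (1 / t) * exp (- (1 / t)))"

lemma poly_div_exp_tendsto: "((\<lambda>y. poly p y * exp (- y)) \<longlongrightarrow> (0::real)) at_top"
proof -
  have "((\<lambda>y. \<Sum>i\<le>degree p. coeff p i * (y ^ i / exp y)) \<longlongrightarrow> (\<Sum>i\<le>degree p. coeff p i * 0)) at_top"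
    by (intro tendsto_sum tendsto_mult tendsto_const tendsto_power_div_exp_0)
  moreover have "(\<lambda>y. \<Sum>i\<le>degree p. coeff p i * (y ^ i / exp y)) = (\<lambda>y. poly p y * exp (- y))"
    by (simp add: poly_altdef sum_distrib_right exp_minus divide_inverse mult.assoc)
  ultimately show ?thesis by simp
qed

text \<open>With \<open>y = 1 / t\<close> the chain rule gives
  \<open>y^2 * (p y - p' y) * exp (- y)\<close>, so the family \<open>flat p\<close> is closed under
  differentiation; \<open>[:0, 0, 1:]\<close> is \<open>y^2\<close>. This is the reason for carrying
  a polynomial factor along with the classical \<open>exp (- 1 / t)\<close>.\<close>

lemma flat_deriv:
  "(flat p has_real_derivative flat ([:0, 0, 1:] * (p - pderiv p)) t) (at t)"
proof -
  consider "t < 0" | "t > 0" | "t = 0" by linarith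
  then show ?thesis
  proof cases
    case 1
    have "\<forall>\<^sub>F s in nhds t. flat p s = 0"
      using eventually_nhds_in_open[of "{..<0}" t] 1
      by (auto elim!: eventually_mono simp: flat_def)
    then have "(flat p has_real_derivative 0) (at t)"
      by (subst DERIV_cong_ev[OF refl, of _ "\<lambda>_. 0" _ 0]) auto
    with 1 show ?thesis by (simp add: flat_def)
  next
    case 2
    have "((\<lambda>t. poly p (1 / t) * exp (- (1 / t))) has_real_derivative
        flat ([:0, 0, 1:] * (p - pderiv p)) t) (at t)"
      using 2 unfolding flat_def
      by (auto intro!: derivative_eq_intros DERIV_chain2[OF poly_DERIV]
          simp: field_simps power2_eq_square)
    moreover have "\<forall>\<^sub>F s in nhds t. flat p s = poly p (1 / s) * exp (- (1 / s))"
      using eventually_nhds_in_open[of "{0<..}" t] 2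
      by (auto elim!: eventually_mono simp: flat_def)
    ultimately show ?thesis
      by (subst DERIV_cong_ev[OF refl _ refl])
  next
    case 3
    have "((\<lambda>s. flat p s / s) \<longlongrightarrow> 0) (at_left 0)"
      by (rule Lim_transform_eventually[of "\<lambda>_. 0"])
        (auto simp: flat_def eventually_at_filter intro!: always_eventually)
    \<comment> \<open>Dividing by \<open>s\<close> multiplies the polynomial by its variable, hence
      \<open>pCons 0 p\<close>; the exponential still wins as \<open>1 / s\<close> tends to
      infinity.\<close>
    moreover have "((\<lambda>s. flat p s / s) \<longlongrightarrow> 0) (at_right 0)"
    proof (rule Lim_transform_eventually)
      show "((\<lambda>s. poly (pCons 0 p) (1 / s) * exp (- (1 / s))) \<longlongrightarrow> 0) (at_right (0::real))"
        by (rule filterlim_compose[OF poly_div_exp_tendsto])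
          (simp add: filterlim_inverse_at_top_right flip: inverse_eq_divide)
      show "\<forall>\<^sub>F s in at_right 0. poly (pCons 0 p) (1 / s) * exp (- (1 / s)) = flat p s / s"
        by (auto simp: eventually_at_filter flat_def intro!: always_eventually)
    qed
    ultimately have "((\<lambda>s. flat p s / s) \<longlongrightarrow> 0) (at 0)"
      by (simp add: filterlim_at_split)
    then have "(flat p has_real_derivative 0) (at 0)"
      by (simp add: DERIV_def flat_def)
    with 3 show ?thesis by (simp add: flat_def)
  qed
qed

lemma smooth1_flat: "smooth1 (flat p)"
proof -
  have "nth_differentiable k (flat p)" for k p
  proof (induction k arbitrary: p)
    case (Suc k)
    show ?case
      unfolding nth_differentiable.simps using flat_deriv[of p] Suc by blast
  qed simp
  then show ?thesis by (simp add: smooth1_def)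
qed

definition bump1 :: "(real \<Rightarrow> real) \<Rightarrow> bool" where
  "bump1 g \<longleftrightarrow> smooth1 g \<and> (\<exists>R. \<forall>s. \<bar>s\<bar> > R \<longrightarrow> g s = 0)"

lemma bump1_deriv:
  assumes "bump1 g"
  shows "bump1 (deriv g)"
proof -
  obtain R where R: "\<And>s. \<bar>s\<bar> > R \<Longrightarrow> g s = 0"
    using assms by (auto simp: bump1_def)
  have "deriv g s = 0" if "\<bar>s\<bar> > R" for s
  proof -
    have "open {s. \<bar>s\<bar> > R}"
      by (intro open_Collect_less continuous_intros)
    then have "\<forall>\<^sub>F t in nhds s. g t = 0"
      using that R eventually_nhds_in_open[of "{s. \<bar>s\<bar> > R}" s] by (auto elim!: eventually_mono)
    then have "(g has_real_derivative 0) (at s)"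
      by (subst DERIV_cong_ev[OF refl, of _ "\<lambda>_. 0" _ 0]) auto
    then show ?thesis by (rule DERIV_imp_deriv)
  qed
  then show ?thesis
    using assms smooth1_deriv(2) by (auto simp: bump1_def)
qed

text \<open>A subclass of the test functions whose iterated partial derivatives are explicit
  products again, so that smoothness in the sense of repeated Frechet derivatives reduces to one
  variable.\<close>

definition product_test :: "(real^'n \<Rightarrow> real) \<Rightarrow> bool" where
  "product_test \<phi> \<longleftrightarrow> (\<exists>g. (\<forall>i. bump1 (g i)) \<and> \<phi> = (\<lambda>x. \<Prod>i\<in>UNIV. g i (x $ i)))"

lemma product_testI: "(\<And>i. bump1 (g i)) \<Longrightarrow> product_test (\<lambda>x. \<Prod>i\<in>UNIV. g i (x $ i))"
  unfolding product_test_def by blast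

lemma has_derivative_product_test:
  fixes g :: "'n::finite \<Rightarrow> real \<Rightarrow> real"
  assumes "\<And>i. smooth1 (g i)"
  shows "((\<lambda>x::real^'n. \<Prod>i\<in>UNIV. g i (x $ i)) has_derivative
     (\<lambda>y. \<Sum>i\<in>UNIV. (deriv (g i) (x $ i) * y $ i) * (\<Prod>j\<in>UNIV - {i}. g j (x $ j)))) (at x)"
proof (rule has_derivative_prod)
  fix i
  have "(g i has_derivative (\<lambda>h. deriv (g i) (x $ i) * h)) (at (x $ i))"
    using smooth1_deriv(1)[OF assms] by (simp add: has_field_derivative_def)
  moreover have "((\<lambda>x. x $ i) has_derivative (\<lambda>y. y $ i)) (at x)"
    by (rule bounded_linear.has_derivative[OF bounded_linear_vec_nth has_derivative_ident])
  ultimately show "((\<lambda>x. g i (x $ i)) has_derivative (\<lambda>y. deriv (g i) (x $ i) * y $ i)) (at x)"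
    using has_derivative_compose by blast
qed

lemma partial_deriv_product:
  fixes g :: "'n::finite \<Rightarrow> real \<Rightarrow> real"
  assumes "\<And>i. smooth1 (g i)"
  shows "partial_deriv k (\<lambda>x::real^'n. \<Prod>i\<in>UNIV. g i (x $ i)) =
     (\<lambda>x. \<Prod>i\<in>UNIV. (g(k := deriv (g k))) i (x $ i))"
proof
  fix x :: "real^'n"
  have "partial_deriv k (\<lambda>x::real^'n. \<Prod>i\<in>UNIV. g i (x $ i)) x =
     (\<Sum>i\<in>UNIV. (deriv (g i) (x $ i) * axis k 1 $ i) * (\<Prod>j\<in>UNIV - {i}. g j (x $ j)))"
    unfolding partial_deriv_def frechet_derivative_at[OF has_derivative_product_test[OF assms], symmetric] ..
  also have "\<dots> = (\<Sum>i\<in>UNIV. if i = k then deriv (g k) (x $ k) * (\<Prod>j\<in>UNIV - {k}. g j (x $ j)) else 0)"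
    by (intro sum.cong) (auto simp: axis_def)
  also have "\<dots> = deriv (g k) (x $ k) * (\<Prod>j\<in>UNIV - {k}. g j (x $ j))"
    by simp
  also have "\<dots> = (\<Prod>i\<in>UNIV. (g(k := deriv (g k))) i (x $ i))"
    by (subst prod.remove[of UNIV k]) (auto intro!: prod.cong)
  finally show "partial_deriv k (\<lambda>x::real^'n. \<Prod>i\<in>UNIV. g i (x $ i)) x =
     (\<Prod>i\<in>UNIV. (g(k := deriv (g k))) i (x $ i))" .
qed

lemma product_test_partial:
  assumes "product_test \<phi>"
  shows "product_test (partial_deriv k \<phi>)"
proof -
  obtain g where g: "\<And>i. bump1 (g i)" "\<phi> = (\<lambda>x. \<Prod>i\<in>UNIV. g i (x $ i))"
    using assms by (auto simp: product_test_def)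
  have "bump1 ((g(k := deriv (g k))) i)" for i
    using g(1) bump1_deriv by simp
  then show ?thesis
    unfolding g(2) using g(1) by (subst partial_deriv_product) (auto simp: bump1_def intro!: product_testI)
qed

text \<open>Differentiation only updates the factor in its own coordinate, and updates in different
  coordinates commute. The symmetry of weak Hessians rests on this.\<close>

lemma product_test_partial_commute:
  assumes "product_test \<phi>"
  shows "partial_deriv i (partial_deriv k \<phi>) = partial_deriv k (partial_deriv i \<phi>)"
proof -
  obtain g where g: "\<And>i. bump1 (g i)" "\<phi> = (\<lambda>x. \<Prod>i\<in>UNIV. g i (x $ i))"
    using assms by (auto simp: product_test_def)
  have s: "smooth1 (g i)" "smooth1 ((g(k := deriv (g k))) i)" for i k
    using g(1) smooth1_deriv(2) by (auto simp: bump1_def)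
  show ?thesis
    unfolding g(2) by (cases "i = k") (simp_all add: partial_deriv_product[OF s(1)]
        partial_deriv_product[OF s(2)] fun_upd_twist del: fun_upd_apply, simp add: fun_upd_twist)
qed

lemma product_test_differentiable:
  assumes "product_test \<phi>"
  shows "\<phi> differentiable (at x)"
proof -
  obtain g where g: "\<And>i. bump1 (g i)" "\<phi> = (\<lambda>x. \<Prod>i\<in>UNIV. g i (x $ i))"
    using assms by (auto simp: product_test_def)
  show ?thesis
    unfolding g(2) using has_derivative_product_test[of g] g(1)
    by (auto simp: bump1_def differentiable_def)
qed

lemma product_test_support:
  fixes \<phi> :: "real^'n \<Rightarrow> real"
  assumes "product_test \<phi>"
  obtains R where "R > 0" "\<And>x. norm x > R \<Longrightarrow> \<phi> x = 0"
proof -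
  obtain g where g: "\<And>i. bump1 (g i)" "\<phi> = (\<lambda>x. \<Prod>i\<in>UNIV. g i (x $ i))"
    using assms by (auto simp: product_test_def)
  from g(1) obtain r where r: "\<And>i s. \<bar>s\<bar> > r i \<Longrightarrow> g i s = 0"
    unfolding bump1_def by metis
  \<comment> \<open>The \<open>r i\<close> may be negative, hence the absolute values. A point with
    all \<open>\<bar>x $ i\<bar> \<le> r i\<close> has l1 norm, and thus Euclidean norm, below
    \<open>R\<close>; the summand 1 makes \<open>R\<close> positive.\<close>
  define R where "R = (\<Sum>i\<in>UNIV. \<bar>r i\<bar>) + 1"
  have "\<phi> x = 0" if "norm x > R" for x
  proof -
    have "\<exists>i. \<bar>x $ i\<bar> > r i"
    proof (rule ccontr)
      assume "\<not> ?thesis"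
      then have "\<bar>x $ i\<bar> \<le> \<bar>r i\<bar>" for i by (metis abs_ge_self linorder_not_le order_trans)
      then have "(\<Sum>i\<in>UNIV. \<bar>x $ i\<bar>) \<le> (\<Sum>i\<in>UNIV. \<bar>r i\<bar>)"
        by (intro sum_mono)
      then show False
        using norm_le_l1_cart[of x] that by (simp add: R_def)
    qed
    then show ?thesis
      unfolding g(2) using r by (intro prod_zero) auto
  qed
  moreover have "R > 0" by (simp add: R_def add_nonneg_pos sum_nonneg)
  ultimately show ?thesis using that by blast
qed

lemma compact_support_iff:
  fixes \<phi> :: "real^'n \<Rightarrow> real"
  shows "compact (closure {x. \<phi> x \<noteq> 0}) \<longleftrightarrow> (\<exists>R>0. \<forall>x. norm x > R \<longrightarrow> \<phi> x = 0)"
proof -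
  have "compact (closure {x. \<phi> x \<noteq> 0}) \<longleftrightarrow> bounded {x. \<phi> x \<noteq> 0}"
    using bounded_closure bounded_subset closure_subset compact_eq_bounded_closed by (metis closed_closure)
  also have "\<dots> \<longleftrightarrow> (\<exists>R>0. \<forall>x. norm x > R \<longrightarrow> \<phi> x = 0)"
    unfolding bounded_pos by (auto simp: not_less[symmetric])
  finally show ?thesis .
qed

lemma product_test_test_function:
  assumes "product_test \<phi>"
  shows "test_function \<phi>"
proof -
  have "product_test (foldr partial_deriv is \<phi>)" for "is"
    by (induction "is") (auto simp: assms product_test_partial)
  then have "smooth \<phi>"
    unfolding smooth_def using product_test_differentiable by blast
  moreover have "compact (closure {x. \<phi> x \<noteq> 0})"
    unfolding compact_support_iff using product_test_support[OF assms] by metis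
  ultimately show ?thesis by (simp add: test_function_def)
qed

section \<open>Smooth cutoffs of intervals and boxes\<close>

definition cutoff :: "real \<Rightarrow> real \<Rightarrow> nat \<Rightarrow> real \<Rightarrow> real" where
  "cutoff a b k s = flat 1 (real k * (s - a)) * flat 1 (real k * (b - s))"

lemma bump1_cutoff: "bump1 (cutoff a b k)"
proof -
  have "smooth1 (\<lambda>s. flat 1 (- real k * a + real k * s) * flat 1 (real k * b + (- real k) * s))"
    by (intro smooth1_mult smooth1_affine smooth1_flat)
  then have "smooth1 (cutoff a b k)"
    by (simp add: cutoff_def[abs_def] algebra_simps)
  moreover have "cutoff a b k s = 0" if "\<bar>s\<bar> > \<bar>a\<bar> + \<bar>b\<bar>" for s
  proof -
    have "s - a \<le> 0 \<or> b - s \<le> 0" using that by linarith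
    then show ?thesis
      by (auto simp: cutoff_def flat_def mult_le_0_iff)
  qed
  ultimately show ?thesis by (auto simp: bump1_def)
qed

lemma flat_1_bounds: "0 \<le> flat 1 t" "flat 1 t \<le> 1"
  by (auto simp: flat_def)

lemma cutoff_bounds: "0 \<le> cutoff a b k s" "cutoff a b k s \<le> 1"
  using flat_1_bounds by (auto simp: cutoff_def intro: mult_le_one)

lemma cutoff_outside: "s \<notin> {a<..<b} \<Longrightarrow> cutoff a b k s = 0"
  by (auto simp: cutoff_def flat_def mult_le_0_iff not_less)

lemma cutoff_inside: "s \<in> {a<..<b} \<Longrightarrow> k > 0 \<Longrightarrow> cutoff a b k s > 0"
  by (auto simp: cutoff_def flat_def not_le mult_le_0_iff)

text \<open>At a positive argument \<open>flat 1 (k * t)\<close> is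
  \<open>exp (- 1 / (k t))\<close>. Steepening by \<open>k\<close> thus fills up the open interval
  from inside while the support stays fixed, which suits dominated convergence.\<close>

lemma flat_1_tendsto:
  assumes "t > 0"
  shows "(\<lambda>k. flat 1 (real k * t)) \<longlonglongrightarrow> 1"
proof (rule Lim_transform_eventually)
  have "(\<lambda>k. exp (- (1 / t) * inverse (real k))) \<longlonglongrightarrow> exp (- (1 / t) * 0)"
    by (intro tendsto_intros lim_inverse_n)
  then show "(\<lambda>k. exp (- (1 / t) * inverse (real k))) \<longlonglongrightarrow> 1" by simp
  show "\<forall>\<^sub>F k in sequentially. exp (- (1 / t) * inverse (real k)) = flat 1 (real k * t)"
    using assms by (intro eventually_sequentiallyI[of 1])
      (auto simp: flat_def field_simps mult_le_0_iff)
qed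

lemma cutoff_tendsto: "(\<lambda>k. cutoff a b k s) \<longlonglongrightarrow> indicator {a<..<b} s"
proof (cases "s \<in> {a<..<b}")
  case True
  then have "(\<lambda>k. cutoff a b k s) \<longlonglongrightarrow> 1 * 1"
    unfolding cutoff_def by (intro tendsto_mult flat_1_tendsto) auto
  with True show ?thesis by simp
next
  case False
  then have "(\<lambda>k. cutoff a b k s) = (\<lambda>_. 0)"
    using cutoff_outside by blast
  with False show ?thesis by simp
qed

definition box_cutoff :: "real^'n \<Rightarrow> real^'n \<Rightarrow> nat \<Rightarrow> real^'n \<Rightarrow> real" where
  "box_cutoff a b k x = (\<Prod>i\<in>UNIV. cutoff (a $ i) (b $ i) k (x $ i))"

lemma product_test_box_cutoff: "product_test (box_cutoff a b k)"
  unfolding box_cutoff_def[abs_def] by (intro product_testI bump1_cutoff)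

lemma box_cutoff_bounds: "0 \<le> box_cutoff a b k x" "box_cutoff a b k x \<le> 1"
  by (auto simp: box_cutoff_def intro!: prod_nonneg prod_le_1 cutoff_bounds)

lemma box_cutoff_outside: "x \<notin> box a b \<Longrightarrow> box_cutoff a b k x = 0"
  unfolding box_cutoff_def mem_box_cart by (auto intro!: prod_zero cutoff_outside)

lemma box_cutoff_inside: "x \<in> box a b \<Longrightarrow> k > 0 \<Longrightarrow> box_cutoff a b k x > 0"
  unfolding box_cutoff_def mem_box_cart by (auto intro!: prod_pos cutoff_inside)

lemma box_cutoff_tendsto: "(\<lambda>k. box_cutoff a b k x) \<longlonglongrightarrow> indicator (box a b) x"
proof -
  have "(\<lambda>k. box_cutoff a b k x) \<longlonglongrightarrow> (\<Prod>i\<in>UNIV. indicator {a $ i<..<b $ i} (x $ i))"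
    unfolding box_cutoff_def by (intro tendsto_prod cutoff_tendsto)
  also have "(\<Prod>i\<in>UNIV. indicator {a $ i<..<b $ i} (x $ i)) = (indicator (box a b) x :: real)"
    by (auto simp: indicator_def mem_box_cart intro!: prod_zero)
  finally show ?thesis .
qed

section \<open>Local integrability and the fundamental lemma of the calculus of variations\<close>

lemma product_test_continuous: "product_test \<phi> \<Longrightarrow> continuous_on S \<phi>"
  by (meson differentiable_imp_continuous_within continuous_at_imp_continuous_on product_test_differentiable)

lemma test_function_continuous: "test_function \<phi> \<Longrightarrow> continuous_on S \<phi>"
  unfolding test_function_def smooth_def
  by (metis differentiable_imp_continuous_within continuous_at_imp_continuous_on foldr_Nil id_apply)

lemma continuous_lebesgue_measurable [intro]:
  fixes f :: "real^'n \<Rightarrow> 'b::euclidean_space"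
  shows "continuous_on UNIV f \<Longrightarrow> f \<in> borel_measurable lebesgue"
  by (intro measurable_completion) (simp add: borel_measurable_continuous_onI)

lemma locally_integrable_indicator:
  "locally_integrable w \<Longrightarrow> compact K \<Longrightarrow> integrable lebesgue (\<lambda>x. indicator K x * w x)"
  unfolding locally_integrable_def set_integrable_def by simp

lemma locally_integrable_measurable:
  assumes "locally_integrable w"
  shows "w \<in> borel_measurable lebesgue"
proof (rule borel_measurable_LIMSEQ_real)
  show "(\<lambda>k. indicator (cball 0 (real k)) x * w x) \<longlonglongrightarrow> w x" for x
  proof (rule tendsto_eventually)
    obtain K where "norm x < real K" using reals_Archimedean2 by blast
    then show "\<forall>\<^sub>F k in sequentially. indicator (cball 0 (real k)) x * w x = w x"
      by (intro eventually_sequentiallyI[of K]) auto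
  qed
  show "(\<lambda>x. indicator (cball 0 (real k)) x * w x) \<in> borel_measurable lebesgue" for k
    using locally_integrable_indicator[OF assms compact_cball, of 0 "real k"] by auto
qed

text \<open>Makes Fubini available for the completed measure, over which all function spaces here
  are defined.\<close>

lemma sigma_finite_lebesgue: "sigma_finite_measure (lebesgue :: 'a::euclidean_space measure)"
proof
  show "\<exists>A::'a set set. countable A \<and> A \<subseteq> sets lebesgue \<and> \<Union> A = space lebesgue \<and>
      (\<forall>a\<in>A. emeasure lebesgue a \<noteq> \<infinity>)"
  proof (intro exI[of _ "range (\<lambda>k. ball 0 (real k))"] conjI)
    show "\<Union> (range (\<lambda>k. ball (0::'a) (real k))) = space lebesgue"
      using reals_Archimedean2 by (auto simp: dist_norm)
    show "\<forall>a\<in>range (\<lambda>k. ball (0::'a) (real k)). emeasure lebesgue a \<noteq> \<infinity>"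
    proof clarify
      fix k :: nat assume "emeasure lebesgue (ball (0::'a) (real k)) = \<infinity>"
      then show False
        using emeasure_lborel_ball_finite[of "0::'a" "real k"] by simp
    qed
  qed auto
qed

interpretation lebesgue: sigma_finite_measure "lebesgue :: 'a::euclidean_space measure"
  by (rule sigma_finite_lebesgue)

text \<open>Open boxes are stable under intersection and generate the Borel sets, so a Dynkin class
  argument extends the vanishing to Borel sets, and a Lebesgue set differs from a Borel set by a
  null set.\<close>

lemma integral_box_zero_AE:
  fixes w :: "real^'n \<Rightarrow> real"
  assumes w: "integrable lebesgue w" and box: "\<And>a b. (LINT x|lebesgue. indicator (box a b) x * w x) = 0"
  shows "AE x in lebesgue. w x = 0"
proof (rule lebesgue.density_zero[OF w])
  have ind: "integrable lebesgue (\<lambda>x. indicator A x * w x)" if "A \<in> sets lebesgue" for A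
    using integrable_mult_indicator[OF that w] by simp
  \<comment> \<open>Complements in the Dynkin class need the integral over the whole space, which is
    the limit over the cubes \<open>?B k\<close>.\<close>
  have all: "(LINT x|lebesgue. w x) = 0"
  proof (rule LIMSEQ_unique)
    let ?B = "\<lambda>k::nat. box (\<chi> i. - real k) (\<chi> i. real k) :: (real^'n) set"
    show "(\<lambda>k. LINT x|lebesgue. indicator (?B k) x * w x) \<longlonglongrightarrow> (LINT x|lebesgue. w x)"
    proof (rule integral_dominated_convergence[where w = "\<lambda>x. norm (w x)"])
      show "AE x in lebesgue. (\<lambda>k. indicator (?B k) x * w x) \<longlonglongrightarrow> w x"
      proof (intro AE_I2 tendsto_eventually)
        fix x :: "real^'n"
        obtain K where K: "norm x < real K" using reals_Archimedean2 by blast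
        have "\<bar>x $ i\<bar> < real k" if "k \<ge> K" for k i
          using component_le_norm_cart[of x i] K that by linarith
        then have "- real k < x $ i \<and> x $ i < real k" if "k \<ge> K" for k i
          by (metis abs_less_iff minus_less_iff that)
        then show "\<forall>\<^sub>F k in sequentially. indicator (?B k) x * w x = w x"
          by (intro eventually_sequentiallyI[of K]) (simp add: mem_box_cart)
      qed
      show "(\<lambda>x. indicator (?B k) x * w x) \<in> borel_measurable lebesgue" for k
        by (intro borel_measurable_integrable ind) auto
    qed (use w in \<open>auto simp: indicator_def\<close>)
    show "(\<lambda>k. LINT x|lebesgue. indicator (?B k) x * w x) \<longlonglongrightarrow> 0"
      by (simp add: box)
  qed
  have borel: "(LINT x|lebesgue. indicator A x * w x) = 0" if "A \<in> sets borel" for A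
  proof -
    have "Int_stable (range (\<lambda>(a, b). box a b :: (real^'n) set))"
      by (auto simp: Int_stable_def box_Int_box)
    moreover have "(range (\<lambda>(a, b). box a b :: (real^'n) set)) \<subseteq> Pow UNIV" by auto
    moreover have "A \<in> sigma_sets UNIV (range (\<lambda>(a, b). box a b))"
      using that unfolding borel_eq_box by simp
    ultimately show ?thesis
    proof (induction rule: sigma_sets_induct_disjoint)
      case (basic A)
      then show ?case by (auto simp: box)
    next
      case (compl A)
      then have [measurable]: "A \<in> sets borel" by (simp add: borel_eq_box)
      have "(\<lambda>x. indicator (UNIV - A) x * w x) = (\<lambda>x. w x - indicator A x * w x)"
        by (auto simp: indicator_def)
      then show ?case
        using compl all w ind[of A] by simp
    next
      case (union F)
      then have F: "\<And>i. F i \<in> sets lebesgue"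
        by (simp add: borel_eq_box subset_eq)
      have "(LINT x:(\<Union>i. F i)|lebesgue. w x) = (\<Sum>i. LINT x:F i|lebesgue. w x)"
        using F union(1) ind[of "\<Union>i. F i"]
        by (intro lebesgue_integral_countable_add) (auto simp: set_integrable_def disjoint_family_on_def)
      then show ?case
        using union by (simp add: set_lebesgue_integral_def)
    qed simp
  qed
  fix A :: "(real^'n) set" assume "A \<in> sets lebesgue"
  then obtain S N N' where A: "A = S \<union> N" "N \<subseteq> N'" "N' \<in> null_sets lborel" "S \<in> sets lborel"
    by (rule sets_completionE)
  have "(LINT x|lebesgue. indicator A x * w x) = (LINT x|lebesgue. indicator S x * w x)"
  proof (rule integral_cong_AE)
    show "AE x in lebesgue. indicator A x * w x = indicator S x * w x"
      by (rule AE_I'[OF null_sets_completionI[OF A(3)]]) (use A in \<open>auto simp: indicator_def\<close>)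
  qed (use ind \<open>A \<in> sets lebesgue\<close> A in \<open>auto intro!: borel_measurable_integrable\<close>)
  also have "\<dots> = 0" using borel[of S] A by simp
  finally show "(LINT x:A|lebesgue. w x) = 0" by (simp add: set_lebesgue_integral_def)
qed

text \<open>\<open>box_cutoff a b k\<close> tends to the indicator of the box and is bounded by the
  indicator of its closure, so the integrals of \<open>w\<close> over all boxes vanish. As
  \<open>w\<close> is only locally integrable, \<open>integral_box_zero_AE\<close> is applied to
  \<open>w\<close> cut to each cube of a countable exhaustion.\<close>

lemma AE_zero_if_test_integrals_zero:
  fixes w :: "real^'n \<Rightarrow> real"
  assumes w: "locally_integrable w"
    and test: "\<And>\<phi>. product_test \<phi> \<Longrightarrow> (LINT x|lebesgue. w x * \<phi> x) = 0"
  shows "AE x in lebesgue. w x = 0"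
proof -
  note [measurable] = locally_integrable_measurable[OF w]
  have box: "(LINT x|lebesgue. indicator (box a b) x * w x) = 0" for a b
  proof (rule LIMSEQ_unique)
    show "(\<lambda>k. LINT x|lebesgue. w x * box_cutoff a b k x) \<longlonglongrightarrow> (LINT x|lebesgue. indicator (box a b) x * w x)"
    proof (rule integral_dominated_convergence[where w = "\<lambda>x. norm (indicator (cbox a b) x * w x)"])
      show "integrable lebesgue (\<lambda>x. norm (indicator (cbox a b) x * w x))"
        by (intro integrable_norm locally_integrable_indicator w compact_cbox)
      show "(\<lambda>x. w x * box_cutoff a b k x) \<in> borel_measurable lebesgue" for k
        by (intro borel_measurable_times[OF locally_integrable_measurable[OF w]]
            continuous_lebesgue_measurable product_test_continuous product_test_box_cutoff)
      show "AE x in lebesgue. (\<lambda>k. w x * box_cutoff a b k x) \<longlonglongrightarrow> indicator (box a b) x * w x"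
        by (subst mult.commute) (intro AE_I2 tendsto_mult box_cutoff_tendsto tendsto_const)
      have "norm (w x * box_cutoff a b k x) \<le> norm (indicator (cbox a b) x * w x)" for k x
      proof (cases "x \<in> box a b")
        case True
        then have "x \<in> cbox a b" using box_subset_cbox by blast
        then show ?thesis using box_cutoff_bounds[of a b k x]
          by (simp add: abs_mult mult_left_le)
      qed (simp add: box_cutoff_outside)
      then show "AE x in lebesgue. norm (w x * box_cutoff a b k x) \<le> norm (indicator (cbox a b) x * w x)" for k
        by simp
      show "(\<lambda>x. indicator (box a b) x * w x) \<in> borel_measurable lebesgue"
        by (intro borel_measurable_times borel_measurable_indicator) auto
    qed
    show "(\<lambda>k. LINT x|lebesgue. w x * box_cutoff a b k x) \<longlonglongrightarrow> 0"
      by (simp add: test product_test_box_cutoff)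
  qed
  let ?B = "\<lambda>k::nat. box (\<chi> i. - real k) (\<chi> i. real k) :: (real^'n) set"
  have "AE x in lebesgue. indicator (?B k) x * w x = 0" for k
  proof (rule integral_box_zero_AE)
    have "integrable lebesgue (\<lambda>x. indicator (?B k) x *\<^sub>R (indicator (cbox (\<chi> i. - real k) (\<chi> i. real k)) x * w x))"
      by (intro integrable_mult_indicator locally_integrable_indicator w compact_cbox) auto
    moreover have "(\<lambda>x. indicator (?B k) x *\<^sub>R (indicator (cbox (\<chi> i. - real k) (\<chi> i. real k)) x * w x)) = (\<lambda>x. indicator (?B k) x * w x)"
      using box_subset_cbox by (auto simp: indicator_def fun_eq_iff)
    ultimately show "integrable lebesgue (\<lambda>x. indicator (?B k) x * w x)" by simp
    show "(LINT x|lebesgue. indicator (box a b) x * (indicator (?B k) x * w x)) = 0" for a b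
      using box by (simp add: box_Int_box mult.assoc[symmetric] indicator_inter_arith[symmetric])
  qed
  then have "AE x in lebesgue. \<forall>k. indicator (?B k) x * w x = 0"
    unfolding AE_all_countable by blast
  then show ?thesis
  proof eventually_elim
    case (elim x)
    obtain K where K: "norm x < real K" using reals_Archimedean2 by blast
    have "\<bar>x $ i\<bar> < real K" for i
      using component_le_norm_cart[of x i] K by linarith
    then have "- real K < x $ i \<and> x $ i < real K" for i
      by (metis abs_less_iff minus_less_iff)
    then have "x \<in> ?B K" by (simp add: mem_box_cart)
    then show ?case using elim by (metis indicator_simps(1) mult_1)
  qed
qed

section \<open>The Fourier transform of integrable functions\<close>

interpretation lebesgue_pair: pair_sigma_finite
  "lebesgue :: 'a::euclidean_space measure" "lebesgue :: 'b::euclidean_space measure" ..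

text \<open>The kernel of the forward transform; negating the first argument gives that of the
  inverse transform, so both share all facts on characters.\<close>

definition wave :: "real^'n \<Rightarrow> real^'n \<Rightarrow> complex" where
  "wave x z = exp (- 2 * of_real pi * \<i> * of_real (x \<bullet> z))"

lemma wave_cis: "wave x z = cis (- 2 * pi * (x \<bullet> z))"
  unfolding wave_def cis_conv_exp by (simp add: mult_ac)

lemma norm_wave [simp]: "norm (wave x z) = 1"
  by (simp add: wave_cis)

lemma wave_commute: "wave x z = wave z x"
  by (simp add: wave_def inner_commute)

lemma wave_add_left: "wave (x + y) z = wave x z * wave y z"
  by (simp add: wave_cis cis_mult inner_add_left algebra_simps)

lemma wave_minus_left: "wave (- x) z = cnj (wave x z)"
  by (simp add: wave_cis cis_cnj)

lemma wave_scale: "wave (c *\<^sub>R x) z = wave x (c *\<^sub>R z)"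
  by (simp add: wave_cis)

lemma continuous_on_wave [continuous_intros]:
  "continuous_on S f \<Longrightarrow> continuous_on S g \<Longrightarrow> continuous_on S (\<lambda>x. wave (f x) (g x))"
  unfolding wave_def by (intro continuous_intros)

lemma tendsto_wave [tendsto_intros]:
  "(f \<longlongrightarrow> a) F \<Longrightarrow> (g \<longlongrightarrow> b) F \<Longrightarrow> ((\<lambda>x. wave (f x) (g x)) \<longlongrightarrow> wave a b) F"
  unfolding wave_def by (intro tendsto_intros)

lemma fourier_L1_wave: "fourier_L1 u z = (LINT x|lebesgue. u x * wave x z)"
  unfolding fourier_L1_def wave_def ..

lemma inv_fourier_L1_wave: "inv_fourier_L1 u x = (LINT z|lebesgue. u z * wave (- x) z)"
  unfolding inv_fourier_L1_def wave_def by simp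

lemma inv_fourier_L1_minus: "inv_fourier_L1 u x = fourier_L1 u (- x)"
  unfolding fourier_L1_wave inv_fourier_L1_wave by (simp add: wave_commute)

lemma inv_fourier_L1_cnj: "inv_fourier_L1 (\<lambda>x. cnj (u x)) z = cnj (fourier_L1 u z)"
  unfolding fourier_L1_wave inv_fourier_L1_wave
  by (simp add: wave_minus_left wave_commute[of z] flip: Bochner_Integration.integral_cnj complex_cnj_mult)

lemma id_lebesgue_borel: "(\<lambda>x. x) \<in> lebesgue \<rightarrow>\<^sub>M borel"
  by (rule measurable_completion) simp

lemma wave_measurable [measurable]: "wave x \<in> borel_measurable lebesgue" "(\<lambda>x. wave x z) \<in> borel_measurable lebesgue"
  by (intro continuous_lebesgue_measurable continuous_intros)+

text \<open>Continuity gives measurability for the Borel product. The product of the completed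
  measures is reached by composing with the identity, which is measurable from
  \<open>lebesgue\<close> to \<open>borel\<close> in each factor.\<close>

lemma wave_pair_measurable:
  "(\<lambda>p. wave (c *\<^sub>R fst p) (snd p)) \<in> borel_measurable (lebesgue \<Otimes>\<^sub>M lebesgue)"
proof -
  have 1: "(\<lambda>p. (fst p, snd p)) \<in> (lebesgue \<Otimes>\<^sub>M lebesgue) \<rightarrow>\<^sub>M (borel \<Otimes>\<^sub>M borel)"
    by (intro measurable_Pair measurable_compose[OF _ id_lebesgue_borel] measurable_fst measurable_snd)
  have 2: "(\<lambda>p. wave (c *\<^sub>R fst p) (snd p)) \<in> borel_measurable (borel \<Otimes>\<^sub>M borel)"
    unfolding borel_prod by (intro borel_measurable_continuous_onI continuous_intros)
  show ?thesis
    using measurable_compose[OF 1 2] by simp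
qed

lemma integrable_wave:
  "integrable lebesgue u \<Longrightarrow> integrable lebesgue (\<lambda>x. u x * wave x z)"
  "integrable lebesgue u \<Longrightarrow> integrable lebesgue (\<lambda>x. u x * wave z x)"
  by (rule Bochner_Integration.integrable_bound[of _ u]; force simp: norm_mult)+

lemma norm_fourier_L1_le:
  "norm (fourier_L1 u z) \<le> (LINT x|lebesgue. norm (u x))"
  unfolding fourier_L1_wave
  using integral_norm_bound[of lebesgue "\<lambda>x. u x * wave x z"] by (simp add: norm_mult)

lemma fourier_L1_continuous:
  assumes "integrable lebesgue u"
  shows "continuous_on UNIV (fourier_L1 u)"
proof (intro continuous_at_imp_continuous_on ballI)
  fix z
  show "isCont (fourier_L1 u) z"
    unfolding continuous_at_sequentially comp_def fourier_L1_wave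
  proof (intro allI impI)
    fix s assume s: "s \<longlonglongrightarrow> z"
    show "(\<lambda>n. LINT x|lebesgue. u x * wave x (s n)) \<longlonglongrightarrow> (LINT x|lebesgue. u x * wave x z)"
    proof (rule integral_dominated_convergence[where w = "\<lambda>x. norm (u x)"])
      show "AE x in lebesgue. (\<lambda>n. u x * wave x (s n)) \<longlonglongrightarrow> u x * wave x z"
        by (intro AE_I2 tendsto_intros s)
    qed (use assms in \<open>auto simp: norm_mult integrable_wave intro!: borel_measurable_integrable\<close>)
  qed
qed

lemma fourier_L1_measurable: "integrable lebesgue u \<Longrightarrow> fourier_L1 u \<in> borel_measurable lebesgue"
  using fourier_L1_continuous continuous_lebesgue_measurable by blast

lemma fourier_L1_diff:
  "integrable lebesgue u \<Longrightarrow> integrable lebesgue v \<Longrightarrow>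
    fourier_L1 (\<lambda>x. u x - v x) z = fourier_L1 u z - fourier_L1 v z"
  unfolding fourier_L1_wave by (simp add: left_diff_distrib integrable_wave)

lemma fourier_L1_scale: "fourier_L1 (\<lambda>x. c * u x) z = c * fourier_L1 u z"
  unfolding fourier_L1_wave by (simp add: mult.assoc)

text \<open>The majorant is \<open>B * norm (u x) * norm (v y)\<close>, a product of integrable
  functions. The bounded factor \<open>w\<close> will be the oscillating kernel.\<close>

lemma integrable_pair_product:
  fixes u :: "'a::euclidean_space \<Rightarrow> complex" and v :: "'b::euclidean_space \<Rightarrow> complex"
  assumes u: "integrable lebesgue u" and v: "integrable lebesgue v"
    and w: "(\<lambda>(x, y). w x y) \<in> borel_measurable (lebesgue \<Otimes>\<^sub>M lebesgue)"
    and B: "\<And>x y. norm (w x y) \<le> B"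
  shows "integrable (lebesgue \<Otimes>\<^sub>M lebesgue) (\<lambda>(x, y). u x * w x y * v y)"
proof (rule lebesgue_pair.Fubini_integrable)
  have [measurable]: "u \<in> borel_measurable lebesgue" "v \<in> borel_measurable lebesgue"
    using u v by auto
  note w[measurable]
  show m: "(\<lambda>(x, y). u x * w x y * v y) \<in> borel_measurable (lebesgue \<Otimes>\<^sub>M lebesgue)"
    by measurable
  have wx: "(\<lambda>y. w x y) \<in> borel_measurable lebesgue" for x
    using measurable_compose[OF measurable_Pair1' w, of x] by simp
  have le: "norm (u x * w x y * v y) \<le> norm (u x) * (B * norm (v y))" for x y
    using B[of x y] by (simp add: norm_mult mult.assoc mult_left_mono mult_right_mono)
  have int: "integrable lebesgue (\<lambda>y. u x * w x y * v y)" for x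
  proof (rule Bochner_Integration.integrable_bound)
    show "integrable lebesgue (\<lambda>y. norm (u x) * (B * norm (v y)))"
      using v by simp
    show "(\<lambda>y. u x * w x y * v y) \<in> borel_measurable lebesgue"
      by (intro borel_measurable_times wx borel_measurable_const borel_measurable_integrable v)
    show "AE y in lebesgue. norm (u x * w x y * v y) \<le> norm (norm (u x) * (B * norm (v y)))"
      unfolding real_norm_def by (intro AE_I2 order.trans[OF le abs_ge_self])
  qed
  then show "AE x in lebesgue. integrable lebesgue (\<lambda>y. case (x, y) of (x, y) \<Rightarrow> u x * w x y * v y)"
    by simp
  let ?I = "\<lambda>x. LINT y|lebesgue. norm (u x * w x y * v y)"
  let ?C = "B * (LINT y|lebesgue. norm (v y))"
  have I: "?I x \<le> norm (u x) * ?C" for x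
  proof -
    have "?I x \<le> (LINT y|lebesgue. norm (u x) * (B * norm (v y)))"
      using v by (intro integral_mono integrable_norm int le integrable_mult_right)
    then show ?thesis by simp
  qed
  have "?I x \<ge> 0" for x
    by (rule Bochner_Integration.integral_nonneg) simp
  then have "norm (?I x) \<le> norm (norm (u x) * ?C)" for x
    unfolding real_norm_def by (simp only: abs_of_nonneg) (rule order.trans[OF I abs_ge_self])
  moreover have "?I \<in> borel_measurable lebesgue"
  proof (rule lebesgue.borel_measurable_lebesgue_integral)
    show "(\<lambda>(x, y). norm (u x * w x y * v y)) \<in> borel_measurable (lebesgue \<Otimes>\<^sub>M lebesgue)"
      using measurable_compose[OF m borel_measurable_norm] by (simp only: case_prod_unfold)
  qed
  moreover have "integrable lebesgue (\<lambda>x. norm (u x) * ?C)"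
    by (intro integrable_mult_left integrable_norm u)
  ultimately have "integrable lebesgue ?I"
    using Bochner_Integration.integrable_bound[of lebesgue "\<lambda>x. norm (u x) * ?C" ?I] by blast
  then show "integrable lebesgue (\<lambda>x. LINT y|lebesgue. norm (case (x, y) of (x, y) \<Rightarrow> u x * w x y * v y))"
    by simp
qed

text \<open>The scalar \<open>c\<close> lets \<open>c = 1\<close> and \<open>c = - 1\<close> produce
  the multiplication formulas of both transforms from one application of Fubini.\<close>

lemma wave_integral_swap:
  assumes "integrable lebesgue u" "integrable lebesgue v"
  shows "(LINT z|lebesgue. (LINT x|lebesgue. u x * wave (c *\<^sub>R x) z) * v z)
       = (LINT x|lebesgue. u x * (LINT z|lebesgue. v z * wave (c *\<^sub>R x) z))"
proof -
  have "integrable (lebesgue \<Otimes>\<^sub>M lebesgue) (\<lambda>(x, z). u x * wave (c *\<^sub>R x) z * v z)"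
    by (rule integrable_pair_product[where B = 1, OF assms])
      (use wave_pair_measurable[of c] in \<open>simp_all add: case_prod_unfold\<close>)
  from lebesgue_pair.Fubini_integral[OF this]
  have "(LINT z|lebesgue. LINT x|lebesgue. u x * wave (c *\<^sub>R x) z * v z)
      = (LINT x|lebesgue. LINT z|lebesgue. u x * wave (c *\<^sub>R x) z * v z)" .
  moreover have "(LINT z|lebesgue. u x * wave (c *\<^sub>R x) z * v z)
      = u x * (LINT z|lebesgue. v z * wave (c *\<^sub>R x) z)" for x
    by (simp add: mult.assoc mult.commute[of "wave _ _"])
  ultimately show ?thesis by simp
qed

lemma fourier_L1_multiplication:
  assumes "integrable lebesgue u" "integrable lebesgue v"
  shows "(LINT z|lebesgue. fourier_L1 u z * v z) = (LINT x|lebesgue. u x * fourier_L1 v x)"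
  using wave_integral_swap[OF assms, of 1] by (simp add: fourier_L1_wave wave_commute)

lemma inv_fourier_L1_multiplication:
  assumes "integrable lebesgue u" "integrable lebesgue v"
  shows "(LINT z|lebesgue. inv_fourier_L1 u z * v z) = (LINT x|lebesgue. u x * inv_fourier_L1 v x)"
proof -
  have "inv_fourier_L1 u z = (LINT x|lebesgue. u x * wave (- 1 *\<^sub>R x) z)" for z
    unfolding inv_fourier_L1_wave by (simp add: wave_cis inner_commute)
  moreover have "inv_fourier_L1 v x = (LINT z|lebesgue. v z * wave (- 1 *\<^sub>R x) z)" for x
    unfolding inv_fourier_L1_wave by simp
  ultimately show ?thesis
    using wave_integral_swap[OF assms, of "-1"] by simp
qed

subsection \<open>Gaussians\<close>

text \<open>For Borel measurable \<open>f\<close> the composition with the affine map stays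
  measurable, and both sides can be computed over \<open>lborel\<close>.\<close>

lemma lebesgue_affine:
  fixes f :: "'a::euclidean_space \<Rightarrow> 'b::{banach, second_countable_topology}"
  assumes f: "f \<in> borel_measurable borel" and c: "c \<noteq> 0"
  shows "integrable lebesgue (\<lambda>x. f (a + c *\<^sub>R x)) \<longleftrightarrow> integrable lebesgue f"
    and "(LINT x|lebesgue. f x) = \<bar>c\<bar> ^ DIM('a) *\<^sub>R (LINT x|lebesgue. f (a + c *\<^sub>R x))"
proof -
  have m: "(\<lambda>x. a + c *\<^sub>R x) \<in> borel_measurable borel" by measurable
  have fm: "(\<lambda>x. f (a + c *\<^sub>R x)) \<in> borel_measurable borel"
    using measurable_compose[OF m f] .
  have "integrable lborel f \<longleftrightarrow> integrable lborel (\<lambda>x. \<bar>c\<bar> ^ DIM('a) *\<^sub>R f (a + c *\<^sub>R x))"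
    using f fm c by (subst lborel_affine[OF c, of a]) (simp add: integrable_density integrable_distr_eq)
  also have "\<dots> \<longleftrightarrow> integrable lborel (\<lambda>x. f (a + c *\<^sub>R x))"
  proof
    assume "integrable lborel (\<lambda>x. \<bar>c\<bar> ^ DIM('a) *\<^sub>R f (a + c *\<^sub>R x))"
    then have "integrable lborel (\<lambda>x. inverse (\<bar>c\<bar> ^ DIM('a)) *\<^sub>R (\<bar>c\<bar> ^ DIM('a) *\<^sub>R f (a + c *\<^sub>R x)))"
      by (rule integrable_scaleR_right)
    then show "integrable lborel (\<lambda>x. f (a + c *\<^sub>R x))"
      using c by simp
  qed (rule integrable_scaleR_right)
  finally show "integrable lebesgue (\<lambda>x. f (a + c *\<^sub>R x)) \<longleftrightarrow> integrable lebesgue f"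
    using f fm by (simp add: integrable_completion)
  have "(LINT x|lborel. f x) = (LINT x|lborel. \<bar>c\<bar> ^ DIM('a) *\<^sub>R f (a + c *\<^sub>R x))"
    using f fm c by (subst lborel_affine[OF c, of a]) (simp add: integral_density integral_distr)
  then show "(LINT x|lebesgue. f x) = \<bar>c\<bar> ^ DIM('a) *\<^sub>R (LINT x|lebesgue. f (a + c *\<^sub>R x))"
    using f fm by (simp add: integral_completion)
qed

text \<open>\<open>lborel\<close> is the image of the product of one-dimensional measures indexed by
  \<open>Basis\<close>, so this is Fubini after renaming the coordinates by basis vectors.\<close>

lemma lebesgue_product_integral:
  fixes f :: "'n::finite \<Rightarrow> real \<Rightarrow> 'b::{real_normed_field, banach, second_countable_topology}"
  assumes f: "\<And>i. integrable lborel (f i)"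
  shows "integrable lebesgue (\<lambda>x::real^'n. \<Prod>i\<in>UNIV. f i (x $ i))"
    and "(LINT x|lebesgue. (\<Prod>i\<in>UNIV. f i ((x::real^'n) $ i))) = (\<Prod>i\<in>UNIV. LINT s|lborel. f i s)"
proof -
  interpret product_sigma_finite "\<lambda>b::real^'n. lborel :: real measure"
    by standard
  \<comment> \<open>The basis vectors are the \<open>axis i 1\<close>, which are distinct for
    distinct indices, so \<open>THE\<close> recovers the index.\<close>
  define g where "g b = f (THE i. b = axis i (1::real))" for b :: "real^'n"
  have g: "g (axis i 1) = f i" for i
    unfolding g_def by (rule arg_cong[of _ _ f]) (auto simp: axis_eq_axis)
  have Basis: "Basis = range (\<lambda>i::'n. axis i (1::real))"
    by (auto simp: Basis_vec_def)
  have inj: "inj (\<lambda>i::'n. axis i (1::real))"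
    by (auto simp: inj_def axis_eq_axis)
  have prod: "(\<Prod>i\<in>UNIV. f i (x $ i)) = (\<Prod>b\<in>Basis. g b (x \<bullet> b))" for x :: "real^'n"
    unfolding Basis by (subst prod.reindex[OF inj]) (simp add: g cart_eq_inner_axis)
  have prod2: "(\<Prod>i\<in>UNIV. LINT s|lborel. f i s) = (\<Prod>b\<in>Basis. LINT s|lborel. g b s)"
    unfolding Basis by (subst prod.reindex[OF inj]) (simp add: g)
  have gi: "integrable lborel (g b)" if "b \<in> Basis" for b
    using that f unfolding Basis by (auto simp: g)
  have inn: "(\<Sum>b\<in>Basis. h b *\<^sub>R b) \<bullet> b' = h b'" if "b' \<in> Basis" for h and b' :: "real^'n"
    using that by (simp add: inner_sum_left inner_Basis if_distrib cong: if_cong)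
  have T: "(\<lambda>f. \<Sum>b\<in>Basis. f b *\<^sub>R (b::real^'n)) \<in> (\<Pi>\<^sub>M b\<in>Basis. lborel) \<rightarrow>\<^sub>M borel"
    by measurable
  have gm: "g b \<in> borel_measurable borel" if "b \<in> Basis" for b
    using borel_measurable_integrable[OF gi[OF that]] by simp
  have pm: "(\<lambda>x::real^'n. \<Prod>b\<in>Basis. g b (x \<bullet> b)) \<in> borel_measurable borel"
    by (intro borel_measurable_prod measurable_compose[OF _ gm]) auto
  have "integrable lborel (\<lambda>x::real^'n. \<Prod>b\<in>Basis. g b (x \<bullet> b))"
    using product_integrable_prod[OF finite_Basis gi]
    by (subst lborel_eq) (subst integrable_distr_eq[OF T pm], simp add: inn)
  then show "integrable lebesgue (\<lambda>x::real^'n. \<Prod>i\<in>UNIV. f i (x $ i))"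
    unfolding prod using pm by (subst integrable_completion) auto
  have "(LINT x|lborel. (\<Prod>b\<in>Basis. g b ((x::real^'n) \<bullet> b))) = (\<Prod>b\<in>Basis. LINT s|lborel. g b s)"
    using product_integral_prod[OF finite_Basis gi]
    by (subst lborel_eq) (subst integral_distr[OF T pm], simp add: inn)
  then show "(LINT x|lebesgue. (\<Prod>i\<in>UNIV. f i ((x::real^'n) $ i))) = (\<Prod>i\<in>UNIV. LINT s|lborel. f i s)"
    unfolding prod prod2 using pm by (subst integral_completion) auto
qed

lemma gauss1_integrable: "integrable lborel (\<lambda>t::real. exp (- t\<^sup>2 / 2))"
proof -
  have "integrable lborel (\<lambda>t. sqrt (2 * pi) * std_normal_density t)"
    by (intro integrable_mult_right integrable_normal_density) simp
  then show ?thesis by (simp add: std_normal_density_def)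
qed

text \<open>The characteristic function of the standard normal law at \<open>- 2 * pi * s\<close>,
  freed of the factor \<open>1 / sqrt (2 * pi)\<close>. Writing the result as a normal density of
  deviation \<open>1 / (2 * pi)\<close> keeps its total mass 1 visible, as required for an
  approximate identity.\<close>

lemma gauss1_fourier:
  "(LINT t|lborel. of_real (exp (- t\<^sup>2 / 2)) * cis (- 2 * pi * (s * t)))
     = complex_of_real (normal_density 0 (1 / (2 * pi)) s)"
proof -
  have "char std_normal_distribution (- 2 * pi * s) = of_real (exp (- ((- 2 * pi * s)\<^sup>2) / 2))"
    by (simp add: char_std_normal_distribution)
  also have "char std_normal_distribution (- 2 * pi * s) =
      (LINT t|lborel. std_normal_density t *\<^sub>R iexp ((- 2 * pi * s) * t))"
    unfolding char_def by (subst integral_density) (auto simp: normal_density_nonneg)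
  also have "\<dots> = (LINT t|lborel. of_real (1 / sqrt (2 * pi)) * (of_real (exp (- t\<^sup>2 / 2)) * cis (- 2 * pi * (s * t))))"
    by (intro Bochner_Integration.integral_cong) (auto simp: std_normal_density_def scaleR_conv_of_real cis_conv_exp mult_ac)
  finally have "of_real (1 / sqrt (2 * pi)) * (LINT t|lborel. of_real (exp (- t\<^sup>2 / 2)) * cis (- 2 * pi * (s * t)))
      = complex_of_real (exp (- ((- 2 * pi * s)\<^sup>2) / 2))" by simp
  then have "(LINT t|lborel. of_real (exp (- t\<^sup>2 / 2)) * cis (- 2 * pi * (s * t)))
      = complex_of_real (sqrt (2 * pi) * exp (- ((- 2 * pi * s)\<^sup>2) / 2))"
    by (simp add: field_simps)
  also have "sqrt (2 * pi) * exp (- ((- 2 * pi * s)\<^sup>2) / 2) = normal_density 0 (1 / (2 * pi)) s"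
  proof -
    have "2 * pi * (1 / (2 * pi))\<^sup>2 = 1 / (2 * pi)" by (simp add: power2_eq_square field_simps)
    moreover have "- (s - 0)\<^sup>2 / (2 * (1 / (2 * pi))\<^sup>2) = - ((- 2 * pi * s)\<^sup>2) / 2"
      by (simp add: power2_eq_square field_simps)
    ultimately show ?thesis
      by (simp add: normal_density_def real_sqrt_divide)
  qed
  finally show ?thesis .
qed

definition gauss :: "real^'n \<Rightarrow> real" where
  "gauss z = (\<Prod>i\<in>UNIV. exp (- (z $ i)\<^sup>2 / 2))"

definition heat :: "real^'n \<Rightarrow> real" where
  "heat x = (\<Prod>i\<in>UNIV. normal_density 0 (1 / (2 * pi)) (x $ i))"

lemma gauss_bounds: "0 < gauss z" "gauss z \<le> 1"
  by (auto simp: gauss_def intro!: prod_pos prod_le_1)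

lemma gauss_continuous [continuous_intros]: "continuous_on S f \<Longrightarrow> continuous_on S (\<lambda>x. gauss (f x))"
  unfolding gauss_def by (intro continuous_intros) auto

lemma gauss_0: "gauss 0 = 1"
  by (simp add: gauss_def)

lemma gauss_integrable: "integrable lebesgue gauss"
  unfolding gauss_def[abs_def] by (intro lebesgue_product_integral gauss1_integrable)

lemma heat_nonneg: "0 \<le> heat x"
  by (auto simp: heat_def intro!: prod_nonneg)

lemma heat_continuous [continuous_intros]: "continuous_on S f \<Longrightarrow> continuous_on S (\<lambda>x. heat (f x))"
  unfolding heat_def normal_density_def by (intro continuous_intros) auto

lemma heat_integrable: "integrable lebesgue heat"
  unfolding heat_def[abs_def] by (intro lebesgue_product_integral integrable_normal_density) simp

lemma heat_integral: "(LINT x|lebesgue. heat x) = 1"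
proof -
  have "(LINT s|lborel. normal_density 0 (1 / (2 * pi)) s) = 1"
    by (rule integral_normal_density) simp
  then show ?thesis
    unfolding heat_def by (subst lebesgue_product_integral) (auto intro!: integrable_normal_density)
qed

lemma fourier_gauss: "(LINT z|lebesgue. of_real (gauss z) * wave x z) = of_real (heat x)"
proof -
  have w: "wave x z = (\<Prod>i\<in>UNIV. cis (- 2 * pi * (x $ i * z $ i)))" for z :: "real^'a"
  proof -
    have "- 2 * pi * (x \<bullet> z) = (\<Sum>i\<in>UNIV. - 2 * pi * (x $ i * z $ i))"
      by (simp add: inner_vec_def sum_distrib_left mult.assoc)
    also have "cis \<dots> = (\<Prod>i\<in>UNIV. cis (- 2 * pi * (x $ i * z $ i)))"
      by (simp add: cis_conv_exp sum_distrib_left flip: exp_sum)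
    finally show ?thesis unfolding wave_cis .
  qed
  have "(LINT z|lebesgue. of_real (gauss z) * wave x z) =
      (LINT z|lebesgue. (\<Prod>i\<in>UNIV. of_real (exp (- (z $ i)\<^sup>2 / 2)) * cis (- 2 * pi * (x $ i * z $ i))))"
    unfolding w gauss_def by (simp add: prod.distrib)
  also have "\<dots> = (\<Prod>i\<in>UNIV. LINT t|lborel. of_real (exp (- t\<^sup>2 / 2)) * cis (- 2 * pi * (x $ i * t)))"
  proof (rule lebesgue_product_integral(2))
    fix i
    show "integrable lborel (\<lambda>t. complex_of_real (exp (- t\<^sup>2 / 2)) * cis (- 2 * pi * (x $ i * t)))"
      by (rule Bochner_Integration.integrable_bound[OF gauss1_integrable])
        (auto simp: norm_mult intro!: borel_measurable_continuous_onI continuous_intros)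
  qed
  also have "\<dots> = of_real (heat x)"
    unfolding gauss1_fourier heat_def by simp
  finally show ?thesis .
qed

lemma fourier_gauss_scaled:
  fixes x :: "real^'n"
  assumes "c > 0"
  shows "integrable lebesgue (\<lambda>z::real^'n. gauss (z /\<^sub>R c))"
    and "(LINT z|lebesgue. of_real (gauss (z /\<^sub>R c)) * wave x z) = of_real (c ^ CARD('n) * heat (c *\<^sub>R x))"
proof -
  show "integrable lebesgue (\<lambda>z::real^'n. gauss (z /\<^sub>R c))"
    using lebesgue_affine(1)[of "gauss :: real^'n \<Rightarrow> real" "inverse c" 0] gauss_integrable assms
    by (simp add: borel_measurable_continuous_onI gauss_continuous)
  have "(LINT z|lebesgue. of_real (gauss (z /\<^sub>R c)) * wave x z)
      = c ^ CARD('n) *\<^sub>R (LINT z|lebesgue. of_real (gauss z) * wave (c *\<^sub>R x) z)"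
    using assms by (subst lebesgue_affine(2)[where c = c and a = 0])
      (auto intro!: borel_measurable_continuous_onI continuous_intros simp: wave_scale)
  then show "(LINT z|lebesgue. of_real (gauss (z /\<^sub>R c)) * wave x z) = of_real (c ^ CARD('n) * heat (c *\<^sub>R x))"
    by (simp add: fourier_gauss scaleR_conv_of_real)
qed

text \<open>The transform of the dilated Gaussian \<open>gauss (z /\<^sub>R c)\<close> at
  \<open>x - y\<close>. In \<open>y\<close> it is a probability density of width of order
  \<open>1 / c\<close> about \<open>x\<close>, an approximate identity as \<open>c\<close>
  grows.\<close>

definition heat_kernel :: "real \<Rightarrow> real^'n \<Rightarrow> real^'n \<Rightarrow> real" where
  "heat_kernel c x y = c ^ CARD('n) * heat (c *\<^sub>R (x - y))"

lemma heat_kernel_nonneg: "c > 0 \<Longrightarrow> heat_kernel c x y \<ge> 0"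
  by (simp add: heat_kernel_def heat_nonneg)

lemma heat_kernel_commute: "heat_kernel c x y = heat_kernel c y x"
proof -
  have "heat (- w) = heat w" for w :: "real^'a"
    by (simp add: heat_def normal_density_def)
  then show ?thesis
    unfolding heat_kernel_def by (metis minus_diff_eq scaleR_minus_right)
qed

lemma heat_kernel_integral:
  fixes x :: "real^'n"
  assumes c: "c > 0"
  shows "integrable lebesgue (heat_kernel c x)" "(LINT y|lebesgue. heat_kernel c x y) = 1"
proof -
  have hb: "(heat :: real^'n \<Rightarrow> real) \<in> borel_measurable borel"
    by (intro borel_measurable_continuous_onI continuous_intros)
  have eq: "heat_kernel c x = (\<lambda>y. c ^ CARD('n) * heat (c *\<^sub>R x + (- c) *\<^sub>R y))"
    by (simp add: heat_kernel_def fun_eq_iff algebra_simps)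
  show "integrable lebesgue (heat_kernel c x)"
    unfolding eq using lebesgue_affine(1)[OF hb, of "- c" "c *\<^sub>R x"] c heat_integrable
    by (intro integrable_mult_right) simp
  have "(LINT y::real^'n|lebesgue. heat y) = c ^ CARD('n) * (LINT y|lebesgue. heat (c *\<^sub>R x + (- c) *\<^sub>R y))"
    using lebesgue_affine(2)[OF hb, of "- c" "c *\<^sub>R x"] c by simp
  then show "(LINT y|lebesgue. heat_kernel c x y) = 1"
    unfolding eq integral_mult_right_zero heat_integral by (rule sym)
qed

lemma inv_fourier_L1_measurable: "integrable lebesgue u \<Longrightarrow> inv_fourier_L1 u \<in> borel_measurable lebesgue"
proof -
  assume "integrable lebesgue u"
  then have "continuous_on UNIV (\<lambda>x. fourier_L1 u (- x))"
    by (intro continuous_on_compose2[OF fourier_L1_continuous] continuous_intros) auto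
  then show ?thesis
    unfolding inv_fourier_L1_minus[abs_def] by (rule continuous_lebesgue_measurable)
qed

lemma norm_inv_fourier_L1_le: "norm (inv_fourier_L1 u z) \<le> (LINT x|lebesgue. norm (u x))"
  unfolding inv_fourier_L1_minus by (rule norm_fourier_L1_le)

text \<open>The Gaussian factor makes the second function integrable, so the multiplication formula
  can be applied once for the forward and once for the inverse transform; what remains is the
  transform of the Gaussian, the heat kernel. The contraction property and inversion both follow
  from this identity.\<close>

lemma gauss_pairing:
  fixes \<phi> \<psi> :: "real^'n \<Rightarrow> complex"
  assumes \<phi>: "integrable lebesgue \<phi>" and \<psi>: "integrable lebesgue \<psi>" and c: "c > 0"
  shows "(LINT z|lebesgue. fourier_L1 \<phi> z * (inv_fourier_L1 \<psi> z * of_real (gauss (z /\<^sub>R c))))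
    = (LINT x|lebesgue. \<phi> x * (LINT y|lebesgue. \<psi> y * of_real (heat_kernel c x y)))"
proof -
  have g: "integrable lebesgue (\<lambda>z::real^'n. complex_of_real (gauss (z /\<^sub>R c)))"
    using fourier_gauss_scaled(1)[OF c] by (rule integrable_of_real)
  have a: "integrable lebesgue (\<lambda>z. inv_fourier_L1 \<psi> z * of_real (gauss (z /\<^sub>R c)))"
  proof (rule Bochner_Integration.integrable_bound)
    show "integrable lebesgue (\<lambda>z::real^'n. (LINT x|lebesgue. norm (\<psi> x)) * gauss (z /\<^sub>R c))"
      by (intro integrable_mult_right fourier_gauss_scaled c)
    show "(\<lambda>z. inv_fourier_L1 \<psi> z * of_real (gauss (z /\<^sub>R c))) \<in> borel_measurable lebesgue"
      by (intro borel_measurable_times inv_fourier_L1_measurable \<psi> borel_measurable_integrable[OF g])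
    have "norm (inv_fourier_L1 \<psi> z * of_real (gauss (z /\<^sub>R c))) \<le> (LINT x|lebesgue. norm (\<psi> x)) * gauss (z /\<^sub>R c)" for z :: "real^'n"
      using norm_inv_fourier_L1_le[of \<psi> z] gauss_bounds(1)[of "z /\<^sub>R c"]
      by (simp add: norm_mult mult_right_mono)
    then show "AE z in lebesgue. norm (inv_fourier_L1 \<psi> z * of_real (gauss (z /\<^sub>R c)))
        \<le> norm ((LINT x|lebesgue. norm (\<psi> x)) * gauss (z /\<^sub>R c))"
      unfolding real_norm_def by (intro AE_I2 order.trans[OF _ abs_ge_self])
  qed
  have gw: "integrable lebesgue (\<lambda>z. of_real (gauss (z /\<^sub>R c)) * wave z x)" for x :: "real^'n"
    by (intro integrable_wave g)
  have "fourier_L1 (\<lambda>z. inv_fourier_L1 \<psi> z * of_real (gauss (z /\<^sub>R c))) x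
      = (LINT y|lebesgue. \<psi> y * of_real (heat_kernel c x y))" for x
  proof -
    \<comment> \<open>The character at \<open>x\<close> and the one at \<open>- y\<close> combine to
      a single character at \<open>x - y\<close>.\<close>
    have inv: "inv_fourier_L1 (\<lambda>z. of_real (gauss (z /\<^sub>R c)) * wave z x) y
        = of_real (heat_kernel c x y)" for y
    proof -
      have "of_real (gauss (z /\<^sub>R c)) * wave z x * wave (- y) z = of_real (gauss (z /\<^sub>R c)) * wave (x - y) z" for z
        by (simp add: wave_commute[of z x] mult.assoc flip: wave_add_left)
      then show ?thesis
        unfolding inv_fourier_L1_wave heat_kernel_def using fourier_gauss_scaled(2)[OF c, of "x - y"] by (simp only:)
    qed
    have "fourier_L1 (\<lambda>z. inv_fourier_L1 \<psi> z * of_real (gauss (z /\<^sub>R c))) x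
       = (LINT z|lebesgue. inv_fourier_L1 \<psi> z * (of_real (gauss (z /\<^sub>R c)) * wave z x))"
      unfolding fourier_L1_wave by (simp only: mult.assoc)
    also have "\<dots> = (LINT y|lebesgue. \<psi> y * inv_fourier_L1 (\<lambda>z. of_real (gauss (z /\<^sub>R c)) * wave z x) y)"
      by (rule inv_fourier_L1_multiplication[OF \<psi> gw])
    also have "\<dots> = (LINT y|lebesgue. \<psi> y * of_real (heat_kernel c x y))"
      by (simp only: inv)
    finally show ?thesis .
  qed
  then show ?thesis
    unfolding fourier_L1_multiplication[OF \<phi> a] by simp
qed

text \<open>A function that is not integrable has Bochner integral 0, so the bound carries no
  integrability condition and can be used inside iterated integrals.\<close>

lemma ennreal_integral_le_nn_integral:
  assumes "\<And>x. f x \<ge> (0::real)"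
  shows "ennreal (LINT x|M. f x) \<le> (\<integral>\<^sup>+x. ennreal (f x) \<partial>M)"
proof (cases "integrable M f")
  case True
  then show ?thesis using assms by (simp add: nn_integral_eq_integral)
next
  case False
  then show ?thesis by (simp add: not_integrable_integral_eq)
qed

text \<open>Schur's test: \<open>f x * f y\<close> is at most the mean of the two squares, and the
  kernel has mass 1 in either variable.\<close>

lemma heat_kernel_quadratic:
  fixes f :: "real^'n \<Rightarrow> real"
  assumes f: "f \<in> Lp 2" "\<And>x. f x \<ge> 0" and c: "c > 0"
  shows "(\<integral>\<^sup>+x. \<integral>\<^sup>+y. ennreal (f x * (f y * heat_kernel c x y)) \<partial>lebesgue \<partial>lebesgue)
     \<le> (\<integral>\<^sup>+x. ennreal ((f x)\<^sup>2) \<partial>lebesgue)"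
proof -
  let ?K = "heat_kernel c :: real^'n \<Rightarrow> real^'n \<Rightarrow> real"
  note K0 = heat_kernel_nonneg[OF c] and K = heat_kernel_integral[OF c]
  have [measurable]: "f \<in> borel_measurable lebesgue" using f by (simp add: Lp2_iff)
  have K1: "(\<integral>\<^sup>+y. ennreal (?K x y) \<partial>lebesgue) = 1" for x
    using nn_integral_eq_integral[OF K(1) AE_I2[OF K0], of x] K(2) by simp
  have K2: "(\<integral>\<^sup>+x. ennreal (?K x y) \<partial>lebesgue) = 1" for y
    using K1[of y] by (simp only: heat_kernel_commute[of c y])
  have Kmeas: "(\<lambda>(x, y). ?K x y) \<in> borel_measurable (lebesgue \<Otimes>\<^sub>M lebesgue)"
  proof -
    have 1: "(\<lambda>p. (fst p, snd p)) \<in> ((lebesgue :: (real^'n) measure) \<Otimes>\<^sub>M (lebesgue :: (real^'n) measure)) \<rightarrow>\<^sub>M (borel \<Otimes>\<^sub>M borel)"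
      by (intro measurable_Pair measurable_compose[OF _ id_lebesgue_borel] measurable_fst measurable_snd)
    have 2: "(\<lambda>p. ?K (fst p) (snd p)) \<in> borel_measurable (borel \<Otimes>\<^sub>M borel)"
      unfolding borel_prod heat_kernel_def by (intro borel_measurable_continuous_onI continuous_intros)
    show ?thesis using measurable_compose[OF 1 2] by (simp add: case_prod_unfold)
  qed
  have Kx: "(\<lambda>y. ennreal (?K x y)) \<in> borel_measurable lebesgue" for x
    using measurable_compose[OF borel_measurable_integrable[OF K(1)] measurable_ennreal] .
  have Ky: "(\<lambda>x. ennreal (?K x y)) \<in> borel_measurable lebesgue" for y
    using Kx[of y] by (simp only: heat_kernel_commute[of c y])
  have m2: "(\<lambda>x. ennreal ((f x)\<^sup>2 / 2)) \<in> borel_measurable lebesgue" by measurable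
  have pm1: "(\<lambda>(x, y). ennreal ((f x)\<^sup>2 / 2) * ennreal (?K x y)) \<in> borel_measurable (lebesgue \<Otimes>\<^sub>M lebesgue)"
    and pm2: "(\<lambda>(x, y). ennreal ((f y)\<^sup>2 / 2) * ennreal (?K x y)) \<in> borel_measurable (lebesgue \<Otimes>\<^sub>M lebesgue)"
    using Kmeas by measurable
  have "(\<integral>\<^sup>+x. \<integral>\<^sup>+y. ennreal (f x * (f y * ?K x y)) \<partial>lebesgue \<partial>lebesgue)
     \<le> (\<integral>\<^sup>+x. \<integral>\<^sup>+y. ennreal ((f x)\<^sup>2 / 2) * ennreal (?K x y) + ennreal ((f y)\<^sup>2 / 2) * ennreal (?K x y) \<partial>lebesgue \<partial>lebesgue)"
  proof (intro nn_integral_mono)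
    fix x y :: "real^'n"
    have "f x * f y \<le> (f x)\<^sup>2 / 2 + (f y)\<^sup>2 / 2"
      using sum_squares_bound[of "f x" "f y"] by simp
    then have "f x * f y * ?K x y \<le> ((f x)\<^sup>2 / 2 + (f y)\<^sup>2 / 2) * ?K x y"
      by (rule mult_right_mono) (rule K0)
    moreover have "ennreal a * ennreal k + ennreal b * ennreal k = ennreal ((a + b) * k)"
      if "a \<ge> 0" "b \<ge> 0" "k \<ge> 0" for a b k
      using that by (simp add: ennreal_mult ennreal_plus distrib_right)
    note this[of "(f x)\<^sup>2 / 2" "(f y)\<^sup>2 / 2" "?K x y"]
    ultimately show "ennreal (f x * (f y * ?K x y)) \<le> ennreal ((f x)\<^sup>2 / 2) * ennreal (?K x y) + ennreal ((f y)\<^sup>2 / 2) * ennreal (?K x y)"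
      using K0[of x y] by (simp add: mult.assoc ennreal_leI)
  qed
  also have "\<dots> = (\<integral>\<^sup>+x. (\<integral>\<^sup>+y. ennreal ((f x)\<^sup>2 / 2) * ennreal (?K x y) \<partial>lebesgue) + (\<integral>\<^sup>+y. ennreal ((f y)\<^sup>2 / 2) * ennreal (?K x y) \<partial>lebesgue) \<partial>lebesgue)"
    by (intro nn_integral_cong nn_integral_add borel_measurable_times_ennreal Kx borel_measurable_const m2)
  also have "\<dots> = (\<integral>\<^sup>+x. (\<integral>\<^sup>+y. ennreal ((f x)\<^sup>2 / 2) * ennreal (?K x y) \<partial>lebesgue) \<partial>lebesgue)
     + (\<integral>\<^sup>+x. (\<integral>\<^sup>+y. ennreal ((f y)\<^sup>2 / 2) * ennreal (?K x y) \<partial>lebesgue) \<partial>lebesgue)"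
    by (intro nn_integral_add lebesgue.borel_measurable_nn_integral pm1 pm2)
  also have "(\<integral>\<^sup>+x. (\<integral>\<^sup>+y. ennreal ((f x)\<^sup>2 / 2) * ennreal (?K x y) \<partial>lebesgue) \<partial>lebesgue) = (\<integral>\<^sup>+x. ennreal ((f x)\<^sup>2 / 2) \<partial>lebesgue)"
    by (simp add: nn_integral_cmult[OF Kx] K1)
  also have "(\<integral>\<^sup>+x. (\<integral>\<^sup>+y. ennreal ((f y)\<^sup>2 / 2) * ennreal (?K x y) \<partial>lebesgue) \<partial>lebesgue)
      = (\<integral>\<^sup>+y. (\<integral>\<^sup>+x. ennreal ((f y)\<^sup>2 / 2) * ennreal (?K x y) \<partial>lebesgue) \<partial>lebesgue)"
    by (rule lebesgue_pair.Fubini'[symmetric, OF pm2])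
  also have "\<dots> = (\<integral>\<^sup>+x. ennreal ((f x)\<^sup>2 / 2) \<partial>lebesgue)"
    by (simp add: nn_integral_cmult[OF Ky] K2)
  also have "(\<integral>\<^sup>+x. ennreal ((f x)\<^sup>2 / 2) \<partial>lebesgue) + (\<integral>\<^sup>+x. ennreal ((f x)\<^sup>2 / 2) \<partial>lebesgue) = (\<integral>\<^sup>+x. ennreal ((f x)\<^sup>2) \<partial>lebesgue)"
    by (subst nn_integral_add[symmetric, OF m2 m2]) (simp flip: ennreal_plus)
  finally show ?thesis .
qed

text \<open>With the conjugate of \<open>\<phi>\<close> as second function in
  \<open>gauss_pairing\<close>, the left side becomes the Gaussian-weighted integral of the squared
  transform. The heat kernel bounds it uniformly in \<open>c\<close>, and Fatou's lemma removes the
  Gaussian. Equality of the norms has to wait for the inversion formula.\<close>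

lemma fourier_L1_contraction:
  fixes \<phi> :: "real^'n \<Rightarrow> complex"
  assumes "\<phi> \<in> Lp 1 \<inter> Lp 2"
  shows "fourier_L1 \<phi> \<in> Lp 2" "Lp_norm 2 (fourier_L1 \<phi>) \<le> Lp_norm 2 \<phi>"
proof -
  have \<phi>1: "integrable lebesgue \<phi>" and \<phi>2: "\<phi> \<in> Lp 2" using assms by (auto simp: Lp1_iff)
  have n2: "(\<lambda>x. norm (\<phi> x)) \<in> Lp 2" using \<phi>2 by (auto simp: Lp2_iff)
  note Fm = fourier_L1_measurable[OF \<phi>1]
  have bound: "(\<integral>\<^sup>+z. ennreal ((norm (fourier_L1 \<phi> z))\<^sup>2 * gauss (z /\<^sub>R c)) \<partial>lebesgue) \<le> ennreal ((Lp_norm 2 \<phi>)\<^sup>2)"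
    if c: "c > 0" for c
  proof -
    let ?K = "heat_kernel c"
    let ?g = "\<lambda>z. (norm (fourier_L1 \<phi> z))\<^sup>2 * gauss (z /\<^sub>R c)"
    let ?r = "\<lambda>x. norm (\<phi> x) * (LINT y|lebesgue. norm (\<phi> y) * ?K x y)"
    have K0: "?K x y \<ge> 0" for x y by (rule heat_kernel_nonneg[OF c])
    have "integrable lebesgue ?g"
    proof (rule Bochner_Integration.integrable_bound)
      show "integrable lebesgue (\<lambda>z. (LINT x|lebesgue. norm (\<phi> x))\<^sup>2 * gauss (z /\<^sub>R c))"
        by (intro integrable_mult_right fourier_gauss_scaled c)
      show "?g \<in> borel_measurable lebesgue"
        by (intro borel_measurable_times borel_measurable_power measurable_compose[OF Fm borel_measurable_norm]
            borel_measurable_integrable[OF fourier_gauss_scaled(1)[OF c]])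
      have "?g z \<le> (LINT x|lebesgue. norm (\<phi> x))\<^sup>2 * gauss (z /\<^sub>R c)" for z
        using gauss_bounds(1)[of "z /\<^sub>R c"]
        by (intro mult_right_mono power_mono norm_fourier_L1_le) auto
      then show "AE z in lebesgue. norm (?g z) \<le> norm ((LINT x|lebesgue. norm (\<phi> x))\<^sup>2 * gauss (z /\<^sub>R c))"
        by (intro AE_I2) (simp add: abs_mult abs_of_pos[OF gauss_bounds(1)])
    qed
    then have "(\<integral>\<^sup>+z. ennreal (?g z) \<partial>lebesgue) = ennreal (LINT z|lebesgue. ?g z)"
      by (intro nn_integral_eq_integral AE_I2 mult_nonneg_nonneg zero_le_power2 less_imp_le[OF gauss_bounds(1)])
    also have "(LINT z|lebesgue. ?g z) = Re (LINT z|lebesgue. of_real (?g z))"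
      by (simp only: integral_complex_of_real Re_complex_of_real)
    also have "\<dots> \<le> norm (LINT z|lebesgue. complex_of_real (?g z))" by (rule complex_Re_le_cmod)
    also have "(LINT z|lebesgue. complex_of_real (?g z)) =
       (LINT z|lebesgue. fourier_L1 \<phi> z * (inv_fourier_L1 (\<lambda>x. cnj (\<phi> x)) z * of_real (gauss (z /\<^sub>R c))))"
      by (intro Bochner_Integration.integral_cong refl) (simp add: inv_fourier_L1_cnj complex_norm_square mult.assoc flip: of_real_power)
    also have "\<dots> = (LINT x|lebesgue. \<phi> x * (LINT y|lebesgue. cnj (\<phi> y) * of_real (?K x y)))"
      using \<phi>1 by (intro gauss_pairing c) auto
    also have "norm \<dots> \<le> (LINT x|lebesgue. norm (\<phi> x * (LINT y|lebesgue. cnj (\<phi> y) * of_real (?K x y))))"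
      by (rule integral_norm_bound)
    also have "ennreal \<dots> \<le> (\<integral>\<^sup>+x. ennreal (norm (\<phi> x * (LINT y|lebesgue. cnj (\<phi> y) * of_real (?K x y)))) \<partial>lebesgue)"
      by (rule ennreal_integral_le_nn_integral) simp
    also have "\<dots> \<le> (\<integral>\<^sup>+x. \<integral>\<^sup>+y. ennreal (norm (\<phi> x) * (norm (\<phi> y) * ?K x y)) \<partial>lebesgue \<partial>lebesgue)"
    proof (rule nn_integral_mono)
      fix x :: "real^'n"
      have "norm (LINT y|lebesgue. \<phi> x * (cnj (\<phi> y) * of_real (?K x y)))
          \<le> (LINT y|lebesgue. norm (\<phi> x * (cnj (\<phi> y) * of_real (?K x y))))"
        by (rule integral_norm_bound)
      also have "\<dots> = (LINT y|lebesgue. norm (\<phi> x) * (norm (\<phi> y) * ?K x y))"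
        by (intro Bochner_Integration.integral_cong refl) (simp add: norm_mult K0)
      finally have "ennreal (norm (\<phi> x * (LINT y|lebesgue. cnj (\<phi> y) * of_real (?K x y))))
         \<le> ennreal (LINT y|lebesgue. norm (\<phi> x) * (norm (\<phi> y) * ?K x y))"
        by (intro ennreal_leI) simp
      also have "\<dots> \<le> (\<integral>\<^sup>+y. ennreal (norm (\<phi> x) * (norm (\<phi> y) * ?K x y)) \<partial>lebesgue)"
        by (intro ennreal_integral_le_nn_integral mult_nonneg_nonneg norm_ge_zero K0)
      finally show "ennreal (norm (\<phi> x * (LINT y|lebesgue. cnj (\<phi> y) * of_real (?K x y))))
         \<le> (\<integral>\<^sup>+y. ennreal (norm (\<phi> x) * (norm (\<phi> y) * ?K x y)) \<partial>lebesgue)" .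
    qed
    also have "\<dots> \<le> (\<integral>\<^sup>+x. ennreal ((norm (\<phi> x))\<^sup>2) \<partial>lebesgue)"
      by (intro heat_kernel_quadratic n2 c) simp
    also have "\<dots> = ennreal ((Lp_norm 2 \<phi>)\<^sup>2)"
      using \<phi>2 by (subst nn_integral_eq_integral) (auto simp: Lp2_iff Lp_norm_2_power2)
    finally show ?thesis by (simp add: ennreal_leI)
  qed
  have "(\<integral>\<^sup>+z. ennreal ((norm (fourier_L1 \<phi> z))\<^sup>2) \<partial>lebesgue)
     = (\<integral>\<^sup>+z. liminf (\<lambda>k. ennreal ((norm (fourier_L1 \<phi> z))\<^sup>2 * gauss (z /\<^sub>R real (Suc k)))) \<partial>lebesgue)"
  proof (rule nn_integral_cong)
    fix z :: "real^'n"
    have "(\<lambda>k. gauss (inverse (real (Suc k)) *\<^sub>R z)) \<longlonglongrightarrow> gauss (0 *\<^sub>R z)"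
      by (rule continuous_on_tendsto_compose[OF gauss_continuous[OF continuous_on_id, of UNIV]])
        (rule tendsto_scaleR[OF LIMSEQ_inverse_real_of_nat tendsto_const], auto)
    then have "(\<lambda>k. ennreal ((norm (fourier_L1 \<phi> z))\<^sup>2 * gauss (inverse (real (Suc k)) *\<^sub>R z)))
        \<longlonglongrightarrow> ennreal ((norm (fourier_L1 \<phi> z))\<^sup>2 * gauss (0 *\<^sub>R z))"
      by (intro tendsto_ennrealI tendsto_mult tendsto_const)
    from lim_imp_Liminf[OF sequentially_bot this]
    show "ennreal ((norm (fourier_L1 \<phi> z))\<^sup>2) = liminf (\<lambda>k. ennreal ((norm (fourier_L1 \<phi> z))\<^sup>2 * gauss (z /\<^sub>R real (Suc k))))"
      by (simp add: gauss_0)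
  qed
  also have "\<dots> \<le> liminf (\<lambda>k. \<integral>\<^sup>+z. ennreal ((norm (fourier_L1 \<phi> z))\<^sup>2 * gauss (z /\<^sub>R real (Suc k))) \<partial>lebesgue)"
  proof (rule nn_integral_liminf)
    fix k
    have "(\<lambda>z::real^'n. gauss (z /\<^sub>R real (Suc k))) \<in> borel_measurable lebesgue"
      by (intro continuous_lebesgue_measurable continuous_intros)
    then show "(\<lambda>z. ennreal ((norm (fourier_L1 \<phi> z))\<^sup>2 * gauss (z /\<^sub>R real (Suc k)))) \<in> borel_measurable lebesgue"
      using Fm by measurable
  qed
  also have "\<dots> \<le> ennreal ((Lp_norm 2 \<phi>)\<^sup>2)"
    by (rule Liminf_le[OF sequentially_bot always_eventually]) (intro allI bound, simp)
  finally have fin: "(\<integral>\<^sup>+z. ennreal ((norm (fourier_L1 \<phi> z))\<^sup>2) \<partial>lebesgue) \<le> ennreal ((Lp_norm 2 \<phi>)\<^sup>2)" .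
  have "(\<integral>\<^sup>+z. ennreal (norm ((norm (fourier_L1 \<phi> z))\<^sup>2)) \<partial>lebesgue) < \<infinity>"
    using le_less_trans[OF fin ennreal_less_top] by simp
  then have int: "integrable lebesgue (\<lambda>z. (norm (fourier_L1 \<phi> z))\<^sup>2)"
    by (intro integrableI_bounded borel_measurable_power measurable_compose[OF Fm borel_measurable_norm])
  with Fm show "fourier_L1 \<phi> \<in> Lp 2" by (simp add: Lp2_iff)
  have "(Lp_norm 2 (fourier_L1 \<phi>))\<^sup>2 \<le> (Lp_norm 2 \<phi>)\<^sup>2"
    using fin int by (simp add: nn_integral_eq_integral Lp_norm_2_power2)
  then show "Lp_norm 2 (fourier_L1 \<phi>) \<le> Lp_norm 2 \<phi>"
    by (rule power2_le_imp_le) (rule Lp_norm_nonneg)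
qed

lemma inv_fourier_L1_cnj': "inv_fourier_L1 u z = cnj (fourier_L1 (\<lambda>x. cnj (u x)) z)"
  using inv_fourier_L1_cnj[of "\<lambda>x. cnj (u x)" z] by simp

lemma inv_fourier_L1_contraction:
  fixes \<phi> :: "real^'n \<Rightarrow> complex"
  assumes "\<phi> \<in> Lp 1 \<inter> Lp 2"
  shows "inv_fourier_L1 \<phi> \<in> Lp 2" "Lp_norm 2 (inv_fourier_L1 \<phi>) \<le> Lp_norm 2 \<phi>"
proof -
  have "(\<lambda>x. cnj (\<phi> x)) \<in> Lp 1 \<inter> Lp 2"
    using assms Lp2_cnj[of \<phi>] by (auto simp: Lp1_iff)
  note c = fourier_L1_contraction[OF this]
  show "inv_fourier_L1 \<phi> \<in> Lp 2"
    unfolding inv_fourier_L1_cnj'[abs_def] by (rule Lp2_cnj[OF c(1)])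
  show "Lp_norm 2 (inv_fourier_L1 \<phi>) \<le> Lp_norm 2 \<phi>"
    using c(2) unfolding inv_fourier_L1_cnj'[abs_def] by (simp add: Lp_norm_2)
qed

text \<open>By \<open>gauss_pairing\<close> the left side is the pairing of \<open>\<phi>\<close>
  with heat kernel averages of \<open>\<psi>\<close>; these are bounded by \<open>B\<close> and tend
  to \<open>\<psi>\<close> pointwise by continuity.\<close>

lemma gauss_regularized_inversion:
  fixes \<phi> \<psi> :: "real^'n \<Rightarrow> complex"
  assumes \<phi>: "integrable lebesgue \<phi>" and \<psi>: "integrable lebesgue \<psi>"
    and cont: "continuous_on UNIV \<psi>" and B: "\<And>x. norm (\<psi> x) \<le> B"
  shows "(\<lambda>k. LINT z|lebesgue. fourier_L1 \<phi> z * (inv_fourier_L1 \<psi> z * of_real (gauss (z /\<^sub>R real (Suc k)))))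
    \<longlonglongrightarrow> (LINT x|lebesgue. \<phi> x * \<psi> x)"
proof -
  let ?c = "\<lambda>k. real (Suc k)"
  let ?J = "\<lambda>k x. LINT s|lebesgue. \<psi> (x + (- inverse (?c k)) *\<^sub>R s) * of_real (heat s)"
  \<comment> \<open>Substituting \<open>y = x - s / c\<close> moves the parameter from the kernel
    into \<open>\<psi>\<close>, so that dominated convergence has the fixed weight
    \<open>heat\<close>.\<close>
  have J: "(LINT y|lebesgue. \<psi> y * of_real (heat_kernel (?c k) x y)) = ?J k x" for k x
  proof -
    let ?f = "\<lambda>y. \<psi> y * of_real (heat_kernel (?c k) x y)"
    have m: "?f \<in> borel_measurable borel"
      unfolding heat_kernel_def by (intro borel_measurable_continuous_onI continuous_intros cont)
    have "(LINT y|lebesgue. ?f y) = \<bar>- inverse (?c k)\<bar> ^ DIM(real^'n) *\<^sub>R (LINT s|lebesgue. ?f (x + (- inverse (?c k)) *\<^sub>R s))"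
      by (rule lebesgue_affine(2)[OF m]) simp
    also have "\<dots> = (LINT s|lebesgue. \<bar>- inverse (?c k)\<bar> ^ CARD('n) *\<^sub>R ?f (x + (- inverse (?c k)) *\<^sub>R s))"
      by (simp del: of_nat_Suc)
    also have "\<dots> = ?J k x"
    proof (intro Bochner_Integration.integral_cong refl)
      fix s :: "real^'n"
      have "?c k *\<^sub>R (x - (x + (- inverse (?c k)) *\<^sub>R s)) = s"
        by (simp del: of_nat_Suc)
      moreover have "\<bar>- inverse (?c k)\<bar> ^ CARD('n) * ?c k ^ CARD('n) = 1"
        by (simp del: of_nat_Suc flip: power_mult_distrib)
      moreover have "of_real a * (P * of_real (b * h)) = P * of_real h" if "a * b = 1" for a b h and P :: complex
      proof -
        have "of_real a * (P * of_real (b * h)) = of_real (a * b) * (P * of_real h)" by simp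
        then show ?thesis using that by simp
      qed
      ultimately show "\<bar>- inverse (?c k)\<bar> ^ CARD('n) *\<^sub>R ?f (x + (- inverse (?c k)) *\<^sub>R s)
          = \<psi> (x + (- inverse (?c k)) *\<^sub>R s) * of_real (heat s)"
        unfolding heat_kernel_def scaleR_conv_of_real[where 'a = complex] by (simp only:)
    qed
    finally show ?thesis .
  qed
  have B0: "B \<ge> 0" using B[of 0] norm_ge_zero order.trans by blast
  have hm: "(\<lambda>s::real^'n. complex_of_real (heat s)) \<in> borel_measurable lebesgue"
    by (intro continuous_lebesgue_measurable continuous_intros)
  have bd: "norm (?J k x) \<le> B" for k x
  proof -
    have "norm (?J k x) \<le> (LINT s|lebesgue. norm (\<psi> (x + (- inverse (?c k)) *\<^sub>R s) * of_real (heat s)))"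
      by (rule integral_norm_bound)
    also have "\<dots> \<le> (LINT s::real^'n|lebesgue. B * heat s)"
      by (rule integral_mono_AE')
        (use heat_integrable B B0 in \<open>auto simp: norm_mult heat_nonneg mult_right_mono\<close>)
    finally show ?thesis by (simp add: heat_integral)
  qed
  have \<psi>m: "(\<lambda>s. \<psi> (x + (- inverse (?c k)) *\<^sub>R s)) \<in> borel_measurable lebesgue" for x k
    by (intro continuous_lebesgue_measurable continuous_on_compose2[OF cont] continuous_intros) auto
  have lim: "(\<lambda>k. ?J k x) \<longlonglongrightarrow> \<psi> x" for x
  proof -
    have "(\<lambda>k. ?J k x) \<longlonglongrightarrow> (LINT s::real^'n|lebesgue. \<psi> x * of_real (heat s))"
    proof (rule integral_dominated_convergence[where w = "\<lambda>s::real^'n. B * heat s"])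
      show "integrable lebesgue (\<lambda>s::real^'n. B * heat s)"
        by (intro integrable_mult_right heat_integrable)
      show "AE s in lebesgue. (\<lambda>k. \<psi> (x + (- inverse (?c k)) *\<^sub>R s) * of_real (heat s)) \<longlonglongrightarrow> \<psi> x * of_real (heat s)"
      proof (intro AE_I2 tendsto_mult tendsto_const)
        fix s :: "real^'n"
        have "(\<lambda>k. x + (- inverse (?c k)) *\<^sub>R s) \<longlonglongrightarrow> x + (- 0) *\<^sub>R s"
          by (intro tendsto_intros LIMSEQ_inverse_real_of_nat)
        then show "(\<lambda>k. \<psi> (x + (- inverse (?c k)) *\<^sub>R s)) \<longlonglongrightarrow> \<psi> x"
          by (intro continuous_on_tendsto_compose[OF cont]) auto
      qed
      show "AE s in lebesgue. norm (\<psi> (x + (- inverse (?c k)) *\<^sub>R s) * of_real (heat s)) \<le> B * heat s" for k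
        using B by (intro AE_I2) (simp add: norm_mult heat_nonneg mult_right_mono)
      show "(\<lambda>s. \<psi> (x + (- inverse (?c k)) *\<^sub>R s) * of_real (heat s)) \<in> borel_measurable lebesgue" for k
        by (intro borel_measurable_times \<psi>m hm)
      show "(\<lambda>s::real^'n. \<psi> x * of_real (heat s)) \<in> borel_measurable lebesgue"
        by (intro borel_measurable_times borel_measurable_const hm)
    qed
    also have "(LINT s::real^'n|lebesgue. \<psi> x * of_real (heat s)) = \<psi> x"
      by (simp add: heat_integral)
    finally show ?thesis .
  qed
  \<comment> \<open>Measurability of the averages comes from their sequential continuity, again by
    dominated convergence.\<close>
  have Jm: "?J k \<in> borel_measurable lebesgue" for k
  proof (intro continuous_lebesgue_measurable)
    show "continuous_on UNIV (?J k)"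
    proof (intro continuous_at_imp_continuous_on ballI)
      fix x
      show "isCont (?J k) x"
        unfolding continuous_at_sequentially comp_def
      proof (intro allI impI)
        fix \<xi> assume \<xi>: "\<xi> \<longlonglongrightarrow> x"
        show "(\<lambda>n. ?J k (\<xi> n)) \<longlonglongrightarrow> ?J k x"
        proof (rule integral_dominated_convergence[where w = "\<lambda>s::real^'n. B * heat s"])
          show "integrable lebesgue (\<lambda>s::real^'n. B * heat s)"
            by (intro integrable_mult_right heat_integrable)
          show "AE s in lebesgue. (\<lambda>n. \<psi> (\<xi> n + (- inverse (?c k)) *\<^sub>R s) * of_real (heat s)) \<longlonglongrightarrow> \<psi> (x + (- inverse (?c k)) *\<^sub>R s) * of_real (heat s)"
            by (intro AE_I2 tendsto_mult tendsto_const continuous_on_tendsto_compose[OF cont] tendsto_add \<xi>) auto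
          show "AE s in lebesgue. norm (\<psi> (\<xi> n + (- inverse (?c k)) *\<^sub>R s) * of_real (heat s)) \<le> B * heat s" for n
            using B by (intro AE_I2) (simp add: norm_mult heat_nonneg mult_right_mono)
        qed (intro borel_measurable_times \<psi>m hm)+
      qed
    qed
  qed
  have "(\<lambda>k. LINT x|lebesgue. \<phi> x * ?J k x) \<longlonglongrightarrow> (LINT x|lebesgue. \<phi> x * \<psi> x)"
  proof (rule integral_dominated_convergence[where w = "\<lambda>x. norm (\<phi> x) * B"])
    show "integrable lebesgue (\<lambda>x. norm (\<phi> x) * B)"
      by (intro integrable_mult_left integrable_norm \<phi>)
    show "AE x in lebesgue. (\<lambda>k. \<phi> x * ?J k x) \<longlonglongrightarrow> \<phi> x * \<psi> x"
      by (intro AE_I2 tendsto_mult tendsto_const lim)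
    show "AE x in lebesgue. norm (\<phi> x * ?J k x) \<le> norm (\<phi> x) * B" for k
      unfolding norm_mult by (intro AE_I2 mult_left_mono bd norm_ge_zero)
    show "(\<lambda>x. \<phi> x * \<psi> x) \<in> borel_measurable lebesgue"
      by (intro borel_measurable_times borel_measurable_integrable \<phi> \<psi>)
    show "(\<lambda>x. \<phi> x * ?J k x) \<in> borel_measurable lebesgue" for k
      by (intro borel_measurable_times borel_measurable_integrable[OF \<phi>] Jm)
  qed
  moreover have "(LINT z|lebesgue. fourier_L1 \<phi> z * (inv_fourier_L1 \<psi> z * of_real (gauss (z /\<^sub>R ?c k))))
      = (LINT x|lebesgue. \<phi> x * ?J k x)" for k
    unfolding J[symmetric] by (rule gauss_pairing[OF \<phi> \<psi>]) simp
  ultimately show ?thesis by simp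
qed

section \<open>The Fourier transform on L2\<close>

subsection \<open>The extension of a contraction\<close>

text \<open>The Gaussian is the strictly positive weight that \<open>Lp2_complete\<close> asks
  for.\<close>

lemma gauss_Lp2: "(gauss :: real^'n \<Rightarrow> real) \<in> Lp 2"
proof -
  have "integrable lebesgue (\<lambda>x::real^'n. (norm (gauss x))\<^sup>2)"
  proof (rule Bochner_Integration.integrable_bound[OF gauss_integrable])
    show "(\<lambda>x::real^'n. (norm (gauss x))\<^sup>2) \<in> borel_measurable lebesgue"
      by (intro continuous_lebesgue_measurable continuous_intros)
    show "AE x::real^'n in lebesgue. norm ((norm (gauss x))\<^sup>2) \<le> norm (gauss x)"
    proof (intro AE_I2)
      fix x :: "real^'n"
      show "norm ((norm (gauss x))\<^sup>2) \<le> norm (gauss x)"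
        using mult_left_mono[OF gauss_bounds(2)[of x] less_imp_le[OF gauss_bounds(1)[of x]]] gauss_bounds(1)[of x]
        by (simp add: power2_eq_square)
    qed
  qed
  then show ?thesis
    using gauss_integrable by (auto simp: Lp2_iff)
qed

lemma Lp1_Lp2_diff:
  fixes u v :: "real^'n \<Rightarrow> complex"
  shows "u \<in> Lp 1 \<inter> Lp 2 \<Longrightarrow> v \<in> Lp 1 \<inter> Lp 2 \<Longrightarrow> (\<lambda>x. u x - v x) \<in> Lp 1 \<inter> Lp 2"
  using Lp2_diff[of u v] by (auto simp: Lp1_iff)

text \<open>The two clauses together make \<open>T\<close> 1-Lipschitz for the L2 distance on L1
  \<inter> L2. Abstracting from the kernel extends both transforms at once.\<close>

definition L2_contraction :: "((real^'n \<Rightarrow> complex) \<Rightarrow> real^'n \<Rightarrow> complex) \<Rightarrow> bool" where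
  "L2_contraction T \<longleftrightarrow>
     (\<forall>u\<in>Lp 1 \<inter> Lp 2. T u \<in> Lp 2 \<and> Lp_norm 2 (T u) \<le> Lp_norm 2 u) \<and>
     (\<forall>u\<in>Lp 1 \<inter> Lp 2. \<forall>v\<in>Lp 1 \<inter> Lp 2. T (\<lambda>x. u x - v x) = (\<lambda>x. T u x - T v x))"

lemma L2_contraction_fourier_L1: "L2_contraction fourier_L1"
  unfolding L2_contraction_def
  by (auto simp: fourier_L1_contraction Lp1_iff fun_eq_iff fourier_L1_diff)

lemma L2_contraction_inv_fourier_L1: "L2_contraction inv_fourier_L1"
  unfolding L2_contraction_def
  by (auto simp: inv_fourier_L1_contraction Lp1_iff fun_eq_iff fourier_L1_diff inv_fourier_L1_minus)

lemma L2_contraction_dist: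
  assumes "L2_contraction T" "u \<in> Lp 1 \<inter> Lp 2" "v \<in> Lp 1 \<inter> Lp 2"
  shows "Lp_norm 2 (\<lambda>x. T u x - T v x) \<le> Lp_norm 2 (\<lambda>x. u x - v x)"
proof -
  have "Lp_norm 2 (T (\<lambda>x. u x - v x)) \<le> Lp_norm 2 (\<lambda>x. u x - v x)"
    using assms(1) Lp1_Lp2_diff[OF assms(2,3)] unfolding L2_contraction_def by blast
  moreover have "T (\<lambda>x. u x - v x) = (\<lambda>x. T u x - T v x)"
    using assms unfolding L2_contraction_def by blast
  ultimately show ?thesis by simp
qed

text \<open>Shows that the choice in \<open>L2_extension\<close> has a witness. The limit along
  truncations exists by completeness; for any other approximating sequence, the distance between its
  images and those of the truncations is at most the sum of both distances to
  \<open>f\<close>.\<close>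

lemma L2_extension_exists:
  fixes f :: "real^'n \<Rightarrow> complex"
  assumes T: "L2_contraction T" and f: "f \<in> Lp 2"
  shows "\<exists>g. g \<in> Lp 2 \<and>
     (\<forall>\<phi>::nat \<Rightarrow> real^'n \<Rightarrow> complex.
        (\<forall>k. \<phi> k \<in> Lp 1 \<inter> Lp 2) \<longrightarrow> (\<lambda>k. Lp_norm 2 (\<lambda>x. \<phi> k x - f x)) \<longlonglongrightarrow> 0 \<longrightarrow>
        (\<forall>k. T (\<phi> k) \<in> Lp 2) \<and> (\<lambda>k. Lp_norm 2 (\<lambda>x. T (\<phi> k) x - g x)) \<longlonglongrightarrow> 0)"
proof -
  define t where "t k x = indicator (ball 0 (real k)) x *\<^sub>R f x" for k x
  have t: "t k \<in> Lp 1 \<inter> Lp 2" for k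
    unfolding t_def by (rule Lp2_truncation(1)[OF f])
  have tlim: "(\<lambda>k. Lp_norm 2 (\<lambda>x. t k x - f x)) \<longlonglongrightarrow> 0"
    unfolding t_def by (rule Lp2_truncation(2)[OF f])
  have T2: "T u \<in> Lp 2" if "u \<in> Lp 1 \<inter> Lp 2" for u
    using T that unfolding L2_contraction_def by blast
  obtain g where g: "g \<in> Lp 2" "(\<lambda>k. Lp_norm 2 (\<lambda>x. T (t k) x - g x)) \<longlonglongrightarrow> 0"
  proof (rule Lp2_complete[of "\<lambda>k. T (t k)", OF T2[OF t] gauss_Lp2 gauss_bounds(1)])
    fix e :: real assume "e > 0"
    then obtain N where N: "\<And>k. k \<ge> N \<Longrightarrow> Lp_norm 2 (\<lambda>x. t k x - f x) < e / 2"
      using LIMSEQ_D[OF tlim, of "e / 2"] by fastforce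
    have "Lp_norm 2 (\<lambda>x. T (t i) x - T (t j) x) < e" if "i \<ge> N" "j \<ge> N" for i j
    proof -
      have "Lp_norm 2 (\<lambda>x. T (t i) x - T (t j) x) \<le> Lp_norm 2 (\<lambda>x. t i x - t j x)"
        by (rule L2_contraction_dist[OF T t t])
      also have "\<dots> \<le> Lp_norm 2 (\<lambda>x. t i x - f x) + Lp_norm 2 (\<lambda>x. f x - t j x)"
        using t f by (intro Lp_norm_2_triangle_diff) auto
      also have "\<dots> < e / 2 + e / 2"
        using N[OF that(1)] N[OF that(2)] by (simp only: Lp_norm_2_minus_commute[of f "t j"])
      finally show ?thesis by simp
    qed
    then show "\<exists>N. \<forall>i\<ge>N. \<forall>j\<ge>N. Lp_norm 2 (\<lambda>x. T (t i) x - T (t j) x) < e" by blast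
  qed
  have "(\<lambda>k. Lp_norm 2 (\<lambda>x. T (\<phi> k) x - g x)) \<longlonglongrightarrow> 0"
    if \<phi>: "\<And>k. \<phi> k \<in> Lp 1 \<inter> Lp 2" and lim: "(\<lambda>k. Lp_norm 2 (\<lambda>x. \<phi> k x - f x)) \<longlonglongrightarrow> 0" for \<phi>
  proof (rule tendsto_sandwich[OF always_eventually always_eventually tendsto_const])
    show "\<forall>k. Lp_norm 2 (\<lambda>x. T (\<phi> k) x - g x) \<le>
       (Lp_norm 2 (\<lambda>x. \<phi> k x - f x) + Lp_norm 2 (\<lambda>x. t k x - f x)) + Lp_norm 2 (\<lambda>x. T (t k) x - g x)"
    proof
      fix k
      have "Lp_norm 2 (\<lambda>x. T (\<phi> k) x - g x) \<le> Lp_norm 2 (\<lambda>x. T (\<phi> k) x - T (t k) x) + Lp_norm 2 (\<lambda>x. T (t k) x - g x)"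
        by (intro Lp_norm_2_triangle_diff T2 \<phi> t g)
      also have "Lp_norm 2 (\<lambda>x. T (\<phi> k) x - T (t k) x) \<le> Lp_norm 2 (\<lambda>x. \<phi> k x - t k x)"
        by (rule L2_contraction_dist[OF T \<phi> t])
      also have "\<dots> \<le> Lp_norm 2 (\<lambda>x. \<phi> k x - f x) + Lp_norm 2 (\<lambda>x. f x - t k x)"
        using \<phi>[of k] t[of k] f by (intro Lp_norm_2_triangle_diff) auto
      finally show "Lp_norm 2 (\<lambda>x. T (\<phi> k) x - g x) \<le>
         (Lp_norm 2 (\<lambda>x. \<phi> k x - f x) + Lp_norm 2 (\<lambda>x. t k x - f x)) + Lp_norm 2 (\<lambda>x. T (t k) x - g x)"
        by (simp only: Lp_norm_2_minus_commute[of f "t k"])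
    qed
    show "(\<lambda>k. (Lp_norm 2 (\<lambda>x. \<phi> k x - f x) + Lp_norm 2 (\<lambda>x. t k x - f x)) + Lp_norm 2 (\<lambda>x. T (t k) x - g x)) \<longlonglongrightarrow> 0"
      using tendsto_add[OF tendsto_add[OF lim tlim] g(2)] by simp
    show "\<forall>k. 0 \<le> Lp_norm 2 (\<lambda>x. T (\<phi> k) x - g x)"
      by (simp add: Lp_norm_nonneg)
  qed
  with g T2 show ?thesis by blast
qed

lemma L2_extension:
  fixes f :: "real^'n \<Rightarrow> complex"
  assumes T: "L2_contraction T" and f: "f \<in> Lp 2"
  shows "L2_extension T f \<in> Lp 2"
    and "\<And>\<phi>. (\<And>k. \<phi> k \<in> Lp 1 \<inter> Lp 2) \<Longrightarrow> (\<lambda>k. Lp_norm 2 (\<lambda>x. \<phi> k x - f x)) \<longlonglongrightarrow> 0 \<Longrightarrow>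
      (\<lambda>k. Lp_norm 2 (\<lambda>x. T (\<phi> k) x - L2_extension T f x)) \<longlonglongrightarrow> 0"
  using someI_ex[OF L2_extension_exists[OF assms]] unfolding L2_extension_def by blast+

lemma L2_extension_norm_le:
  fixes f :: "real^'n \<Rightarrow> complex"
  assumes T: "L2_contraction T" and f: "f \<in> Lp 2"
  shows "Lp_norm 2 (L2_extension T f) \<le> Lp_norm 2 f"
proof -
  define t where "t k x = indicator (ball 0 (real k)) x *\<^sub>R f x" for k x
  have t: "t k \<in> Lp 1 \<inter> Lp 2" for k
    unfolding t_def by (rule Lp2_truncation(1)[OF f])
  have tlim: "(\<lambda>k. Lp_norm 2 (\<lambda>x. t k x - f x)) \<longlonglongrightarrow> 0"
    unfolding t_def by (rule Lp2_truncation(2)[OF f])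
  note g = L2_extension[OF T f]
  have T2: "T (t k) \<in> Lp 2" "Lp_norm 2 (T (t k)) \<le> Lp_norm 2 (t k)" for k
    using T t unfolding L2_contraction_def by blast+
  have tf: "Lp_norm 2 (t k) \<le> 1 * Lp_norm 2 f" for k
    using t[of k] by (intro Lp2_norm_dominated[OF f]) (auto simp: t_def Lp2_iff indicator_def)
  have "Lp_norm 2 (L2_extension T f) \<le> Lp_norm 2 (\<lambda>x. T (t k) x - L2_extension T f x) + Lp_norm 2 f" for k
  proof -
    have "Lp_norm 2 (\<lambda>x. (L2_extension T f x - T (t k) x) + T (t k) x)
        \<le> Lp_norm 2 (\<lambda>x. L2_extension T f x - T (t k) x) + Lp_norm 2 (T (t k))"
      by (intro Lp_norm_2_triangle Lp2_diff g T2)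
    then show ?thesis
      using T2(2)[of k] tf[of k] Lp_norm_2_minus_commute[of "L2_extension T f" "T (t k)"] by simp
  qed
  moreover have "(\<lambda>k. Lp_norm 2 (\<lambda>x. T (t k) x - L2_extension T f x) + Lp_norm 2 f) \<longlonglongrightarrow> 0 + Lp_norm 2 f"
    by (intro tendsto_add g(2) t tlim tendsto_const)
  ultimately show ?thesis
    using LIMSEQ_le_const[of _ "0 + Lp_norm 2 f"] by auto
qed

text \<open>The constant sequence \<open>f\<close> is itself an admissible approximation; its images
  do not move, so their distance to the extension is 0.\<close>

lemma L2_extension_eq:
  fixes f :: "real^'n \<Rightarrow> complex"
  assumes T: "L2_contraction T" and f: "f \<in> Lp 1 \<inter> Lp 2"
  shows "AE x in lebesgue. L2_extension T f x = T f x"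
proof -
  have f2: "f \<in> Lp 2" using f by simp
  have "(\<lambda>k::nat. Lp_norm 2 (\<lambda>x. T f x - L2_extension T f x)) \<longlonglongrightarrow> 0"
    using L2_extension(2)[OF T f2, of "\<lambda>_. f"] f by (simp add: Lp_norm_2)
  then have "Lp_norm 2 (\<lambda>x. T f x - L2_extension T f x) = 0"
    by (simp add: LIMSEQ_const_iff)
  moreover have "(\<lambda>x. T f x - L2_extension T f x) \<in> Lp 2"
    using T f L2_extension(1)[OF T f2] unfolding L2_contraction_def by (intro Lp2_diff) blast+
  ultimately show ?thesis
    using Lp_norm_2_eq_0 by fastforce
qed

subsection \<open>Testing\<close>

lemma test_function_bounded_support:
  fixes \<phi> :: "real^'n \<Rightarrow> real"
  assumes "test_function \<phi>"
  obtains R B where "R > 0" "\<And>x. norm x > R \<Longrightarrow> \<phi> x = 0" "\<And>x. \<bar>\<phi> x\<bar> \<le> B * indicator (cball 0 R) x" "B > 0"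
proof -
  obtain R where R: "R > 0" "\<And>x. norm x > R \<Longrightarrow> \<phi> x = 0"
    using assms unfolding test_function_def compact_support_iff by blast
  have "compact (\<phi> ` cball 0 R)"
    by (intro compact_continuous_image test_function_continuous assms compact_cball)
  then obtain B where B: "\<forall>y\<in>\<phi> ` cball 0 R. norm y \<le> B" "B > 0"
    using compact_imp_bounded bounded_pos by metis
  have "\<bar>\<phi> x\<bar> \<le> B * indicator (cball 0 R) x" for x
    using R(2)[of x] B(1) by (cases "x \<in> cball 0 R") auto
  with R B that show ?thesis by blast
qed

lemma test_function_Lp:
  fixes \<phi> :: "real^'n \<Rightarrow> real"
  assumes "test_function \<phi>"
  shows "(\<lambda>x. complex_of_real (\<phi> x)) \<in> Lp 1 \<inter> Lp 2"
proof -
  obtain R B where RB: "\<And>x. \<bar>\<phi> x\<bar> \<le> B * indicator (cball 0 R) x" "B > 0"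
    using test_function_bounded_support[OF assms] by metis
  have m: "(\<lambda>x. complex_of_real (\<phi> x)) \<in> borel_measurable lebesgue"
    using test_function_continuous[OF assms] by (intro continuous_lebesgue_measurable continuous_intros)
  have ind: "integrable lebesgue (\<lambda>x::real^'n. indicator (cball 0 R) x :: real)"
    using lmeasurable_cball[of "0::real^'n" R] by (simp add: fmeasurable_def)
  have "integrable lebesgue (\<lambda>x. complex_of_real (\<phi> x))"
  proof (rule Bochner_Integration.integrable_bound)
    show "integrable lebesgue (\<lambda>x::real^'n. B * indicator (cball 0 R) x)"
      by (intro integrable_mult_right ind)
    show "AE x in lebesgue. norm (complex_of_real (\<phi> x)) \<le> norm (B * indicator (cball 0 R) x)"
      using order.trans[OF RB(1) abs_ge_self] by simp
  qed (rule m)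
  moreover have "(\<lambda>x. complex_of_real (\<phi> x)) \<in> Lp 2"
  proof (rule Lp2_dominated[OF indicator_Lp2[OF lmeasurable_cball] m, where B = B])
    show "AE x in lebesgue. norm (complex_of_real (\<phi> x)) \<le> B * norm (indicator (cball 0 R) x :: real)"
      using RB by (intro AE_I2) simp
  qed
  ultimately show ?thesis by (simp add: Lp1_iff)
qed

lemma AE_zero_if_test_integrals_zero_complex:
  fixes w :: "real^'n \<Rightarrow> complex"
  assumes w: "\<And>R. integrable lebesgue (\<lambda>x. indicator (cball 0 R) x *\<^sub>R w x)"
    and test: "\<And>\<phi>. product_test \<phi> \<Longrightarrow> (LINT x|lebesgue. w x * of_real (\<phi> x)) = 0"
  shows "AE x in lebesgue. w x = 0"
proof -
  have wK: "integrable lebesgue (\<lambda>x. indicator K x *\<^sub>R w x)" if K: "compact K" for K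
  proof -
    obtain R where "K \<subseteq> cball 0 R"
      using compact_imp_bounded[OF K] unfolding bounded_pos by (auto simp: subset_eq)
    then have "(\<lambda>x. indicator K x *\<^sub>R (indicator (cball 0 R) x *\<^sub>R w x)) = (\<lambda>x. indicator K x *\<^sub>R w x)"
      by (auto simp: indicator_def fun_eq_iff)
    moreover have "integrable lebesgue (\<lambda>x. indicator K x *\<^sub>R (indicator (cball 0 R) x *\<^sub>R w x))"
      using K by (intro integrable_mult_indicator w) (simp add: compact_imp_closed)
    ultimately show ?thesis by simp
  qed
  have int: "integrable lebesgue (\<lambda>x. w x * of_real (\<phi> x))" if \<phi>: "product_test \<phi>" for \<phi>
  proof -
    obtain R B where RB: "\<And>x. norm x > R \<Longrightarrow> \<phi> x = 0" "\<And>x. \<bar>\<phi> x\<bar> \<le> B * indicator (cball 0 R) x" "B > 0"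
      using test_function_bounded_support[OF product_test_test_function[OF \<phi>]] by metis
    have B: "\<bar>\<phi> x\<bar> \<le> B" for x
      using RB(2)[of x] RB(3) by (cases "x \<in> cball 0 R") auto
    have 1: "integrable lebesgue (\<lambda>x. B *\<^sub>R norm (indicator (cball 0 R) x *\<^sub>R w x))"
      by (intro integrable_scaleR_right integrable_norm w)
    have eq: "w x * of_real (\<phi> x) = (indicator (cball 0 R) x *\<^sub>R w x) * of_real (\<phi> x)" for x
      using RB(1)[of x] by (cases "x \<in> cball 0 R") auto
    have 2: "(\<lambda>x. (indicator (cball 0 R) x *\<^sub>R w x) * of_real (\<phi> x)) \<in> borel_measurable lebesgue"
      by (intro borel_measurable_times borel_measurable_integrable[OF w] continuous_lebesgue_measurable
          continuous_intros product_test_continuous \<phi>)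
    have 3: "norm ((indicator (cball 0 R) x *\<^sub>R w x) * of_real (\<phi> x)) \<le> norm (B *\<^sub>R norm (indicator (cball 0 R) x *\<^sub>R w x))" for x
      using mult_left_mono[OF B[of x], of "norm (indicator (cball 0 R) x *\<^sub>R w x)"] RB(3)
      by (simp add: norm_mult mult_ac)
    have "integrable lebesgue (\<lambda>x. (indicator (cball 0 R) x *\<^sub>R w x) * of_real (\<phi> x))"
      by (rule Bochner_Integration.integrable_bound[OF 1 2 AE_I2[OF 3]])
    then show ?thesis by (simp only: eq[symmetric])
  qed
  have "AE x in lebesgue. Re (w x) = 0"
  proof (rule AE_zero_if_test_integrals_zero)
    show "locally_integrable (\<lambda>x. Re (w x))"
      unfolding locally_integrable_def set_integrable_def
      using integrable_Re[OF wK] by simp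
    show "(LINT x|lebesgue. Re (w x) * \<phi> x) = 0" if "product_test \<phi>" for \<phi>
      using integral_Re[OF int[OF that]] test[OF that] by simp
  qed
  moreover have "AE x in lebesgue. Im (w x) = 0"
  proof (rule AE_zero_if_test_integrals_zero)
    show "locally_integrable (\<lambda>x. Im (w x))"
      unfolding locally_integrable_def set_integrable_def
      using integrable_Im[OF wK] by simp
    show "(LINT x|lebesgue. Im (w x) * \<phi> x) = 0" if "product_test \<phi>" for \<phi>
      using integral_Im[OF int[OF that]] test[OF that] by simp
  qed
  ultimately show ?thesis by eventually_elim (simp add: complex_eq_iff)
qed

lemma Lp2_eq_if_test_integrals_eq:
  fixes a b :: "real^'n \<Rightarrow> complex"
  assumes a: "a \<in> Lp 2" and b: "b \<in> Lp 2"
    and test: "\<And>\<phi>. product_test \<phi> \<Longrightarrow> (LINT x|lebesgue. a x * of_real (\<phi> x)) = (LINT x|lebesgue. b x * of_real (\<phi> x))"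
  shows "AE x in lebesgue. a x = b x"
proof -
  have "AE x in lebesgue. a x - b x = 0"
  proof (rule AE_zero_if_test_integrals_zero_complex)
    show "integrable lebesgue (\<lambda>x. indicator (cball 0 R) x *\<^sub>R (a x - b x))" for R
      by (intro Lp2_indicator_integrable Lp2_diff a b lmeasurable_cball)
    fix \<phi> :: "real^'n \<Rightarrow> real" assume \<phi>: "product_test \<phi>"
    have "(\<lambda>x. complex_of_real (\<phi> x)) \<in> Lp 2"
      using test_function_Lp[OF product_test_test_function[OF \<phi>]] by simp
    then show "(LINT x|lebesgue. (a x - b x) * of_real (\<phi> x)) = 0"
      using test[OF \<phi>] by (simp add: left_diff_distrib Lp2_product_integrable a b)
  qed
  then show ?thesis by simp
qed

text \<open>Injectivity on L1: in the regularized inversion formula against a test function, the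
  left side is identically 0.\<close>

lemma fourier_L1_eq_0:
  fixes w :: "real^'n \<Rightarrow> complex"
  assumes w: "integrable lebesgue w" and 0: "\<And>z. fourier_L1 w z = 0"
  shows "AE x in lebesgue. w x = 0"
proof (rule AE_zero_if_test_integrals_zero_complex)
  show "integrable lebesgue (\<lambda>x. indicator (cball 0 R) x *\<^sub>R w x)" for R
    by (intro integrable_mult_indicator w) auto
  fix \<phi> :: "real^'n \<Rightarrow> real" assume \<phi>: "product_test \<phi>"
  note t = product_test_test_function[OF \<phi>]
  obtain R B where RB: "\<And>x. \<bar>\<phi> x\<bar> \<le> B * indicator (cball 0 R) x" "B > 0"
    using test_function_bounded_support[OF t] by metis
  have B: "norm (complex_of_real (\<phi> x)) \<le> B" for x
    using RB(1)[of x] RB(2) by (cases "x \<in> cball 0 R") auto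
  have "(\<lambda>k. LINT z|lebesgue. fourier_L1 w z * (inv_fourier_L1 (\<lambda>x. of_real (\<phi> x)) z * of_real (gauss (z /\<^sub>R real (Suc k)))))
    \<longlonglongrightarrow> (LINT x|lebesgue. w x * of_real (\<phi> x))"
    using test_function_Lp[OF t] B
    by (intro gauss_regularized_inversion w continuous_intros product_test_continuous \<phi>) (auto simp: Lp1_iff)
  then show "(LINT x|lebesgue. w x * of_real (\<phi> x)) = 0"
    by (simp add: 0 LIMSEQ_const_iff)
qed

text \<open>Both transforms are in L2, hence their product dominates the regularized integrands and
  the Gaussian can be removed in the limit.\<close>

lemma fourier_L1_inversion_weak:
  fixes a :: "real^'n \<Rightarrow> complex"
  assumes a: "a \<in> Lp 1 \<inter> Lp 2" and \<phi>: "product_test \<phi>"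
  shows "(LINT z|lebesgue. fourier_L1 a z * inv_fourier_L1 (\<lambda>x. of_real (\<phi> x)) z)
    = (LINT x|lebesgue. a x * of_real (\<phi> x))"
proof (rule LIMSEQ_unique)
  note t = product_test_test_function[OF \<phi>]
  note t12 = test_function_Lp[OF t]
  let ?I = "inv_fourier_L1 (\<lambda>x. complex_of_real (\<phi> x))"
  obtain R B where RB: "\<And>x. \<bar>\<phi> x\<bar> \<le> B * indicator (cball 0 R) x" "B > 0"
    using test_function_bounded_support[OF t] by metis
  have B: "norm (complex_of_real (\<phi> x)) \<le> B" for x
    using RB(1)[of x] RB(2) by (cases "x \<in> cball 0 R") auto
  show "(\<lambda>k. LINT z|lebesgue. fourier_L1 a z * (?I z * of_real (gauss (z /\<^sub>R real (Suc k)))))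
    \<longlonglongrightarrow> (LINT x|lebesgue. a x * of_real (\<phi> x))"
    using a t12 B by (intro gauss_regularized_inversion continuous_intros product_test_continuous \<phi>) (auto simp: Lp1_iff)
  have int: "integrable lebesgue (\<lambda>z. fourier_L1 a z * ?I z)"
    by (intro Lp2_product_integrable fourier_L1_contraction inv_fourier_L1_contraction a t12)
  have gm: "(\<lambda>z::real^'n. complex_of_real (gauss (z /\<^sub>R real (Suc k)))) \<in> borel_measurable lebesgue" for k
    by (intro continuous_lebesgue_measurable continuous_intros)
  show "(\<lambda>k. LINT z|lebesgue. fourier_L1 a z * (?I z * of_real (gauss (z /\<^sub>R real (Suc k)))))
    \<longlonglongrightarrow> (LINT z|lebesgue. fourier_L1 a z * ?I z)"
  proof (rule integral_dominated_convergence[where w = "\<lambda>z. norm (fourier_L1 a z * ?I z)"])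
    show "AE z in lebesgue. (\<lambda>k. fourier_L1 a z * (?I z * of_real (gauss (z /\<^sub>R real (Suc k))))) \<longlonglongrightarrow> fourier_L1 a z * ?I z"
    proof (intro AE_I2)
      fix z :: "real^'n"
      have "(\<lambda>k. gauss (inverse (real (Suc k)) *\<^sub>R z)) \<longlonglongrightarrow> gauss (0 *\<^sub>R z)"
        by (rule continuous_on_tendsto_compose[OF gauss_continuous[OF continuous_on_id, of UNIV]])
          (rule tendsto_scaleR[OF LIMSEQ_inverse_real_of_nat tendsto_const], auto)
      then have "(\<lambda>k. fourier_L1 a z * (?I z * of_real (gauss (inverse (real (Suc k)) *\<^sub>R z)))) \<longlonglongrightarrow> fourier_L1 a z * (?I z * of_real (gauss (0 *\<^sub>R z)))"
        by (intro tendsto_mult tendsto_const tendsto_of_real)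
      then show "(\<lambda>k. fourier_L1 a z * (?I z * of_real (gauss (z /\<^sub>R real (Suc k))))) \<longlonglongrightarrow> fourier_L1 a z * ?I z"
        by (simp add: gauss_0)
    qed
    show "AE z in lebesgue. norm (fourier_L1 a z * (?I z * of_real (gauss (z /\<^sub>R real (Suc k))))) \<le> norm (fourier_L1 a z * ?I z)" for k
    proof (intro AE_I2)
      fix z :: "real^'n"
      show "norm (fourier_L1 a z * (?I z * of_real (gauss (z /\<^sub>R real (Suc k))))) \<le> norm (fourier_L1 a z * ?I z)"
        using gauss_bounds[of "z /\<^sub>R real (Suc k)"]
        by (simp add: norm_mult mult_left_le mult_left_mono del: of_nat_Suc flip: mult.assoc)
    qed
    show "(\<lambda>z. fourier_L1 a z * (?I z * of_real (gauss (z /\<^sub>R real (Suc k))))) \<in> borel_measurable lebesgue" for k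
      using borel_measurable_times[OF borel_measurable_integrable[OF int] gm[of k]] by (simp only: mult.assoc)
  qed (use int in \<open>auto intro: borel_measurable_integrable\<close>)
qed

subsection \<open>Plancherel and inversion\<close>

abbreviation F2 :: "(real^'n \<Rightarrow> complex) \<Rightarrow> real^'n \<Rightarrow> complex" where
  "F2 \<equiv> L2_extension fourier_L1"

abbreviation I2 :: "(real^'n \<Rightarrow> complex) \<Rightarrow> real^'n \<Rightarrow> complex" where
  "I2 \<equiv> L2_extension inv_fourier_L1"

lemmas F2_Lp2 = L2_extension(1)[OF L2_contraction_fourier_L1]
  and I2_Lp2 = L2_extension(1)[OF L2_contraction_inv_fourier_L1]
  and F2_limit = L2_extension(2)[OF L2_contraction_fourier_L1]
  and I2_limit = L2_extension(2)[OF L2_contraction_inv_fourier_L1]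
  and F2_eq = L2_extension_eq[OF L2_contraction_fourier_L1]
  and I2_eq = L2_extension_eq[OF L2_contraction_inv_fourier_L1]

lemma L2_extension_multiplication:
  fixes a b :: "real^'n \<Rightarrow> complex"
  assumes T: "L2_contraction T"
    and mult: "\<And>u v. u \<in> Lp 1 \<inter> Lp 2 \<Longrightarrow> v \<in> Lp 1 \<inter> Lp 2 \<Longrightarrow>
      (LINT x|lebesgue. T u x * v x) = (LINT x|lebesgue. u x * T v x)"
    and a: "a \<in> Lp 2" and b: "b \<in> Lp 2"
  shows "(LINT x|lebesgue. L2_extension T a x * b x) = (LINT x|lebesgue. a x * L2_extension T b x)"
proof -
  define s where "s k x = indicator (ball 0 (real k)) x *\<^sub>R a x" for k x
  define t where "t k x = indicator (ball 0 (real k)) x *\<^sub>R b x" for k x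
  have s: "s k \<in> Lp 1 \<inter> Lp 2" and t: "t k \<in> Lp 1 \<inter> Lp 2" for k
    unfolding s_def t_def by (rule Lp2_truncation(1)[OF a], rule Lp2_truncation(1)[OF b])
  have slim: "(\<lambda>k. Lp_norm 2 (\<lambda>x. s k x - a x)) \<longlonglongrightarrow> 0" and tlim: "(\<lambda>k. Lp_norm 2 (\<lambda>x. t k x - b x)) \<longlonglongrightarrow> 0"
    unfolding s_def t_def by (rule Lp2_truncation(2)[OF a], rule Lp2_truncation(2)[OF b])
  have T2: "T u \<in> Lp 2" if "u \<in> Lp 1 \<inter> Lp 2" for u
    using T that unfolding L2_contraction_def by blast
  have s2: "s k \<in> Lp 2" and t2: "t k \<in> Lp 2" for k using s t by auto
  have "(\<lambda>k. LINT x|lebesgue. T (s k) x * t k x) \<longlonglongrightarrow> (LINT x|lebesgue. L2_extension T a x * b x)"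
    by (intro Lp2_tendsto_product T2 s t2 L2_extension T a b slim tlim)
  moreover have "(\<lambda>k. LINT x|lebesgue. s k x * T (t k) x) \<longlonglongrightarrow> (LINT x|lebesgue. a x * L2_extension T b x)"
    by (intro Lp2_tendsto_product T2 t s2 L2_extension T a b slim tlim)
  ultimately show ?thesis
    unfolding mult[OF s t] by (rule LIMSEQ_unique)
qed

lemma F2_multiplication:
  assumes "a \<in> Lp 2" "b \<in> Lp 2"
  shows "(LINT x|lebesgue. F2 a x * b x) = (LINT x|lebesgue. a x * F2 b x)"
  by (rule L2_extension_multiplication[OF L2_contraction_fourier_L1 _ assms])
    (rule fourier_L1_multiplication, auto simp: Lp1_iff)

lemma I2_multiplication:
  assumes "a \<in> Lp 2" "b \<in> Lp 2"
  shows "(LINT x|lebesgue. I2 a x * b x) = (LINT x|lebesgue. a x * I2 b x)"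
  by (rule L2_extension_multiplication[OF L2_contraction_inv_fourier_L1 _ assms])
    (rule inv_fourier_L1_multiplication, auto simp: Lp1_iff)

lemma integral_times_cong_AE:
  fixes f g h :: "real^'n \<Rightarrow> complex"
  assumes "AE x in lebesgue. f x = g x" "f \<in> borel_measurable lebesgue" "g \<in> borel_measurable lebesgue"
    "h \<in> borel_measurable lebesgue"
  shows "(LINT x|lebesgue. h x * f x) = (LINT x|lebesgue. h x * g x)"
    and "(LINT x|lebesgue. f x * h x) = (LINT x|lebesgue. g x * h x)"
  using assms(1) by (intro integral_cong_AE borel_measurable_times assms; auto)+

lemma F2_test:
  assumes a: "a \<in> Lp 2" and \<phi>: "test_function \<phi>"
  shows "(LINT x|lebesgue. F2 a x * of_real (\<phi> x)) = (LINT x|lebesgue. a x * fourier_L1 (\<lambda>x. of_real (\<phi> x)) x)"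
proof -
  note t = test_function_Lp[OF \<phi>]
  then have t2: "(\<lambda>x. complex_of_real (\<phi> x)) \<in> Lp 2" by simp
  show ?thesis
    unfolding F2_multiplication[OF a t2]
    by (intro integral_times_cong_AE F2_eq t Lp2_measurable[OF a] Lp2_measurable[OF F2_Lp2[OF t2]]
        Lp2_measurable[OF fourier_L1_contraction(1)[OF t]])
qed

lemma I2_test:
  assumes a: "a \<in> Lp 2" and \<phi>: "test_function \<phi>"
  shows "(LINT x|lebesgue. I2 a x * of_real (\<phi> x)) = (LINT x|lebesgue. a x * inv_fourier_L1 (\<lambda>x. of_real (\<phi> x)) x)"
proof -
  note t = test_function_Lp[OF \<phi>]
  then have t2: "(\<lambda>x. complex_of_real (\<phi> x)) \<in> Lp 2" by simp
  show ?thesis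
    unfolding I2_multiplication[OF a t2]
    by (intro integral_times_cong_AE I2_eq t Lp2_measurable[OF a] Lp2_measurable[OF I2_Lp2[OF t2]]
        Lp2_measurable[OF inv_fourier_L1_contraction(1)[OF t]])
qed

lemma F2_inv_test:
  assumes a: "a \<in> Lp 2" and \<phi>: "product_test \<phi>"
  shows "(LINT x|lebesgue. F2 a x * inv_fourier_L1 (\<lambda>x. of_real (\<phi> x)) x) = (LINT x|lebesgue. a x * of_real (\<phi> x))"
proof -
  define s where "s k x = indicator (ball 0 (real k)) x *\<^sub>R a x" for k x
  have s: "s k \<in> Lp 1 \<inter> Lp 2" for k
    unfolding s_def by (rule Lp2_truncation(1)[OF a])
  then have s2: "s k \<in> Lp 2" for k by auto
  have slim: "(\<lambda>k. Lp_norm 2 (\<lambda>x. s k x - a x)) \<longlonglongrightarrow> 0"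
    unfolding s_def by (rule Lp2_truncation(2)[OF a])
  let ?\<phi> = "\<lambda>x. complex_of_real (\<phi> x)"
  note t = test_function_Lp[OF product_test_test_function[OF \<phi>]]
  then have t2: "?\<phi> \<in> Lp 2" by simp
  have c: "(\<lambda>k. Lp_norm 2 (\<lambda>x. h x - h x)) \<longlonglongrightarrow> 0" for h :: "real^'a \<Rightarrow> complex"
    by (simp add: Lp_norm_2)
  have "(\<lambda>k. LINT x|lebesgue. fourier_L1 (s k) x * inv_fourier_L1 ?\<phi> x) \<longlonglongrightarrow> (LINT x|lebesgue. F2 a x * inv_fourier_L1 ?\<phi> x)"
    by (intro Lp2_tendsto_product fourier_L1_contraction s inv_fourier_L1_contraction t F2_Lp2 F2_limit a slim c)
  moreover have "(\<lambda>k. LINT x|lebesgue. s k x * ?\<phi> x) \<longlonglongrightarrow> (LINT x|lebesgue. a x * ?\<phi> x)"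
    by (intro Lp2_tendsto_product s2 t2 a slim c)
  ultimately show ?thesis
    unfolding fourier_L1_inversion_weak[OF s \<phi>] by (rule LIMSEQ_unique)
qed

text \<open>Moving \<open>I2\<close> onto the test function leaves the pairing of
  \<open>F2 a\<close> with the inverse transform of a test function, which is the weak inversion
  formula.\<close>

lemma I2_F2:
  assumes a: "a \<in> Lp 2"
  shows "AE x in lebesgue. I2 (F2 a) x = a x"
proof (rule Lp2_eq_if_test_integrals_eq[OF I2_Lp2[OF F2_Lp2[OF a]] a])
  fix \<phi> :: "real^'a \<Rightarrow> real" assume \<phi>: "product_test \<phi>"
  show "(LINT x|lebesgue. I2 (F2 a) x * of_real (\<phi> x)) = (LINT x|lebesgue. a x * of_real (\<phi> x))"
    unfolding I2_test[OF F2_Lp2[OF a] product_test_test_function[OF \<phi>]] by (rule F2_inv_test[OF a \<phi>])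
qed

text \<open>Neither transform increases the norm and \<open>I2\<close> undoes \<open>F2\<close>, so
  \<open>F2\<close> cannot decrease it.\<close>

lemma F2_norm:
  assumes a: "a \<in> Lp 2"
  shows "Lp_norm 2 (F2 a) = Lp_norm 2 a"
proof (rule antisym)
  show "Lp_norm 2 (F2 a) \<le> Lp_norm 2 a"
    by (rule L2_extension_norm_le[OF L2_contraction_fourier_L1 a])
  have "Lp_norm 2 a = Lp_norm 2 (I2 (F2 a))"
    by (rule Lp_norm_2_cong_AE[symmetric]) (intro Lp2_measurable a I2_Lp2 F2_Lp2 I2_F2)+
  also have "\<dots> \<le> Lp_norm 2 (F2 a)"
    by (intro L2_extension_norm_le L2_contraction_inv_fourier_L1 F2_Lp2 a)
  finally show "Lp_norm 2 a \<le> Lp_norm 2 (F2 a)" .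
qed

text \<open>The value of \<open>F2\<close> is a chosen representative, so identities such as
  linearity are obtained by comparing pairings with test functions, where the transform has moved to
  the test function.\<close>

lemma Lp2_eq_F2:
  assumes g: "g \<in> Lp 2" and a: "a \<in> Lp 2"
    and test: "\<And>\<phi>. product_test \<phi> \<Longrightarrow>
      (LINT x|lebesgue. g x * of_real (\<phi> x)) = (LINT x|lebesgue. a x * fourier_L1 (\<lambda>x. of_real (\<phi> x)) x)"
  shows "AE x in lebesgue. g x = F2 a x"
  by (rule Lp2_eq_if_test_integrals_eq[OF g F2_Lp2[OF a]])
    (simp only: test F2_test[OF a product_test_test_function])

lemma test_fourier_Lp2:
  "test_function \<phi> \<Longrightarrow> fourier_L1 (\<lambda>x. complex_of_real (\<phi> x)) \<in> Lp 2"
  "test_function \<phi> \<Longrightarrow> inv_fourier_L1 (\<lambda>x. complex_of_real (\<phi> x)) \<in> Lp 2"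
  by (intro fourier_L1_contraction inv_fourier_L1_contraction test_function_Lp; assumption)+

lemma F2_add:
  assumes a: "a \<in> Lp 2" and b: "b \<in> Lp 2"
  shows "AE x in lebesgue. F2 (\<lambda>x. a x + b x) x = F2 a x + F2 b x"
proof -
  have "AE x in lebesgue. F2 a x + F2 b x = F2 (\<lambda>x. a x + b x) x"
  proof (rule Lp2_eq_F2)
    fix \<phi> :: "real^'a \<Rightarrow> real" assume "product_test \<phi>"
    then have \<phi>: "test_function \<phi>" by (rule product_test_test_function)
    then have t2: "(\<lambda>x. complex_of_real (\<phi> x)) \<in> Lp 2" using test_function_Lp by blast
    show "(LINT x|lebesgue. (F2 a x + F2 b x) * of_real (\<phi> x)) =
        (LINT x|lebesgue. (a x + b x) * fourier_L1 (\<lambda>x. of_real (\<phi> x)) x)"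
      unfolding distrib_right
      by (subst (1 2) Bochner_Integration.integral_add)
        (simp_all add: Lp2_product_integrable F2_Lp2 a b t2 test_fourier_Lp2 \<phi> F2_test)
  qed (intro Lp2_add F2_Lp2 a b)+
  then show ?thesis by eventually_elim simp
qed

lemma F2_scale:
  assumes a: "a \<in> Lp 2"
  shows "AE x in lebesgue. F2 (\<lambda>x. c * a x) x = c * F2 a x"
proof -
  have "AE x in lebesgue. c * F2 a x = F2 (\<lambda>x. c * a x) x"
  proof (rule Lp2_eq_F2)
    fix \<phi> :: "real^'a \<Rightarrow> real" assume "product_test \<phi>"
    then have \<phi>: "test_function \<phi>" by (rule product_test_test_function)
    show "(LINT x|lebesgue. c * F2 a x * of_real (\<phi> x)) =
        (LINT x|lebesgue. c * a x * fourier_L1 (\<lambda>x. of_real (\<phi> x)) x)"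
      unfolding mult.assoc by (simp add: F2_test[OF a \<phi>])
  qed (intro Lp2_scale F2_Lp2 a)+
  then show ?thesis by eventually_elim simp
qed

lemma F2_diff:
  assumes a: "a \<in> Lp 2" and b: "b \<in> Lp 2"
  shows "AE x in lebesgue. F2 (\<lambda>x. a x - b x) x = F2 a x - F2 b x"
  using F2_add[OF a Lp2_scale[OF b, of "-1"]] F2_scale[OF b, of "-1"]
  by eventually_elim simp

lemma F2_cong:
  assumes "a \<in> Lp 2" "b \<in> Lp 2" "AE x in lebesgue. a x = b x"
  shows "AE x in lebesgue. F2 a x = F2 b x"
proof (rule Lp2_eq_F2[OF F2_Lp2[OF assms(1)] assms(2)])
  fix \<phi> :: "real^'a \<Rightarrow> real" assume "product_test \<phi>"
  then have \<phi>: "test_function \<phi>" by (rule product_test_test_function)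
  show "(LINT x|lebesgue. F2 a x * of_real (\<phi> x)) = (LINT x|lebesgue. b x * fourier_L1 (\<lambda>x. of_real (\<phi> x)) x)"
    unfolding F2_test[OF assms(1) \<phi>]
    by (intro integral_times_cong_AE assms Lp2_measurable test_fourier_Lp2 \<phi>)
qed

lemma F2_sum:
  assumes "\<And>i. i \<in> I \<Longrightarrow> a i \<in> Lp 2"
  shows "AE x in lebesgue. F2 (\<lambda>x. \<Sum>i\<in>I. a i x) x = (\<Sum>i\<in>I. F2 (a i) x)"
  using assms
proof (induction I rule: infinite_finite_induct)
  case (insert i I)
  have "AE x in lebesgue. F2 (\<lambda>x. a i x + (\<Sum>i\<in>I. a i x)) x = F2 (a i) x + F2 (\<lambda>x. \<Sum>i\<in>I. a i x) x"
    using insert by (intro F2_add Lp2_sum) auto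
  moreover have "AE x in lebesgue. F2 (\<lambda>x. \<Sum>i\<in>I. a i x) x = (\<Sum>i\<in>I. F2 (a i) x)"
    using insert by auto
  ultimately show ?case
    unfolding sum.insert[OF insert(1,2)] by eventually_elim simp
next
  case empty
  have "(\<lambda>x. 0) \<in> Lp 2" by (simp add: Lp2_iff)
  from F2_scale[OF this, of 0] show ?case by simp
next
  case (infinite I)
  have "(\<lambda>x. 0) \<in> Lp 2" by (simp add: Lp2_iff)
  from F2_scale[OF this, of 0] show ?case using infinite by simp
qed

text \<open>In the pairing with the transform of a test function, \<open>I2\<close> moves over to
  that transform and cancels it by \<open>I2_F2\<close>.\<close>

lemma F2_I2:
  assumes a: "a \<in> Lp 2"
  shows "AE x in lebesgue. F2 (I2 a) x = a x"
proof -
  have "AE x in lebesgue. a x = F2 (I2 a) x"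
  proof (rule Lp2_eq_F2[OF a I2_Lp2[OF a]])
    fix \<phi> :: "real^'a \<Rightarrow> real" assume \<phi>: "product_test \<phi>"
    let ?\<phi> = "\<lambda>x. complex_of_real (\<phi> x)"
    note t = test_function_Lp[OF product_test_test_function[OF \<phi>]]
    then have t2: "?\<phi> \<in> Lp 2" by simp
    have "(LINT x|lebesgue. I2 a x * fourier_L1 ?\<phi> x) = (LINT x|lebesgue. I2 a x * F2 ?\<phi> x)"
      by (intro integral_times_cong_AE AE_symmetric[OF F2_eq] t Lp2_measurable F2_Lp2 I2_Lp2 t2 a
          fourier_L1_contraction)
    also have "\<dots> = (LINT x|lebesgue. a x * I2 (F2 ?\<phi>) x)"
      by (intro I2_multiplication a F2_Lp2 t2)
    also have "\<dots> = (LINT x|lebesgue. a x * ?\<phi> x)"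
      by (intro integral_times_cong_AE I2_F2 Lp2_measurable I2_Lp2 F2_Lp2 t2 a)
    finally show "(LINT x|lebesgue. a x * ?\<phi> x) = (LINT x|lebesgue. I2 a x * fourier_L1 ?\<phi> x)" ..
  qed
  then show ?thesis by eventually_elim simp
qed

lemma I2_norm:
  assumes a: "a \<in> Lp 2"
  shows "Lp_norm 2 (I2 a) = Lp_norm 2 a"
proof -
  have "Lp_norm 2 (I2 a) = Lp_norm 2 (F2 (I2 a))"
    by (rule F2_norm[OF I2_Lp2[OF a], symmetric])
  also have "\<dots> = Lp_norm 2 a"
    by (intro Lp_norm_2_cong_AE Lp2_measurable F2_Lp2 I2_Lp2 a F2_I2)
  finally show ?thesis .
qed

section \<open>Sobolev inequality\<close>

text \<open>Dyadic shells: where \<open>R / 2 ^ (k + 1) \<le> norm z < R / 2 ^ k\<close> the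
  integrand is at most \<open>(2 ^ (k + 1) / R) ^ (2 * s)\<close>. Multiplied by the volume of the
  whole ball of radius \<open>R / 2 ^ k\<close>, this gives a geometric series of ratio
  \<open>1 / 2 ^ d\<close> with \<open>d = CARD('n) - 2 * s\<close>.\<close>

lemma singular_integral_bound:
  fixes R :: real
  assumes s: "2 * s < CARD('n)" and R: "R > 0"
  shows "(\<integral>\<^sup>+z. ennreal (indicator (ball 0 R) z * (1 / norm z) ^ (2 * s)) \<partial>(lebesgue :: (real^'n) measure))
    \<le> ennreal (2 ^ (2 * s + 1) * unit_ball_vol (CARD('n)) * R ^ (CARD('n) - 2 * s))"
proof -
  let ?n = "CARD('n)" let ?d = "CARD('n) - 2 * s" let ?V = "unit_ball_vol (real CARD('n))"
  have V: "?V \<ge> 0" by simp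
  let ?f = "\<lambda>(k::nat) z::real^'n. ennreal ((2 ^ (k + 1) / R) ^ (2 * s) * indicator (ball 0 (R / 2 ^ k)) z)"
  have "(\<integral>\<^sup>+z. ennreal (indicator (ball 0 R) z * (1 / norm z) ^ (2 * s)) \<partial>(lebesgue :: (real^'n) measure))
    \<le> (\<integral>\<^sup>+z. (\<Sum>k. ?f k z) \<partial>lebesgue)"
  proof (rule nn_integral_mono_AE)
    have "AE z::real^'n in lebesgue. z \<noteq> 0"
      by (rule AE_completion) (rule AE_lborel_singleton)
    then show "AE z::real^'n in lebesgue. ennreal (indicator (ball 0 R) z * (1 / norm z) ^ (2 * s)) \<le> (\<Sum>k. ?f k z)"
    proof eventually_elim
      case (elim z)
      show ?case
      proof (cases "z \<in> ball 0 R")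
        case True
        then have z: "norm z > 0" "norm z < R" using elim by auto
        obtain m where "R / norm z < 2 ^ m"
          using real_arch_pow[of 2 "R / norm z"] by auto
        then have ex: "\<exists>m. R / 2 ^ m \<le> norm z"
          using z by (intro exI[of _ m]) (simp add: field_simps)
        \<comment> \<open>The first dyadic radius that does not exceed \<open>norm z\<close>; the
          predecessor of its index selects the term of the majorant.\<close>
        define m where "m = (LEAST m. R / 2 ^ m \<le> norm z)"
        have m: "R / 2 ^ m \<le> norm z"
          unfolding m_def using LeastI_ex[OF ex] .
        have "m \<noteq> 0" using m z by (intro notI) simp
        then obtain k where k: "m = Suc k" by (cases m) auto
        have k2: "\<not> R / 2 ^ k \<le> norm z"
          using not_less_Least[of k "\<lambda>m. R / 2 ^ m \<le> norm z"] k m_def by simp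
        have "1 / norm z \<le> 2 ^ (k + 1) / R"
          using m z R k by (simp add: field_simps)
        then have "(1 / norm z) ^ (2 * s) \<le> (2 ^ (k + 1) / R) ^ (2 * s)"
          using z by (intro power_mono) auto
        then have "ennreal (indicator (ball 0 R) z * (1 / norm z) ^ (2 * s)) \<le> ?f k z"
          using True k2 by (simp add: ennreal_leI)
        also have "\<dots> \<le> (\<Sum>k. ?f k z)"
        proof -
          have "h k \<le> (\<Sum>k. h k)" for h :: "nat \<Rightarrow> ennreal"
            using sum_le_suminf[OF summableI finite.insertI[OF finite.emptyI] zero_le, of h k] by simp
          then show ?thesis .
        qed
        finally show ?thesis .
      qed simp
    qed
  qed
  also have "\<dots> = (\<Sum>k. \<integral>\<^sup>+z. ?f k z \<partial>lebesgue)"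
    by (rule nn_integral_suminf) (intro measurable_compose[OF _ measurable_ennreal] borel_measurable_times borel_measurable_const borel_measurable_indicator, simp)
  also have "\<dots> = (\<Sum>k. ennreal (2 ^ (2 * s) * ?V * R ^ ?d * (1 / 2 ^ ?d) ^ k))"
  proof (intro suminf_cong)
    fix k :: nat
    have "(\<integral>\<^sup>+z. ?f k z \<partial>lebesgue) = ennreal ((2 ^ (k + 1) / R) ^ (2 * s)) * emeasure lebesgue (ball (0::real^'n) (R / 2 ^ k))"
    proof -
      have "?f k z = ennreal ((2 ^ (k + 1) / R) ^ (2 * s)) * indicator (ball 0 (R / 2 ^ k)) z" for z
        using R by (simp add: indicator_def)
      then show ?thesis
        by (simp only:) (rule nn_integral_cmult_indicator, simp)
    qed
    also have "\<dots> = ennreal ((2 ^ (k + 1) / R) ^ (2 * s) * (?V * (R / 2 ^ k) ^ ?n))"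
      using R by (simp add: emeasure_ball ennreal_mult')
    also have "(2 ^ (k + 1) / R) ^ (2 * s) * (?V * (R / 2 ^ k) ^ ?n) = 2 ^ (2 * s) * ?V * R ^ ?d * (1 / 2 ^ ?d) ^ k"
    proof -
      have n: "?n = 2 * s + ?d" using s by simp
      have p: "(x::real) ^ ?n = x ^ (2 * s) * x ^ ?d" for x
        by (subst n) (rule power_add)
      have "(2 ^ (k + 1) / R) ^ (2 * s) * (R / 2 ^ k) ^ (2 * s) = (2::real) ^ (2 * s)"
        using R by (simp flip: power_mult_distrib)
      moreover have "(R / 2 ^ k) ^ ?d = R ^ ?d * (1 / 2 ^ ?d) ^ k"
        by (simp add: power_divide mult.commute flip: power_mult)
      ultimately show ?thesis unfolding p by (simp add: mult_ac)
    qed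
    finally show "(\<integral>\<^sup>+z. ?f k z \<partial>lebesgue) = ennreal (2 ^ (2 * s) * ?V * R ^ ?d * (1 / 2 ^ ?d) ^ k)" .
  qed
  also have "\<dots> = ennreal (2 ^ (2 * s) * ?V * R ^ ?d * (1 / (1 - 1 / 2 ^ ?d)))"
  proof (rule suminf_ennreal_eq)
    have "?d \<ge> 1" using s by simp
    then have "(2::real) ^ 1 \<le> 2 ^ ?d" by (intro power_increasing) auto
    then have "norm (1 / 2 ^ ?d :: real) < 1" by simp
    then show "(\<lambda>k. 2 ^ (2 * s) * ?V * R ^ ?d * (1 / 2 ^ ?d) ^ k) sums (2 ^ (2 * s) * ?V * R ^ ?d * (1 / (1 - 1 / 2 ^ ?d)))"
      by (intro sums_mult geometric_sums)
  qed (use R in simp)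
  \<comment> \<open>As \<open>?d \<ge> 1\<close>, the ratio is at most 1/2 and the series at most 2;
    this is the extra power in \<open>2 * s + 1\<close>.\<close>
  also have "\<dots> \<le> ennreal (2 ^ (2 * s + 1) * ?V * R ^ ?d)"
  proof (rule ennreal_leI)
    have "?d \<ge> 1" using s by simp
    then have "(2::real) ^ 1 \<le> 2 ^ ?d" by (intro power_increasing) auto
    then have "1 / (1 - 1 / 2 ^ ?d) \<le> (2::real)" by (simp add: field_simps)
    then have "2 ^ (2 * s) * ?V * R ^ ?d * (1 / (1 - 1 / 2 ^ ?d)) \<le> 2 ^ (2 * s) * ?V * R ^ ?d * 2"
      using R by (intro mult_left_mono) auto
    then show "2 ^ (2 * s) * ?V * R ^ ?d * (1 / (1 - 1 / 2 ^ ?d)) \<le> 2 ^ (2 * s + 1) * ?V * R ^ ?d"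
      by (simp add: mult_ac)
  qed
  finally show ?thesis .
qed

text \<open>Functions with \<open>z \<mapsto> |z|\<^sup>s g z\<close> in L2 have the low frequency part in L1, and the high
  frequency part in L2.\<close>

definition weighted_L2 :: "nat \<Rightarrow> (real^'n \<Rightarrow> complex) \<Rightarrow> bool" where
  "weighted_L2 s g \<longleftrightarrow> g \<in> borel_measurable lebesgue \<and> (\<lambda>z. norm z ^ s *\<^sub>R g z) \<in> Lp 2"

definition low :: "real \<Rightarrow> (real^'n \<Rightarrow> complex) \<Rightarrow> real^'n \<Rightarrow> complex" where
  "low R g z = indicator (ball 0 R) z *\<^sub>R g z"

definition high :: "real \<Rightarrow> (real^'n \<Rightarrow> complex) \<Rightarrow> real^'n \<Rightarrow> complex" where
  "high R g z = indicator (- ball 0 R) z *\<^sub>R g z"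

text \<open>Plays the role of the transform of a tempered distribution. The radius 1 is arbitrary by
  \<open>fourier_weighted_split\<close>, and for \<open>g\<close> in L2 the result agrees with
  \<open>F2\<close> almost everywhere.\<close>

definition fourier_weighted :: "(real^'n \<Rightarrow> complex) \<Rightarrow> real^'n \<Rightarrow> complex" where
  "fourier_weighted g x = fourier_L1 (low 1 g) x + F2 (high 1 g) x"

lemma low_measurable: "g \<in> borel_measurable lebesgue \<Longrightarrow> low R g \<in> borel_measurable lebesgue"
  unfolding low_def[abs_def] by (intro borel_measurable_scaleR borel_measurable_indicator) auto

lemma high_measurable: "g \<in> borel_measurable lebesgue \<Longrightarrow> high R g \<in> borel_measurable lebesgue"
  unfolding high_def[abs_def] by (intro borel_measurable_scaleR borel_measurable_indicator) auto

lemma high_Lp2: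
  assumes g: "weighted_L2 s g" and R: "R > 0"
  shows "high R g \<in> Lp 2"
proof (rule Lp2_dominated[where B = "1 / R ^ s"])
  show "(\<lambda>z. norm z ^ s *\<^sub>R g z) \<in> Lp 2" "high R g \<in> borel_measurable lebesgue"
    using g high_measurable by (auto simp: weighted_L2_def)
  have "norm (high R g z) \<le> 1 / R ^ s * norm (norm z ^ s *\<^sub>R g z)" for z
  proof (cases "z \<in> ball 0 R")
    case False
    then have "R ^ s \<le> norm z ^ s" using R by (intro power_mono) auto
    then have "R ^ s * norm (g z) \<le> norm z ^ s * norm (g z)" by (intro mult_right_mono) auto
    then show ?thesis using R False by (simp add: high_def field_simps)
  qed (use R in \<open>simp add: high_def\<close>)
  then show "AE z in lebesgue. norm (high R g z) \<le> 1 / R ^ s * norm (norm z ^ s *\<^sub>R g z)" by simp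
qed

text \<open>Square root of the constant in \<open>singular_integral_bound\<close>, as produced by
  Cauchy-Schwarz.\<close>

definition low_constant :: "nat \<Rightarrow> 'n itself \<Rightarrow> real" where
  "low_constant s _ = sqrt (2 ^ (2 * s + 1) * unit_ball_vol (CARD('n)))"

lemma low_constant_pos: "low_constant s TYPE('n) > 0"
  unfolding low_constant_def by simp

text \<open>Cauchy-Schwarz after writing \<open>g\<close> as \<open>(1 / norm z) ^ s\<close> times
  the weighted function. The first factor is square integrable on the ball because
  \<open>2 * s < CARD('n)\<close>, with norm bounded by a multiple of \<open>R\<close> to the power
  \<open>n / 2 - s\<close>.\<close>

lemma low_integrable:
  fixes g :: "real^'n \<Rightarrow> complex"
  assumes g: "weighted_L2 s g" and R: "R > 0" and s: "2 * s < CARD('n)"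
  shows "integrable lebesgue (low R g)"
    and "(LINT z|lebesgue. norm (low R g z)) \<le>
      low_constant s TYPE('n) * R powr (real CARD('n) / 2 - real s) * Lp_norm 2 (\<lambda>z. norm z ^ s *\<^sub>R g z)"
proof -
  let ?G = "\<lambda>z. norm z ^ s *\<^sub>R g z"
  let ?k = "\<lambda>z::real^'n. indicator (ball 0 R) z * (1 / norm z) ^ s"
  have G: "?G \<in> Lp 2" and gm: "g \<in> borel_measurable lebesgue" using g by (auto simp: weighted_L2_def)
  have nm: "(\<lambda>z::real^'n. 1 / norm z) \<in> borel_measurable lebesgue"
    by (rule measurable_completion) measurable
  have km: "?k \<in> borel_measurable lebesgue"
    by (intro borel_measurable_times borel_measurable_indicator borel_measurable_power nm) simp
  have k2: "(?k z)\<^sup>2 = indicator (ball 0 R) z * (1 / norm z) ^ (2 * s)" for z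
    by (simp add: indicator_def power_mult_distrib flip: power_mult add: mult.commute[of s])
  let ?c = "2 ^ (2 * s + 1) * unit_ball_vol (CARD('n)) * R ^ (CARD('n) - 2 * s)"
  have nn: "(\<integral>\<^sup>+z. ennreal ((norm (?k z))\<^sup>2) \<partial>lebesgue) \<le> ennreal ?c"
    using singular_integral_bound[OF s R] by (simp only: k2 real_norm_def power2_abs)
  have "(\<integral>\<^sup>+z. ennreal (norm ((norm (?k z))\<^sup>2)) \<partial>lebesgue) < \<infinity>"
    using le_less_trans[OF nn ennreal_less_top] by simp
  then have ki: "integrable lebesgue (\<lambda>z. (norm (?k z))\<^sup>2)"
    by (intro integrableI_bounded borel_measurable_power measurable_compose[OF km borel_measurable_norm])
  then have k: "?k \<in> Lp 2" using km by (simp add: Lp2_iff)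
  have "(Lp_norm 2 ?k)\<^sup>2 \<le> ?c"
    using nn ki R by (simp add: Lp_norm_2_power2 nn_integral_eq_integral)
  then have "Lp_norm 2 ?k \<le> sqrt ?c"
    by (intro real_le_rsqrt)
  also have "sqrt ?c = low_constant s TYPE('n) * R powr (real CARD('n) / 2 - real s)"
  proof -
    have "sqrt (R ^ (CARD('n) - 2 * s)) = R powr (real CARD('n) / 2 - real s)"
      using R s by (simp add: powr_half_sqrt[symmetric] powr_powr of_nat_diff diff_divide_distrib flip: powr_realpow)
    then show ?thesis by (simp add: low_constant_def real_sqrt_mult)
  qed
  finally have kn: "Lp_norm 2 ?k \<le> low_constant s TYPE('n) * R powr (real CARD('n) / 2 - real s)" .
  have ae: "AE z in lebesgue. norm (low R g z) = norm (?k z) * norm (?G z)"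
  proof -
    have "AE z::real^'n in lebesgue. z \<noteq> 0"
      by (rule AE_completion) (rule AE_lborel_singleton)
    then show ?thesis
      by eventually_elim (auto simp: low_def indicator_def power_divide)
  qed
  show "integrable lebesgue (low R g)"
  proof (rule Bochner_Integration.integrable_bound[OF Lp2_norm_product_integrable[OF k G]])
    show "AE z in lebesgue. norm (low R g z) \<le> norm (norm (?k z) * norm (?G z))"
      using ae by eventually_elim simp
  qed (rule low_measurable[OF gm])
  have "(LINT z|lebesgue. norm (low R g z)) = (LINT z|lebesgue. norm (?k z) * norm (?G z))"
    by (rule integral_cong_AE[OF _ _ ae])
      (intro borel_measurable_times measurable_compose[OF _ borel_measurable_norm] low_measurable gm km Lp2_measurable[OF G])+
  also have "\<dots> \<le> Lp_norm 2 ?k * Lp_norm 2 ?G"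
    by (rule Cauchy_Schwarz_Lp2[OF k G])
  also have "\<dots> \<le> low_constant s TYPE('n) * R powr (real CARD('n) / 2 - real s) * Lp_norm 2 ?G"
    by (intro mult_right_mono kn Lp_norm_nonneg)
  finally show "(LINT z|lebesgue. norm (low R g z)) \<le>
      low_constant s TYPE('n) * R powr (real CARD('n) / 2 - real s) * Lp_norm 2 ?G" .
qed

lemma fourier_weighted_measurable:
  fixes g :: "real^'n \<Rightarrow> complex"
  assumes g: "weighted_L2 s g" and s: "2 * s < CARD('n)"
  shows "fourier_weighted g \<in> borel_measurable lebesgue"
  unfolding fourier_weighted_def[abs_def]
  by (intro borel_measurable_add fourier_L1_measurable low_integrable(1)[OF g _ s] Lp2_measurable F2_Lp2
      high_Lp2[OF g]) auto

text \<open>Changing the radius moves a function supported in a shell from one part to the other; it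
  lies in L1 and in L2, where \<open>fourier_L1\<close> and \<open>F2\<close> agree.\<close>

lemma fourier_weighted_split:
  fixes g :: "real^'n \<Rightarrow> complex"
  assumes g: "weighted_L2 s g" and s: "2 * s < CARD('n)" and R: "R > 0"
  shows "AE x in lebesgue. fourier_weighted g x = fourier_L1 (low R g) x + F2 (high R g) x"
proof -
  define d where "d z = low 1 g z - low R g z" for z
  have gm: "g \<in> borel_measurable lebesgue" using g by (auto simp: weighted_L2_def)
  note l = low_integrable(1)[OF g _ s]
  have d': "d z = high R g z - high 1 g z" for z
    by (auto simp: d_def low_def high_def indicator_def)
  have d1: "d \<in> Lp 1"
    unfolding d_def[abs_def] Lp1_iff using R by (intro Bochner_Integration.integrable_diff l) auto
  have d2: "d \<in> Lp 2"
    unfolding d'[abs_def] using R by (intro Lp2_diff high_Lp2[OF g]) auto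
  have f1: "fourier_L1 d x = fourier_L1 (low 1 g) x - fourier_L1 (low R g) x" for x
    unfolding d_def[abs_def] using R by (intro fourier_L1_diff l) auto
  have "AE x in lebesgue. F2 d x = F2 (high R g) x - F2 (high 1 g) x"
    unfolding d'[abs_def] using R by (intro F2_diff high_Lp2[OF g]) auto
  moreover have "AE x in lebesgue. F2 d x = fourier_L1 d x"
    using d1 d2 by (intro F2_eq) simp
  ultimately show ?thesis
    unfolding fourier_weighted_def by eventually_elim (use f1 in \<open>simp add: algebra_simps\<close>)
qed

section \<open>Level sets and the Sobolev inequality\<close>

lemma nn_integral_powr:
  assumes q: "q > 0" and b: "b \<ge> 0"
  shows "(\<integral>\<^sup>+t. ennreal (indicator {0<..<b} t * (q * t powr (q - 1))) \<partial>(lebesgue :: real measure)) = ennreal (b powr q)"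
    and "(\<integral>\<^sup>+t. ennreal (indicator {0<..b} t * (q * t powr (q - 1))) \<partial>(lebesgue :: real measure)) = ennreal (b powr q)"
proof -
  have I: "((\<lambda>t. q * t powr (q - 1)) has_integral (b powr q)) {0..b}"
    using has_integral_mult_right[OF has_integral_powr_from_0[of "q - 1" b], of q] q b by simp
  have eq: "(\<integral>\<^sup>+t. ennreal (indicator {0..b} t * (q * t powr (q - 1))) \<partial>(lebesgue :: real measure)) = ennreal (b powr q)"
    using nn_integral_has_integral_lebesgue[OF _ I] q by (simp add: nn_integral_completion)
  have ae: "AE t::real in lebesgue. t \<noteq> 0 \<and> t \<noteq> b"
    using AE_completion[OF AE_lborel_singleton[of "0::real"]] AE_completion[OF AE_lborel_singleton[of b]]
    by eventually_elim simp
  show "(\<integral>\<^sup>+t. ennreal (indicator {0<..<b} t * (q * t powr (q - 1))) \<partial>(lebesgue :: real measure)) = ennreal (b powr q)"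
    unfolding eq[symmetric] by (rule nn_integral_cong_AE, use ae in eventually_elim) (auto simp: indicator_def)
  show "(\<integral>\<^sup>+t. ennreal (indicator {0<..b} t * (q * t powr (q - 1))) \<partial>(lebesgue :: real measure)) = ennreal (b powr q)"
    unfolding eq[symmetric] by (rule nn_integral_cong_AE, use ae in eventually_elim) (auto simp: indicator_def)
qed

text \<open>The radius \<open>R\<close> is adapted to the height \<open>t\<close> such that the low
  part is at most \<open>t / 2\<close> everywhere. Where the transform exceeds \<open>t\<close>, the
  high part is then at least \<open>t / 2\<close>, and Chebyshev's inequality with Plancherel bounds
  the measure. \<open>t \<le> \<Lambda> z\<close> expresses \<open>R \<le> norm z\<close>, with the
  dependence of \<open>R\<close> on \<open>t\<close> solved for \<open>t\<close>.\<close>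

lemma sobolev_level_set:
  fixes g :: "real^'n \<Rightarrow> complex"
  assumes g: "weighted_L2 s g" and s: "2 * s < CARD('n)" and t: "t > 0"
    and M: "Lp_norm 2 (\<lambda>z. norm z ^ s *\<^sub>R g z) \<le> M" "M > 0"
  defines "\<Lambda> \<equiv> \<lambda>z::real^'n. 2 * low_constant s TYPE('n) * M * norm z powr (real CARD('n) / 2 - real s)"
  shows "emeasure lebesgue {x. t < norm (fourier_weighted g x)}
    \<le> (\<integral>\<^sup>+z. ennreal (4 / t\<^sup>2 * (indicator {0<..\<Lambda> z} t * (norm (g z))\<^sup>2)) \<partial>lebesgue)"
proof -
  let ?c = "low_constant s TYPE('n)" let ?d = "real CARD('n) / 2 - real s"
  have c: "?c > 0" by (rule low_constant_pos)
  have d: "?d > 0" using s by simp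
  \<comment> \<open>The solution of \<open>?c * R powr ?d * M = t / 2\<close>.\<close>
  define R where "R = (t / (2 * ?c * M)) powr (1 / ?d)"
  have R: "R > 0" using t c M by (simp add: R_def)
  have Rd: "R powr ?d = t / (2 * ?c * M)"
    using d t c M by (simp add: R_def powr_powr)
  have gm: "g \<in> borel_measurable lebesgue" using g by (auto simp: weighted_L2_def)
  note h2 = high_Lp2[OF g R]
  have low: "norm (fourier_L1 (low R g) x) \<le> t / 2" for x
  proof -
    have "norm (fourier_L1 (low R g) x) \<le> ?c * R powr ?d * Lp_norm 2 (\<lambda>z. norm z ^ s *\<^sub>R g z)"
      using norm_fourier_L1_le[of "low R g" x] low_integrable(2)[OF g R s] by linarith
    also have "\<dots> \<le> ?c * R powr ?d * M"
      using c by (intro mult_left_mono M) auto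
    also have "\<dots> = t / 2" unfolding Rd using c M by (simp add: field_simps)
    finally show ?thesis .
  qed
  have um: "(\<lambda>x. ennreal ((norm (F2 (high R g) x))\<^sup>2)) \<in> borel_measurable lebesgue"
    by (intro measurable_compose[OF _ measurable_ennreal] borel_measurable_power
        measurable_compose[OF _ borel_measurable_norm] Lp2_measurable F2_Lp2 h2)
  let ?S = "{x\<in>UNIV. 1 \<le> ennreal (4 / t\<^sup>2) * ennreal ((norm (F2 (high R g) x))\<^sup>2)}"
  have "emeasure lebesgue {x. t < norm (fourier_weighted g x)} \<le> emeasure lebesgue ?S"
  proof (rule emeasure_mono_AE)
    show "AE x in lebesgue. x \<in> {x. t < norm (fourier_weighted g x)} \<longrightarrow> x \<in> ?S"
      using fourier_weighted_split[OF g s R]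
    proof eventually_elim
      case (elim x)
      show ?case
      proof
        assume "x \<in> {x. t < norm (fourier_weighted g x)}"
        then have "t < norm (fourier_L1 (low R g) x + F2 (high R g) x)" using elim by simp
        also have "\<dots> \<le> t / 2 + norm (F2 (high R g) x)"
          using low[of x] norm_triangle_ineq[of "fourier_L1 (low R g) x" "F2 (high R g) x"] by linarith
        finally have "t / 2 \<le> norm (F2 (high R g) x)" by simp
        then have "(t / 2)\<^sup>2 \<le> (norm (F2 (high R g) x))\<^sup>2" using t by (intro power_mono) auto
        then have "1 \<le> 4 / t\<^sup>2 * (norm (F2 (high R g) x))\<^sup>2"
          using t by (simp add: field_simps power2_eq_square)
        then have "ennreal 1 \<le> ennreal (4 / t\<^sup>2 * (norm (F2 (high R g) x))\<^sup>2)" by (rule ennreal_leI)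
        moreover have "ennreal (4 / t\<^sup>2 * (norm (F2 (high R g) x))\<^sup>2)
            = ennreal (4 / t\<^sup>2) * ennreal ((norm (F2 (high R g) x))\<^sup>2)"
          by (rule ennreal_mult') simp
        ultimately have "1 \<le> ennreal (4 / t\<^sup>2) * ennreal ((norm (F2 (high R g) x))\<^sup>2)"
          unfolding ennreal_1 by (simp only:)
        then show "x \<in> ?S" by blast
      qed
    qed
    have "{x \<in> space lebesgue. 1 \<le> ennreal (4 / t\<^sup>2) * ennreal ((norm (F2 (high R g) x))\<^sup>2)} \<in> sets lebesgue"
      using um by measurable
    then show "?S \<in> sets lebesgue"
      by (simp only: space_completion space_lborel space_borel)
  qed
  also have "\<dots> \<le> ennreal (4 / t\<^sup>2) * (\<integral>\<^sup>+x. ennreal ((norm (F2 (high R g) x))\<^sup>2) * indicator UNIV x \<partial>lebesgue)"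
  proof (rule nn_integral_Markov_inequality)
    show U: "(UNIV :: (real^'n) set) \<in> sets lebesgue"
      by (rule sets_completionI_sets) simp
    show "(\<lambda>x. ennreal ((norm (F2 (high R g) x))\<^sup>2) * indicator UNIV x) \<in> borel_measurable lebesgue"
      by (intro borel_measurable_times_ennreal um borel_measurable_indicator U)
  qed
  also have "(\<integral>\<^sup>+x. ennreal ((norm (F2 (high R g) x))\<^sup>2) * indicator UNIV x \<partial>lebesgue) = ennreal ((Lp_norm 2 (F2 (high R g)))\<^sup>2)"
    using nn_integral_eq_integral[of lebesgue "\<lambda>x. (norm (F2 (high R g) x))\<^sup>2"] F2_Lp2[OF h2]
    by (simp add: Lp2_iff Lp_norm_2_power2)
  also have "\<dots> = (\<integral>\<^sup>+x. ennreal ((norm (high R g x))\<^sup>2) \<partial>lebesgue)"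
    unfolding F2_norm[OF h2] using nn_integral_eq_integral[of lebesgue "\<lambda>x. (norm (high R g x))\<^sup>2"] h2
    by (simp add: Lp2_iff Lp_norm_2_power2)
  also have "ennreal (4 / t\<^sup>2) * \<dots> = (\<integral>\<^sup>+x. ennreal (4 / t\<^sup>2) * ennreal ((norm (high R g x))\<^sup>2) \<partial>lebesgue)"
    by (intro nn_integral_cmult[symmetric] measurable_compose[OF _ measurable_ennreal] borel_measurable_power
        measurable_compose[OF _ borel_measurable_norm] Lp2_measurable h2)
  also have "\<dots> \<le> (\<integral>\<^sup>+z. ennreal (4 / t\<^sup>2 * (indicator {0<..\<Lambda> z} t * (norm (g z))\<^sup>2)) \<partial>lebesgue)"
  proof (rule nn_integral_mono)
    fix z :: "real^'n"
    have "(norm (high R g z))\<^sup>2 \<le> indicator {0<..\<Lambda> z} t * (norm (g z))\<^sup>2"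
    proof (cases "z \<in> ball 0 R")
      case False
      then have "R powr ?d \<le> norm z powr ?d" using R d by (intro powr_mono2) auto
      then have "t \<le> \<Lambda> z" unfolding Rd \<Lambda>_def using c M by (simp add: field_simps)
      then show ?thesis using t False by (simp add: high_def)
    qed (simp add: high_def)
    then have "4 / t\<^sup>2 * (norm (high R g z))\<^sup>2 \<le> 4 / t\<^sup>2 * (indicator {0<..\<Lambda> z} t * (norm (g z))\<^sup>2)"
      by (intro mult_left_mono) auto
    then show "ennreal (4 / t\<^sup>2) * ennreal ((norm (high R g z))\<^sup>2) \<le> ennreal (4 / t\<^sup>2 * (indicator {0<..\<Lambda> z} t * (norm (g z))\<^sup>2))"
      by (simp add: ennreal_leI flip: ennreal_mult')
  qed
  finally show ?thesis .
qed

lemma snd_lebesgue_measurable: "snd \<in> borel_measurable (lebesgue \<Otimes>\<^sub>M lebesgue)"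
  and fst_lebesgue_measurable: "fst \<in> borel_measurable (lebesgue \<Otimes>\<^sub>M lebesgue)"
  using measurable_compose[OF measurable_snd id_lebesgue_borel] measurable_compose[OF measurable_fst id_lebesgue_borel]
  by auto

lemma powr_layer_measurable:
  "(\<lambda>t::real. ennreal (indicator {0<..b} t * (q * t powr r))) \<in> borel_measurable lebesgue"
  by (rule measurable_completion) measurable

text \<open>Layer cake formula, level set estimate and Fubini: for fixed \<open>z\<close> the
  integral of \<open>4 * p * t powr (p - 3)\<close> over \<open>t\<close> up to
  \<open>\<Lambda> z\<close> is \<open>4 * p / (p - 2) * \<Lambda> z powr (p - 2)\<close>. The
  critical exponent is the one for which this is a multiple of
  \<open>norm z ^ (2 * s)\<close>.\<close>

lemma sobolev_integral:
  fixes g :: "real^'n \<Rightarrow> complex"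
  assumes g: "weighted_L2 s g" and s: "2 * s < CARD('n)" "s \<ge> 1"
    and M: "Lp_norm 2 (\<lambda>z. norm z ^ s *\<^sub>R g z) \<le> M" "M > 0"
    and p: "p = 2 * real CARD('n) / (real CARD('n) - 2 * real s)"
  shows "(\<integral>\<^sup>+x. ennreal (norm (fourier_weighted g x) powr p) \<partial>lebesgue)
    \<le> ennreal (4 * p / (p - 2) * (2 * low_constant s TYPE('n)) powr (p - 2) * M powr p)"
proof -
  let ?c = "low_constant s TYPE('n)" let ?d = "real CARD('n) / 2 - real s"
  let ?U = "fourier_weighted g"
  let ?G = "\<lambda>z. norm z ^ s *\<^sub>R g z"
  define \<Lambda> where "\<Lambda> = (\<lambda>z::real^'n. 2 * ?c * M * norm z powr ?d)"
  have c: "?c > 0" by (rule low_constant_pos)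
  have d: "?d > 0" using s by simp
  \<comment> \<open>The scaling relation that fixes the exponent:
    \<open>(p - 2) * ?d = 2 * s\<close>.\<close>
  have p2: "p - 2 = 2 * real s / ?d"
    unfolding p using s by (simp add: field_simps)
  have p2': "p > 2" using p2 s d by (smt (verit) divide_pos_pos of_nat_1 of_nat_mono)
  have gm[measurable]: "g \<in> borel_measurable lebesgue" and G: "?G \<in> Lp 2" using g by (auto simp: weighted_L2_def)
  have Um[measurable]: "?U \<in> borel_measurable lebesgue" by (rule fourier_weighted_measurable[OF g s(1)])
  have \<Lambda>m[measurable]: "\<Lambda> \<in> borel_measurable lebesgue"
    unfolding \<Lambda>_def by (rule measurable_completion) measurable
  note [measurable] = snd_lebesgue_measurable fst_lebesgue_measurable id_lebesgue_borel
  \<comment> \<open>Conditionals in place of indicators, since the sets depend on both variables and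
    joint measurability is wanted.\<close>
  let ?f = "\<lambda>x t. ennreal (if 0 < t \<and> t < norm (?U x) then p * t powr (p - 1) else 0)"
  let ?k = "\<lambda>t z. ennreal (if 0 < t \<and> t \<le> \<Lambda> z then 4 * p * t powr (p - 3) * (norm (g z))\<^sup>2 else 0)"
  have fm: "(\<lambda>(x, t). ?f x t) \<in> borel_measurable ((lebesgue :: (real^'n) measure) \<Otimes>\<^sub>M (lebesgue :: real measure))"
    by measurable
  have km: "(\<lambda>(t, z). ?k t z) \<in> borel_measurable ((lebesgue :: real measure) \<Otimes>\<^sub>M (lebesgue :: (real^'n) measure))"
    by measurable
  have "(\<integral>\<^sup>+x. ennreal (norm (?U x) powr p) \<partial>lebesgue) = (\<integral>\<^sup>+x. (\<integral>\<^sup>+t. ?f x t \<partial>lebesgue) \<partial>lebesgue)"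
  proof (intro nn_integral_cong)
    fix x
    have "(\<integral>\<^sup>+t. ?f x t \<partial>lebesgue) = (\<integral>\<^sup>+t. ennreal (indicator {0<..<norm (?U x)} t * (p * t powr (p - 1))) \<partial>lebesgue)"
      by (intro nn_integral_cong) (auto simp: indicator_def)
    then show "ennreal (norm (?U x) powr p) = (\<integral>\<^sup>+t. ?f x t \<partial>lebesgue)"
      using nn_integral_powr(1)[of p "norm (?U x)"] p2' by simp
  qed
  also have "\<dots> = (\<integral>\<^sup>+t. (\<integral>\<^sup>+x. ?f x t \<partial>lebesgue) \<partial>lebesgue)"
    by (rule lebesgue_pair.Fubini'[symmetric, OF fm])
  also have "\<dots> \<le> (\<integral>\<^sup>+t. (\<integral>\<^sup>+z. ?k t z \<partial>lebesgue) \<partial>lebesgue)"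
  proof (rule nn_integral_mono)
    fix t :: real
    show "(\<integral>\<^sup>+x. ?f x t \<partial>lebesgue) \<le> (\<integral>\<^sup>+z. ?k t z \<partial>lebesgue)"
    proof (cases "t > 0")
      case True
      have "(\<integral>\<^sup>+x. ?f x t \<partial>lebesgue) = (\<integral>\<^sup>+x. ennreal (p * t powr (p - 1)) * indicator {x. t < norm (?U x)} x \<partial>lebesgue)"
        using True by (intro nn_integral_cong) (auto simp: indicator_def)
      also have "\<dots> = ennreal (p * t powr (p - 1)) * emeasure lebesgue {x. t < norm (?U x)}"
      proof (rule nn_integral_cmult_indicator)
        have "{x \<in> space lebesgue. t < norm (?U x)} \<in> sets lebesgue" by measurable
        then show "{x. t < norm (?U x)} \<in> sets lebesgue" by simp
      qed
      also have "\<dots> \<le> ennreal (p * t powr (p - 1)) * (\<integral>\<^sup>+z. ennreal (4 / t\<^sup>2 * (indicator {0<..\<Lambda> z} t * (norm (g z))\<^sup>2)) \<partial>lebesgue)"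
        unfolding \<Lambda>_def by (intro mult_left_mono sobolev_level_set[OF g s(1) True M]) simp
      also have "\<dots> = (\<integral>\<^sup>+z. ennreal (p * t powr (p - 1)) * ennreal (4 / t\<^sup>2 * (indicator {0<..\<Lambda> z} t * (norm (g z))\<^sup>2)) \<partial>lebesgue)"
      proof (rule nn_integral_cmult[symmetric])
        have "(\<lambda>z. ennreal (4 / t\<^sup>2 * ((if 0 < t \<and> t \<le> \<Lambda> z then 1 else 0) * (norm (g z))\<^sup>2))) \<in> borel_measurable lebesgue"
          by measurable
        then show "(\<lambda>z. ennreal (4 / t\<^sup>2 * (indicator {0<..\<Lambda> z} t * (norm (g z))\<^sup>2))) \<in> borel_measurable lebesgue"
          by (simp add: indicator_def of_bool_def)
      qed
      also have "\<dots> = (\<integral>\<^sup>+z. ?k t z \<partial>lebesgue)"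
      proof (rule nn_integral_cong)
        fix z
        have "t powr (p - 1) = t\<^sup>2 * t powr (p - 3)"
          using True powr_add[of t 2 "p - 3"] by simp
        then have "p * t powr (p - 1) * (4 / t\<^sup>2 * (indicator {0<..\<Lambda> z} t * (norm (g z))\<^sup>2))
            = (if 0 < t \<and> t \<le> \<Lambda> z then 4 * p * t powr (p - 3) * (norm (g z))\<^sup>2 else 0)"
          using True by (simp add: indicator_def)
        then show "ennreal (p * t powr (p - 1)) * ennreal (4 / t\<^sup>2 * (indicator {0<..\<Lambda> z} t * (norm (g z))\<^sup>2)) = ?k t z"
          using p2' by (subst ennreal_mult'[symmetric]) auto
      qed
      finally show ?thesis .
    qed simp
  qed
  also have "\<dots> = (\<integral>\<^sup>+z. (\<integral>\<^sup>+t. ?k t z \<partial>lebesgue) \<partial>lebesgue)"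
    by (rule lebesgue_pair.Fubini'[symmetric, OF km])
  also have "\<dots> = (\<integral>\<^sup>+z. ennreal (4 * p / (p - 2) * (2 * ?c * M) powr (p - 2)) * ennreal ((norm (?G z))\<^sup>2) \<partial>lebesgue)"
  proof (rule nn_integral_cong)
    fix z :: "real^'n"
    have \<Lambda>0: "\<Lambda> z \<ge> 0" using c M by (simp add: \<Lambda>_def)
    let ?a = "4 * p / (p - 2) * (norm (g z))\<^sup>2"
    have "(\<integral>\<^sup>+t. ?k t z \<partial>lebesgue) = (\<integral>\<^sup>+t. ennreal ?a * ennreal (indicator {0<..\<Lambda> z} t * ((p - 2) * t powr (p - 2 - 1))) \<partial>lebesgue)"
    proof (rule nn_integral_cong)
      fix t :: real
      have "(if 0 < t \<and> t \<le> \<Lambda> z then 4 * p * t powr (p - 3) * (norm (g z))\<^sup>2 else 0)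
          = ?a * (indicator {0<..\<Lambda> z} t * ((p - 2) * t powr (p - 2 - 1)))"
        using p2' by (simp add: indicator_def)
      then show "?k t z = ennreal ?a * ennreal (indicator {0<..\<Lambda> z} t * ((p - 2) * t powr (p - 2 - 1)))"
        using p2' by (subst ennreal_mult'[symmetric]) auto
    qed
    also have "\<dots> = ennreal ?a * (\<integral>\<^sup>+t. ennreal (indicator {0<..\<Lambda> z} t * ((p - 2) * t powr (p - 2 - 1))) \<partial>lebesgue)"
      by (rule nn_integral_cmult[OF powr_layer_measurable])
    also have "\<dots> = ennreal ?a * ennreal (\<Lambda> z powr (p - 2))"
      using p2' \<Lambda>0 by (subst nn_integral_powr(2)) auto
    also have "\<Lambda> z powr (p - 2) = (2 * ?c * M) powr (p - 2) * (norm z ^ s)\<^sup>2"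
    proof -
      have "(norm z powr ?d) powr (p - 2) = norm z powr (2 * real s)"
        unfolding powr_powr p2 using d by simp
      also have "\<dots> = (norm z ^ s)\<^sup>2"
      proof (cases "z = 0")
        case False
        then show ?thesis using powr_realpow[of "norm z" "2 * s"] by (simp add: power_even_eq)
      qed (use s in \<open>simp add: power_0_left\<close>)
      finally show ?thesis
        unfolding \<Lambda>_def using c M by (simp add: powr_mult)
    qed
    also have "ennreal ?a * ennreal ((2 * ?c * M) powr (p - 2) * (norm z ^ s)\<^sup>2)
        = ennreal (4 * p / (p - 2) * (2 * ?c * M) powr (p - 2)) * ennreal ((norm (?G z))\<^sup>2)"
      using p2' by (simp add: power_mult_distrib mult_ac flip: ennreal_mult')
    finally show "(\<integral>\<^sup>+t. ?k t z \<partial>lebesgue) = ennreal (4 * p / (p - 2) * (2 * ?c * M) powr (p - 2)) * ennreal ((norm (?G z))\<^sup>2)" .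
  qed
  also have "\<dots> = ennreal (4 * p / (p - 2) * (2 * ?c * M) powr (p - 2)) * (\<integral>\<^sup>+z. ennreal ((norm (?G z))\<^sup>2) \<partial>lebesgue)"
    by (intro nn_integral_cmult measurable_compose[OF _ measurable_ennreal] borel_measurable_power
        measurable_compose[OF _ borel_measurable_norm] Lp2_measurable G)
  also have "\<dots> = ennreal (4 * p / (p - 2) * (2 * ?c * M) powr (p - 2)) * ennreal ((Lp_norm 2 ?G)\<^sup>2)"
    using nn_integral_eq_integral[of lebesgue "\<lambda>z. (norm (?G z))\<^sup>2"] G
    by (simp add: Lp2_iff Lp_norm_2_power2)
  also have "\<dots> \<le> ennreal (4 * p / (p - 2) * (2 * ?c * M) powr (p - 2)) * ennreal (M\<^sup>2)"
    by (intro mult_left_mono ennreal_leI power_mono M Lp_norm_nonneg) auto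
  also have "\<dots> = ennreal (4 * p / (p - 2) * (2 * ?c * M) powr (p - 2) * M\<^sup>2)"
    using p2' by (subst ennreal_mult') auto
  also have "4 * p / (p - 2) * (2 * ?c * M) powr (p - 2) * M\<^sup>2 = 4 * p / (p - 2) * (2 * ?c) powr (p - 2) * M powr p"
    using c M powr_add[of M "p - 2" 2] by (simp add: powr_mult)
  finally show ?thesis .
qed

lemma sobolev:
  assumes s: "2 * s < CARD('n)" "s \<ge> 1"
    and p: "p = 2 * real CARD('n) / (real CARD('n) - 2 * real s)"
  obtains C where "C > 0"
    "\<And>g :: real^'n \<Rightarrow> complex. weighted_L2 s g \<Longrightarrow> fourier_weighted g \<in> Lp p"
    "\<And>g :: real^'n \<Rightarrow> complex. weighted_L2 s g \<Longrightarrow>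
       Lp_norm p (fourier_weighted g) \<le> C * Lp_norm 2 (\<lambda>z. norm z ^ s *\<^sub>R g z)"
proof -
  let ?c = "low_constant s TYPE('n)"
  define C0 where "C0 = 4 * p / (p - 2) * (2 * ?c) powr (p - 2)"
  have p2: "p > 2" unfolding p using s by (simp add: field_simps)
  have C0: "C0 > 0" unfolding C0_def using p2 low_constant_pos[of s, where 'n = 'n] by simp
  have int: "integrable lebesgue (\<lambda>x. norm (fourier_weighted g x) powr p)"
    and bd: "(LINT x|lebesgue. norm (fourier_weighted g x) powr p) \<le> C0 * M powr p"
    if g: "weighted_L2 s g" and M: "M > Lp_norm 2 (\<lambda>z. norm z ^ s *\<^sub>R g z)" for g :: "real^'n \<Rightarrow> complex" and M
  proof -
    have M0: "M > 0" using M Lp_norm_nonneg[of 2 "\<lambda>z. norm z ^ s *\<^sub>R g z"] by linarith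
    have m: "(\<lambda>x. norm (fourier_weighted g x) powr p) \<in> borel_measurable lebesgue"
      using fourier_weighted_measurable[OF g s(1)] by measurable
    note b = sobolev_integral[OF g s less_imp_le[OF M] M0 p, folded C0_def]
    have "(\<integral>\<^sup>+x. ennreal (norm (norm (fourier_weighted g x) powr p)) \<partial>lebesgue) < \<infinity>"
      using le_less_trans[OF b ennreal_less_top] by simp
    then show int: "integrable lebesgue (\<lambda>x. norm (fourier_weighted g x) powr p)"
      by (intro integrableI_bounded m)
    show "(LINT x|lebesgue. norm (fourier_weighted g x) powr p) \<le> C0 * M powr p"
      using b C0 by (subst (asm) nn_integral_eq_integral[OF int]) auto
  qed
  show ?thesis
  proof (rule that[of "C0 powr (1 / p)"])
    show "C0 powr (1 / p) > 0" using C0 by simp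
    fix g :: "real^'n \<Rightarrow> complex" assume g: "weighted_L2 s g"
    let ?m = "Lp_norm 2 (\<lambda>z. norm z ^ s *\<^sub>R g z)"
    show "fourier_weighted g \<in> Lp p"
      unfolding Lp_def using int[OF g, of "?m + 1"] fourier_weighted_measurable[OF g s(1)] by simp
    have le: "Lp_norm p (fourier_weighted g) \<le> C0 powr (1 / p) * M" if M: "M > ?m" for M
    proof -
      have M0: "M > 0" using M Lp_norm_nonneg[of 2 "\<lambda>z. norm z ^ s *\<^sub>R g z"] by linarith
      have "Lp_norm p (fourier_weighted g) \<le> (C0 * M powr p) powr (1 / p)"
        unfolding Lp_norm_def using p2 by (intro powr_mono2 bd[OF g M]) auto
      also have "\<dots> = C0 powr (1 / p) * M"
        using C0 M0 p2 by (simp add: powr_mult powr_powr)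
      finally show ?thesis .
    qed
    \<comment> \<open>The integral bound asks for a positive \<open>M\<close>, while the weighted
      norm may be 0; taking the infimum over all larger \<open>M\<close> covers both cases.\<close>
    have "Lp_norm p (fourier_weighted g) / C0 powr (1 / p) \<le> ?m"
    proof (rule dense_ge)
      fix M assume "?m < M"
      from le[OF this] show "Lp_norm p (fourier_weighted g) / C0 powr (1 / p) \<le> M"
        using C0 by (simp add: divide_le_eq mult.commute)
    qed
    then show "Lp_norm p (fourier_weighted g) \<le> C0 powr (1 / p) * ?m"
      using C0 by (simp add: divide_le_eq mult.commute)
  qed
qed

section \<open>Weak derivatives\<close>

lemma test_function_differentiable: "test_function \<phi> \<Longrightarrow> \<phi> differentiable (at x)"
  unfolding test_function_def smooth_def by (metis foldr_Nil id_apply)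

lemma test_function_partial:
  assumes "test_function \<phi>"
  shows "test_function (partial_deriv j \<phi>)"
proof -
  obtain R where R: "R > 0" "\<And>x. norm x > R \<Longrightarrow> \<phi> x = 0"
    using assms unfolding test_function_def compact_support_iff by blast
  have "partial_deriv j \<phi> x = 0" if "norm x > R" for x
  proof -
    have "open {x::real^'a. norm x > R}"
      by (intro open_Collect_less continuous_intros)
    then have "(\<phi> has_derivative (\<lambda>_. 0)) (at x)"
      by (rule has_derivative_transform_within_open[where f = "\<lambda>_. 0", OF has_derivative_const])
        (use that R in auto)
    from frechet_derivative_at[OF this, symmetric] show ?thesis
      by (simp add: partial_deriv_def)
  qed
  then have "compact (closure {x. partial_deriv j \<phi> x \<noteq> 0})"
    unfolding compact_support_iff using R(1) by blast
  moreover have "smooth (partial_deriv j \<phi>)"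
    unfolding smooth_def
  proof (intro allI)
    fix "is" x
    \<comment> \<open>\<open>foldr\<close> applies the last list entry first, so \<open>j\<close> is
      appended at the end.\<close>
    have "foldr partial_deriv (is @ [j]) \<phi> differentiable (at x)"
      using assms unfolding test_function_def smooth_def by blast
    then show "foldr partial_deriv is (partial_deriv j \<phi>) differentiable (at x)" by simp
  qed
  ultimately show ?thesis by (simp add: test_function_def)
qed

lemma partial_deriv_line:
  assumes "test_function \<phi>"
  shows "((\<lambda>s. \<phi> (x + s *\<^sub>R axis j 1)) has_real_derivative partial_deriv j \<phi> (x + s *\<^sub>R axis j 1)) (at s)"
proof -
  let ?y = "x + s *\<^sub>R axis j 1"
  have "(\<phi> has_derivative frechet_derivative \<phi> (at ?y)) (at ?y)"
    using test_function_differentiable[OF assms] frechet_derivative_works by blast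
  moreover have "((\<lambda>s. x + s *\<^sub>R axis j 1) has_derivative (\<lambda>h. h *\<^sub>R axis j 1)) (at s)"
    by (auto intro!: derivative_eq_intros)
  ultimately have "((\<lambda>s. \<phi> (x + s *\<^sub>R axis j 1)) has_derivative (\<lambda>h. frechet_derivative \<phi> (at ?y) (h *\<^sub>R axis j 1))) (at s)"
    using has_derivative_compose by blast
  moreover have "frechet_derivative \<phi> (at ?y) (h *\<^sub>R axis j 1) = partial_deriv j \<phi> ?y * h" for h
    using linear_scale[OF linear_frechet_derivative[OF test_function_differentiable[OF assms]]]
    by (simp add: partial_deriv_def)
  ultimately show ?thesis
    by (simp add: has_field_derivative_def)
qed

text \<open>Difference quotients turn into multiplication with \<open>(exp (2 \<pi> i t z\<^sub>j) - 1) / t\<close>.\<close>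

lemma fourier_partial_deriv:
  fixes \<phi> :: "real^'n \<Rightarrow> real"
  assumes \<phi>: "test_function \<phi>"
  shows "fourier_L1 (\<lambda>x. of_real (partial_deriv j \<phi> x)) z
    = 2 * of_real pi * \<i> * of_real (z $ j) * fourier_L1 (\<lambda>x. of_real (\<phi> x)) z"
proof (rule LIMSEQ_unique)
  let ?e = "axis j 1 :: real^'n"
  let ?t = "\<lambda>k. inverse (real (Suc k))"
  let ?D = "\<lambda>k x. (\<phi> (x + ?t k *\<^sub>R ?e) - \<phi> x) / ?t k"
  have t: "?t k > 0" "?t k \<le> 1" for k by (auto simp: field_simps)
  obtain R where R: "R > 0" "\<And>x. norm x > R \<Longrightarrow> \<phi> x = 0"
    using \<phi> unfolding test_function_def compact_support_iff by blast
  obtain R' B where B: "\<And>x. \<bar>partial_deriv j \<phi> x\<bar> \<le> B * indicator (cball 0 R') x" "B > 0"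
    using test_function_bounded_support[OF test_function_partial[OF \<phi>]] by metis
  have B': "\<bar>partial_deriv j \<phi> x\<bar> \<le> B" for x
    using B(1)[of x] B(2) by (cases "x \<in> cball 0 R'") auto
  \<comment> \<open>Mean value theorem on a segment of length at most 1; this is why the radius of
    the support grows to \<open>R + 1\<close>.\<close>
  have D: "\<bar>?D k x\<bar> \<le> B * indicator (cball 0 (R + 1)) x" for k x
  proof (cases "x \<in> cball 0 (R + 1)")
    case True
    obtain \<xi> where "\<phi> (x + ?t k *\<^sub>R ?e) - \<phi> (x + 0 *\<^sub>R ?e) = (?t k - 0) * partial_deriv j \<phi> (x + \<xi> *\<^sub>R ?e)"
      using MVT2[OF t(1)[of k], of "\<lambda>s. \<phi> (x + s *\<^sub>R ?e)" "\<lambda>s. partial_deriv j \<phi> (x + s *\<^sub>R ?e)"] partial_deriv_line[OF \<phi>] by blast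
    then have "?D k x = partial_deriv j \<phi> (x + \<xi> *\<^sub>R ?e)"
      using t[of k] by (simp del: of_nat_Suc)
    with B' True show ?thesis by simp
  next
    case False
    then have x: "norm x > R + 1" by simp
    have "norm x \<le> norm (x + ?t k *\<^sub>R ?e) + norm (?t k *\<^sub>R ?e)"
      using norm_triangle_ineq4[of "x + ?t k *\<^sub>R ?e" "?t k *\<^sub>R ?e"] by simp
    then have "norm (x + ?t k *\<^sub>R ?e) > R"
      using x t[of k] by (simp del: of_nat_Suc)
    then show ?thesis using x False R(2) by simp
  qed
  have \<phi>c: "continuous_on UNIV \<phi>" by (rule test_function_continuous[OF \<phi>])
  have \<phi>i: "integrable lebesgue (\<lambda>x. complex_of_real (\<phi> x))"
    using test_function_Lp[OF \<phi>] by (simp add: Lp1_iff)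
  have Dc: "continuous_on UNIV (\<lambda>x. ?D k x)" for k
  proof -
    have 1: "continuous_on UNIV (\<lambda>x. \<phi> (x + ?t k *\<^sub>R ?e))"
      by (rule continuous_on_compose2[OF \<phi>c]) (intro continuous_intros, simp)
    show ?thesis
      by (rule continuous_on_divide, rule continuous_on_diff, rule 1, rule \<phi>c, rule continuous_on_const) simp
  qed
  have "(\<lambda>k. LINT x|lebesgue. of_real (?D k x) * wave x z) \<longlonglongrightarrow> (LINT x|lebesgue. of_real (partial_deriv j \<phi> x) * wave x z)"
  proof (rule integral_dominated_convergence[where w = "\<lambda>x::real^'n. B * indicator (cball 0 (R + 1)) x"])
    show "integrable lebesgue (\<lambda>x::real^'n. B * indicator (cball 0 (R + 1)) x)"
      using lmeasurable_cball[of "0::real^'n" "R + 1"] by (intro integrable_mult_right) (simp add: fmeasurable_def)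
    show "AE x in lebesgue. (\<lambda>k. of_real (?D k x) * wave x z) \<longlonglongrightarrow> of_real (partial_deriv j \<phi> x) * wave x z"
    proof (intro AE_I2 tendsto_mult tendsto_const tendsto_of_real)
      fix x
      have "((\<lambda>h. (\<phi> (x + (0 + h) *\<^sub>R ?e) - \<phi> (x + 0 *\<^sub>R ?e)) / h) \<longlongrightarrow> partial_deriv j \<phi> (x + 0 *\<^sub>R ?e)) (at 0)"
        using partial_deriv_line[OF \<phi>, of x j 0] unfolding DERIV_def .
      then have "((\<lambda>h. (\<phi> (x + h *\<^sub>R ?e) - \<phi> x) / h) \<longlongrightarrow> partial_deriv j \<phi> x) (at 0)" by simp
      moreover have "filterlim ?t (at 0) sequentially"
        using LIMSEQ_inverse_real_of_nat t by (auto simp: filterlim_at simp del: of_nat_Suc)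
      ultimately show "(\<lambda>k. ?D k x) \<longlonglongrightarrow> partial_deriv j \<phi> x"
        by (rule filterlim_compose)
    qed
    show "AE x in lebesgue. norm (complex_of_real (?D k x) * wave x z) \<le> B * indicator (cball 0 (R + 1)) x" for k
      using D by (intro AE_I2) (simp only: norm_mult norm_of_real norm_wave mult_1_right)
    show "(\<lambda>x. complex_of_real (?D k x) * wave x z) \<in> borel_measurable lebesgue" for k
      by (intro continuous_lebesgue_measurable continuous_on_mult[OF continuous_on_of_real[OF Dc]] continuous_intros)
    show "(\<lambda>x. complex_of_real (partial_deriv j \<phi> x) * wave x z) \<in> borel_measurable lebesgue"
      by (intro continuous_lebesgue_measurable continuous_intros test_function_continuous test_function_partial \<phi>)
  qed
  then show "(\<lambda>k. LINT x|lebesgue. of_real (?D k x) * wave x z) \<longlonglongrightarrow> fourier_L1 (\<lambda>x. of_real (partial_deriv j \<phi> x)) z"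
    by (simp only: fourier_L1_wave)
  let ?s = "2 * of_real pi * \<i> * of_real (z $ j) :: complex"
  \<comment> \<open>Translating back by \<open>?t k\<close> puts the shift onto the character, which
    contributes the factor \<open>exp (?s * of_real (?t k))\<close>.\<close>
  have eq: "(LINT x|lebesgue. of_real (?D k x) * wave x z)
      = (exp (?s * of_real (?t k)) - 1) / of_real (?t k) * fourier_L1 (\<lambda>x. of_real (\<phi> x)) z" for k
  proof -
    let ?h = "\<lambda>x. complex_of_real (\<phi> x) * wave (x - ?t k *\<^sub>R ?e) z"
    have hm: "?h \<in> borel_measurable borel"
      by (intro borel_measurable_continuous_onI continuous_intros \<phi>c)
    have hi: "integrable lebesgue ?h"
      by (rule Bochner_Integration.integrable_bound[OF \<phi>i]) (use hm in \<open>auto simp: norm_mult intro: measurable_completion\<close>)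
    have w: "wave (x - ?t k *\<^sub>R ?e) z = exp (?s * of_real (?t k)) * wave x z" for x
      unfolding wave_def exp_add[symmetric]
      by (simp add: inner_diff_left inner_axis' algebra_simps del: of_nat_Suc)
    have 1: "integrable lebesgue (\<lambda>x. ?h (?t k *\<^sub>R ?e + 1 *\<^sub>R x))"
      "(LINT x|lebesgue. ?h x) = (LINT x|lebesgue. ?h (?t k *\<^sub>R ?e + 1 *\<^sub>R x))"
      using lebesgue_affine[OF hm, of 1 "?t k *\<^sub>R ?e"] hi by simp_all
    have 2: "?h (?t k *\<^sub>R ?e + 1 *\<^sub>R x) = of_real (\<phi> (x + ?t k *\<^sub>R ?e)) * wave x z" for x
      by (simp add: add.commute)
    have 3: "integrable lebesgue (\<lambda>x. complex_of_real (\<phi> x) * wave x z)"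
      by (intro integrable_wave \<phi>i)
    have "(LINT x|lebesgue. of_real (?D k x) * wave x z)
       = (LINT x|lebesgue. (of_real (\<phi> (x + ?t k *\<^sub>R ?e)) * wave x z - of_real (\<phi> x) * wave x z) / of_real (?t k))"
      by (intro Bochner_Integration.integral_cong refl) (simp add: left_diff_distrib del: of_nat_Suc)
    also have "\<dots> = ((LINT x|lebesgue. of_real (\<phi> (x + ?t k *\<^sub>R ?e)) * wave x z) - (LINT x|lebesgue. of_real (\<phi> x) * wave x z)) / of_real (?t k)"
      using 1(1) 3 unfolding 2 by (simp del: of_nat_Suc)
    also have "(LINT x|lebesgue. of_real (\<phi> (x + ?t k *\<^sub>R ?e)) * wave x z) = (LINT x|lebesgue. ?h x)"
      using 1(2) unfolding 2 by (rule sym)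
    also have "\<dots> = exp (?s * of_real (?t k)) * (LINT x|lebesgue. of_real (\<phi> x) * wave x z)"
    proof -
      have "complex_of_real (\<phi> x) * (exp (?s * of_real (?t k)) * wave x z)
          = exp (?s * of_real (?t k)) * (of_real (\<phi> x) * wave x z)" for x
        by (rule mult.left_commute)
      then show ?thesis unfolding w by (simp only: integral_mult_right_zero)
    qed
    finally show ?thesis
      by (simp add: fourier_L1_wave left_diff_distrib del: of_nat_Suc)
  qed
  have "(\<lambda>k. (exp (?s * of_real (?t k)) - 1) / of_real (?t k)) \<longlonglongrightarrow> ?s"
  proof -
    have "((\<lambda>w. exp (?s * w)) has_field_derivative exp (?s * 0) * ?s) (at 0)"
      by (auto intro!: derivative_eq_intros)
    then have "((\<lambda>h. (exp (?s * h) - 1) / h) \<longlongrightarrow> ?s) (at 0)"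
      by (simp add: DERIV_def)
    moreover have "filterlim (\<lambda>k. complex_of_real (?t k)) (at 0) sequentially"
      using tendsto_of_real[OF LIMSEQ_inverse_real_of_nat, where 'a = complex] t
      by (simp add: filterlim_at less_imp_neq[symmetric] del: of_nat_Suc)
    ultimately show ?thesis by (rule filterlim_compose)
  qed
  then show "(\<lambda>k. LINT x|lebesgue. of_real (?D k x) * wave x z) \<longlonglongrightarrow> ?s * fourier_L1 (\<lambda>x. of_real (\<phi> x)) z"
    unfolding eq by (intro tendsto_mult tendsto_const)
qed

section \<open>Weak derivatives of weighted Fourier transforms\<close>

lemma test_fourier_bounded:
  assumes "test_function \<phi>"
  obtains B where "\<And>z. norm (fourier_L1 (\<lambda>x. complex_of_real (\<phi> x)) z) \<le> B"
  using norm_fourier_L1_le by blast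

text \<open>The multiplication formula for each part of the cut, in L1 for the low and in L2 for the
  high frequencies. On the right the arbitrary cut has disappeared, so this characterizes
  \<open>fourier_weighted\<close> in the sense of distributions.\<close>

lemma fourier_weighted_test:
  fixes g :: "real^'n \<Rightarrow> complex"
  assumes g: "weighted_L2 s g" and s: "2 * s < CARD('n)" and \<phi>: "test_function \<phi>"
  shows "(LINT x|lebesgue. fourier_weighted g x * of_real (\<phi> x))
      = (LINT z|lebesgue. g z * fourier_L1 (\<lambda>x. of_real (\<phi> x)) z)"
    and "integrable lebesgue (\<lambda>x. fourier_weighted g x * of_real (\<phi> x))"
proof -
  let ?\<phi> = "\<lambda>x. complex_of_real (\<phi> x)"
  note t = test_function_Lp[OF \<phi>]
  have t1: "integrable lebesgue ?\<phi>" and t2: "?\<phi> \<in> Lp 2" using t by (auto simp: Lp1_iff)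
  have low: "integrable lebesgue (low 1 g)" and high: "high 1 g \<in> Lp 2"
    by (intro low_integrable[OF g _ s] high_Lp2[OF g]; simp)+
  have Ft: "fourier_L1 ?\<phi> \<in> Lp 2" by (intro fourier_L1_contraction t)
  obtain B where B: "\<And>z. norm (fourier_L1 ?\<phi> z) \<le> B" using test_fourier_bounded[OF \<phi>] by blast
  have mult_bd: "integrable lebesgue (\<lambda>x. a x * b x)"
    if "integrable lebesgue a" "\<And>x. norm (b x) \<le> B" "b \<in> borel_measurable lebesgue" for a b :: "real^'n \<Rightarrow> complex" and B
  proof (rule Bochner_Integration.integrable_bound[of lebesgue "\<lambda>x. norm (a x) * B"])
    show "integrable lebesgue (\<lambda>x. norm (a x) * B)"
      by (intro integrable_mult_left integrable_norm that)
    show "(\<lambda>x. a x * b x) \<in> borel_measurable lebesgue"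
      by (intro borel_measurable_times borel_measurable_integrable that)
    have "norm (a x * b x) \<le> norm (a x) * B" for x
      unfolding norm_mult by (intro mult_left_mono that) simp
    then show "AE x in lebesgue. norm (a x * b x) \<le> norm (norm (a x) * B)"
      unfolding real_norm_def by (intro AE_I2 order.trans[OF _ abs_ge_self])
  qed
  have i1: "integrable lebesgue (\<lambda>z. low 1 g z * fourier_L1 ?\<phi> z)"
    by (rule mult_bd[OF low B Lp2_measurable[OF Ft]])
  have i2: "integrable lebesgue (\<lambda>z. high 1 g z * fourier_L1 ?\<phi> z)"
    by (rule Lp2_product_integrable[OF high Ft])
  have i3: "integrable lebesgue (\<lambda>x. fourier_L1 (low 1 g) x * ?\<phi> x)"
    using mult_bd[OF t1 norm_fourier_L1_le fourier_L1_measurable[OF low]] by (simp only: mult.commute)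
  have i4: "integrable lebesgue (\<lambda>x. F2 (high 1 g) x * ?\<phi> x)"
    by (rule Lp2_product_integrable[OF F2_Lp2[OF high] t2])
  show "integrable lebesgue (\<lambda>x. fourier_weighted g x * ?\<phi> x)"
    unfolding fourier_weighted_def distrib_right by (intro Bochner_Integration.integrable_add i3 i4)
  have split: "g z = low 1 g z + high 1 g z" for z
    by (auto simp: low_def high_def indicator_def)
  have "(LINT x|lebesgue. fourier_weighted g x * ?\<phi> x)
     = (LINT x|lebesgue. fourier_L1 (low 1 g) x * ?\<phi> x) + (LINT x|lebesgue. F2 (high 1 g) x * ?\<phi> x)"
    unfolding fourier_weighted_def distrib_right by (rule Bochner_Integration.integral_add[OF i3 i4])
  also have "\<dots> = (LINT z|lebesgue. low 1 g z * fourier_L1 ?\<phi> z) + (LINT z|lebesgue. high 1 g z * fourier_L1 ?\<phi> z)"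
    by (simp only: fourier_L1_multiplication[OF low t1] F2_test[OF high \<phi>])
  also have "\<dots> = (LINT z|lebesgue. low 1 g z * fourier_L1 ?\<phi> z + high 1 g z * fourier_L1 ?\<phi> z)"
    by (rule Bochner_Integration.integral_add[OF i1 i2, symmetric])
  also have "\<dots> = (LINT z|lebesgue. g z * fourier_L1 ?\<phi> z)"
    by (simp only: distrib_right[symmetric] split[symmetric])
  finally show "(LINT x|lebesgue. fourier_weighted g x * ?\<phi> x) = (LINT z|lebesgue. g z * fourier_L1 ?\<phi> z)" .
qed

text \<open>The solution is a forward transform of its frequency function, so a derivative in
  \<open>x\<close> brings down the factor \<open>- 2 * pi * \<i> * z $ j\<close>, of opposite sign
  to the one in \<open>fourier_partial_deriv\<close>.\<close>

definition freq_mult :: "'n \<Rightarrow> (real^'n \<Rightarrow> complex) \<Rightarrow> real^'n \<Rightarrow> complex" where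
  "freq_mult j g z = - 2 * of_real pi * \<i> * of_real (z $ j) * g z"

lemma vec_nth_measurable: "(\<lambda>z::real^'n. z $ j) \<in> borel_measurable lebesgue"
  by (intro continuous_lebesgue_measurable continuous_intros)

lemma of_real_vec_nth_measurable: "(\<lambda>z::real^'n. complex_of_real (z $ j)) \<in> borel_measurable lebesgue"
  by (intro continuous_lebesgue_measurable continuous_intros)

lemma freq_mult_measurable: "g \<in> borel_measurable lebesgue \<Longrightarrow> freq_mult j g \<in> borel_measurable lebesgue"
  unfolding freq_mult_def[abs_def]
  by (intro borel_measurable_times borel_measurable_const of_real_vec_nth_measurable)

text \<open>One power of the weight pays for the factor \<open>z $ j\<close>; a frequency function
  of weight 2 can be differentiated twice and then lies in L2.\<close>

lemma freq_mult_weighted: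
  assumes g: "weighted_L2 (Suc s) g"
  shows "weighted_L2 s (freq_mult j g)"
    and "Lp_norm 2 (\<lambda>z. norm z ^ s *\<^sub>R freq_mult j g z) \<le> 2 * pi * Lp_norm 2 (\<lambda>z. norm z ^ Suc s *\<^sub>R g z)"
proof -
  have gm: "g \<in> borel_measurable lebesgue" and G: "(\<lambda>z. norm z ^ Suc s *\<^sub>R g z) \<in> Lp 2"
    using g by (auto simp: weighted_L2_def)
  have m: "(\<lambda>z. norm z ^ s *\<^sub>R freq_mult j g z) \<in> borel_measurable lebesgue"
    by (intro borel_measurable_scaleR freq_mult_measurable gm continuous_lebesgue_measurable continuous_intros)
  have "norm (norm z ^ s *\<^sub>R freq_mult j g z) \<le> 2 * pi * norm (norm z ^ Suc s *\<^sub>R g z)" for z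
  proof -
    have "\<bar>z $ j\<bar> * (norm z ^ s * norm (g z)) \<le> norm z * (norm z ^ s * norm (g z))"
      by (intro mult_right_mono component_le_norm_cart) auto
    then show ?thesis by (simp add: freq_mult_def norm_mult mult_ac)
  qed
  then have le: "AE z in lebesgue. norm (norm z ^ s *\<^sub>R freq_mult j g z) \<le> 2 * pi * norm (norm z ^ Suc s *\<^sub>R g z)"
    by simp
  show "weighted_L2 s (freq_mult j g)"
    unfolding weighted_L2_def using freq_mult_measurable[OF gm] Lp2_dominated[OF G m le] by blast
  show "Lp_norm 2 (\<lambda>z. norm z ^ s *\<^sub>R freq_mult j g z) \<le> 2 * pi * Lp_norm 2 (\<lambda>z. norm z ^ Suc s *\<^sub>R g z)"
    by (rule Lp2_norm_dominated[OF G m le]) simp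
qed

lemma fourier_weighted_partial:
  fixes g :: "real^'n \<Rightarrow> complex"
  assumes g: "weighted_L2 (Suc s) g" and s: "2 * Suc s < CARD('n)" and \<phi>: "test_function \<phi>"
  shows "(LINT x|lebesgue. fourier_weighted g x * of_real (partial_deriv j \<phi> x))
      = - (LINT x|lebesgue. fourier_weighted (freq_mult j g) x * of_real (\<phi> x))"
proof -
  have s': "2 * s < CARD('n)" using s by simp
  show ?thesis
    unfolding fourier_weighted_test(1)[OF g s test_function_partial[OF \<phi>]]
      fourier_weighted_test(1)[OF freq_mult_weighted(1)[OF g] s' \<phi>] fourier_partial_deriv[OF \<phi>]
    by (simp add: freq_mult_def mult_ac flip: Bochner_Integration.integral_minus)
qed

lemma bounded_linear_integrable_indicator:
  fixes U :: "real^'n \<Rightarrow> complex"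
  assumes P: "bounded_linear (P :: complex \<Rightarrow> real)"
    and U: "\<And>K. compact K \<Longrightarrow> integrable lebesgue (\<lambda>x. indicator K x *\<^sub>R U x)"
  shows "locally_integrable (\<lambda>x. P (U x))"
  unfolding locally_integrable_def set_integrable_def
proof (intro allI impI)
  fix K :: "(real^'n) set" assume "compact K"
  from integrable_bounded_linear[OF P U[OF this]]
  show "integrable lebesgue (\<lambda>x. indicator K x *\<^sub>R P (U x))"
    by (simp only: bounded_linear.linear[OF P, THEN linear_scale])
qed

lemma fourier_weighted_integrable_indicator:
  fixes g :: "real^'n \<Rightarrow> complex"
  assumes g: "weighted_L2 s g" and s: "2 * s < CARD('n)" and K: "compact K"
  shows "integrable lebesgue (\<lambda>x. indicator K x *\<^sub>R fourier_weighted g x)"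
proof -
  have low: "integrable lebesgue (low 1 g)" and high: "high 1 g \<in> Lp 2"
    by (intro low_integrable[OF g _ s] high_Lp2[OF g]; simp)+
  have Kl: "K \<in> lmeasurable" by (rule lmeasurable_compact[OF K])
  let ?B = "LINT x|lebesgue. norm (low 1 g x)"
  have "integrable lebesgue (\<lambda>x. indicator K x *\<^sub>R fourier_L1 (low 1 g) x)"
  proof (rule Bochner_Integration.integrable_bound)
    show "integrable lebesgue (\<lambda>x. indicator K x * ?B)"
      using Kl by (intro integrable_mult_left integrable_real_indicator) (auto simp: fmeasurable_def)
    show "(\<lambda>x. indicator K x *\<^sub>R fourier_L1 (low 1 g) x) \<in> borel_measurable lebesgue"
      by (intro borel_measurable_scaleR borel_measurable_indicator fmeasurableD Kl fourier_L1_measurable low)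
    show "AE x in lebesgue. norm (indicator K x *\<^sub>R fourier_L1 (low 1 g) x) \<le> norm (indicator K x * ?B)"
    proof (intro AE_I2)
      fix x
      show "norm (indicator K x *\<^sub>R fourier_L1 (low 1 g) x) \<le> norm (indicator K x * ?B)"
        using norm_fourier_L1_le[of "low 1 g" x] by (simp add: indicator_def)
    qed
  qed
  moreover have "integrable lebesgue (\<lambda>x. indicator K x *\<^sub>R F2 (high 1 g) x)"
    by (intro Lp2_indicator_integrable F2_Lp2 high Kl)
  ultimately show ?thesis
    unfolding fourier_weighted_def scaleR_add_right by (rule Bochner_Integration.integrable_add)
qed

text \<open>Kept general in the real-linear functional \<open>P\<close>, since the solution is later
  shown to be real by comparing two functionals. \<open>P\<close> commutes with integrals and with
  real test functions.\<close>

lemma has_weak_partial_fourier_weighted: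
  fixes g :: "real^'n \<Rightarrow> complex"
  assumes P: "bounded_linear (P :: complex \<Rightarrow> real)"
    and g: "weighted_L2 (Suc s) g" and s: "2 * Suc s < CARD('n)"
  shows "has_weak_partial j (\<lambda>x. P (fourier_weighted g x)) (\<lambda>x. P (fourier_weighted (freq_mult j g) x))"
  unfolding has_weak_partial_def
proof (intro conjI allI impI)
  have s': "2 * s < CARD('n)" using s by simp
  note g' = freq_mult_weighted(1)[OF g]
  show "locally_integrable (\<lambda>x. P (fourier_weighted g x))"
    by (intro bounded_linear_integrable_indicator P fourier_weighted_integrable_indicator[OF g s])
  show "locally_integrable (\<lambda>x. P (fourier_weighted (freq_mult j g) x))"
    by (intro bounded_linear_integrable_indicator P fourier_weighted_integrable_indicator[OF g' s'])
  have PP: "P u * r = P (u * of_real r)" for u r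
  proof -
    have "P (r *\<^sub>R u) = r *\<^sub>R P u" by (rule linear_scale[OF bounded_linear.linear[OF P]])
    then show ?thesis by (simp add: scaleR_conv_of_real mult.commute)
  qed
  fix \<phi> :: "real^'n \<Rightarrow> real" assume \<phi>: "test_function \<phi>"
  show "(LINT x|lebesgue. P (fourier_weighted g x) * partial_deriv j \<phi> x)
      = - (LINT x|lebesgue. P (fourier_weighted (freq_mult j g) x) * \<phi> x)"
    unfolding PP integral_bounded_linear[OF P fourier_weighted_test(2)[OF g s test_function_partial[OF \<phi>]]]
      integral_bounded_linear[OF P fourier_weighted_test(2)[OF g' s' \<phi>]] fourier_weighted_partial[OF g s \<phi>]
    by (rule linear_neg[OF bounded_linear.linear[OF P]])
qed

text \<open>For weight 0 the low part is in L2 as well as in L1, where both transforms agree, and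
  additivity of \<open>F2\<close> joins the two parts.\<close>

lemma fourier_weighted_0:
  fixes g :: "real^'n \<Rightarrow> complex"
  assumes "g \<in> Lp 2"
  shows "AE x in lebesgue. fourier_weighted g x = F2 g x"
proof -
  have w: "weighted_L2 0 g" using assms by (simp add: weighted_L2_def Lp2_iff)
  have high: "high 1 g \<in> Lp 2" by (rule high_Lp2[OF w]) simp
  have l1: "integrable lebesgue (low 1 g)" by (rule low_integrable(1)[OF w]) auto
  have l2: "low 1 g \<in> Lp 2"
    unfolding low_def[abs_def] by (intro Lp2_indicator assms) auto
  have split: "(\<lambda>z. low 1 g z + high 1 g z) = g"
    by (auto simp: low_def high_def indicator_def)
  have "AE x in lebesgue. F2 (low 1 g) x = fourier_L1 (low 1 g) x"
    using l1 l2 by (intro F2_eq) (simp add: Lp1_iff)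
  moreover have "AE x in lebesgue. F2 g x = F2 (low 1 g) x + F2 (high 1 g) x"
    using F2_add[OF l2 high] unfolding split .
  ultimately show ?thesis
    unfolding fourier_weighted_def by eventually_elim simp
qed

subsection \<open>Uniqueness\<close>

lemma locally_integrable_diff:
  "locally_integrable v \<Longrightarrow> locally_integrable w \<Longrightarrow> locally_integrable (\<lambda>x. v x - w x)"
  unfolding locally_integrable_def set_integrable_def
  by (auto simp: right_diff_distrib)

lemma test_mult_integrable:
  fixes w :: "real^'n \<Rightarrow> real"
  assumes w: "locally_integrable w" and \<phi>: "test_function \<phi>"
  shows "integrable lebesgue (\<lambda>x. w x * \<phi> x)"
proof -
  obtain R B where RB: "\<And>x. \<bar>\<phi> x\<bar> \<le> B * indicator (cball 0 R) x" "B > 0"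
    using test_function_bounded_support[OF \<phi>] by metis
  show ?thesis
  proof (rule Bochner_Integration.integrable_bound)
    show "integrable lebesgue (\<lambda>x. B * norm (indicator (cball 0 R) x * w x))"
      by (intro integrable_mult_right integrable_norm locally_integrable_indicator w compact_cball)
    show "(\<lambda>x. w x * \<phi> x) \<in> borel_measurable lebesgue"
      by (intro borel_measurable_times locally_integrable_measurable[OF w] continuous_lebesgue_measurable
          test_function_continuous \<phi>)
    show "AE x in lebesgue. norm (w x * \<phi> x) \<le> norm (B * norm (indicator (cball 0 R) x * w x))"
    proof (intro AE_I2)
      fix x
      show "norm (w x * \<phi> x) \<le> norm (B * norm (indicator (cball 0 R) x * w x))"
        using mult_left_mono[OF RB(1)[of x] abs_ge_zero[of "w x"]] RB(2)
        by (simp add: abs_mult mult_ac)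
    qed
  qed
qed

lemma has_weak_partial_unique:
  fixes w w' :: "real^'n \<Rightarrow> real"
  assumes "has_weak_partial j v w" "has_weak_partial j v w'"
  shows "AE x in lebesgue. w x = w' x"
proof -
  have l: "locally_integrable w" "locally_integrable w'"
    using assms by (auto simp: has_weak_partial_def)
  have "AE x in lebesgue. w x - w' x = 0"
  proof (rule AE_zero_if_test_integrals_zero[OF locally_integrable_diff[OF l]])
    fix \<phi> :: "real^'n \<Rightarrow> real" assume "product_test \<phi>"
    then have \<phi>: "test_function \<phi>" by (rule product_test_test_function)
    have "(LINT x|lebesgue. w x * \<phi> x) = (LINT x|lebesgue. w' x * \<phi> x)"
      using assms \<phi> unfolding has_weak_partial_def by fastforce
    then show "(LINT x|lebesgue. (w x - w' x) * \<phi> x) = 0"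
      using test_mult_integrable[OF l(1) \<phi>] test_mult_integrable[OF l(2) \<phi>]
      by (simp add: left_diff_distrib)
  qed
  then show ?thesis by simp
qed

lemma has_weak_partial_weak_partial:
  "has_weak_partial j v w \<Longrightarrow> has_weak_partial j v (weak_partial j v)"
  unfolding weak_partial_def by (rule someI[where P = "has_weak_partial j v"])

lemma weak_partial_AE:
  "has_weak_partial j v w \<Longrightarrow> AE x in lebesgue. weak_partial j v x = w x"
  using has_weak_partial_unique has_weak_partial_weak_partial by blast

text \<open>Second derivatives are taken of \<open>weak_partial\<close>, a chosen representative of
  the first derivative; this allows it to be exchanged with an explicit one.\<close>

lemma has_weak_partial_cong:
  fixes v v' :: "real^'n \<Rightarrow> real"
  assumes "has_weak_partial j v w" "locally_integrable v'" "AE x in lebesgue. v' x = v x"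
  shows "has_weak_partial j v' w"
proof -
  have "(LINT x|lebesgue. v' x * partial_deriv j \<phi> x) = (LINT x|lebesgue. v x * partial_deriv j \<phi> x)"
    if "test_function \<phi>" for \<phi>
  proof (rule integral_cong_AE)
    have v: "locally_integrable v" using assms(1) by (simp add: has_weak_partial_def)
    note t = test_function_partial[OF that]
    show "(\<lambda>x. v' x * partial_deriv j \<phi> x) \<in> borel_measurable lebesgue"
      by (rule borel_measurable_integrable[OF test_mult_integrable[OF assms(2) t]])
    show "(\<lambda>x. v x * partial_deriv j \<phi> x) \<in> borel_measurable lebesgue"
      by (rule borel_measurable_integrable[OF test_mult_integrable[OF v t]])
    show "AE x in lebesgue. v' x * partial_deriv j \<phi> x = v x * partial_deriv j \<phi> x"
      using assms(3) by eventually_elim simp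
  qed
  with assms show ?thesis by (auto simp: has_weak_partial_def)
qed

section \<open>Finite sums and differences in Lp\<close>

lemma sum_powr_bound:
  fixes a :: "'i \<Rightarrow> real"
  assumes "finite I" "\<And>i. i \<in> I \<Longrightarrow> a i \<ge> 0" "p > 0"
  shows "(\<Sum>i\<in>I. a i) powr p \<le> real (card I) powr p * (\<Sum>i\<in>I. a i powr p)"
proof (cases "I = {}")
  case False
  define m where "m = Max (a ` I)"
  have "m \<in> a ` I" unfolding m_def using assms False by (intro Max_in) auto
  then obtain k where k: "k \<in> I" "a k = m" by auto
  have "a i \<le> m" if "i \<in> I" for i
    unfolding m_def using assms that by (intro Max_ge) auto
  then have "(\<Sum>i\<in>I. a i) \<le> real (card I) * m"
    using sum_bounded_above[of I a m] by simp
  then have "(\<Sum>i\<in>I. a i) powr p \<le> (real (card I) * m) powr p"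
    using assms by (intro powr_mono2) (auto intro!: sum_nonneg)
  also have "\<dots> = real (card I) powr p * a k powr p"
    using k assms(2) by (subst powr_mult) auto
  also have "\<dots> \<le> real (card I) powr p * (\<Sum>i\<in>I. a i powr p)"
    using assms k by (intro mult_left_mono member_le_sum) auto
  finally show ?thesis .
qed simp

text \<open>A form of Minkowski's inequality with a crude constant: the sum is at most
  \<open>card I\<close> times its largest term, and adding \<open>card I\<close> integrals leaves
  the further factor \<open>card I powr (1 / p)\<close>. It turns componentwise bounds into bounds
  for vectors and matrices.\<close>

lemma Lp_sum_bound:
  fixes f :: "'i \<Rightarrow> real^'n \<Rightarrow> 'b::euclidean_space" and v :: "real^'n \<Rightarrow> 'c::euclidean_space"
  assumes I: "finite I" and p: "p > 0" and f: "\<And>i. i \<in> I \<Longrightarrow> f i \<in> Lp p"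
    and v: "v \<in> borel_measurable lebesgue"
    and le: "AE x in lebesgue. norm (v x) \<le> (\<Sum>i\<in>I. norm (f i x))"
  shows "v \<in> Lp p"
    and "(\<And>i. i \<in> I \<Longrightarrow> Lp_norm p (f i) \<le> B) \<Longrightarrow> B \<ge> 0 \<Longrightarrow> Lp_norm p v \<le> real (card I) * real (card I) powr (1 / p) * B"
proof -
  let ?S = "\<lambda>x. real (card I) powr p * (\<Sum>i\<in>I. norm (f i x) powr p)"
  have fi: "integrable lebesgue (\<lambda>x. norm (f i x) powr p)" if "i \<in> I" for i
    using f[OF that] by (simp add: Lp_def)
  have Si: "integrable lebesgue ?S"
    by (intro integrable_mult_right Bochner_Integration.integrable_sum fi)
  have vS: "AE x in lebesgue. norm (v x) powr p \<le> ?S x"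
    using le
  proof eventually_elim
    case (elim x)
    have "norm (v x) powr p \<le> (\<Sum>i\<in>I. norm (f i x)) powr p"
      using elim p by (intro powr_mono2) auto
    also have "\<dots> \<le> ?S x" by (rule sum_powr_bound) (use I p in auto)
    finally show ?case .
  qed
  have vm: "(\<lambda>x. norm (v x) powr p) \<in> borel_measurable lebesgue" using v by measurable
  have vi: "integrable lebesgue (\<lambda>x. norm (v x) powr p)"
  proof (rule Bochner_Integration.integrable_bound[OF Si vm])
    show "AE x in lebesgue. norm (norm (v x) powr p) \<le> norm (?S x)"
      using vS
    proof eventually_elim
      case (elim x)
      then show ?case unfolding real_norm_def by (metis abs_ge_self abs_of_nonneg order_trans powr_ge_zero)
    qed
  qed
  then show "v \<in> Lp p" using v by (simp add: Lp_def)
  assume B: "\<And>i. i \<in> I \<Longrightarrow> Lp_norm p (f i) \<le> B" "B \<ge> 0"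
  have fB: "(LINT x|lebesgue. norm (f i x) powr p) \<le> B powr p" if "i \<in> I" for i
  proof -
    have "(LINT x|lebesgue. norm (f i x) powr p) = Lp_norm p (f i) powr p"
      using p unfolding Lp_norm_def by (simp add: powr_powr Bochner_Integration.integral_nonneg)
    also have "\<dots> \<le> B powr p"
      using p B(1)[OF that] by (intro powr_mono2 Lp_norm_nonneg) auto
    finally show ?thesis .
  qed
  have "(LINT x|lebesgue. norm (v x) powr p) \<le> (LINT x|lebesgue. ?S x)"
    by (rule integral_mono_AE[OF vi Si vS])
  also have "\<dots> = real (card I) powr p * (\<Sum>i\<in>I. LINT x|lebesgue. norm (f i x) powr p)"
    using fi by simp
  also have "\<dots> \<le> real (card I) powr p * (\<Sum>i\<in>I. B powr p)"
    using fB by (intro mult_left_mono sum_mono) auto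
  finally have "(LINT x|lebesgue. norm (v x) powr p) \<le> real (card I) powr p * (real (card I) * B powr p)"
    by simp
  then have "Lp_norm p v \<le> (real (card I) powr p * (real (card I) * B powr p)) powr (1 / p)"
    unfolding Lp_norm_def using p by (intro powr_mono2) (auto intro!: Bochner_Integration.integral_nonneg)
  also have "\<dots> = real (card I) * real (card I) powr (1 / p) * B"
    using p B(2) by (simp add: powr_mult powr_powr)
  finally show "Lp_norm p v \<le> real (card I) * real (card I) powr (1 / p) * B" .
qed

lemma Lp_dominated:
  fixes v :: "real^'n \<Rightarrow> 'b::euclidean_space" and w :: "real^'n \<Rightarrow> 'c::euclidean_space"
  assumes "p > 0" "w \<in> Lp p" "v \<in> borel_measurable lebesgue" "\<And>x. norm (v x) \<le> norm (w x)"
  shows "v \<in> Lp p"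
  by (rule Lp_sum_bound(1)[of "{()}" p "\<lambda>_. w"]) (use assms in auto)

lemma Lp_diff:
  fixes v w :: "real^'n \<Rightarrow> real"
  assumes p: "p > 0" and v: "v \<in> Lp p" and w: "w \<in> Lp p"
  shows "(\<lambda>x. v x - w x) \<in> Lp p"
proof (rule Lp_sum_bound(1)[of "UNIV :: bool set" p "\<lambda>b. if b then v else w"])
  show "(\<lambda>x. v x - w x) \<in> borel_measurable lebesgue"
    using v w by (intro borel_measurable_diff) (auto simp: Lp_def)
  show "AE x in lebesgue. norm (v x - w x) \<le> (\<Sum>b\<in>UNIV. norm ((if b then v else w) x))"
    by (intro AE_I2) (simp add: UNIV_bool norm_triangle_ineq4 add.commute)
qed (use assms in auto)

subsection \<open>A function in \<open>L\<^sup>q\<close> that is constant in one direction vanishes\<close>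

text \<open>A difference of translates has integral 0, so its antiderivative vanishes on both sides
  of the support and is a bump function itself.\<close>

lemma bump1_antiderivative:
  assumes g: "bump1 g" and t: "t > 0"
  obtains A where "bump1 A" "\<And>s. deriv A s = g s - g (s - t)"
proof -
  have gs: "smooth1 g" using g by (simp add: bump1_def)
  obtain R where R: "\<And>s. \<bar>s\<bar> > R \<Longrightarrow> g s = 0" using g by (auto simp: bump1_def)
  define G where "G u = (LBINT y=ereal 0..ereal u. g y)" for u :: real
  have G: "(G has_real_derivative g x) (at x)" for x
  proof -
    let ?a = "- \<bar>x\<bar> - 1" let ?b = "\<bar>x\<bar> + 1"
    have "((\<lambda>u. LBINT y=ereal 0..ereal u. g y) has_vector_derivative g x) (at x within {?a..?b})"
      by (rule interval_integral_FTC2) (auto intro: smooth1_continuous gs)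
    then have "(G has_vector_derivative g x) (at x)"
      unfolding G_def[abs_def] by (subst (asm) at_within_interior) auto
    then show ?thesis by (simp add: has_real_derivative_iff_has_vector_derivative)
  qed
  define A where "A s = G s - G (s - t)" for s
  have A: "(A has_real_derivative g s - g (s - t)) (at s)" for s
  proof -
    have "((\<lambda>s. G (s - t)) has_real_derivative g (s - t) * 1) (at s)"
      by (rule DERIV_chain2[OF G]) (auto intro!: derivative_eq_intros)
    then show ?thesis unfolding A_def[abs_def] using DERIV_diff[OF G[of s]] by simp
  qed
  have "smooth1 (\<lambda>s. g s + (- 1) * g (- t + 1 * s))"
    by (intro smooth1_add smooth1_mult smooth1_const smooth1_affine gs)
  then have "smooth1 (\<lambda>s. g s - g (s - t))" by simp
  then have As: "smooth1 A" using smooth1_antiderivative[OF A] by blast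
  \<comment> \<open>The increment of \<open>G\<close> over a window of length \<open>t\<close>
    outside the support is \<open>t\<close> times a value of \<open>g\<close> there.\<close>
  have "A s = 0" if "\<bar>s\<bar> > R + t" for s
  proof -
    obtain \<xi> where \<xi>: "s - t < \<xi>" "\<xi> < s" "G s - G (s - t) = (s - (s - t)) * g \<xi>"
      using MVT2[of "s - t" s G g] G t by auto
    have "\<bar>\<xi>\<bar> > R" using that \<xi> t by linarith
    then show ?thesis using \<xi>(3) R by (simp add: A_def)
  qed
  then have "bump1 A" using As by (auto simp: bump1_def)
  moreover have "deriv A s = g s - g (s - t)" for s by (rule DERIV_imp_deriv[OF A])
  ultimately show ?thesis using that by blast
qed

text \<open>The difference of \<open>\<psi>\<close> and its translate is the partial derivative of
  the product in which the factor \<open>g i\<close> is replaced by the antiderivative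
  \<open>A\<close>. Hence \<open>w\<close> acts on these tests like a function constant in direction
  \<open>i\<close>.\<close>

lemma product_test_shift_eq:
  fixes w :: "real^'n \<Rightarrow> real"
  assumes w: "locally_integrable w"
    and 0: "\<And>\<phi>. product_test \<phi> \<Longrightarrow> (LINT x|lebesgue. w x * partial_deriv i \<phi> x) = 0"
    and \<psi>: "product_test \<psi>" and t: "t > 0"
  shows "product_test (\<lambda>x. \<psi> (x - t *\<^sub>R axis i 1))"
    and "(LINT x|lebesgue. w x * \<psi> x) = (LINT x|lebesgue. w x * \<psi> (x - t *\<^sub>R axis i 1))"
proof -
  obtain g where g: "\<And>j. bump1 (g j)" "\<psi> = (\<lambda>x. \<Prod>j\<in>UNIV. g j (x $ j))"
    using \<psi> by (auto simp: product_test_def)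
  obtain A where A: "bump1 A" "\<And>s. deriv A s = g i s - g i (s - t)"
    using bump1_antiderivative[OF g(1) t] by blast
  let ?h = "g(i := (\<lambda>s. g i (s - t)))"
  have shift: "\<psi> (x - t *\<^sub>R axis i 1) = (\<Prod>j\<in>UNIV. ?h j (x $ j))" for x :: "real^'n"
    unfolding g(2) by (intro prod.cong) (auto simp: axis_def)
  have "bump1 (\<lambda>s. g i (s - t))"
  proof -
    obtain R where R: "\<And>s. \<bar>s\<bar> > R \<Longrightarrow> g i s = 0" using g(1)[of i] by (auto simp: bump1_def)
    have "g i (s - t) = 0" if "\<bar>s\<bar> > R + \<bar>t\<bar>" for s by (rule R) (use that in linarith)
    moreover have "smooth1 (\<lambda>s. g i (- t + 1 * s))"
      using g(1)[of i] by (intro smooth1_affine) (simp add: bump1_def)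
    ultimately show ?thesis by (auto simp: bump1_def)
  qed
  then have "bump1 (?h j)" for j using g(1) by simp
  then show pt: "product_test (\<lambda>x. \<psi> (x - t *\<^sub>R axis i 1))"
    unfolding shift by (rule product_testI)
  let ?k = "g(i := A)"
  have k: "bump1 (?k j)" for j using g(1) A(1) by simp
  have eq: "partial_deriv i (\<lambda>x. \<Prod>j\<in>UNIV. ?k j (x $ j)) = (\<lambda>x. \<psi> x - \<psi> (x - t *\<^sub>R axis i 1))"
  proof
    fix x :: "real^'n"
    have "partial_deriv i (\<lambda>x. \<Prod>j\<in>UNIV. ?k j (x $ j)) x = (\<Prod>j\<in>UNIV. (?k(i := deriv (?k i))) j (x $ j))"
      using k by (subst partial_deriv_product) (auto simp: bump1_def)
    also have "\<dots> = (g i (x $ i) - g i (x $ i - t)) * (\<Prod>j\<in>UNIV - {i}. g j (x $ j))"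
      by (subst prod.remove[of UNIV i]) (auto simp: A(2) intro!: prod.cong)
    also have "\<dots> = \<psi> x - \<psi> (x - t *\<^sub>R axis i 1)"
    proof -
      have "\<psi> x = g i (x $ i) * (\<Prod>j\<in>UNIV - {i}. g j (x $ j))"
        unfolding g(2) by (subst prod.remove[of UNIV i]) auto
      moreover have "\<psi> (x - t *\<^sub>R axis i 1) = g i (x $ i - t) * (\<Prod>j\<in>UNIV - {i}. g j (x $ j))"
        unfolding shift by (subst prod.remove[of UNIV i]) (auto intro!: prod.cong)
      ultimately show ?thesis by (simp add: left_diff_distrib)
    qed
    finally show "partial_deriv i (\<lambda>x. \<Prod>j\<in>UNIV. ?k j (x $ j)) x = \<psi> x - \<psi> (x - t *\<^sub>R axis i 1)" .
  qed
  have "(LINT x|lebesgue. w x * (\<psi> x - \<psi> (x - t *\<^sub>R axis i 1))) = 0"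
  proof -
    have "product_test (\<lambda>x. \<Prod>j\<in>UNIV. ?k j (x $ j))"
      by (rule product_testI) (rule k)
    from 0[OF this] show ?thesis unfolding eq .
  qed
  then show "(LINT x|lebesgue. w x * \<psi> x) = (LINT x|lebesgue. w x * \<psi> (x - t *\<^sub>R axis i 1))"
    using test_mult_integrable[OF w product_test_test_function[OF \<psi>]]
      test_mult_integrable[OF w product_test_test_function[OF pt]]
    by (simp add: right_diff_distrib)
qed

text \<open>The pairing with \<open>\<psi>\<close> is unchanged when \<open>\<psi>\<close> is pushed
  to infinity in direction \<open>i\<close>, while the integral of
  \<open>\<bar>w\<bar> powr q\<close> over the moving ball tends to 0. Splitting \<open>w\<close> at
  a height \<open>\<epsilon>\<close> plays the part of Hoelder's inequality and includes
  \<open>q = 1\<close>; the translation goes to its limit first, then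
  \<open>\<epsilon>\<close>.\<close>

lemma AE_zero_if_partial_zero:
  fixes w :: "real^'n \<Rightarrow> real"
  assumes w: "locally_integrable w" "w \<in> Lp q" and q: "q \<ge> 1"
    and 0: "\<And>\<phi>. product_test \<phi> \<Longrightarrow> (LINT x|lebesgue. w x * partial_deriv i \<phi> x) = 0"
  shows "AE x in lebesgue. w x = 0"
proof (rule AE_zero_if_test_integrals_zero[OF w(1)])
  fix \<psi> :: "real^'n \<Rightarrow> real" assume \<psi>: "product_test \<psi>"
  obtain R B where R: "\<And>x. \<bar>\<psi> x\<bar> \<le> B * indicator (cball 0 R) x" "B > 0"
    using test_function_bounded_support[OF product_test_test_function[OF \<psi>]] by metis
  let ?e = "axis i 1 :: real^'n"
  let ?S = "\<lambda>k. cball (real (Suc k) *\<^sub>R ?e) R"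
  let ?V = "measure lebesgue (cball (0::real^'n) R)"
  have wq: "integrable lebesgue (\<lambda>x. \<bar>w x\<bar> powr q)" and wm: "w \<in> borel_measurable lebesgue"
    using w(2) by (auto simp: Lp_def)
  have V: "measure lebesgue (?S k) = ?V" for k
    using measure_translation[of "real (Suc k) *\<^sub>R ?e" "cball 0 R"] by (simp add: cball_translation[symmetric])
  have lim: "(\<lambda>k. LINT x|lebesgue. indicator (?S k) x * \<bar>w x\<bar> powr q) \<longlonglongrightarrow> 0"
  proof -
    have "(\<lambda>k. LINT x|lebesgue. indicator (?S k) x * \<bar>w x\<bar> powr q) \<longlonglongrightarrow> (LINT x::real^'n|lebesgue. 0)"
    proof (rule integral_dominated_convergence[where w = "\<lambda>x. \<bar>w x\<bar> powr q"])
      show "AE x in lebesgue. (\<lambda>k. indicator (?S k) x * \<bar>w x\<bar> powr q) \<longlonglongrightarrow> 0"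
      proof (intro AE_I2 tendsto_eventually)
        fix x :: "real^'n"
        obtain K where K: "norm x + R < real K" using reals_Archimedean2 by blast
        have "x \<notin> ?S k" if "k \<ge> K" for k
        proof
          assume "x \<in> ?S k"
          then have "norm (real (Suc k) *\<^sub>R ?e - x) \<le> R" by (simp add: dist_norm)
          moreover have "norm (real (Suc k) *\<^sub>R ?e) \<le> norm (real (Suc k) *\<^sub>R ?e - x) + norm x"
            using norm_triangle_ineq[of "real (Suc k) *\<^sub>R ?e - x" x] by simp
          ultimately have "real (Suc k) \<le> R + norm x" by simp
          then show False using K that by simp
        qed
        then show "\<forall>\<^sub>F k in sequentially. indicator (?S k) x * \<bar>w x\<bar> powr q = 0"
          by (intro eventually_sequentiallyI[of K]) simp
      qed
      show "(\<lambda>x. indicator (?S k) x * \<bar>w x\<bar> powr q) \<in> borel_measurable lebesgue" for k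
        by (intro borel_measurable_times borel_measurable_indicator borel_measurable_integrable[OF wq]) simp
    qed (use wq in \<open>auto simp: indicator_def\<close>)
    then show ?thesis by simp
  qed
  have bound: "\<bar>LINT x|lebesgue. w x * \<psi> x\<bar> \<le> B * (\<epsilon> * ?V)" if \<epsilon>: "\<epsilon> > 0" for \<epsilon>
  proof (rule LIMSEQ_le_const)
    show "(\<lambda>k. B * (\<epsilon> * ?V + \<epsilon> powr (1 - q) * (LINT x|lebesgue. indicator (?S k) x * \<bar>w x\<bar> powr q)))
        \<longlonglongrightarrow> B * (\<epsilon> * ?V)"
      using tendsto_mult[OF tendsto_const[of B] tendsto_add[OF tendsto_const[of "\<epsilon> * ?V"] tendsto_mult[OF tendsto_const[of "\<epsilon> powr (1 - q)"] lim]]]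
      by simp
    show "\<exists>N. \<forall>k\<ge>N. \<bar>LINT x|lebesgue. w x * \<psi> x\<bar>
        \<le> B * (\<epsilon> * ?V + \<epsilon> powr (1 - q) * (LINT x|lebesgue. indicator (?S k) x * \<bar>w x\<bar> powr q))"
    proof (intro exI allI impI)
      fix k :: nat
      have t: "real (Suc k) > 0" by simp
      note sh = product_test_shift_eq[OF w(1) 0 \<psi> t]
      have ind: "integrable lebesgue (\<lambda>x. indicator (?S k) x :: real)"
        using lmeasurable_cball[of "real (Suc k) *\<^sub>R ?e" R] by (intro integrable_real_indicator) (auto simp: fmeasurable_def)
      have iq: "integrable lebesgue (\<lambda>x. indicator (?S k) x * \<bar>w x\<bar> powr q)"
        using integrable_mult_indicator[OF _ wq, of "?S k"] by simp
      \<comment> \<open>Where \<open>\<bar>w x\<bar> > \<epsilon>\<close>, the factor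
        \<open>(\<bar>w x\<bar> / \<epsilon>) powr (q - 1)\<close> is at least 1.\<close>
      have pt: "\<bar>w x\<bar> \<le> \<epsilon> + \<epsilon> powr (1 - q) * \<bar>w x\<bar> powr q" for x
      proof (cases "\<bar>w x\<bar> \<le> \<epsilon>")
        case True
        have "0 \<le> \<epsilon> powr (1 - q) * \<bar>w x\<bar> powr q" by simp
        then show ?thesis using True by linarith
      next
        case False
        have "\<epsilon> powr (q - 1) \<le> \<bar>w x\<bar> powr (q - 1)"
          using False \<epsilon> q by (intro powr_mono2) auto
        then have "\<epsilon> powr (1 - q) * \<epsilon> powr (q - 1) * \<bar>w x\<bar> \<le> \<epsilon> powr (1 - q) * \<bar>w x\<bar> powr (q - 1) * \<bar>w x\<bar>"
          by (intro mult_right_mono mult_left_mono) auto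
        moreover have "\<epsilon> powr (1 - q) * \<epsilon> powr (q - 1) = 1"
          using \<epsilon> by (simp flip: powr_add)
        moreover have "\<bar>w x\<bar> powr (q - 1) * \<bar>w x\<bar> = \<bar>w x\<bar> powr q"
          using powr_add[of "\<bar>w x\<bar>" "q - 1" 1] False \<epsilon> by simp
        ultimately have "\<bar>w x\<bar> \<le> \<epsilon> powr (1 - q) * \<bar>w x\<bar> powr q" by (simp add: mult.assoc)
        then show ?thesis using \<epsilon> by linarith
      qed
      have "\<bar>LINT x|lebesgue. w x * \<psi> x\<bar> = \<bar>LINT x|lebesgue. w x * \<psi> (x - real (Suc k) *\<^sub>R ?e)\<bar>"
        by (simp only: sh(2))
      also have "\<dots> \<le> (LINT x|lebesgue. \<bar>w x * \<psi> (x - real (Suc k) *\<^sub>R ?e)\<bar>)"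
        using integral_norm_bound[of lebesgue "\<lambda>x. w x * \<psi> (x - real (Suc k) *\<^sub>R ?e)"] by simp
      also have "\<dots> \<le> (LINT x|lebesgue. B * (\<epsilon> * indicator (?S k) x + \<epsilon> powr (1 - q) * (indicator (?S k) x * \<bar>w x\<bar> powr q)))"
      proof (rule integral_mono)
        show "integrable lebesgue (\<lambda>x. \<bar>w x * \<psi> (x - real (Suc k) *\<^sub>R ?e)\<bar>)"
          by (intro integrable_abs test_mult_integrable w product_test_test_function sh(1))
        show "integrable lebesgue (\<lambda>x. B * (\<epsilon> * indicator (?S k) x + \<epsilon> powr (1 - q) * (indicator (?S k) x * \<bar>w x\<bar> powr q)))"
          by (intro integrable_mult_right Bochner_Integration.integrable_add ind iq)
        fix x :: "real^'n"
        have "\<bar>\<psi> (x - real (Suc k) *\<^sub>R ?e)\<bar> \<le> B * indicator (cball 0 R) (x - real (Suc k) *\<^sub>R ?e)" by (rule R)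
        also have "indicator (cball 0 R) (x - real (Suc k) *\<^sub>R ?e) = (indicator (?S k) x :: real)"
          by (simp add: indicator_def dist_norm norm_minus_commute)
        finally have "\<bar>w x * \<psi> (x - real (Suc k) *\<^sub>R ?e)\<bar> \<le> \<bar>w x\<bar> * (B * indicator (?S k) x)"
          unfolding abs_mult by (intro mult_left_mono) auto
        also have "\<dots> \<le> (\<epsilon> + \<epsilon> powr (1 - q) * \<bar>w x\<bar> powr q) * (B * indicator (?S k) x)"
          using R(2) by (intro mult_right_mono pt) auto
        finally show "\<bar>w x * \<psi> (x - real (Suc k) *\<^sub>R ?e)\<bar>
            \<le> B * (\<epsilon> * indicator (?S k) x + \<epsilon> powr (1 - q) * (indicator (?S k) x * \<bar>w x\<bar> powr q))"
          by (simp add: algebra_simps)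
      qed
      also have "\<dots> = B * (\<epsilon> * measure lebesgue (?S k) + \<epsilon> powr (1 - q) * (LINT x|lebesgue. indicator (?S k) x * \<bar>w x\<bar> powr q))"
        using ind iq by (simp add: Bochner_Integration.integral_add del: of_nat_Suc)
      finally show "\<bar>LINT x|lebesgue. w x * \<psi> x\<bar>
        \<le> B * (\<epsilon> * ?V + \<epsilon> powr (1 - q) * (LINT x|lebesgue. indicator (?S k) x * \<bar>w x\<bar> powr q))"
        by (simp only: V)
    qed
  qed
  have "\<bar>LINT x|lebesgue. w x * \<psi> x\<bar> \<le> 0"
  proof (rule LIMSEQ_le_const)
    have "(\<lambda>k. B * (inverse (real (Suc k)) * ?V)) \<longlonglongrightarrow> B * (0 * ?V)"
      by (intro tendsto_intros LIMSEQ_inverse_real_of_nat)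
    then show "(\<lambda>k. B * (inverse (real (Suc k)) * ?V)) \<longlonglongrightarrow> 0" by simp
    show "\<exists>N. \<forall>k\<ge>N. \<bar>LINT x|lebesgue. w x * \<psi> x\<bar> \<le> B * (inverse (real (Suc k)) * ?V)"
      by (intro exI allI impI bound) simp
  qed
  then show "(LINT x|lebesgue. w x * \<psi> x) = 0" by simp
qed

subsection \<open>The Fourier transform of a Hessian\<close>

text \<open>Translating the test function multiplies its Fourier transform with a character, so the
  function below is integrable with vanishing Fourier transform.\<close>

lemma compatible_fourier:
  fixes a b :: "real^'n \<Rightarrow> complex"
  assumes a: "a \<in> Lp 2" and b: "b \<in> Lp 2"
    and eq: "\<And>\<phi>. product_test \<phi> \<Longrightarrow>
      (LINT x|lebesgue. a x * of_real (partial_deriv k \<phi> x)) = (LINT x|lebesgue. b x * of_real (partial_deriv i \<phi> x))"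
  shows "AE z in lebesgue. of_real (z $ k) * F2 a z = of_real (z $ i) * F2 b z"
proof -
  let ?I = "\<lambda>\<phi>. inv_fourier_L1 (\<lambda>x. complex_of_real (\<phi> x))"
  let ?w = "\<lambda>z. of_real (z $ k) * F2 a z - of_real (z $ i) * F2 b z"
  have Id: "?I (partial_deriv j \<phi>) z = - (2 * of_real pi * \<i>) * (of_real (z $ j) * ?I \<phi> z)"
    if "product_test \<phi>" for \<phi> z j
    unfolding inv_fourier_L1_minus fourier_partial_deriv[OF product_test_test_function[OF that]] by simp
  \<comment> \<open>Although \<open>z $ j\<close> is unbounded, the product is up to a constant the
    transform of a derivative of the test function.\<close>
  have L2: "(\<lambda>z. of_real (z $ j) * ?I \<phi> z) \<in> Lp 2" if "product_test \<phi>" for \<phi> j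
  proof -
    have "?I (partial_deriv j \<phi>) \<in> Lp 2"
      by (intro test_fourier_Lp2 product_test_test_function product_test_partial that)
    from Lp2_scale[OF this, of "- 1 / (2 * of_real pi * \<i>)"] show ?thesis
      unfolding Id[OF that] by simp
  qed
  have int: "integrable lebesgue (\<lambda>z. F2 c z * (of_real (z $ j) * ?I \<phi> z))"
    if "c \<in> Lp 2" "product_test \<phi>" for c j \<phi>
    by (intro Lp2_product_integrable F2_Lp2 L2 that)
  have weq: "?w z * c = F2 a z * (of_real (z $ k) * c) - F2 b z * (of_real (z $ i) * c)" for z c
    by (simp add: algebra_simps)
  have w0: "(LINT z|lebesgue. ?w z * ?I \<phi> z) = 0" if \<phi>: "product_test \<phi>" for \<phi>
  proof -
    let ?c = "- (2 * of_real pi * \<i>) :: complex"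
    have "(LINT z|lebesgue. F2 a z * (?c * (of_real (z $ k) * ?I \<phi> z))) = (LINT z|lebesgue. F2 b z * (?c * (of_real (z $ i) * ?I \<phi> z)))"
      using eq[OF \<phi>] unfolding F2_inv_test[OF a product_test_partial[OF \<phi>], symmetric]
        F2_inv_test[OF b product_test_partial[OF \<phi>], symmetric] Id[OF \<phi>] .
    then have "?c * (LINT z|lebesgue. F2 a z * (of_real (z $ k) * ?I \<phi> z)) = ?c * (LINT z|lebesgue. F2 b z * (of_real (z $ i) * ?I \<phi> z))"
      by (simp only: mult.left_commute[of _ ?c] integral_mult_right_zero)
    then have "(LINT z|lebesgue. F2 a z * (of_real (z $ k) * ?I \<phi> z)) = (LINT z|lebesgue. F2 b z * (of_real (z $ i) * ?I \<phi> z))"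
      by simp
    then have "(LINT z|lebesgue. F2 a z * (of_real (z $ k) * ?I \<phi> z) - F2 b z * (of_real (z $ i) * ?I \<phi> z)) = 0"
      by (subst Bochner_Integration.integral_diff[OF int[OF a \<phi>] int[OF b \<phi>]]) simp
    then show ?thesis by (simp only: weq)
  qed
  have shift: "product_test (\<lambda>x. \<phi> (x - y))" "?I (\<lambda>x. \<phi> (x - y)) z = wave (- y) z * ?I \<phi> z"
    if \<phi>: "product_test \<phi>" for \<phi> y z
  proof -
    obtain g where g: "\<And>j. bump1 (g j)" "\<phi> = (\<lambda>x. \<Prod>j\<in>UNIV. g j (x $ j))"
      using \<phi> by (auto simp: product_test_def)
    have "bump1 (\<lambda>s. g j (s - y $ j))" for j
    proof -
      obtain R where R: "\<And>s. \<bar>s\<bar> > R \<Longrightarrow> g j s = 0" using g(1)[of j] by (auto simp: bump1_def)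
      have "g j (s - y $ j) = 0" if "\<bar>s\<bar> > R + \<bar>y $ j\<bar>" for s by (rule R) (use that in linarith)
      moreover have "smooth1 (\<lambda>s. g j (- (y $ j) + 1 * s))"
        using g(1)[of j] by (intro smooth1_affine) (simp add: bump1_def)
      ultimately show ?thesis by (auto simp: bump1_def)
    qed
    from product_testI[of "\<lambda>j s. g j (s - y $ j)", OF this]
    show "product_test (\<lambda>x. \<phi> (x - y))" unfolding g(2) by simp
    have m: "(\<lambda>x. complex_of_real (\<phi> (x - y)) * wave (- z) x) \<in> borel_measurable borel"
      by (intro borel_measurable_continuous_onI continuous_intros continuous_on_compose2[OF product_test_continuous[OF \<phi>]]) auto
    have "?I (\<lambda>x. \<phi> (x - y)) z = (LINT x|lebesgue. complex_of_real (\<phi> x) * wave (- z) (y + x))"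
      unfolding inv_fourier_L1_wave using lebesgue_affine(2)[OF m, of 1 y] by simp
    also have "\<dots> = (LINT x|lebesgue. wave (- y) z * (complex_of_real (\<phi> x) * wave (- z) x))"
      by (intro Bochner_Integration.integral_cong refl)
        (simp add: wave_commute[of z] wave_add_left wave_minus_left mult_ac)
    finally show "?I (\<lambda>x. \<phi> (x - y)) z = wave (- y) z * ?I \<phi> z"
      unfolding inv_fourier_L1_wave by simp
  qed
  have ae: "AE z in lebesgue. ?w z * ?I \<phi> z = 0" if \<phi>: "product_test \<phi>" for \<phi>
  proof (rule fourier_L1_eq_0)
    have "integrable lebesgue (\<lambda>z. F2 a z * (of_real (z $ k) * ?I \<phi> z) - F2 b z * (of_real (z $ i) * ?I \<phi> z))"
      by (intro Bochner_Integration.integrable_diff int a b \<phi>)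
    then show "integrable lebesgue (\<lambda>z. ?w z * ?I \<phi> z)"
      by (simp only: weq)
    fix y
    have "(LINT z|lebesgue. ?w z * ?I \<phi> z * wave z y) = (LINT z|lebesgue. ?w z * ?I (\<lambda>x. \<phi> (x - (- y))) z)"
      unfolding shift(2)[OF \<phi>] by (simp add: wave_commute[of _ y] mult_ac)
    also have "\<dots> = 0" by (rule w0[OF shift(1)[OF \<phi>]])
    finally show "fourier_L1 (\<lambda>z. ?w z * ?I \<phi> z) y = 0" unfolding fourier_L1_wave .
  qed
  \<comment> \<open>In the cube of half side \<open>?r m\<close> the l1 norm is at most
    \<open>1 / (8 * (m + 1))\<close>, so \<open>\<bar>x \<bullet> z\<bar> \<le> 1 / 8\<close> for
    \<open>norm z \<le> m + 1\<close>, and \<open>cos (2 * pi * (x \<bullet> z))\<close> stays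
    positive. Hence the transform of a cutoff of this cube has no zeros among such \<open>z\<close>,
    and countably many cutoffs reach every frequency.\<close>
  let ?r = "\<lambda>m::nat. 1 / (8 * real CARD('n) * real (Suc m))"
  let ?\<phi> = "\<lambda>m. box_cutoff (\<chi> j. - ?r m) (\<chi> j. ?r m) 1 :: real^'n \<Rightarrow> real"
  have nz: "?I (?\<phi> m) z \<noteq> 0" if z: "norm z \<le> real (Suc m)" for m z
  proof
    assume I0: "?I (?\<phi> m) z = 0"
    let ?B = "box (\<chi> j. - ?r m) (\<chi> j. ?r m) :: (real^'n) set"
    have r: "?r m > 0" by simp
    have cos: "cos (2 * pi * (x \<bullet> z)) > 0" if x: "x \<in> ?B" for x
    proof -
      have xj: "\<bar>x $ j\<bar> \<le> ?r m" for j
      proof -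
        have "- ?r m < x $ j \<and> x $ j < ?r m" using x unfolding mem_box_cart by (simp only: vec_lambda_beta)
        then show ?thesis by linarith
      qed
      have "norm x \<le> (\<Sum>j\<in>UNIV. \<bar>x $ j\<bar>)" by (rule norm_le_l1_cart)
      also have "\<dots> \<le> (\<Sum>j\<in>(UNIV :: 'n set). ?r m)" by (intro sum_mono xj)
      also have "\<dots> = 1 / (8 * real (Suc m))" by (simp del: of_nat_Suc)
      finally have "norm x * norm z \<le> 1 / (8 * real (Suc m)) * real (Suc m)"
        using z by (intro mult_mono) auto
      then have "\<bar>x \<bullet> z\<bar> \<le> 1 / 8"
        using Cauchy_Schwarz_ineq2[of x z] by (simp del: of_nat_Suc)
      then have "\<bar>2 * pi * (x \<bullet> z)\<bar> \<le> 2 * pi * (1 / 8)"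
        unfolding abs_mult by (intro mult_mono) auto
      then have "- (pi / 2) < 2 * pi * (x \<bullet> z)" "2 * pi * (x \<bullet> z) < pi / 2"
        using pi_gt_zero by linarith+
      then show ?thesis by (rule cos_gt_zero_pi)
    qed
    note \<phi> = product_test_box_cutoff[of "\<chi> j. - ?r m" "\<chi> j. ?r m" 1]
    have i1: "integrable lebesgue (\<lambda>x. complex_of_real (?\<phi> m x) * wave (- z) x)"
      using test_function_Lp[OF product_test_test_function[OF \<phi>]] by (intro integrable_wave) (auto simp: Lp1_iff)
    have Re: "Re (complex_of_real (?\<phi> m x) * wave (- z) x) = ?\<phi> m x * cos (2 * pi * (x \<bullet> z))" for x
      by (simp add: wave_cis inner_commute)
    have i2: "integrable lebesgue (\<lambda>x. ?\<phi> m x * cos (2 * pi * (x \<bullet> z)))"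
      using integrable_Re[OF i1] unfolding Re .
    have "(LINT x|lebesgue. ?\<phi> m x * cos (2 * pi * (x \<bullet> z))) = 0"
      using I0 integral_Re[OF i1] unfolding Re inv_fourier_L1_wave by simp
    moreover have "AE x in lebesgue. 0 \<le> ?\<phi> m x * cos (2 * pi * (x \<bullet> z))"
    proof (intro AE_I2)
      fix x
      show "0 \<le> ?\<phi> m x * cos (2 * pi * (x \<bullet> z))"
      proof (cases "x \<in> ?B")
        case True
        show ?thesis by (intro mult_nonneg_nonneg box_cutoff_bounds less_imp_le[OF cos[OF True]])
      next
        case False
        show ?thesis by (simp only: box_cutoff_outside[OF False] mult_zero_left order_refl)
      qed
    qed
    ultimately have "AE x in lebesgue. ?\<phi> m x * cos (2 * pi * (x \<bullet> z)) = 0"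
      using integral_nonneg_eq_0_iff_AE[OF i2] by blast
    \<comment> \<open>Cutoff and cosine are both strictly positive inside the cube, so a vanishing
      integral would make a nonempty open box negligible.\<close>
    then have "AE x in lebesgue. x \<notin> ?B"
    proof eventually_elim
      case (elim x)
      then show ?case using cos[of x] box_cutoff_inside[of x "\<chi> j. - ?r m" "\<chi> j. ?r m" 1] by auto
    qed
    then have "?B \<in> null_sets lebesgue"
      using AE_iff_null_sets[of ?B lebesgue] by simp
    then have "negligible ?B" by (simp add: negligible_iff_null_sets)
    moreover have "0 \<in> ?B" using r by (simp add: mem_box_cart)
    ultimately show False using open_not_negligible[of ?B] open_box by blast
  qed
  have "AE z in lebesgue. \<forall>m. ?w z * ?I (?\<phi> m) z = 0"
    unfolding AE_all_countable using ae product_test_box_cutoff by blast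
  then show ?thesis
  proof eventually_elim
    case (elim z)
    obtain m where "norm z < real m" using reals_Archimedean2 by blast
    then have "norm z \<le> real (Suc m)" by simp
    from nz[OF this] elim show ?case by auto
  qed
qed

section \<open>The estimate of the Hessian and uniqueness\<close>

lemma rank_one_form_symbol: "rank_one_form A \<eta> a = \<eta> \<bullet> (symbol_matrix A a *v \<eta>)"
  unfolding rank_one_form_def symbol_matrix_def matrix_vector_mult_def inner_vec_def
  by (simp add: sum_distrib_left sum_distrib_right mult_ac)

text \<open>Normalizing \<open>\<eta>\<close> lets the minimum bound the quadratic form from below;
  Cauchy-Schwarz bounds the form \<open>\<eta> \<bullet> (X *v \<eta>)\<close> from above.\<close>

lemma ellipticity_lower_bound:
  fixes A :: "real^'n^'n^'N^'N"
  assumes a: "norm a = 1"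
  shows "ellipticity A * norm \<eta> \<le> norm (symbol_matrix A a *v \<eta>)"
proof (cases "\<eta> = 0")
  case False
  let ?X = "symbol_matrix A a"
  have "ellipticity A \<le> rank_one_form A (\<eta> /\<^sub>R norm \<eta>) a"
    using ellipticity_attained[of A] a False by simp
  also have "\<dots> = (\<eta> \<bullet> (?X *v \<eta>)) / (norm \<eta>)\<^sup>2"
    unfolding rank_one_form_symbol matrix_vector_mult_scaleR by (simp add: power2_eq_square field_simps)
  finally have "ellipticity A * (norm \<eta>)\<^sup>2 \<le> \<eta> \<bullet> (?X *v \<eta>)"
    using False by (simp add: field_simps)
  also have "\<dots> \<le> norm \<eta> * norm (?X *v \<eta>)"
    by (rule norm_cauchy_schwarz)
  finally have "norm \<eta> * (ellipticity A * norm \<eta>) \<le> norm \<eta> * norm (?X *v \<eta>)"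
    by (simp add: power2_eq_square mult_ac)
  then show ?thesis using False by (simp add: mult_le_cancel_left)
qed simp

lemma norm_vec_power2: "(norm (x :: ('a::real_normed_vector)^'n))\<^sup>2 = (\<Sum>i\<in>UNIV. (norm (x $ i))\<^sup>2)"
  unfolding norm_vec_def L2_set_def by (simp add: sum_nonneg)

text \<open>The symbol matrix is real and acts separately on real and imaginary parts. The estimate
  is stated with squares since these add up over both parts.\<close>

lemma ellipticity_lower_bound_complex:
  fixes A :: "real^'n^'n^'N^'N" and g :: "'N \<Rightarrow> complex"
  assumes a: "norm a = 1" and A: "ellipticity A \<ge> 0"
  shows "(ellipticity A)\<^sup>2 * (\<Sum>\<beta>\<in>UNIV. (norm (g \<beta>))\<^sup>2)
    \<le> (\<Sum>\<alpha>\<in>UNIV. (norm (\<Sum>\<beta>\<in>UNIV. of_real (symbol_matrix A a $ \<alpha> $ \<beta>) * g \<beta>))\<^sup>2)"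
proof -
  let ?X = "symbol_matrix A a"
  have real: "(ellipticity A)\<^sup>2 * (\<Sum>\<beta>\<in>UNIV. (h \<beta>)\<^sup>2) \<le> (\<Sum>\<alpha>\<in>UNIV. (\<Sum>\<beta>\<in>UNIV. ?X $ \<alpha> $ \<beta> * h \<beta>)\<^sup>2)"
    for h :: "'N \<Rightarrow> real"
  proof -
    have "(ellipticity A * norm (\<chi> \<beta>. h \<beta>))\<^sup>2 \<le> (norm (?X *v (\<chi> \<beta>. h \<beta>)))\<^sup>2"
      using A by (intro power_mono ellipticity_lower_bound a) auto
    then show ?thesis
      by (simp add: power_mult_distrib norm_vec_power2 matrix_vector_mult_def)
  qed
  have "(ellipticity A)\<^sup>2 * (\<Sum>\<beta>\<in>UNIV. (norm (g \<beta>))\<^sup>2)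
     = (ellipticity A)\<^sup>2 * (\<Sum>\<beta>\<in>UNIV. (Re (g \<beta>))\<^sup>2) + (ellipticity A)\<^sup>2 * (\<Sum>\<beta>\<in>UNIV. (Im (g \<beta>))\<^sup>2)"
    by (simp add: cmod_power2 sum.distrib distrib_left)
  also have "\<dots> \<le> (\<Sum>\<alpha>\<in>UNIV. (\<Sum>\<beta>\<in>UNIV. ?X $ \<alpha> $ \<beta> * Re (g \<beta>))\<^sup>2) + (\<Sum>\<alpha>\<in>UNIV. (\<Sum>\<beta>\<in>UNIV. ?X $ \<alpha> $ \<beta> * Im (g \<beta>))\<^sup>2)"
    by (intro add_mono real)
  also have "\<dots> = (\<Sum>\<alpha>\<in>UNIV. (norm (\<Sum>\<beta>\<in>UNIV. of_real (?X $ \<alpha> $ \<beta>) * g \<beta>))\<^sup>2)"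
    by (simp add: cmod_power2 sum.distrib Re_sum Im_sum)
  finally show ?thesis .
qed

lemma of_real_Lp2:
  assumes "w \<in> Lp 2"
  shows "(\<lambda>x. complex_of_real (w x)) \<in> Lp 2"
proof -
  have [measurable]: "w \<in> borel_measurable lebesgue" using assms by (rule Lp2_measurable)
  have "(\<lambda>x. complex_of_real (w x)) \<in> borel_measurable lebesgue" by measurable
  then show ?thesis using assms by (simp add: Lp2_iff)
qed

lemma Lp_norm_2_of_real: "Lp_norm 2 (\<lambda>x. complex_of_real (w x)) = Lp_norm 2 w"
  by (simp add: Lp_norm_2)

section \<open>The Hessian on the Fourier side\<close>

lemma weak_second_partial_test:
  fixes v :: "real^'n \<Rightarrow> real"
  assumes "has_weak_partial j v v1" "has_weak_partial i v1 w" "product_test \<phi>"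
  shows "(LINT x|lebesgue. w x * \<phi> x) = (LINT x|lebesgue. v x * partial_deriv j (partial_deriv i \<phi>) x)"
  using assms product_test_test_function[OF assms(3)]
    product_test_test_function[OF product_test_partial[OF assms(3), of i]]
  unfolding has_weak_partial_def by fastforce

text \<open>Two families of identities are combined: the symmetry of the transforms
  \<open>W i j\<close>, and \<open>z_k W_ij = z_i W_kj\<close> from commuting derivatives on the
  test function. Multiplying by \<open>z_k\<close> once more, exchanging indices and summing over
  \<open>k\<close> replaces \<open>W i j\<close> by \<open>z_i z_j\<close> times the trace.\<close>

lemma hessian_fourier:
  fixes v :: "real^'n \<Rightarrow> real" and w :: "'n \<Rightarrow> 'n \<Rightarrow> real^'n \<Rightarrow> real"
  assumes v1: "\<And>j. has_weak_partial j v (v1 j)" and w: "\<And>i j. has_weak_partial i (v1 j) (w i j)"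
    and L2: "\<And>i j. w i j \<in> Lp 2"
  shows "AE z in lebesgue. \<forall>i j. of_real ((norm z)\<^sup>2) * F2 (\<lambda>x. of_real (w i j x)) z
    = of_real (z $ i * z $ j) * (\<Sum>k\<in>UNIV. F2 (\<lambda>x. of_real (w k k x)) z)"
proof -
  let ?W = "\<lambda>i j. F2 (\<lambda>x. complex_of_real (w i j x))"
  note test = weak_second_partial_test[OF v1 w]
  have cint: "(LINT x|lebesgue. complex_of_real (w i j x) * of_real (h x)) = of_real (LINT x|lebesgue. w i j x * h x)" for i j h
    by (simp only: of_real_mult[symmetric] integral_complex_of_real)
  have sym: "AE z in lebesgue. ?W i j z = ?W j i z" for i j
  proof (rule F2_cong[OF of_real_Lp2[OF L2] of_real_Lp2[OF L2]])
    show "AE x in lebesgue. complex_of_real (w i j x) = of_real (w j i x)"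
    proof (rule Lp2_eq_if_test_integrals_eq[OF of_real_Lp2[OF L2] of_real_Lp2[OF L2]])
      fix \<phi> :: "real^'n \<Rightarrow> real" assume \<phi>: "product_test \<phi>"
      show "(LINT x|lebesgue. complex_of_real (w i j x) * of_real (\<phi> x)) = (LINT x|lebesgue. complex_of_real (w j i x) * of_real (\<phi> x))"
        unfolding cint test[OF \<phi>] product_test_partial_commute[OF \<phi>, of i j] ..
    qed
  qed
  have compat: "AE z in lebesgue. of_real (z $ k) * ?W i j z = of_real (z $ i) * ?W k j z" for i j k
  proof (rule compatible_fourier[OF of_real_Lp2[OF L2] of_real_Lp2[OF L2]])
    fix \<phi> :: "real^'n \<Rightarrow> real" assume \<phi>: "product_test \<phi>"
    show "(LINT x|lebesgue. complex_of_real (w i j x) * of_real (partial_deriv k \<phi> x))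
        = (LINT x|lebesgue. complex_of_real (w k j x) * of_real (partial_deriv i \<phi> x))"
      unfolding cint test[OF product_test_partial[OF \<phi>]] product_test_partial_commute[OF \<phi>, of i k] ..
  qed
  have "AE z in lebesgue. (\<forall>i j. ?W i j z = ?W j i z) \<and> (\<forall>i j k. of_real (z $ k) * ?W i j z = of_real (z $ i) * ?W k j z)"
    by (intro AE_conjI AE_finite_allI sym compat finite_class.finite_UNIV[THEN finite_subset[OF subset_UNIV]] | (simp only: AE_all_countable, intro allI sym compat))+
  then show ?thesis
  proof eventually_elim
    case (elim z)
    then have sym: "\<And>i j. ?W i j z = ?W j i z" and c: "\<And>i j k. of_real (z $ k) * ?W i j z = of_real (z $ i) * ?W k j z"
      by blast+
    show ?case
    proof (intro allI)
      fix i j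
      have "(norm z)\<^sup>2 = (\<Sum>k\<in>UNIV. z $ k * z $ k)"
        unfolding norm_vec_power2 real_norm_def power2_abs by (simp only: power2_eq_square)
      then have "complex_of_real ((norm z)\<^sup>2) = (\<Sum>k\<in>UNIV. of_real (z $ k) * of_real (z $ k))"
        by simp
      then have "of_real ((norm z)\<^sup>2) * ?W i j z = (\<Sum>k\<in>UNIV. of_real (z $ k) * (of_real (z $ k) * ?W i j z))"
        by (simp add: sum_distrib_right mult.assoc)
      also have "\<dots> = (\<Sum>k\<in>UNIV. of_real (z $ i * z $ j) * ?W k k z)"
      proof (intro sum.cong refl)
        fix k
        have "of_real (z $ k) * (of_real (z $ k) * ?W i j z) = of_real (z $ k) * (of_real (z $ i) * ?W k j z)"
          by (simp only: c)
        also have "\<dots> = of_real (z $ i) * (of_real (z $ k) * ?W j k z)"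
          by (simp only: sym[of k j] mult_ac)
        also have "of_real (z $ k) * ?W j k z = of_real (z $ j) * ?W k k z"
          by (rule c)
        finally show "of_real (z $ k) * (of_real (z $ k) * ?W i j z) = of_real (z $ i * z $ j) * ?W k k z"
          by simp
      qed
      finally show "of_real ((norm z)\<^sup>2) * ?W i j z = of_real (z $ i * z $ j) * (\<Sum>k\<in>UNIV. ?W k k z)"
        by (simp add: sum_distrib_left)
    qed
  qed
qed

lemma sum_triple:
  "(\<Sum>\<beta>\<in>UNIV. \<Sum>i\<in>UNIV. \<Sum>j\<in>UNIV. f \<beta> i j) = (\<Sum>p\<in>UNIV. f (fst p) (fst (snd p)) (snd (snd p)))"
  for f :: "'a::finite \<Rightarrow> 'b::finite \<Rightarrow> 'c::finite \<Rightarrow> 'd::comm_monoid_add"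
  by (simp add: sum.cartesian_product case_prod_unfold flip: UNIV_Times_UNIV)

lemma vec_comp_measurable:
  fixes H :: "real^'n \<Rightarrow> 'b::euclidean_space^'m"
  shows "H \<in> borel_measurable lebesgue \<Longrightarrow> (\<lambda>x. H x $ i) \<in> borel_measurable lebesgue"
  by (erule measurable_compose) (intro borel_measurable_continuous_onI continuous_intros)

lemma vec_comp_Lp:
  fixes H :: "real^'n \<Rightarrow> 'b::euclidean_space^'m"
  assumes "H \<in> Lp p" "p > 0"
  shows "(\<lambda>x. H x $ i) \<in> Lp p"
  using assms by (intro Lp_dominated[OF assms(2,1)] vec_comp_measurable Finite_Cartesian_Product.norm_nth_le) (simp add: Lp_def)

lemma contract2_component:
  "contract2 A H $ \<alpha> = (\<Sum>p\<in>UNIV. A $ \<alpha> $ fst p $ fst (snd p) $ snd (snd p) * H $ fst p $ fst (snd p) $ snd (snd p))"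
  unfolding contract2_def by (simp add: sum_triple)

lemma contract2_diff: "contract2 A (H - K) = contract2 A H - contract2 A K"
  by (simp add: vec_eq_iff contract2_component right_diff_distrib sum_subtractf)

lemma contract2_Lp2:
  fixes A :: "real^'n^'n^'N^'N"
  assumes "H \<in> Lp 2"
  shows "(\<lambda>x. contract2 A (H x) $ \<alpha>) \<in> Lp 2"
proof -
  have "(\<lambda>x. A $ \<alpha> $ \<beta> $ i $ j * H x $ \<beta> $ i $ j) \<in> Lp 2" for \<beta> i j
  proof (rule Lp2_dominated[OF vec_comp_Lp[OF vec_comp_Lp[OF vec_comp_Lp[OF assms]]]])
    show "(\<lambda>x. A $ \<alpha> $ \<beta> $ i $ j * H x $ \<beta> $ i $ j) \<in> borel_measurable lebesgue"
      using assms by (intro borel_measurable_times borel_measurable_const vec_comp_measurable) (simp add: Lp2_iff)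
    show "AE x in lebesgue. norm (A $ \<alpha> $ \<beta> $ i $ j * H x $ \<beta> $ i $ j) \<le> \<bar>A $ \<alpha> $ \<beta> $ i $ j\<bar> * norm (H x $ \<beta> $ i $ j)"
      by (simp add: abs_mult)
  qed simp_all
  then show ?thesis
    unfolding contract2_component by (intro Lp2_sum) blast
qed

text \<open>With the unit vector \<open>a = z / norm z\<close> the transformed Hessian is
  \<open>a_i a_j g \<alpha>\<close>, whose square sum is that of \<open>g\<close>, and its
  contraction with \<open>A\<close> is the symbol matrix applied to \<open>g\<close>. Ellipticity
  gives the estimate pointwise, and Plancherel integrates it. \<open>v1\<close> and \<open>H\<close>
  are arbitrary weak derivatives rather than chosen ones, so that differences of two solutions are
  covered.\<close>

lemma hessian_estimate:
  fixes A :: "real^'n^'n^'N^'N" and H :: "real^'n \<Rightarrow> real^'n^'n^'N"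
  assumes \<nu>: "ellipticity A > 0"
    and v1: "\<And>\<alpha> j. has_weak_partial j (v \<alpha>) (v1 \<alpha> j)"
    and H: "\<And>\<alpha> i j. has_weak_partial i (v1 \<alpha> j) (\<lambda>x. H x $ \<alpha> $ i $ j)"
    and L2: "H \<in> Lp 2"
  shows "Lp_norm 2 H \<le> 1 / ellipticity A * Lp_norm 2 (\<lambda>x. contract2 A (H x))"
proof -
  let ?\<nu> = "ellipticity A"
  define W where "W \<alpha> i j = F2 (\<lambda>x. complex_of_real (H x $ \<alpha> $ i $ j))" for \<alpha> i j
  define F where "F \<alpha> = F2 (\<lambda>x. complex_of_real (contract2 A (H x) $ \<alpha>))" for \<alpha>
  have h2: "(\<lambda>x. H x $ \<alpha> $ i $ j) \<in> Lp 2" for \<alpha> i j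
    by (intro vec_comp_Lp L2) auto
  have c2: "(\<lambda>x. contract2 A (H x) $ \<alpha>) \<in> Lp 2" for \<alpha>
    by (rule contract2_Lp2[OF L2])
  have W2: "W \<alpha> i j \<in> Lp 2" for \<alpha> i j unfolding W_def by (intro F2_Lp2 of_real_Lp2 h2)
  have F2': "F \<alpha> \<in> Lp 2" for \<alpha> unfolding F_def by (intro F2_Lp2 of_real_Lp2 c2)
  have Wn: "(LINT z|lebesgue. (norm (W \<alpha> i j z))\<^sup>2) = (LINT x|lebesgue. (H x $ \<alpha> $ i $ j)\<^sup>2)" for \<alpha> i j
    using F2_norm[OF of_real_Lp2[OF h2[of \<alpha> i j]]] unfolding W_def Lp_norm_2_of_real
    by (simp add: Lp_norm_2)
  have Fn: "(LINT z|lebesgue. (norm (F \<alpha> z))\<^sup>2) = (LINT x|lebesgue. (contract2 A (H x) $ \<alpha>)\<^sup>2)" for \<alpha>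
    using F2_norm[OF of_real_Lp2[OF c2[of \<alpha>]]] unfolding F_def Lp_norm_2_of_real
    by (simp add: Lp_norm_2)
  have Wi: "integrable lebesgue (\<lambda>z. (norm (W \<alpha> i j z))\<^sup>2)" for \<alpha> i j using W2 by (simp add: Lp2_iff)
  have Fi: "integrable lebesgue (\<lambda>z. (norm (F \<alpha> z))\<^sup>2)" for \<alpha> using F2' by (simp add: Lp2_iff)
  have hi: "integrable lebesgue (\<lambda>x. (H x $ \<alpha> $ i $ j)\<^sup>2)" for \<alpha> i j using h2[of \<alpha> i j] by (simp add: Lp2_iff)
  have ci: "integrable lebesgue (\<lambda>x. (contract2 A (H x) $ \<alpha>)\<^sup>2)" for \<alpha> using c2[of \<alpha>] by (simp add: Lp2_iff)
  have H_norm: "(Lp_norm 2 H)\<^sup>2 = (LINT z|lebesgue. (\<Sum>\<alpha>\<in>UNIV. \<Sum>i\<in>UNIV. \<Sum>j\<in>UNIV. (norm (W \<alpha> i j z))\<^sup>2))"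
    unfolding Lp_norm_2_power2 norm_vec_power2 real_norm_def power2_abs
    by (simp add: Wi hi Wn)
  have F_norm: "(Lp_norm 2 (\<lambda>x. contract2 A (H x)))\<^sup>2 = (LINT z|lebesgue. (\<Sum>\<alpha>\<in>UNIV. (norm (F \<alpha> z))\<^sup>2))"
    unfolding Lp_norm_2_power2 norm_vec_power2 real_norm_def power2_abs
    by (simp add: Fi ci Fn)
  have FW: "AE z in lebesgue. F \<alpha> z = (\<Sum>p\<in>UNIV. of_real (A $ \<alpha> $ fst p $ fst (snd p) $ snd (snd p)) * W (fst p) (fst (snd p)) (snd (snd p)) z)" for \<alpha>
  proof -
    let ?h = "\<lambda>p x. complex_of_real (A $ \<alpha> $ fst p $ fst (snd p) $ snd (snd p)) * of_real (H x $ fst p $ fst (snd p) $ snd (snd p))"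
    have eq: "(\<lambda>x. complex_of_real (contract2 A (H x) $ \<alpha>)) = (\<lambda>x. \<Sum>p\<in>UNIV. ?h p x)"
      unfolding contract2_component by simp
    have "AE z in lebesgue. F2 (\<lambda>x. \<Sum>p\<in>UNIV. ?h p x) z = (\<Sum>p\<in>UNIV. F2 (?h p) z)"
      by (intro F2_sum Lp2_scale of_real_Lp2 h2)
    moreover have "AE z in lebesgue. \<forall>p. F2 (?h p) z = of_real (A $ \<alpha> $ fst p $ fst (snd p) $ snd (snd p)) * W (fst p) (fst (snd p)) (snd (snd p)) z"
      unfolding AE_all_countable W_def by (intro allI F2_scale of_real_Lp2 h2)
    ultimately show ?thesis
      unfolding F_def eq by eventually_elim simp
  qed
  have Wsym: "AE z in lebesgue. \<forall>\<alpha> i j. of_real ((norm z)\<^sup>2) * W \<alpha> i j z = of_real (z $ i * z $ j) * (\<Sum>k\<in>UNIV. W \<alpha> k k z)"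
    unfolding W_def by (subst AE_all_countable) (intro allI hessian_fourier[OF v1 H h2])
  have FWall: "AE z in lebesgue. \<forall>\<alpha>. F \<alpha> z = (\<Sum>p\<in>UNIV. of_real (A $ \<alpha> $ fst p $ fst (snd p) $ snd (snd p)) * W (fst p) (fst (snd p)) (snd (snd p)) z)"
    unfolding AE_all_countable using FW by blast
  have nz: "AE z::real^'n in lebesgue. z \<noteq> 0"
    by (rule AE_completion) (rule AE_lborel_singleton)
  have pointwise: "AE z in lebesgue. ?\<nu>\<^sup>2 * (\<Sum>\<alpha>\<in>UNIV. \<Sum>i\<in>UNIV. \<Sum>j\<in>UNIV. (norm (W \<alpha> i j z))\<^sup>2) \<le> (\<Sum>\<alpha>\<in>UNIV. (norm (F \<alpha> z))\<^sup>2)"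
    using Wsym FWall nz
  proof eventually_elim
    case (elim z)
    let ?a = "z /\<^sub>R norm z"
    define g where "g \<alpha> = (\<Sum>k\<in>UNIV. W \<alpha> k k z)" for \<alpha>
    have W: "W \<alpha> i j z = of_real (?a $ i * ?a $ j) * g \<alpha>" for \<alpha> i j
    proof -
      have "of_real ((norm z)\<^sup>2) * W \<alpha> i j z = of_real (z $ i * z $ j) * g \<alpha>"
        using elim(1) by (simp add: g_def)
      then have "W \<alpha> i j z = of_real (z $ i * z $ j) * g \<alpha> / of_real ((norm z)\<^sup>2)"
        using elim(3) by (simp add: field_simps)
      then show ?thesis using elim(3) by (simp add: power2_eq_square field_simps)
    qed
    have a1: "norm ?a = 1" using elim(3) by simp
    have a2: "(\<Sum>i\<in>UNIV. (?a $ i)\<^sup>2) = 1"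
      using norm_vec_power2[of ?a] a1 by simp
    have "(\<Sum>i\<in>UNIV. \<Sum>j\<in>UNIV. (norm (W \<alpha> i j z))\<^sup>2) = (norm (g \<alpha>))\<^sup>2" for \<alpha>
    proof -
      have "(norm (W \<alpha> i j z))\<^sup>2 = (?a $ i)\<^sup>2 * ((?a $ j)\<^sup>2 * (norm (g \<alpha>))\<^sup>2)" for i j
        unfolding W norm_mult norm_of_real power_mult_distrib power2_abs by (simp only: mult.assoc)
      then have "(\<Sum>i\<in>UNIV. \<Sum>j\<in>UNIV. (norm (W \<alpha> i j z))\<^sup>2) = (\<Sum>i\<in>UNIV. (?a $ i)\<^sup>2) * ((\<Sum>j\<in>UNIV. (?a $ j)\<^sup>2) * (norm (g \<alpha>))\<^sup>2)"
        by (simp only: sum_distrib_left[symmetric] sum_distrib_right[symmetric])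
      then show ?thesis unfolding a2 by simp
    qed
    moreover have "F \<alpha> z = (\<Sum>\<beta>\<in>UNIV. of_real (symbol_matrix A ?a $ \<alpha> $ \<beta>) * g \<beta>)" for \<alpha>
    proof -
      have "F \<alpha> z = (\<Sum>\<beta>\<in>UNIV. \<Sum>i\<in>UNIV. \<Sum>j\<in>UNIV. of_real (A $ \<alpha> $ \<beta> $ i $ j) * W \<beta> i j z)"
        unfolding sum_triple using elim(2) by blast
      also have "\<dots> = (\<Sum>\<beta>\<in>UNIV. of_real (symbol_matrix A ?a $ \<alpha> $ \<beta>) * g \<beta>)"
        unfolding W symbol_matrix_def by (simp add: sum_distrib_right mult.assoc)
      finally show ?thesis .
    qed
    ultimately show ?case
      using ellipticity_lower_bound_complex[OF a1, of A g] \<nu> by simp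
  qed
  have "?\<nu>\<^sup>2 * (Lp_norm 2 H)\<^sup>2 \<le> (Lp_norm 2 (\<lambda>x. contract2 A (H x)))\<^sup>2"
    unfolding H_norm F_norm integral_mult_right_zero[symmetric]
    by (intro integral_mono_AE pointwise integrable_mult_right Bochner_Integration.integrable_sum Wi Fi)
  then have "(?\<nu> * Lp_norm 2 H)\<^sup>2 \<le> (Lp_norm 2 (\<lambda>x. contract2 A (H x)))\<^sup>2"
    by (simp add: power_mult_distrib)
  then have "?\<nu> * Lp_norm 2 H \<le> Lp_norm 2 (\<lambda>x. contract2 A (H x))"
    by (rule power2_le_imp_le) (rule Lp_norm_nonneg)
  then show ?thesis using \<nu> by (simp add: field_simps)
qed

section \<open>The estimate and uniqueness in the solution space\<close>

lemma W22_star_weak_partials: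
  fixes u :: "real^'n \<Rightarrow> real^'N"
  assumes "u \<in> W22_star"
  shows "has_weak_partial j (\<lambda>x. u x $ \<alpha>) (\<lambda>x. weak_grad u x $ \<alpha> $ j)"
    and "has_weak_partial i (\<lambda>x. weak_grad u x $ \<alpha> $ j) (\<lambda>x. weak_hess u x $ \<alpha> $ i $ j)"
    and "u \<in> Lp (crit_exp2 TYPE('n))" "weak_grad u \<in> Lp (crit_exp1 TYPE('n))" "weak_hess u \<in> Lp 2"
proof -
  have ex: "has_weak_partial j v (weak_partial j v)" if "weakly_differentiable v" for j and v :: "real^'n \<Rightarrow> real"
    using that has_weak_partial_weak_partial unfolding weakly_differentiable_def by blast
  show "has_weak_partial j (\<lambda>x. u x $ \<alpha>) (\<lambda>x. weak_grad u x $ \<alpha> $ j)"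
    using assms unfolding weak_grad_def by (simp add: W22_star_def ex)
  show "has_weak_partial i (\<lambda>x. weak_grad u x $ \<alpha> $ j) (\<lambda>x. weak_hess u x $ \<alpha> $ i $ j)"
    using assms unfolding weak_grad_def weak_hess_def by (simp add: W22_star_def ex)
  show "u \<in> Lp (crit_exp2 TYPE('n))" "weak_grad u \<in> Lp (crit_exp1 TYPE('n))" "weak_hess u \<in> Lp 2"
    using assms by (auto simp: W22_star_def)
qed

lemma has_weak_partial_diff:
  fixes v v' :: "real^'n \<Rightarrow> real"
  assumes "has_weak_partial j v w" "has_weak_partial j v' w'"
  shows "has_weak_partial j (\<lambda>x. v x - v' x) (\<lambda>x. w x - w' x)"
proof -
  have l: "locally_integrable v" "locally_integrable v'" "locally_integrable w" "locally_integrable w'"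
    using assms by (auto simp: has_weak_partial_def)
  have "(LINT x|lebesgue. (v x - v' x) * partial_deriv j \<phi> x) = - (LINT x|lebesgue. (w x - w' x) * \<phi> x)"
    if \<phi>: "test_function \<phi>" for \<phi>
    using assms \<phi> unfolding has_weak_partial_def
    by (simp add: left_diff_distrib test_mult_integrable l test_function_partial)
  then show ?thesis using l by (simp add: has_weak_partial_def locally_integrable_diff)
qed

lemma crit_exp_bounds:
  assumes "CARD('n::finite) \<ge> 5"
  shows "crit_exp1 TYPE('n) \<ge> 2" "crit_exp2 TYPE('n) \<ge> 2"
  using assms by (auto simp: crit_exp1_def crit_exp2_def field_simps)

lemma W22_star_estimate:
  fixes A :: "real^'n^'n^'N^'N"
  assumes "ellipticity A > 0" "u \<in> W22_star"
  shows "Lp_norm 2 (weak_hess u) \<le> 1 / ellipticity A * Lp_norm 2 (\<lambda>x. contract2 A (weak_hess u x))"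
  by (rule hessian_estimate[OF assms(1) W22_star_weak_partials(1,2,5)]) (rule assms(2))+

lemma W22_star_unique:
  fixes A :: "real^'n^'n^'N^'N" and u v :: "real^'n \<Rightarrow> real^'N"
  assumes n: "CARD('n) \<ge> 5" and \<nu>: "ellipticity A > 0" and u: "u \<in> W22_star" and v: "v \<in> W22_star"
    and eq: "AE x in lebesgue. contract2 A (weak_hess v x) = contract2 A (weak_hess u x)"
  shows "AE x in lebesgue. v x = u x"
proof -
  note U = W22_star_weak_partials[OF u] and V = W22_star_weak_partials[OF v]
  note c = crit_exp_bounds[OF n]
  \<comment> \<open>The difference of the chosen Hessians rather than the chosen Hessian of the
    difference; \<open>hessian_estimate\<close> accepts it as a weak derivative.\<close>
  define H where "H x = weak_hess v x - weak_hess u x" for x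
  have H2: "H \<in> Lp 2" unfolding H_def[abs_def] by (intro Lp2_diff U V)
  have d1: "has_weak_partial j (\<lambda>x. v x $ \<alpha> - u x $ \<alpha>) (\<lambda>x. weak_grad v x $ \<alpha> $ j - weak_grad u x $ \<alpha> $ j)" for \<alpha> j
    by (intro has_weak_partial_diff U V)
  have d2: "has_weak_partial i (\<lambda>x. weak_grad v x $ \<alpha> $ j - weak_grad u x $ \<alpha> $ j) (\<lambda>x. H x $ \<alpha> $ i $ j)" for \<alpha> i j
    unfolding H_def vector_minus_component by (intro has_weak_partial_diff U V)
  have z: "AE x in lebesgue. contract2 A (H x) = 0"
    using eq unfolding H_def contract2_diff by eventually_elim simp
  have "Lp_norm 2 (\<lambda>x. contract2 A (H x)) = 0"
  proof -
    have "(LINT x|lebesgue. (norm (contract2 A (H x)))\<^sup>2) = 0"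
      by (rule integral_eq_zero_AE) (use z in eventually_elim, simp)
    then show ?thesis by (simp add: Lp_norm_2)
  qed
  then have "Lp_norm 2 H \<le> 0"
    using hessian_estimate[OF \<nu> d1 d2 H2] by simp
  then have H0: "AE x in lebesgue. H x = 0"
    using Lp_norm_2_eq_0[OF H2] Lp_norm_nonneg[of 2 H] by simp
  \<comment> \<open>With integrability at infinity one vanishing partial derivative is enough.
    Below, the diagonal entry \<open>H x $ \<alpha> $ j $ j\<close> kills the gradient, and the
    gradient in an arbitrary direction, \<open>undefined\<close>, kills the difference
    itself.\<close>
  have vanish: "AE x in lebesgue. a x = 0"
    if a: "has_weak_partial i a b" "a \<in> Lp q" "q \<ge> 1" "AE x in lebesgue. b x = 0" for a b :: "real^'n \<Rightarrow> real" and q i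
  proof (rule AE_zero_if_partial_zero[OF _ a(2,3)])
    show "locally_integrable a" using a(1) by (simp add: has_weak_partial_def)
    fix \<phi> :: "real^'n \<Rightarrow> real" assume "product_test \<phi>"
    then have \<phi>: "test_function \<phi>" by (rule product_test_test_function)
    have "(LINT x|lebesgue. b x * \<phi> x) = 0"
      by (rule integral_eq_zero_AE) (use a(4) in eventually_elim, simp)
    then show "(LINT x|lebesgue. a x * partial_deriv i \<phi> x) = 0"
      using a(1) \<phi> unfolding has_weak_partial_def by auto
  qed
  have g0: "AE x in lebesgue. weak_grad v x $ \<alpha> $ j - weak_grad u x $ \<alpha> $ j = 0" for \<alpha> j
  proof (rule vanish[OF d2[of j]])
    show "(\<lambda>x. weak_grad v x $ \<alpha> $ j - weak_grad u x $ \<alpha> $ j) \<in> Lp (crit_exp1 TYPE('n))"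
      using c by (intro Lp_diff vec_comp_Lp U V) auto
    show "AE x in lebesgue. H x $ \<alpha> $ j $ j = 0" using H0 by eventually_elim simp
  qed (use c in simp)
  have "AE x in lebesgue. v x $ \<alpha> - u x $ \<alpha> = 0" for \<alpha>
  proof (rule vanish[OF d1])
    show "(\<lambda>x. v x $ \<alpha> - u x $ \<alpha>) \<in> Lp (crit_exp2 TYPE('n))"
      using c by (intro Lp_diff vec_comp_Lp U V) auto
    show "AE x in lebesgue. weak_grad v x $ \<alpha> $ undefined - weak_grad u x $ \<alpha> $ undefined = 0" by (rule g0)
  qed (use c in simp)
  then have "AE x in lebesgue. \<forall>\<alpha>. v x $ \<alpha> - u x $ \<alpha> = 0"
    unfolding AE_all_countable by blast
  then show ?thesis by eventually_elim (simp add: vec_eq_iff)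
qed

section \<open>The Fourier symbol of the solution\<close>

lemma vec_measurable:
  fixes f :: "'a \<Rightarrow> ('b::euclidean_space)^'n"
  assumes "\<And>i. (\<lambda>x. f x $ i) \<in> borel_measurable M"
  shows "f \<in> borel_measurable M"
proof (subst borel_measurable_euclidean_space, intro ballI)
  fix b :: "'b^'n" assume "b \<in> Basis"
  then obtain i u where b: "b = axis i u" by (auto simp: Basis_vec_def)
  show "(\<lambda>x. f x \<bullet> b) \<in> borel_measurable M"
    unfolding b inner_axis by (intro borel_measurable_inner assms borel_measurable_const)
qed

lemma of_real_measurable:
  assumes [measurable]: "f \<in> borel_measurable M"
  shows "(\<lambda>x. complex_of_real (f x)) \<in> borel_measurable M"
  by measurable

lemma det_measurable:
  fixes X :: "'a \<Rightarrow> real^'m^'m"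
  assumes "\<And>i j. (\<lambda>z. X z $ i $ j) \<in> borel_measurable M"
  shows "(\<lambda>z. det (X z)) \<in> borel_measurable M"
  unfolding det_def by (intro borel_measurable_sum borel_measurable_times borel_measurable_const borel_measurable_prod assms)

lemma cof_measurable:
  fixes X :: "'a \<Rightarrow> real^'m^'m"
  assumes "\<And>i j. (\<lambda>z. X z $ i $ j) \<in> borel_measurable M"
  shows "(\<lambda>z. cof (X z) $ k $ l) \<in> borel_measurable M"
  unfolding cof_def vec_lambda_beta
proof (rule det_measurable)
  fix i j
  show "(\<lambda>z. (\<chi> m. if m = k then axis l 1 else X z $ m) $ i $ j) \<in> borel_measurable M"
    using assms[of i j] by (cases "i = k") simp_all
qed

lemma symbol_matrix_measurable:
  fixes A :: "real^'n^'n^'N^'N"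
  shows "(\<lambda>z. symbol_matrix A (sgn z) $ i $ j) \<in> borel_measurable lebesgue"
proof -
  have "(\<lambda>z::real^'n. sgn z $ k) \<in> borel_measurable lebesgue" for k
    unfolding sgn_div_norm vector_scaleR_component
    by (intro borel_measurable_times vec_nth_measurable measurable_completion) measurable
  then show ?thesis
    unfolding symbol_matrix_def vec_lambda_beta
    by (intro borel_measurable_sum borel_measurable_times borel_measurable_const) auto
qed

section \<open>The inverse symbol applied to the data\<close>

definition data_freq :: "(real^'n \<Rightarrow> real^'N) \<Rightarrow> 'N \<Rightarrow> real^'n \<Rightarrow> complex" where
  "data_freq f \<beta> = I2 (\<lambda>x. of_real (f x $ \<beta>))"

lemma data_freq_Lp2: "f \<in> Lp 2 \<Longrightarrow> data_freq f \<beta> \<in> Lp 2"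
  unfolding data_freq_def by (intro I2_Lp2 of_real_Lp2 vec_comp_Lp) auto

lemma data_freq_norm:
  assumes "f \<in> Lp 2"
  shows "Lp_norm 2 (data_freq f \<beta>) \<le> Lp_norm 2 f"
proof -
  have c: "(\<lambda>x. f x $ \<beta>) \<in> Lp 2" using assms by (intro vec_comp_Lp) auto
  have "Lp_norm 2 (data_freq f \<beta>) = Lp_norm 2 (\<lambda>x. f x $ \<beta>)"
    unfolding data_freq_def I2_norm[OF of_real_Lp2[OF c]] Lp_norm_2_of_real ..
  also have "\<dots> \<le> 1 * Lp_norm 2 f"
    by (rule Lp2_norm_dominated[OF assms Lp2_measurable[OF c]])
      (auto intro: Finite_Cartesian_Product.norm_nth_le component_le_norm_cart)
  finally show ?thesis by simp
qed

lemma repr_symbol_component: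
  "repr_symbol A f z $ \<alpha> = (\<Sum>\<beta>\<in>UNIV. of_real (1 / det (symbol_matrix A (sgn z)) * cof (symbol_matrix A (sgn z)) $ \<beta> $ \<alpha>) * data_freq f \<beta> z)"
  unfolding repr_symbol_def Let_def matrix_vector_mult_def inv_fourier_L2_def data_freq_def cmat_def cvec_def transpose_def
  by simp

text \<open>The lower bound makes the matrix injective, hence invertible.\<close>

lemma symbol_matrix_det:
  fixes A :: "real^'n^'n^'N^'N"
  assumes \<nu>: "ellipticity A > 0" and a: "norm a = 1"
  shows "det (symbol_matrix A a) \<noteq> 0"
proof -
  let ?X = "symbol_matrix A a"
  have "x = y" if "?X *v x = ?X *v y" for x y
  proof -
    have "ellipticity A * norm (x - y) \<le> norm (?X *v (x - y))"
      by (rule ellipticity_lower_bound[OF a])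
    also have "\<dots> = 0" using that by (simp add: matrix_vector_mult_diff_distrib)
    finally show ?thesis using \<nu> by (simp add: mult_le_0_iff)
  qed
  then have "\<exists>B. B ** ?X = mat 1"
    unfolding matrix_left_invertible_injective inj_def by blast
  then have "invertible ?X" by (simp add: invertible_left_inverse)
  then show ?thesis by (simp add: invertible_det_nz)
qed

text \<open>By \<open>cof_identity\<close> divided by the determinant, the bracket of the
  representation formula is the inverse symbol applied to the data. At \<open>z = 0\<close> the
  symbol matrix is 0, since \<open>sgn 0 = 0\<close>, hence the exception.\<close>

lemma symbol_repr_symbol:
  fixes A :: "real^'n^'n^'N^'N"
  assumes \<nu>: "ellipticity A > 0" and z: "z \<noteq> 0"
  shows "(\<Sum>\<beta>\<in>UNIV. of_real (symbol_matrix A (sgn z) $ \<alpha> $ \<beta>) * repr_symbol A f z $ \<beta>) = data_freq f \<alpha> z"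
proof -
  let ?X = "symbol_matrix A (sgn z)"
  have d: "det ?X \<noteq> 0" by (rule symbol_matrix_det[OF \<nu>]) (simp add: norm_sgn z)
  have XY: "(\<Sum>\<beta>\<in>UNIV. ?X $ \<alpha> $ \<beta> * (1 / det ?X * cof ?X $ \<gamma> $ \<beta>)) = (if \<alpha> = \<gamma> then 1 else 0)" for \<gamma>
  proof -
    have "(?X ** transpose (cof ?X)) $ \<alpha> $ \<gamma> = mat (det ?X) $ \<alpha> $ \<gamma>" by (simp only: cof_identity)
    then have s: "(\<Sum>\<beta>\<in>UNIV. ?X $ \<alpha> $ \<beta> * cof ?X $ \<gamma> $ \<beta>) = (if \<alpha> = \<gamma> then det ?X else 0)"
      by (simp add: matrix_matrix_mult_def transpose_def mat_def)
    have "(\<Sum>\<beta>\<in>UNIV. ?X $ \<alpha> $ \<beta> * (1 / det ?X * cof ?X $ \<gamma> $ \<beta>)) = 1 / det ?X * (\<Sum>\<beta>\<in>UNIV. ?X $ \<alpha> $ \<beta> * cof ?X $ \<gamma> $ \<beta>)"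
      by (simp add: sum_distrib_left mult_ac)
    then show ?thesis unfolding s using d by simp
  qed
  have "(\<Sum>\<beta>\<in>UNIV. of_real (?X $ \<alpha> $ \<beta>) * repr_symbol A f z $ \<beta>)
     = (\<Sum>\<beta>\<in>UNIV. \<Sum>\<gamma>\<in>UNIV. of_real (?X $ \<alpha> $ \<beta> * (1 / det ?X * cof ?X $ \<gamma> $ \<beta>)) * data_freq f \<gamma> z)"
    unfolding repr_symbol_component sum_distrib_left by (simp only: of_real_mult mult.assoc)
  also have "\<dots> = (\<Sum>\<gamma>\<in>UNIV. \<Sum>\<beta>\<in>UNIV. of_real (?X $ \<alpha> $ \<beta> * (1 / det ?X * cof ?X $ \<gamma> $ \<beta>)) * data_freq f \<gamma> z)"
    by (rule sum.swap)
  also have "\<dots> = (\<Sum>\<gamma>\<in>UNIV. of_real (\<Sum>\<beta>\<in>UNIV. ?X $ \<alpha> $ \<beta> * (1 / det ?X * cof ?X $ \<gamma> $ \<beta>)) * data_freq f \<gamma> z)"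
    by (simp only: of_real_sum sum_distrib_right)
  also have "\<dots> = (\<Sum>\<gamma>\<in>UNIV. if \<alpha> = \<gamma> then data_freq f \<gamma> z else 0)"
    unfolding XY by (intro sum.cong) auto
  finally show ?thesis by simp
qed

lemma repr_symbol_measurable:
  fixes A :: "real^'n^'n^'N^'N"
  assumes "f \<in> Lp 2"
  shows "(\<lambda>z. repr_symbol A f z $ \<alpha>) \<in> borel_measurable lebesgue"
proof -
  have "(\<lambda>z. 1 / det (symbol_matrix A (sgn z)) * cof (symbol_matrix A (sgn z)) $ \<beta> $ \<alpha>) \<in> borel_measurable lebesgue" for \<beta>
    by (intro borel_measurable_times borel_measurable_divide borel_measurable_const det_measurable cof_measurable symbol_matrix_measurable)
  then have m: "(\<lambda>z. complex_of_real (1 / det (symbol_matrix A (sgn z)) * cof (symbol_matrix A (sgn z)) $ \<beta> $ \<alpha>)) \<in> borel_measurable lebesgue" for \<beta>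
    by (rule of_real_measurable)
  show ?thesis
    unfolding repr_symbol_component
    by (intro borel_measurable_sum borel_measurable_times m Lp2_measurable[OF data_freq_Lp2[OF assms]])
qed

text \<open>Rather than estimating cofactors, the ellipticity bound is applied to the vector
  \<open>repr_symbol A f z\<close>, whose image under the symbol is the data. The sum of norms on
  the right has the shape that \<open>Lp_sum_bound\<close> expects.\<close>

lemma repr_symbol_bound:
  fixes A :: "real^'n^'n^'N^'N"
  assumes \<nu>: "ellipticity A > 0" and z: "z \<noteq> 0"
  shows "norm (repr_symbol A f z $ \<alpha>) \<le> (\<Sum>\<beta>\<in>UNIV. norm (of_real (1 / ellipticity A) * data_freq f \<beta> z))"
proof -
  let ?\<nu> = "ellipticity A"
  have "?\<nu>\<^sup>2 * (\<Sum>\<beta>\<in>UNIV. (norm (repr_symbol A f z $ \<beta>))\<^sup>2) \<le> (\<Sum>\<alpha>\<in>UNIV. (norm (data_freq f \<alpha> z))\<^sup>2)"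
    using ellipticity_lower_bound_complex[of "sgn z" A "\<lambda>\<beta>. repr_symbol A f z $ \<beta>"] \<nu> z
    by (simp add: symbol_repr_symbol norm_sgn)
  moreover have "(norm (repr_symbol A f z $ \<alpha>))\<^sup>2 \<le> (\<Sum>\<beta>\<in>UNIV. (norm (repr_symbol A f z $ \<beta>))\<^sup>2)"
    by (rule member_le_sum) auto
  ultimately have "?\<nu>\<^sup>2 * (norm (repr_symbol A f z $ \<alpha>))\<^sup>2 \<le> (\<Sum>\<alpha>\<in>UNIV. (norm (data_freq f \<alpha> z))\<^sup>2)"
    by (meson mult_left_mono order_trans zero_le_power2)
  also have "\<dots> \<le> (\<Sum>\<alpha>\<in>UNIV. norm (data_freq f \<alpha> z))\<^sup>2"
    using L2_set_le_sum[of UNIV "\<lambda>\<alpha>. norm (data_freq f \<alpha> z)"] unfolding L2_set_def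
    by (metis (no_types, lifting) norm_ge_zero real_sqrt_le_iff real_sqrt_abs2 abs_of_nonneg power2_eq_square sum_nonneg real_sqrt_abs)
  finally have "(?\<nu> * norm (repr_symbol A f z $ \<alpha>))\<^sup>2 \<le> (\<Sum>\<alpha>\<in>UNIV. norm (data_freq f \<alpha> z))\<^sup>2"
    by (simp add: power_mult_distrib)
  then have "?\<nu> * norm (repr_symbol A f z $ \<alpha>) \<le> (\<Sum>\<alpha>\<in>UNIV. norm (data_freq f \<alpha> z))"
    by (rule power2_le_imp_le) (simp add: sum_nonneg)
  then have "norm (repr_symbol A f z $ \<alpha>) \<le> 1 / ?\<nu> * (\<Sum>\<alpha>\<in>UNIV. norm (data_freq f \<alpha> z))"
    using \<nu> by (simp add: field_simps)
  also have "\<dots> = (\<Sum>\<beta>\<in>UNIV. norm (of_real (1 / ?\<nu>) * data_freq f \<beta> z))"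
    using \<nu> by (simp add: norm_mult norm_divide sum_distrib_left sum_divide_distrib)
  finally show ?thesis .
qed

lemma AE_nonzero: "AE z::'a::euclidean_space in lebesgue. z \<noteq> 0"
  by (rule AE_completion) (rule AE_lborel_singleton)

text \<open>The constant of \<open>Lp_sum_bound\<close> for \<open>p = 2\<close> and
  \<open>CARD('N)\<close> summands, times the bound for the inverse symbol.\<close>

definition symbol_constant :: "real^'n^'n^'N^'N \<Rightarrow> real" where
  "symbol_constant A = real CARD('N) * real CARD('N) powr (1 / 2) * (1 / ellipticity A)"

lemma repr_symbol_Lp2:
  fixes A :: "real^'n^'n^'N^'N"
  assumes \<nu>: "ellipticity A > 0" and f: "f \<in> Lp 2"
  shows "(\<lambda>z. repr_symbol A f z $ \<alpha>) \<in> Lp 2"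
    and "Lp_norm 2 (\<lambda>z. repr_symbol A f z $ \<alpha>) \<le> symbol_constant A * Lp_norm 2 f"
proof -
  let ?h = "\<lambda>\<beta> z. of_real (1 / ellipticity A) * data_freq f \<beta> z"
  have h: "?h \<beta> \<in> Lp 2" for \<beta> by (intro Lp2_scale data_freq_Lp2 f)
  have hn: "Lp_norm 2 (?h \<beta>) \<le> 1 / ellipticity A * Lp_norm 2 f" for \<beta>
  proof -
    have "Lp_norm 2 (?h \<beta>) \<le> 1 / ellipticity A * Lp_norm 2 (data_freq f \<beta>)"
      using \<nu> by (intro Lp2_norm_dominated[OF data_freq_Lp2[OF f] Lp2_measurable[OF h]])
        (auto simp: norm_mult norm_divide)
    also have "\<dots> \<le> 1 / ellipticity A * Lp_norm 2 f"
      using \<nu> by (intro mult_left_mono data_freq_norm f) auto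
    finally show ?thesis .
  qed
  have le: "AE z in lebesgue. norm (repr_symbol A f z $ \<alpha>) \<le> (\<Sum>\<beta>\<in>UNIV. norm (?h \<beta> z))"
    using AE_nonzero by eventually_elim (rule repr_symbol_bound[OF \<nu>])
  note b = Lp_sum_bound[of "UNIV :: 'N set" 2 ?h, OF finite_class.finite_UNIV _ h repr_symbol_measurable[OF f] le]
  show "(\<lambda>z. repr_symbol A f z $ \<alpha>) \<in> Lp 2" by (rule b(1)) simp
  have "Lp_norm 2 (\<lambda>z. repr_symbol A f z $ \<alpha>) \<le> real CARD('N) * real CARD('N) powr (1 / 2) * (1 / ellipticity A * Lp_norm 2 f)"
    by (rule b(2)) (use hn \<nu> Lp_norm_nonneg[of 2 f] in auto)
  then show "Lp_norm 2 (\<lambda>z. repr_symbol A f z $ \<alpha>) \<le> symbol_constant A * Lp_norm 2 f"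
    by (simp add: symbol_constant_def mult.assoc)
qed

subsection \<open>The convolution formula\<close>

lemma integrable_inverse_1_plus_square_lborel: "integrable lborel (\<lambda>x::real. inverse (1 + x\<^sup>2))"
  using integrable_inverse_1_plus_square
  by (simp add: set_integrable_def einterval_def)

lemma schwartz_bounds:
  fixes h :: "real^'n \<Rightarrow> real"
  assumes "schwartz h"
  obtains B where "\<And>x. norm x ^ k * \<bar>h x\<bar> \<le> B"
proof -
  have "bounded (range (\<lambda>x. norm x ^ k * h x))"
    using assms unfolding schwartz_def by (metis foldr_Nil id_apply)
  then obtain B where "\<forall>x. norm (norm x ^ k * h x) \<le> B"
    unfolding bounded_iff by auto
  then show ?thesis by (intro that[of B]) (simp add: abs_mult)
qed

lemma schwartz_continuous: "schwartz h \<Longrightarrow> continuous_on S h"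
  unfolding schwartz_def smooth_def
  by (metis differentiable_imp_continuous_within continuous_at_imp_continuous_on foldr_Nil id_apply)

text \<open>The majorant is a product over the coordinates, so that its integrability reduces to
  \<open>1 / (1 + t^2)\<close> on the line. It is reached from decay of order
  \<open>2 * CARD('n)\<close> by \<open>(1 + r)^n \<le> 2^n * (1 + r^n)\<close> for
  \<open>r = (norm x)^2\<close>.\<close>

lemma schwartz_Lp:
  fixes h :: "real^'n \<Rightarrow> real"
  assumes h: "schwartz h"
  shows "(\<lambda>x. complex_of_real (h x)) \<in> Lp 1 \<inter> Lp 2"
proof -
  let ?n = "CARD('n)"
  obtain B0 where B0: "\<And>x. \<bar>h x\<bar> \<le> B0" using schwartz_bounds[OF h, of 0] by auto
  obtain B where B: "\<And>x. norm x ^ (2 * ?n) * \<bar>h x\<bar> \<le> B" using schwartz_bounds[OF h] by blast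
  let ?w = "\<lambda>x::real^'n. \<Prod>i\<in>UNIV. inverse (1 + (x $ i)\<^sup>2)"
  let ?C = "2 ^ ?n * (B0 + B)"
  have hm: "(\<lambda>x. complex_of_real (h x)) \<in> borel_measurable lebesgue"
    by (intro continuous_lebesgue_measurable continuous_intros schwartz_continuous h)
  have le: "\<bar>h x\<bar> \<le> ?C * ?w x" for x
  proof -
    let ?r = "(norm x)\<^sup>2"
    have "(\<Prod>i\<in>UNIV. 1 + (x $ i)\<^sup>2) \<le> (\<Prod>i\<in>(UNIV :: 'n set). 1 + ?r)"
    proof (intro prod_mono conjI)
      fix i
      have "(x $ i)\<^sup>2 \<le> ?r"
        using power_mono[OF component_le_norm_cart[of x i] abs_ge_zero, of 2] by simp
      then show "1 + (x $ i)\<^sup>2 \<le> 1 + ?r" by simp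
      show "0 \<le> 1 + (x $ i)\<^sup>2" by simp
    qed
    also have "\<dots> = (1 + ?r) ^ ?n" by simp
    also have "\<dots> \<le> (2 * max 1 ?r) ^ ?n" by (intro power_mono) auto
    also have "\<dots> = 2 ^ ?n * (max 1 ?r) ^ ?n" by (rule power_mult_distrib)
    also have "\<dots> \<le> 2 ^ ?n * (1 + ?r ^ ?n)"
      by (intro mult_left_mono) (auto simp: max_def)
    finally have "(\<Prod>i\<in>UNIV. 1 + (x $ i)\<^sup>2) * \<bar>h x\<bar> \<le> 2 ^ ?n * (1 + ?r ^ ?n) * \<bar>h x\<bar>"
      by (rule mult_right_mono) simp
    also have "\<dots> = 2 ^ ?n * (\<bar>h x\<bar> + norm x ^ (2 * ?n) * \<bar>h x\<bar>)"
      by (simp add: algebra_simps flip: power_mult)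
    also have "\<dots> \<le> ?C" by (intro mult_left_mono add_mono B0 B) auto
    finally have *: "(\<Prod>i\<in>UNIV. 1 + (x $ i)\<^sup>2) * \<bar>h x\<bar> \<le> ?C" .
    have pos: "(\<Prod>i\<in>UNIV. 1 + (x $ i)\<^sup>2) > 0" by (intro prod_pos) (auto intro: add_pos_nonneg)
    have w: "?w x = inverse (\<Prod>i\<in>UNIV. 1 + (x $ i)\<^sup>2)"
      using prod_inversef[of "\<lambda>i. 1 + (x $ i)\<^sup>2" UNIV] unfolding comp_def .
    have div: "a \<le> c * inverse q" if "q * a \<le> c" "q > 0" for a c q :: real
      using that by (simp add: field_simps)
    show ?thesis unfolding w by (rule div[OF * pos])
  qed
  have wi: "integrable lebesgue ?w"
    by (intro lebesgue_product_integral integrable_inverse_1_plus_square_lborel)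
  have hi: "integrable lebesgue (\<lambda>x. complex_of_real (h x))"
  proof (rule Bochner_Integration.integrable_bound[OF integrable_mult_right[OF wi, of ?C] hm])
    show "AE x in lebesgue. norm (complex_of_real (h x)) \<le> norm (?C * ?w x)"
      unfolding norm_of_real real_norm_def by (intro AE_I2 order.trans[OF le abs_ge_self])
  qed
  have "integrable lebesgue (\<lambda>x. (norm (complex_of_real (h x)))\<^sup>2)"
  proof (rule Bochner_Integration.integrable_bound)
    show "integrable lebesgue (\<lambda>x. B0 * norm (complex_of_real (h x)))"
      by (intro integrable_mult_right integrable_norm hi)
    show "(\<lambda>x. (norm (complex_of_real (h x)))\<^sup>2) \<in> borel_measurable lebesgue"
      by (intro borel_measurable_power measurable_compose[OF hm borel_measurable_norm])
    have "(norm (complex_of_real (h x)))\<^sup>2 \<le> B0 * norm (complex_of_real (h x))" for x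
      using mult_right_mono[OF B0[of x] abs_ge_zero[of "h x"]] by (simp add: power2_eq_square)
    then show "AE x in lebesgue. norm ((norm (complex_of_real (h x)))\<^sup>2) \<le> norm (B0 * norm (complex_of_real (h x)))"
      unfolding real_norm_def abs_power2 by (intro AE_I2 order.trans[OF _ abs_ge_self])
  qed
  then show ?thesis using hi hm by (simp add: Lp1_iff Lp2_iff)
qed

text \<open>As a function of \<open>y\<close>, the kernel at \<open>x - y\<close> is the inverse
  transform of \<open>h\<close> times a character. \<open>F2_multiplication\<close> moves the
  transform from \<open>G\<close> to this kernel, where it cancels, and the remaining integral is a
  forward transform at \<open>x\<close>.\<close>

lemma convolution_formula:
  fixes h :: "real^'n \<Rightarrow> real" and G :: "real^'n \<Rightarrow> complex"
  assumes h: "schwartz h" and G: "G \<in> Lp 2"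
  shows "(LINT y|lebesgue. fourier_L1 (\<lambda>x. of_real (h x)) (x - y) * F2 G y)
    = fourier_L1 (\<lambda>z. of_real (h z) * G z) x"
proof -
  let ?h = "\<lambda>x. complex_of_real (h x)"
  let ?k = "\<lambda>z. ?h z * wave x z"
  note h12 = schwartz_Lp[OF h]
  have k1: "?k \<in> Lp 1" using h12 integrable_wave(2)[of ?h x] by (simp add: Lp1_iff)
  have k2: "?k \<in> Lp 2"
  proof (rule Lp2_dominated[where B = 1])
    show "?h \<in> Lp 2" using h12 by simp
    show "?k \<in> borel_measurable lebesgue" using k1 by (auto simp: Lp1_iff)
  qed (simp add: norm_mult)
  then have k: "?k \<in> Lp 1 \<inter> Lp 2" using k1 by simp
  have b: "fourier_L1 ?h (x - y) = inv_fourier_L1 ?k y" for y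
    unfolding fourier_L1_wave inv_fourier_L1_wave
    by (simp add: wave_commute[of _ "x - y"] mult.assoc flip: wave_add_left)
  note bI = inv_fourier_L1_contraction(1)[OF k]
  have "(LINT y|lebesgue. inv_fourier_L1 ?k y * F2 G y) = (LINT y|lebesgue. F2 (inv_fourier_L1 ?k) y * G y)"
    by (rule F2_multiplication[symmetric, OF bI G])
  also have "\<dots> = (LINT y|lebesgue. ?k y * G y)"
  proof (rule integral_times_cong_AE(2))
    have "AE y in lebesgue. F2 (inv_fourier_L1 ?k) y = F2 (I2 ?k) y"
      by (intro F2_cong bI I2_Lp2 k2 AE_symmetric[OF I2_eq[OF k]])
    then show "AE y in lebesgue. F2 (inv_fourier_L1 ?k) y = ?k y"
      using F2_I2[OF k2] by eventually_elim simp
  qed (intro Lp2_measurable F2_Lp2 bI k2 G)+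
  also have "\<dots> = fourier_L1 (\<lambda>z. ?h z * G z) x"
    unfolding fourier_L1_wave by (simp add: wave_commute[of x] mult_ac)
  finally show ?thesis unfolding b .
qed

lemma approx_solution_component:
  fixes A :: "real^'n^'n^'N^'N"
  assumes \<nu>: "ellipticity A > 0" and f: "f \<in> Lp 2" and h: "schwartz h"
  shows "approx_solution A f h x $ \<alpha>
    = fourier_L1 (\<lambda>z. of_real (- 1 / (4 * pi\<^sup>2) * h z) * repr_symbol A f z $ \<alpha>) x"
proof -
  have "approx_solution A f h x $ \<alpha> = of_real (- 1 / (4 * pi\<^sup>2)) * fourier_L1 (\<lambda>z. of_real (h z) * repr_symbol A f z $ \<alpha>) x"
  proof -
    have "approx_solution A f h x $ \<alpha> = (- 1 / (4 * pi\<^sup>2)) *\<^sub>R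
        (LINT y|lebesgue. fourier_L1 (\<lambda>y. of_real (h y)) (x - y) * F2 (\<lambda>z. repr_symbol A f z $ \<alpha>) y)"
      unfolding approx_solution_def Defs.convolution_def fourier_L2_def vector_scaleR_component vec_lambda_beta ..
    then show ?thesis
      unfolding convolution_formula[OF h repr_symbol_Lp2(1)[OF \<nu> f]] scaleR_conv_of_real .
  qed
  also have "\<dots> = fourier_L1 (\<lambda>z. of_real (- 1 / (4 * pi\<^sup>2) * h z) * repr_symbol A f z $ \<alpha>) x"
    unfolding fourier_L1_scale[symmetric] of_real_mult mult.assoc ..
  finally show ?thesis .
qed

section \<open>Convergence in Lp\<close>

lemma Lp_cong_AE:
  assumes "p > 0" "w \<in> Lp p" "v \<in> borel_measurable lebesgue" "AE x in lebesgue. v x = w x"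
  shows "v \<in> Lp p"
  by (rule Lp_sum_bound(1)[of "{()}" p "\<lambda>_. w"]) (use assms in auto)

lemma Lp_norm_cong_AE:
  assumes "v \<in> borel_measurable lebesgue" "w \<in> borel_measurable lebesgue" "AE x in lebesgue. v x = w x"
  shows "Lp_norm p v = Lp_norm p w"
proof -
  note [measurable] = assms(1,2)
  have "(LINT x|lebesgue. norm (v x) powr p) = (LINT x|lebesgue. norm (w x) powr p)"
  proof (rule integral_cong_AE)
    show "AE x in lebesgue. norm (v x) powr p = norm (w x) powr p"
      using assms(3) by eventually_elim simp
  qed measurable
  then show ?thesis by (simp add: Lp_norm_def)
qed

lemma Lp_bounded_linear:
  fixes U :: "real^'n \<Rightarrow> complex"
  assumes P: "bounded_linear (P :: complex \<Rightarrow> real)" and p: "p > 0" and U: "U \<in> Lp p"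
  shows "(\<lambda>x. P (U x)) \<in> Lp p"
proof -
  obtain K where K: "\<And>c. norm (P c) \<le> norm c * K" "K > 0"
    using bounded_linear.pos_bounded[OF P] by blast
  obtain k where k: "K \<le> real k" using real_arch_simple by blast
  have m: "P \<in> borel_measurable borel"
    by (intro borel_measurable_continuous_onI linear_continuous_on P)
  show ?thesis
  \<comment> \<open>The operator bound is rounded up to an integer \<open>k\<close> and written as a
    sum of \<open>k\<close> copies of \<open>norm (U x)\<close>.\<close>
  proof (rule Lp_sum_bound(1)[of "{..<k}" p "\<lambda>_. U"])
    show "(\<lambda>x. P (U x)) \<in> borel_measurable lebesgue"
    proof -
      have "U \<in> borel_measurable lebesgue" using U by (simp add: Lp_def)
      then show ?thesis by (rule measurable_compose[OF _ m])
    qed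
    have "norm (P (U x)) \<le> real k * norm (U x)" for x
      using K(1)[of "U x"] mult_left_mono[OF k norm_ge_zero[of "U x"]] by (simp add: mult.commute)
    then show "AE x in lebesgue. norm (P (U x)) \<le> (\<Sum>i<k. norm (U x))" by simp
  qed (use p U in auto)
qed

lemma Lp_norm_nonexpansive:
  fixes U :: "real^'n \<Rightarrow> complex" and P :: "complex \<Rightarrow> real"
  assumes p: "p > 0" and U: "U \<in> Lp p" and PU: "(\<lambda>x. P (U x)) \<in> Lp p" and P: "\<And>c. \<bar>P c\<bar> \<le> norm c"
  shows "Lp_norm p (\<lambda>x. P (U x)) \<le> Lp_norm p U"
proof -
  have "Lp_norm p (\<lambda>x. P (U x)) \<le> real (card {()}) * real (card {()}) powr (1 / p) * Lp_norm p U"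
    by (rule Lp_sum_bound(2)[of "{()}" p "\<lambda>_. U"]) (use assms Lp_norm_nonneg in \<open>auto simp: Lp_def\<close>)
  then show ?thesis by simp
qed

section \<open>From norm convergence to weak and almost everywhere convergence\<close>

lemma Lp_norm_tendsto_integral:
  assumes p: "p > 0" and lim: "(\<lambda>m. Lp_norm p (D m)) \<longlonglongrightarrow> 0"
  shows "(\<lambda>m. LINT x|lebesgue. norm (D m x) powr p) \<longlonglongrightarrow> 0"
proof -
  have "(LINT x|lebesgue. norm (D m x) powr p) = Lp_norm p (D m) powr p" for m
    using p unfolding Lp_norm_def by (simp add: powr_powr Bochner_Integration.integral_nonneg)
  moreover have "(\<lambda>m. Lp_norm p (D m) powr p) \<longlonglongrightarrow> 0"
    by (rule tendsto_zero_powrI[OF lim tendsto_const _ p]) (simp add: Lp_norm_nonneg)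
  ultimately show ?thesis by simp
qed

text \<open>Young's inequality for \<open>norm (a x) / l\<close> and \<open>l * norm (b x)\<close>.
  The free scale \<open>l\<close> weighs the two integrals against each other and replaces the
  normalization in Hoelder's inequality.\<close>

lemma Lp_dual_integrable:
  fixes a b :: "real^'n \<Rightarrow> complex"
  assumes p: "p > 1" and a: "a \<in> Lp p" and b: "b \<in> Lp (p / (p - 1))"
  shows "integrable lebesgue (\<lambda>x. a x * b x)"
    and "l > 0 \<Longrightarrow> norm (LINT x|lebesgue. a x * b x)
      \<le> l powr (- p) * (LINT x|lebesgue. norm (a x) powr p) + l powr (p / (p - 1)) * (LINT x|lebesgue. norm (b x) powr (p / (p - 1)))"
proof -
  let ?q = "p / (p - 1)"
  have q: "?q > 1" "1 / p + 1 / ?q = 1" using p by (auto simp: field_simps)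
  have ai: "integrable lebesgue (\<lambda>x. norm (a x) powr p)" and bi: "integrable lebesgue (\<lambda>x. norm (b x) powr ?q)"
    using a b by (auto simp: Lp_def)
  have le: "norm (a x * b x) \<le> l powr (- p) * norm (a x) powr p + l powr ?q * norm (b x) powr ?q" if l: "l > 0" for l x
  proof -
    have "norm (a x * b x) = (norm (a x) / l) * (l * norm (b x))" using l by (simp add: norm_mult)
    also have "\<dots> \<le> (norm (a x) / l) powr p / p + (l * norm (b x)) powr ?q / ?q"
      using l by (intro Youngs_inequality p q) auto
    also have "\<dots> \<le> (norm (a x) / l) powr p + (l * norm (b x)) powr ?q"
    proof -
      have div: "y / c \<le> y" if "y \<ge> 0" "c > 1" for y c :: real
        using that by (simp add: divide_le_eq mult_le_cancel_left1)
      show ?thesis by (rule add_mono; rule div) (simp_all only: powr_ge_zero p q)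
    qed
    also have "\<dots> = l powr (- p) * norm (a x) powr p + l powr ?q * norm (b x) powr ?q"
      using l by (simp add: powr_divide powr_mult powr_minus field_simps)
    finally show ?thesis .
  qed
  have int: "integrable lebesgue (\<lambda>x. l powr (- p) * norm (a x) powr p + l powr ?q * norm (b x) powr ?q)" for l
    by (intro Bochner_Integration.integrable_add integrable_mult_right ai bi)
  show abi: "integrable lebesgue (\<lambda>x. a x * b x)"
  proof (rule Bochner_Integration.integrable_bound[OF int[of 1]])
    show "(\<lambda>x. a x * b x) \<in> borel_measurable lebesgue"
      using a b by (intro borel_measurable_times) (auto simp: Lp_def)
    show "AE x in lebesgue. norm (a x * b x) \<le> norm (1 powr (- p) * norm (a x) powr p + 1 powr ?q * norm (b x) powr ?q)"
      unfolding real_norm_def by (intro AE_I2 order.trans[OF le abs_ge_self]) simp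
  qed
  assume l: "l > 0"
  have "norm (LINT x|lebesgue. a x * b x) \<le> (LINT x|lebesgue. norm (a x * b x))"
    by (rule integral_norm_bound)
  also have "\<dots> \<le> (LINT x|lebesgue. l powr (- p) * norm (a x) powr p + l powr ?q * norm (b x) powr ?q)"
    by (intro integral_mono integrable_norm abi int le l)
  also have "\<dots> = l powr (- p) * (LINT x|lebesgue. norm (a x) powr p) + l powr ?q * (LINT x|lebesgue. norm (b x) powr ?q)"
    by (subst Bochner_Integration.integral_add) (auto intro!: integrable_mult_right ai bi)
  finally show "norm (LINT x|lebesgue. a x * b x)
      \<le> l powr (- p) * (LINT x|lebesgue. norm (a x) powr p) + l powr ?q * (LINT x|lebesgue. norm (b x) powr ?q)" .
qed

lemma Lp_strong_imp_weak:
  fixes D :: "nat \<Rightarrow> real^'n \<Rightarrow> complex"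
  assumes p: "p > 1" and D: "\<And>m. D m \<in> Lp p" and b: "b \<in> Lp (p / (p - 1))"
    and lim: "(\<lambda>m. Lp_norm p (D m)) \<longlonglongrightarrow> 0"
  shows "(\<lambda>m. LINT x|lebesgue. D m x * b x) \<longlonglongrightarrow> 0"
proof (rule LIMSEQ_I)
  fix e :: real assume e: "e > 0"
  let ?q = "p / (p - 1)"
  have q: "?q > 0" using p by simp
  define B where "B = (LINT x|lebesgue. norm (b x) powr ?q)"
  have B: "B \<ge> 0" unfolding B_def by (rule Bochner_Integration.integral_nonneg) simp
  \<comment> \<open>Solves \<open>l powr ?q = e / (2 * (B + 1))\<close>, which leaves less than
    \<open>e / 2\<close> for the second term; the summand 1 admits \<open>B = 0\<close>.\<close>
  define l where "l = (e / (2 * (B + 1))) powr (1 / ?q)"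
  have l: "l > 0" unfolding l_def using e B by (simp add: add_nonneg_pos)
  have "l powr ?q = e / (2 * (B + 1))" unfolding l_def using e B p by (simp add: powr_powr)
  then have "l powr ?q * B = e / 2 * (B / (B + 1))" using B by simp
  also have "\<dots> < e / 2 * 1" using e B by (intro mult_strict_left_mono) auto
  finally have lB: "l powr ?q * B < e / 2" by simp
  have "(\<lambda>m. l powr (- p) * (LINT x|lebesgue. norm (D m x) powr p)) \<longlonglongrightarrow> l powr (- p) * 0"
    using p by (intro tendsto_mult tendsto_const Lp_norm_tendsto_integral lim) simp
  then have "\<forall>\<^sub>F m in sequentially. l powr (- p) * (LINT x|lebesgue. norm (D m x) powr p) < e / 2"
    using e by (intro order_tendstoD(2)) auto
  then obtain N where N: "\<And>m. m \<ge> N \<Longrightarrow> l powr (- p) * (LINT x|lebesgue. norm (D m x) powr p) < e / 2"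
    unfolding eventually_sequentially by blast
  have "norm ((LINT x|lebesgue. D m x * b x) - 0) < e" if "m \<ge> N" for m
    using Lp_dual_integrable(2)[OF p D b l, of m, folded B_def] N[OF that] lB by simp
  then show "\<exists>N. \<forall>m\<ge>N. norm ((LINT x|lebesgue. D m x * b x) - 0) < e" by blast
qed

text \<open>Componentwise norm convergence gives both modes. For the second, the sum of the
  \<open>p\<close>-th powers tends to 0 in L1 along any given subsequence, and a sequence tending to
  0 in L1 has a subsequence that does so almost everywhere.\<close>

lemma Lp_limit_weak_and_ae:
  fixes V :: "nat \<Rightarrow> real^'n \<Rightarrow> complex^'N" and v :: "real^'n \<Rightarrow> complex^'N"
  assumes p: "p > 1" and V: "\<And>m. V m \<in> Lp p" and v: "v \<in> Lp p"
    and D: "\<And>m \<alpha>. (\<lambda>x. V m x $ \<alpha> - v x $ \<alpha>) \<in> Lp p"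
    and lim: "\<And>\<alpha>. (\<lambda>m. Lp_norm p (\<lambda>x. V m x $ \<alpha> - v x $ \<alpha>)) \<longlonglongrightarrow> 0"
  shows "weakly_converges_Lp p V v" and "ae_converges_subseq V v"
proof -
  have p0: "p > 0" using p by simp
  show "weakly_converges_Lp p V v"
    unfolding weakly_converges_Lp_def
  proof (intro conjI ballI allI V v)
    fix \<phi> :: "real^'n \<Rightarrow> complex^'N" assume \<phi>: "\<phi> \<in> Lp (p / (p - 1))"
    have c: "(\<lambda>x. \<phi> x $ \<alpha>) \<in> Lp (p / (p - 1))" for \<alpha> using p by (intro vec_comp_Lp \<phi>) auto
    have iV: "integrable lebesgue (\<lambda>x. V m x $ \<alpha> * \<phi> x $ \<alpha>)" for m \<alpha>
      by (rule Lp_dual_integrable(1)[OF p vec_comp_Lp[OF V p0] c])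
    have iv: "integrable lebesgue (\<lambda>x. v x $ \<alpha> * \<phi> x $ \<alpha>)" for \<alpha>
      by (rule Lp_dual_integrable(1)[OF p vec_comp_Lp[OF v p0] c])
    have "(\<lambda>m. LINT x|lebesgue. V m x $ \<alpha> * \<phi> x $ \<alpha>) \<longlonglongrightarrow> (LINT x|lebesgue. v x $ \<alpha> * \<phi> x $ \<alpha>)" for \<alpha>
    proof -
      have "(\<lambda>m. LINT x|lebesgue. (V m x $ \<alpha> - v x $ \<alpha>) * \<phi> x $ \<alpha>) \<longlonglongrightarrow> 0"
        by (rule Lp_strong_imp_weak[OF p D c lim])
      then have "(\<lambda>m. (LINT x|lebesgue. V m x $ \<alpha> * \<phi> x $ \<alpha>) - (LINT x|lebesgue. v x $ \<alpha> * \<phi> x $ \<alpha>)) \<longlonglongrightarrow> 0"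
        unfolding left_diff_distrib Bochner_Integration.integral_diff[OF iV iv] .
      then show ?thesis by (rule LIM_zero_cancel)
    qed
    then have "(\<lambda>m. \<Sum>\<alpha>\<in>UNIV. LINT x|lebesgue. V m x $ \<alpha> * \<phi> x $ \<alpha>) \<longlonglongrightarrow> (\<Sum>\<alpha>\<in>UNIV. LINT x|lebesgue. v x $ \<alpha> * \<phi> x $ \<alpha>)"
      by (intro tendsto_sum)
    then show "(\<lambda>m. LINT x|lebesgue. (\<Sum>\<alpha>\<in>UNIV. V m x $ \<alpha> * \<phi> x $ \<alpha>)) \<longlonglongrightarrow> (LINT x|lebesgue. (\<Sum>\<alpha>\<in>UNIV. v x $ \<alpha> * \<phi> x $ \<alpha>))"
      by (simp add: Bochner_Integration.integral_sum[OF iV] Bochner_Integration.integral_sum[OF iv])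
  qed
  show "ae_converges_subseq V v"
    unfolding ae_converges_subseq_def
  proof (intro allI impI)
    fix r :: "nat \<Rightarrow> nat" assume r: "strict_mono r"
    let ?w = "\<lambda>m x. \<Sum>\<alpha>\<in>UNIV. norm (V (r m) x $ \<alpha> - v x $ \<alpha>) powr p"
    have i: "integrable lebesgue (\<lambda>x. norm (V m x $ \<alpha> - v x $ \<alpha>) powr p)" for m \<alpha>
      using D[of m \<alpha>] by (simp add: Lp_def)
    have wi: "integrable lebesgue (?w m)" for m
      by (intro Bochner_Integration.integrable_sum i)
    have "(\<lambda>m. LINT x|lebesgue. norm (V (r m) x $ \<alpha> - v x $ \<alpha>) powr p) \<longlonglongrightarrow> 0" for \<alpha>
      using LIMSEQ_subseq_LIMSEQ[OF Lp_norm_tendsto_integral[OF p0 lim[of \<alpha>]] r] by (simp add: comp_def)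
    then have "(\<lambda>m. \<Sum>\<alpha>\<in>UNIV. LINT x|lebesgue. norm (V (r m) x $ \<alpha> - v x $ \<alpha>) powr p) \<longlonglongrightarrow> (\<Sum>\<alpha>\<in>(UNIV :: 'N set). 0)"
      by (intro tendsto_sum)
    then have "(\<lambda>m. LINT x|lebesgue. norm (?w m x)) \<longlonglongrightarrow> 0"
      by (simp add: sum_nonneg i)
    from tendsto_L1_AE_subseq[OF wi this]
    obtain s where s: "strict_mono s" "AE x in lebesgue. (\<lambda>m. ?w (s m) x) \<longlonglongrightarrow> 0" by blast
    show "\<exists>s. strict_mono s \<and> (AE x in lebesgue. (\<lambda>m. V (r (s m)) x) \<longlonglongrightarrow> v x)"
    proof (intro exI[of _ s] conjI s(1))
      show "AE x in lebesgue. (\<lambda>m. V (r (s m)) x) \<longlonglongrightarrow> v x"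
        using s(2)
      proof eventually_elim
        case (elim x)
        show ?case
        proof (rule vec_tendstoI)
          fix \<alpha>
          have "(\<lambda>m. norm (V (r (s m)) x $ \<alpha> - v x $ \<alpha>) powr p) \<longlonglongrightarrow> 0"
          proof (rule tendsto_sandwich[OF always_eventually always_eventually tendsto_const elim])
            show "\<forall>m. norm (V (r (s m)) x $ \<alpha> - v x $ \<alpha>) powr p \<le> ?w (s m) x"
              by (intro allI member_le_sum) auto
          qed simp
          then have "(\<lambda>m. (norm (V (r (s m)) x $ \<alpha> - v x $ \<alpha>) powr p) powr (1 / p)) \<longlonglongrightarrow> 0"
            using p0 by (rule_tac tendsto_zero_powrI[OF _ tendsto_const]) auto
          then have "(\<lambda>m. norm (V (r (s m)) x $ \<alpha> - v x $ \<alpha>)) \<longlonglongrightarrow> 0"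
            using p0 by (simp add: powr_powr)
          then have "(\<lambda>m. V (r (s m)) x $ \<alpha> - v x $ \<alpha>) \<longlonglongrightarrow> 0"
            by (rule tendsto_norm_zero_cancel)
          then show "(\<lambda>m. V (r (s m)) x $ \<alpha>) \<longlonglongrightarrow> v x $ \<alpha>" by (rule LIM_zero_cancel)
        qed
      qed
    qed
  qed
qed

section \<open>The solution\<close>

text \<open>Two derivatives of a forward transform bring down \<open>- 4 * pi^2 * z_i * z_j\<close>,
  which explains the constant. At the origin \<open>1 / (norm z)\<^sup>2\<close> has the value
  0.\<close>

definition sol_freq :: "real^'n^'n^'N^'N \<Rightarrow> (real^'n \<Rightarrow> real^'N) \<Rightarrow> 'N \<Rightarrow> real^'n \<Rightarrow> complex" where
  "sol_freq A f \<alpha> z = of_real (- 1 / (4 * pi\<^sup>2) * (1 / (norm z)\<^sup>2)) * repr_symbol A f z $ \<alpha>"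

definition sol :: "real^'n^'n^'N^'N \<Rightarrow> (real^'n \<Rightarrow> real^'N) \<Rightarrow> 'N \<Rightarrow> real^'n \<Rightarrow> complex" where
  "sol A f \<alpha> = fourier_weighted (sol_freq A f \<alpha>)"

text \<open>\<open>sgn z\<close> in place of \<open>z\<close> shows the cancellation of the singular
  factor: what is left is a bounded multiple of \<open>repr_symbol\<close>.\<close>

definition hess_freq :: "real^'n^'n^'N^'N \<Rightarrow> (real^'n \<Rightarrow> real^'N) \<Rightarrow> 'N \<Rightarrow> 'n \<Rightarrow> 'n \<Rightarrow> real^'n \<Rightarrow> complex" where
  "hess_freq A f \<alpha> i j z = of_real (sgn z $ i * sgn z $ j) * repr_symbol A f z $ \<alpha>"

lemma inverse_4_pi_squared: "\<bar>- 1 / (4 * pi\<^sup>2)\<bar> \<le> 1"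
proof -
  have "1 \<le> pi\<^sup>2" using pi_gt3 by (intro one_le_power) simp
  then show ?thesis by (simp add: divide_le_eq)
qed

lemma sol_freq_measurable:
  "f \<in> Lp 2 \<Longrightarrow> sol_freq A f \<alpha> \<in> borel_measurable lebesgue"
  unfolding sol_freq_def[abs_def]
proof (intro borel_measurable_times repr_symbol_measurable of_real_measurable borel_measurable_const)
  show "(\<lambda>z::real^'a. 1 / (norm z)\<^sup>2) \<in> borel_measurable lebesgue"
    by (rule measurable_completion) measurable
qed

lemma sol_freq_weighted:
  fixes A :: "real^'n^'n^'N^'N"
  assumes \<nu>: "ellipticity A > 0" and f: "f \<in> Lp 2"
  shows "weighted_L2 2 (sol_freq A f \<alpha>)"
    and "Lp_norm 2 (\<lambda>z. (norm z)\<^sup>2 *\<^sub>R sol_freq A f \<alpha> z) \<le> symbol_constant A * Lp_norm 2 f"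
proof -
  note G = repr_symbol_Lp2[OF \<nu> f, of \<alpha>]
  have m: "(\<lambda>z. (norm z)\<^sup>2 *\<^sub>R sol_freq A f \<alpha> z) \<in> borel_measurable lebesgue"
    by (intro borel_measurable_scaleR sol_freq_measurable f continuous_lebesgue_measurable continuous_intros)
  have le: "AE z in lebesgue. norm ((norm z)\<^sup>2 *\<^sub>R sol_freq A f \<alpha> z) \<le> 1 * norm (repr_symbol A f z $ \<alpha>)"
    using AE_nonzero
  proof eventually_elim
    case (elim z)
    have "norm ((norm z)\<^sup>2 *\<^sub>R sol_freq A f \<alpha> z) = \<bar>- 1 / (4 * pi\<^sup>2)\<bar> * norm (repr_symbol A f z $ \<alpha>)"
      using elim by (simp add: sol_freq_def norm_mult norm_divide norm_power)
    also have "\<dots> \<le> 1 * norm (repr_symbol A f z $ \<alpha>)"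
      by (intro mult_right_mono inverse_4_pi_squared) simp
    finally show ?case .
  qed
  show "weighted_L2 2 (sol_freq A f \<alpha>)"
    unfolding weighted_L2_def using sol_freq_measurable[OF f] Lp2_dominated[OF G(1) m le] by blast
  show "Lp_norm 2 (\<lambda>z. (norm z)\<^sup>2 *\<^sub>R sol_freq A f \<alpha> z) \<le> symbol_constant A * Lp_norm 2 f"
    using Lp2_norm_dominated[OF G(1) m le] G(2) by simp
qed

text \<open>The two factors \<open>- 2 * pi * \<i>\<close> multiply to \<open>- 4 * pi^2\<close> and
  cancel the constant in \<open>sol_freq\<close>. At the origin both sides are 0, so the functions
  are equal everywhere.\<close>

lemma freq_mult_sol_freq: "freq_mult i (freq_mult j (sol_freq A f \<alpha>)) = hess_freq A f \<alpha> i j"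
proof
  fix z
  have "- 2 * of_real pi * \<i> * of_real (z $ i) * (- 2 * of_real pi * \<i> * of_real (z $ j) * (of_real (- 1 / (4 * pi\<^sup>2) * (1 / (norm z)\<^sup>2)) * c))
      = of_real (sgn z $ i * sgn z $ j) * c" for c
  proof (cases "z = 0")
    case False
    then show ?thesis
      by (simp add: sgn_div_norm power2_eq_square field_simps)
  qed simp
  then show "freq_mult i (freq_mult j (sol_freq A f \<alpha>)) z = hess_freq A f \<alpha> i j z"
    unfolding freq_mult_def sol_freq_def hess_freq_def .
qed

lemma hess_freq_Lp2:
  fixes A :: "real^'n^'n^'N^'N"
  assumes \<nu>: "ellipticity A > 0" and f: "f \<in> Lp 2"
  shows "hess_freq A f \<alpha> i j \<in> Lp 2"
proof -
  have "weighted_L2 (Suc (Suc 0)) (sol_freq A f \<alpha>)" using sol_freq_weighted(1)[OF \<nu> f] by (simp add: numeral_2_eq_2)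
  from freq_mult_weighted(1)[OF freq_mult_weighted(1)[OF this], of i j]
  show ?thesis unfolding freq_mult_sol_freq weighted_L2_def by simp
qed

text \<open>On the frequency side the contraction is the symbol matrix applied to
  \<open>repr_symbol\<close>, which leaves \<open>data_freq\<close>, and the forward transform
  brings \<open>f\<close> back. The identity holds for complex values, before any real part is
  taken.\<close>

lemma hess_freq_equation:
  fixes A :: "real^'n^'n^'N^'N"
  assumes \<nu>: "ellipticity A > 0" and f: "f \<in> Lp 2"
  shows "AE x in lebesgue. (\<Sum>p\<in>UNIV. of_real (A $ \<alpha> $ fst p $ fst (snd p) $ snd (snd p)) * F2 (hess_freq A f (fst p) (fst (snd p)) (snd (snd p))) x)
    = of_real (f x $ \<alpha>)"
proof -
  let ?h = "\<lambda>p z. complex_of_real (A $ \<alpha> $ fst p $ fst (snd p) $ snd (snd p)) * hess_freq A f (fst p) (fst (snd p)) (snd (snd p)) z"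
  have h2: "?h p \<in> Lp 2" for p by (intro Lp2_scale hess_freq_Lp2 \<nu> f)
  have sum: "AE z in lebesgue. (\<Sum>p\<in>UNIV. ?h p z) = data_freq f \<alpha> z"
    using AE_nonzero
  proof eventually_elim
    case (elim z)
    have "(\<Sum>p\<in>UNIV. ?h p z) = (\<Sum>\<beta>\<in>UNIV. \<Sum>i\<in>UNIV. \<Sum>j\<in>UNIV. of_real (A $ \<alpha> $ \<beta> $ i $ j) * hess_freq A f \<beta> i j z)"
      unfolding sum_triple ..
    also have "\<dots> = (\<Sum>\<beta>\<in>UNIV. of_real (symbol_matrix A (sgn z) $ \<alpha> $ \<beta>) * repr_symbol A f z $ \<beta>)"
      unfolding hess_freq_def symbol_matrix_def by (simp add: sum_distrib_right mult.assoc)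
    also have "\<dots> = data_freq f \<alpha> z" by (rule symbol_repr_symbol[OF \<nu> elim])
    finally show ?case .
  qed
  have "AE x in lebesgue. F2 (\<lambda>z. \<Sum>p\<in>UNIV. ?h p z) x = F2 (data_freq f \<alpha>) x"
    by (intro F2_cong Lp2_sum h2 data_freq_Lp2 f sum)
  moreover have "AE x in lebesgue. F2 (data_freq f \<alpha>) x = of_real (f x $ \<alpha>)"
    unfolding data_freq_def by (intro F2_I2 of_real_Lp2 vec_comp_Lp f) simp
  moreover have "AE x in lebesgue. F2 (\<lambda>z. \<Sum>p\<in>UNIV. ?h p z) x = (\<Sum>p\<in>UNIV. F2 (?h p) x)"
    by (intro F2_sum h2)
  moreover have "AE x in lebesgue. \<forall>p. F2 (?h p) x = of_real (A $ \<alpha> $ fst p $ fst (snd p) $ snd (snd p)) * F2 (hess_freq A f (fst p) (fst (snd p)) (snd (snd p))) x"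
    unfolding AE_all_countable by (intro allI F2_scale hess_freq_Lp2 \<nu> f)
  ultimately show ?thesis by eventually_elim simp
qed

lemma norm_le_sum_components: "norm (x :: ('a::real_normed_vector)^'n) \<le> (\<Sum>i\<in>UNIV. norm (x $ i))"
  unfolding norm_vec_def by (rule L2_set_le_sum) simp

text \<open>A real candidate for every real-linear \<open>P\<close> on the complex values of
  \<open>sol\<close>; the solution of the theorem is the one for \<open>Re\<close>.\<close>

definition sol_part :: "(complex \<Rightarrow> real) \<Rightarrow> real^'n^'n^'N^'N \<Rightarrow> (real^'n \<Rightarrow> real^'N) \<Rightarrow> real^'n \<Rightarrow> real^'N" where
  "sol_part P A f x = (\<chi> \<alpha>. P (sol A f \<alpha> x))"

definition sol_grad :: "real^'n^'n^'N^'N \<Rightarrow> (real^'n \<Rightarrow> real^'N) \<Rightarrow> 'N \<Rightarrow> 'n \<Rightarrow> real^'n \<Rightarrow> complex" where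
  "sol_grad A f \<alpha> j = fourier_weighted (freq_mult j (sol_freq A f \<alpha>))"

section \<open>Bounds and weak derivatives of the solution\<close>

lemma sobolev_crit2:
  assumes n: "CARD('n) \<ge> 5"
  shows "\<exists>C>0. \<forall>g :: real^'n \<Rightarrow> complex. weighted_L2 2 g \<longrightarrow>
    fourier_weighted g \<in> Lp (crit_exp2 TYPE('n)) \<and>
    Lp_norm (crit_exp2 TYPE('n)) (fourier_weighted g) \<le> C * Lp_norm 2 (\<lambda>z. (norm z)\<^sup>2 *\<^sub>R g z)"
proof -
  have *: "2 * 2 < CARD('n)" "(1::nat) \<le> 2" "crit_exp2 TYPE('n) = 2 * real CARD('n) / (real CARD('n) - 2 * real 2)"
    using n by (simp_all add: crit_exp2_def)
  obtain C where C: "C > 0"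
    "\<And>g :: real^'n \<Rightarrow> complex. weighted_L2 2 g \<Longrightarrow> fourier_weighted g \<in> Lp (crit_exp2 TYPE('n))"
    "\<And>g :: real^'n \<Rightarrow> complex. weighted_L2 2 g \<Longrightarrow>
      Lp_norm (crit_exp2 TYPE('n)) (fourier_weighted g) \<le> C * Lp_norm 2 (\<lambda>z. (norm z)\<^sup>2 *\<^sub>R g z)"
    by (rule sobolev[OF *]) (rule that)
  show ?thesis by (intro exI[of _ C] conjI C allI impI)
qed

lemma sobolev_crit1:
  assumes n: "CARD('n) \<ge> 5"
  shows "\<exists>C>0. \<forall>g :: real^'n \<Rightarrow> complex. weighted_L2 1 g \<longrightarrow>
    fourier_weighted g \<in> Lp (crit_exp1 TYPE('n)) \<and>
    Lp_norm (crit_exp1 TYPE('n)) (fourier_weighted g) \<le> C * Lp_norm 2 (\<lambda>z. norm z ^ 1 *\<^sub>R g z)"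
proof -
  have *: "2 * 1 < CARD('n)" "(1::nat) \<le> 1" "crit_exp1 TYPE('n) = 2 * real CARD('n) / (real CARD('n) - 2 * real 1)"
    using n by (simp_all add: crit_exp1_def)
  obtain C where C: "C > 0"
    "\<And>g :: real^'n \<Rightarrow> complex. weighted_L2 1 g \<Longrightarrow> fourier_weighted g \<in> Lp (crit_exp1 TYPE('n))"
    "\<And>g :: real^'n \<Rightarrow> complex. weighted_L2 1 g \<Longrightarrow>
      Lp_norm (crit_exp1 TYPE('n)) (fourier_weighted g) \<le> C * Lp_norm 2 (\<lambda>z. norm z ^ 1 *\<^sub>R g z)"
    by (rule sobolev[OF *]) (rule that)
  show ?thesis by (intro exI[of _ C] conjI C allI impI)
qed

text \<open>\<open>C\<close> is quantified before \<open>f\<close>: the Sobolev constant comes from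
  the dimension, and \<open>symbol_constant A\<close> carries the dependence on the tensor.\<close>

lemma sol_Lp:
  fixes A :: "real^'n^'n^'N^'N"
  assumes n: "CARD('n) \<ge> 5" and \<nu>: "ellipticity A > 0"
  shows "\<exists>C>0. \<forall>f \<alpha>. f \<in> Lp 2 \<longrightarrow> sol A f \<alpha> \<in> Lp (crit_exp2 TYPE('n)) \<and>
    Lp_norm (crit_exp2 TYPE('n)) (sol A f \<alpha>) \<le> C * (symbol_constant A * Lp_norm 2 f)"
proof -
  obtain C where C: "C > 0" "\<forall>g :: real^'n \<Rightarrow> complex. weighted_L2 2 g \<longrightarrow>
    fourier_weighted g \<in> Lp (crit_exp2 TYPE('n)) \<and>
    Lp_norm (crit_exp2 TYPE('n)) (fourier_weighted g) \<le> C * Lp_norm 2 (\<lambda>z. (norm z)\<^sup>2 *\<^sub>R g z)"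
    using sobolev_crit2[OF n] by blast
  show ?thesis
  proof (intro exI[of _ C] conjI[OF C(1)] allI impI)
    fix f :: "real^'n \<Rightarrow> real^'N" and \<alpha> assume f: "f \<in> Lp 2"
    note w = sol_freq_weighted[OF \<nu> f, of \<alpha>]
    show "sol A f \<alpha> \<in> Lp (crit_exp2 TYPE('n)) \<and>
       Lp_norm (crit_exp2 TYPE('n)) (sol A f \<alpha>) \<le> C * (symbol_constant A * Lp_norm 2 f)"
      unfolding sol_def using C(2)[rule_format, OF w(1)] mult_left_mono[OF w(2) less_imp_le[OF C(1)]] by linarith
  qed
qed

lemma sol_grad_Lp:
  fixes A :: "real^'n^'n^'N^'N"
  assumes n: "CARD('n) \<ge> 5" and \<nu>: "ellipticity A > 0"
  shows "\<exists>C>0. \<forall>f \<alpha> j. f \<in> Lp 2 \<longrightarrow> sol_grad A f \<alpha> j \<in> Lp (crit_exp1 TYPE('n)) \<and>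
    Lp_norm (crit_exp1 TYPE('n)) (sol_grad A f \<alpha> j) \<le> C * (symbol_constant A * Lp_norm 2 f)"
proof -
  obtain C where C: "C > 0" "\<forall>g :: real^'n \<Rightarrow> complex. weighted_L2 1 g \<longrightarrow>
    fourier_weighted g \<in> Lp (crit_exp1 TYPE('n)) \<and>
    Lp_norm (crit_exp1 TYPE('n)) (fourier_weighted g) \<le> C * Lp_norm 2 (\<lambda>z. norm z ^ 1 *\<^sub>R g z)"
    using sobolev_crit1[OF n] by blast
  show ?thesis
  proof (intro exI[of _ "C * (2 * pi)"] conjI allI impI)
    show "C * (2 * pi) > 0" using C(1) by simp
    fix f :: "real^'n \<Rightarrow> real^'N" and \<alpha> j assume f: "f \<in> Lp 2"
    note w = sol_freq_weighted[OF \<nu> f, of \<alpha>]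
    have w2: "weighted_L2 (Suc 1) (sol_freq A f \<alpha>)" using w(1) by (simp add: numeral_2_eq_2)
    note w1 = freq_mult_weighted[OF w2, of j]
    note b = C(2)[rule_format, OF w1(1)]
    show "sol_grad A f \<alpha> j \<in> Lp (crit_exp1 TYPE('n))" unfolding sol_grad_def using b by blast
    have "Lp_norm (crit_exp1 TYPE('n)) (sol_grad A f \<alpha> j) \<le> C * Lp_norm 2 (\<lambda>z. norm z ^ 1 *\<^sub>R freq_mult j (sol_freq A f \<alpha>) z)"
      unfolding sol_grad_def using b by blast
    also have "\<dots> \<le> C * (2 * pi * Lp_norm 2 (\<lambda>z. norm z ^ Suc 1 *\<^sub>R sol_freq A f \<alpha> z))"
      using C(1) by (intro mult_left_mono w1(2)) simp
    also have "\<dots> \<le> C * (2 * pi * (symbol_constant A * Lp_norm 2 f))"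
      using C(1) w(2) by (intro mult_left_mono) (simp_all add: numeral_2_eq_2)
    finally show "Lp_norm (crit_exp1 TYPE('n)) (sol_grad A f \<alpha> j) \<le> C * (2 * pi) * (symbol_constant A * Lp_norm 2 f)"
      by (simp only: mult.assoc)
  qed
qed

text \<open>Each derivative lowers the weight by one, so after two of them \<open>hess_freq\<close>
  has weight 0 and the weighted transform may be replaced by \<open>F2\<close>.\<close>

lemma sol_part_derivatives:
  fixes A :: "real^'n^'n^'N^'N"
  assumes n: "CARD('n) \<ge> 5" and \<nu>: "ellipticity A > 0" and f: "f \<in> Lp 2"
    and P: "bounded_linear (P :: complex \<Rightarrow> real)"
  shows "has_weak_partial j (\<lambda>x. sol_part P A f x $ \<alpha>) (\<lambda>x. P (sol_grad A f \<alpha> j x))"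
    and "AE x in lebesgue. weak_grad (sol_part P A f) x $ \<alpha> $ j = P (sol_grad A f \<alpha> j x)"
    and "weakly_differentiable (weak_partial j (\<lambda>x. sol_part P A f x $ \<alpha>))"
    and "AE x in lebesgue. weak_hess (sol_part P A f) x $ \<alpha> $ i $ j = P (F2 (hess_freq A f \<alpha> i j) x)"
    and "(\<lambda>x. weak_hess (sol_part P A f) x $ \<alpha> $ i $ j) \<in> borel_measurable lebesgue"
    and "(\<lambda>x. weak_grad (sol_part P A f) x $ \<alpha> $ j) \<in> borel_measurable lebesgue"
proof -
  have w2: "weighted_L2 (Suc (Suc 0)) (sol_freq A f \<alpha>)"
    using sol_freq_weighted(1)[OF \<nu> f] by (simp add: numeral_2_eq_2)
  have n1: "2 * Suc (Suc 0) < CARD('n)" "2 * Suc 0 < CARD('n)" using n by auto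
  show 1: "has_weak_partial j (\<lambda>x. sol_part P A f x $ \<alpha>) (\<lambda>x. P (sol_grad A f \<alpha> j x))" for j
    unfolding sol_part_def vec_lambda_beta sol_def sol_grad_def
    by (rule has_weak_partial_fourier_weighted[OF P w2 n1(1)])
  let ?v = "weak_partial j (\<lambda>x. sol_part P A f x $ \<alpha>)"
  have v: "AE x in lebesgue. ?v x = P (sol_grad A f \<alpha> j x)"
    by (rule weak_partial_AE[OF 1])
  then show "AE x in lebesgue. weak_grad (sol_part P A f) x $ \<alpha> $ j = P (sol_grad A f \<alpha> j x)"
    by (simp add: weak_grad_def)
  have vl: "locally_integrable ?v"
    using has_weak_partial_weak_partial[OF 1[of j]] by (simp add: has_weak_partial_def)
  \<comment> \<open>\<open>?v\<close> is the chosen first derivative and not the explicit one, hence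
    the passage through \<open>has_weak_partial_cong\<close>.\<close>
  have 2: "has_weak_partial i ?v (\<lambda>x. P (fourier_weighted (freq_mult i (freq_mult j (sol_freq A f \<alpha>))) x))" for i
  proof (rule has_weak_partial_cong[OF _ vl v])
    show "has_weak_partial i (\<lambda>x. P (sol_grad A f \<alpha> j x)) (\<lambda>x. P (fourier_weighted (freq_mult i (freq_mult j (sol_freq A f \<alpha>))) x))"
      unfolding sol_grad_def
      by (rule has_weak_partial_fourier_weighted[OF P freq_mult_weighted(1)[OF w2] n1(2)])
  qed
  then show "weakly_differentiable ?v"
    unfolding weakly_differentiable_def by blast
  have "AE x in lebesgue. fourier_weighted (hess_freq A f \<alpha> i j) x = F2 (hess_freq A f \<alpha> i j) x"
    by (rule fourier_weighted_0[OF hess_freq_Lp2[OF \<nu> f]])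
  moreover have "AE x in lebesgue. weak_partial i ?v x = P (fourier_weighted (hess_freq A f \<alpha> i j) x)"
    using weak_partial_AE[OF 2[of i]] unfolding freq_mult_sol_freq .
  ultimately show "AE x in lebesgue. weak_hess (sol_part P A f) x $ \<alpha> $ i $ j = P (F2 (hess_freq A f \<alpha> i j) x)"
    unfolding weak_hess_def vec_lambda_beta by eventually_elim simp
  show "(\<lambda>x. weak_hess (sol_part P A f) x $ \<alpha> $ i $ j) \<in> borel_measurable lebesgue"
    using has_weak_partial_weak_partial[OF 2[of i]] unfolding weak_hess_def vec_lambda_beta
    by (intro locally_integrable_measurable) (simp add: has_weak_partial_def)
  show "(\<lambda>x. weak_grad (sol_part P A f) x $ \<alpha> $ j) \<in> borel_measurable lebesgue"
    using vl unfolding weak_grad_def vec_lambda_beta by (rule locally_integrable_measurable)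
qed

lemma sol_part_W22_star:
  fixes A :: "real^'n^'n^'N^'N"
  assumes n: "CARD('n) \<ge> 5" and \<nu>: "ellipticity A > 0" and f: "f \<in> Lp 2"
    and P: "bounded_linear (P :: complex \<Rightarrow> real)"
  shows "sol_part P A f \<in> W22_star"
proof -
  note d = sol_part_derivatives[OF n \<nu> f P] and c = crit_exp_bounds[OF n]
  have S: "sol A f \<alpha> \<in> Lp (crit_exp2 TYPE('n))" "sol_grad A f \<alpha> j \<in> Lp (crit_exp1 TYPE('n))" for \<alpha> j
  proof -
    obtain C where "\<forall>f \<alpha>. f \<in> Lp 2 \<longrightarrow> sol A f \<alpha> \<in> Lp (crit_exp2 TYPE('n)) \<and>
      Lp_norm (crit_exp2 TYPE('n)) (sol A f \<alpha>) \<le> C * (symbol_constant A * Lp_norm 2 f)"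
      using sol_Lp[OF n \<nu>] by blast
    then show "sol A f \<alpha> \<in> Lp (crit_exp2 TYPE('n))" using f by blast
    obtain C where "\<forall>f \<alpha> j. f \<in> Lp 2 \<longrightarrow> sol_grad A f \<alpha> j \<in> Lp (crit_exp1 TYPE('n)) \<and>
      Lp_norm (crit_exp1 TYPE('n)) (sol_grad A f \<alpha> j) \<le> C * (symbol_constant A * Lp_norm 2 f)"
      using sol_grad_Lp[OF n \<nu>] by blast
    then show "sol_grad A f \<alpha> j \<in> Lp (crit_exp1 TYPE('n))" using f by blast
  qed
  have Pu: "(\<lambda>x. P (sol A f \<alpha> x)) \<in> Lp (crit_exp2 TYPE('n))" for \<alpha>
    using c by (intro Lp_bounded_linear P S) auto
  have Pg: "(\<lambda>x. P (sol_grad A f \<alpha> j x)) \<in> Lp (crit_exp1 TYPE('n))" for \<alpha> j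
    using c by (intro Lp_bounded_linear P S) auto
  have Ph: "(\<lambda>x. P (F2 (hess_freq A f \<alpha> i j) x)) \<in> Lp 2" for \<alpha> i j
    by (intro Lp_bounded_linear P F2_Lp2 hess_freq_Lp2 \<nu> f) simp
  have wd: "weakly_differentiable (\<lambda>x. sol_part P A f x $ \<alpha>)" for \<alpha>
    unfolding weakly_differentiable_def using d(1) by blast
  have "sol_part P A f \<in> Lp (crit_exp2 TYPE('n))"
  proof (rule Lp_sum_bound(1)[of UNIV _ "\<lambda>\<alpha> x. P (sol A f \<alpha> x)"])
    show "sol_part P A f \<in> borel_measurable lebesgue"
      using Pu by (intro vec_measurable) (simp add: sol_part_def Lp_def)
    show "AE x in lebesgue. norm (sol_part P A f x) \<le> (\<Sum>\<alpha>\<in>UNIV. norm (P (sol A f \<alpha> x)))"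
      using norm_le_sum_components[of "sol_part P A f _"] by (intro AE_I2) (simp add: sol_part_def)
  qed (use Pu c in auto)
  moreover have "weak_grad (sol_part P A f) \<in> Lp (crit_exp1 TYPE('n))"
  proof (rule Lp_sum_bound(1)[of "UNIV :: ('N \<times> 'n) set" _ "\<lambda>q x. P (sol_grad A f (fst q) (snd q) x)"])
    show "weak_grad (sol_part P A f) \<in> borel_measurable lebesgue"
      by (intro vec_measurable d)
    have "AE x in lebesgue. \<forall>q. weak_grad (sol_part P A f) x $ fst q $ snd q = P (sol_grad A f (fst q) (snd q) x)"
      unfolding AE_all_countable by (intro allI d)
    then show "AE x in lebesgue. norm (weak_grad (sol_part P A f) x) \<le> (\<Sum>q\<in>UNIV. norm (P (sol_grad A f (fst q) (snd q) x)))"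
    proof eventually_elim
      case (elim x)
      have "norm (weak_grad (sol_part P A f) x) \<le> (\<Sum>\<alpha>\<in>UNIV. \<Sum>j\<in>UNIV. norm (weak_grad (sol_part P A f) x $ \<alpha> $ j))"
        by (intro order.trans[OF norm_le_sum_components] sum_mono norm_le_sum_components)
      also have "\<dots> = (\<Sum>q\<in>UNIV. norm (weak_grad (sol_part P A f) x $ fst q $ snd q))"
        by (simp add: sum.cartesian_product case_prod_unfold flip: UNIV_Times_UNIV)
      finally show ?case using elim by simp
    qed
  qed (use Pg c in auto)
  moreover have "weak_hess (sol_part P A f) \<in> Lp 2"
  proof (rule Lp_sum_bound(1)[of "UNIV :: ('N \<times> 'n \<times> 'n) set" _ "\<lambda>q x. P (F2 (hess_freq A f (fst q) (fst (snd q)) (snd (snd q))) x)"])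
    show "weak_hess (sol_part P A f) \<in> borel_measurable lebesgue"
      by (intro vec_measurable d)
    have "AE x in lebesgue. \<forall>q. weak_hess (sol_part P A f) x $ fst q $ fst (snd q) $ snd (snd q) = P (F2 (hess_freq A f (fst q) (fst (snd q)) (snd (snd q))) x)"
      unfolding AE_all_countable by (intro allI d)
    then show "AE x in lebesgue. norm (weak_hess (sol_part P A f) x) \<le> (\<Sum>q\<in>UNIV. norm (P (F2 (hess_freq A f (fst q) (fst (snd q)) (snd (snd q))) x)))"
    proof eventually_elim
      case (elim x)
      have "norm (weak_hess (sol_part P A f) x) \<le> (\<Sum>\<alpha>\<in>UNIV. \<Sum>i\<in>UNIV. \<Sum>j\<in>UNIV. norm (weak_hess (sol_part P A f) x $ \<alpha> $ i $ j))"
        by (intro order.trans[OF norm_le_sum_components] sum_mono norm_le_sum_components)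
      then show ?case unfolding sum_triple using elim by simp
    qed
  qed (use Ph in auto)
  ultimately show ?thesis
    using wd d(3) by (simp add: W22_star_def)
qed

text \<open>\<open>P\<close> commutes with the contraction because the entries of \<open>A\<close>
  are real, and it fixes the data because these are real too.\<close>

lemma sol_part_equation:
  fixes A :: "real^'n^'n^'N^'N"
  assumes n: "CARD('n) \<ge> 5" and \<nu>: "ellipticity A > 0" and f: "f \<in> Lp 2"
    and P: "bounded_linear (P :: complex \<Rightarrow> real)" and P1: "\<And>r. P (of_real r) = r"
  shows "AE x in lebesgue. contract2 A (weak_hess (sol_part P A f) x) = f x"
proof -
  have "AE x in lebesgue. \<forall>q. weak_hess (sol_part P A f) x $ fst q $ fst (snd q) $ snd (snd q) = P (F2 (hess_freq A f (fst q) (fst (snd q)) (snd (snd q))) x)"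
    unfolding AE_all_countable by (intro allI sol_part_derivatives[OF n \<nu> f P])
  moreover have "AE x in lebesgue. \<forall>\<alpha>. (\<Sum>p\<in>UNIV. of_real (A $ \<alpha> $ fst p $ fst (snd p) $ snd (snd p)) * F2 (hess_freq A f (fst p) (fst (snd p)) (snd (snd p))) x) = of_real (f x $ \<alpha>)"
    unfolding AE_all_countable by (intro allI hess_freq_equation[OF \<nu> f])
  ultimately show ?thesis
  proof eventually_elim
    case (elim x)
    have "contract2 A (weak_hess (sol_part P A f) x) $ \<alpha> = f x $ \<alpha>" for \<alpha>
    proof -
      have lin: "r * P c = P (of_real r * c)" for r c
        using linear_scale[OF bounded_linear.linear[OF P], of r c] by (simp add: scaleR_conv_of_real)
      have "contract2 A (weak_hess (sol_part P A f) x) $ \<alpha>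
          = (\<Sum>p\<in>UNIV. P (of_real (A $ \<alpha> $ fst p $ fst (snd p) $ snd (snd p)) * F2 (hess_freq A f (fst p) (fst (snd p)) (snd (snd p))) x))"
        unfolding contract2_component using elim(1) by (simp add: lin)
      also have "\<dots> = P (\<Sum>p\<in>UNIV. of_real (A $ \<alpha> $ fst p $ fst (snd p) $ snd (snd p)) * F2 (hess_freq A f (fst p) (fst (snd p)) (snd (snd p))) x)"
        by (rule linear_sum[OF bounded_linear.linear[OF P], symmetric])
      also have "\<dots> = f x $ \<alpha>" using elim(2) P1 by simp
      finally show ?thesis .
    qed
    then show ?case by (simp add: vec_eq_iff)
  qed
qed

text \<open>Every real-linear functional that fixes the reals yields a solution, so by uniqueness
  \<open>Re + Im\<close> and \<open>Re\<close> agree on the solution.\<close>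

lemma sol_real:
  fixes A :: "real^'n^'n^'N^'N"
  assumes n: "CARD('n) \<ge> 5" and \<nu>: "ellipticity A > 0" and f: "f \<in> Lp 2"
  shows "AE x in lebesgue. \<forall>\<alpha>. cvec (sol_part Re A f x) $ \<alpha> = sol A f \<alpha> x"
proof -
  have P: "bounded_linear (\<lambda>c. Re c + Im c)"
    by (intro bounded_linear_add bounded_linear_Re bounded_linear_Im)
  have e1: "AE x in lebesgue. contract2 A (weak_hess (sol_part Re A f) x) = f x"
    by (rule sol_part_equation[OF n \<nu> f bounded_linear_Re]) simp
  have e2: "AE x in lebesgue. contract2 A (weak_hess (sol_part (\<lambda>c. Re c + Im c) A f) x) = f x"
    by (rule sol_part_equation[OF n \<nu> f P]) simp
  have "AE x in lebesgue. contract2 A (weak_hess (sol_part (\<lambda>c. Re c + Im c) A f) x) = contract2 A (weak_hess (sol_part Re A f) x)"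
    using e1 e2 by eventually_elim simp
  then have "AE x in lebesgue. sol_part (\<lambda>c. Re c + Im c) A f x = sol_part Re A f x"
    by (rule W22_star_unique[OF n \<nu> sol_part_W22_star[OF n \<nu> f bounded_linear_Re] sol_part_W22_star[OF n \<nu> f P]])
  then show ?thesis
  proof eventually_elim
    case (elim x)
    then have "Im (sol A f \<alpha> x) = 0" for \<alpha>
      unfolding sol_part_def vec_eq_iff by simp
    then show ?case
      unfolding cvec_def sol_part_def by (simp add: complex_eq_iff)
  qed
qed

section \<open>Approximation by Schwartz multipliers\<close>

lemma weighted_L2_diff:
  assumes "weighted_L2 s g1" "weighted_L2 s g2"
  shows "weighted_L2 s (\<lambda>z. g1 z - g2 z)"
proof -
  have "(\<lambda>z. g1 z - g2 z) \<in> borel_measurable lebesgue"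
    using assms by (intro borel_measurable_diff) (auto simp: weighted_L2_def)
  then show ?thesis
    using assms Lp2_diff[of "\<lambda>z. norm z ^ s *\<^sub>R g1 z" "\<lambda>z. norm z ^ s *\<^sub>R g2 z"]
    unfolding weighted_L2_def by (simp add: scaleR_right_diff_distrib)
qed

lemma fourier_weighted_diff:
  fixes g1 g2 :: "real^'n \<Rightarrow> complex"
  assumes g: "weighted_L2 s g1" "weighted_L2 s g2" and s: "2 * s < CARD('n)"
  shows "AE x in lebesgue. fourier_weighted (\<lambda>z. g1 z - g2 z) x = fourier_weighted g1 x - fourier_weighted g2 x"
proof -
  have low: "low 1 (\<lambda>z. g1 z - g2 z) = (\<lambda>z. low 1 g1 z - low 1 g2 z)"
    and high: "high 1 (\<lambda>z. g1 z - g2 z) = (\<lambda>z. high 1 g1 z - high 1 g2 z)"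
    by (auto simp: low_def high_def scaleR_right_diff_distrib)
  have "fourier_L1 (low 1 (\<lambda>z. g1 z - g2 z)) x = fourier_L1 (low 1 g1) x - fourier_L1 (low 1 g2) x" for x
    unfolding low by (intro fourier_L1_diff low_integrable(1)[OF g(1)] low_integrable(1)[OF g(2)] s) auto
  moreover have "AE x in lebesgue. F2 (high 1 (\<lambda>z. g1 z - g2 z)) x = F2 (high 1 g1) x - F2 (high 1 g2) x"
    unfolding high by (intro F2_diff high_Lp2[OF g(1)] high_Lp2[OF g(2)]) auto
  ultimately show ?thesis
    unfolding fourier_weighted_def by (auto elim!: eventually_mono)
qed

definition approx_freq :: "real^'n^'n^'N^'N \<Rightarrow> (real^'n \<Rightarrow> real^'N) \<Rightarrow> (real^'n \<Rightarrow> real) \<Rightarrow> 'N \<Rightarrow> real^'n \<Rightarrow> complex" where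
  "approx_freq A f h \<alpha> z = of_real (- 1 / (4 * pi\<^sup>2) * h z) * repr_symbol A f z $ \<alpha>"

text \<open>Integrability comes from a product of two L2 functions; boundedness of \<open>h\<close>
  and of \<open>(norm z)^2 * h z\<close> gives the other two memberships. The approximations can
  thus be compared with the solution in the weighted space and still be computed by absolutely
  convergent integrals.\<close>

lemma approx_freq_Lp:
  fixes A :: "real^'n^'n^'N^'N"
  assumes \<nu>: "ellipticity A > 0" and f: "f \<in> Lp 2" and h: "schwartz h"
  shows "approx_freq A f h \<alpha> \<in> Lp 1 \<inter> Lp 2" and "weighted_L2 2 (approx_freq A f h \<alpha>)"
proof -
  let ?c = "- 1 / (4 * pi\<^sup>2)"
  note G = repr_symbol_Lp2[OF \<nu> f, of \<alpha>]
  have "(\<lambda>z. of_real ?c * complex_of_real (h z)) \<in> Lp 2"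
    using schwartz_Lp[OF h] by (intro Lp2_scale) simp
  from Lp2_product_integrable[OF this G(1)] have L1: "approx_freq A f h \<alpha> \<in> Lp 1"
    unfolding Lp1_iff approx_freq_def by simp
  then have m: "approx_freq A f h \<alpha> \<in> borel_measurable lebesgue" by (auto simp: Lp1_iff)
  obtain B where B: "\<And>x. \<bar>h x\<bar> \<le> B" using schwartz_bounds[OF h, of 0] by auto
  obtain B2 where B2: "\<And>x. (norm x)\<^sup>2 * \<bar>h x\<bar> \<le> B2" using schwartz_bounds[OF h, of 2] by blast
  have c: "\<bar>?c\<bar> * a \<le> b" if "a \<le> b" "0 \<le> a" for a b
    using mult_right_mono[OF inverse_4_pi_squared that(2)] that by simp
  have "approx_freq A f h \<alpha> \<in> Lp 2"
  proof (rule Lp2_dominated[OF G(1) m])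
    show "AE z in lebesgue. norm (approx_freq A f h \<alpha> z) \<le> B * norm (repr_symbol A f z $ \<alpha>)"
      unfolding approx_freq_def norm_mult norm_of_real abs_mult
      by (intro AE_I2 mult_right_mono c B) auto
  qed
  with L1 show "approx_freq A f h \<alpha> \<in> Lp 1 \<inter> Lp 2" by simp
  have "(\<lambda>z. (norm z)\<^sup>2 *\<^sub>R approx_freq A f h \<alpha> z) \<in> Lp 2"
  proof (rule Lp2_dominated[OF G(1), where B = B2])
    show "(\<lambda>z. (norm z)\<^sup>2 *\<^sub>R approx_freq A f h \<alpha> z) \<in> borel_measurable lebesgue"
      by (intro borel_measurable_scaleR m continuous_lebesgue_measurable continuous_intros)
    have eqn: "norm ((norm z)\<^sup>2 *\<^sub>R approx_freq A f h \<alpha> z) = \<bar>?c\<bar> * ((norm z)\<^sup>2 * \<bar>h z\<bar>) * norm (repr_symbol A f z $ \<alpha>)" for z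
      unfolding approx_freq_def norm_scaleR norm_mult norm_of_real abs_mult abs_power2 by (simp only: mult_ac power2_abs abs_norm_cancel)
    show "AE z in lebesgue. norm ((norm z)\<^sup>2 *\<^sub>R approx_freq A f h \<alpha> z) \<le> B2 * norm (repr_symbol A f z $ \<alpha>)"
      unfolding eqn by (intro AE_I2 mult_right_mono c B2) auto
  qed
  then show "weighted_L2 2 (approx_freq A f h \<alpha>)"
    using m by (simp add: weighted_L2_def)
qed

text \<open>For a frequency function in L1 \<inter> L2 the transforms \<open>fourier_L1\<close>,
  \<open>F2\<close> and \<open>fourier_weighted\<close> agree almost everywhere.\<close>

lemma approx_solution_fourier:
  fixes A :: "real^'n^'n^'N^'N"
  assumes \<nu>: "ellipticity A > 0" and f: "f \<in> Lp 2" and h: "schwartz h"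
  shows "(\<lambda>x. approx_solution A f h x $ \<alpha>) \<in> borel_measurable lebesgue"
    and "AE x in lebesgue. approx_solution A f h x $ \<alpha> = fourier_weighted (approx_freq A f h \<alpha>) x"
proof -
  note L = approx_freq_Lp(1)[OF \<nu> f h, of \<alpha>]
  have eq: "(\<lambda>x. approx_solution A f h x $ \<alpha>) = fourier_L1 (approx_freq A f h \<alpha>)"
    unfolding approx_freq_def[abs_def] using approx_solution_component[OF \<nu> f h] by blast
  show "(\<lambda>x. approx_solution A f h x $ \<alpha>) \<in> borel_measurable lebesgue"
    unfolding eq using L by (intro fourier_L1_measurable) (simp add: Lp1_iff)
  have "AE x in lebesgue. fourier_weighted (approx_freq A f h \<alpha>) x = F2 (approx_freq A f h \<alpha>) x"
    using L by (intro fourier_weighted_0) simp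
  moreover have "AE x in lebesgue. F2 (approx_freq A f h \<alpha>) x = fourier_L1 (approx_freq A f h \<alpha>) x"
    by (rule F2_eq[OF L])
  ultimately show "AE x in lebesgue. approx_solution A f h x $ \<alpha> = fourier_weighted (approx_freq A f h \<alpha>) x"
    by eventually_elim (simp add: fun_cong[OF eq])
qed

text \<open>After multiplication with \<open>(norm z)^2\<close> the difference is
  \<open>repr_symbol\<close> times \<open>1 - (norm z)^2 * h m z\<close>, up to the constant
  \<open>1 / (4 * pi^2)\<close>. Admissibility places this factor between 0 and 1 and lets it tend
  to 0, so \<open>repr_symbol\<close> itself dominates.\<close>

lemma approx_freq_tendsto:
  fixes A :: "real^'n^'n^'N^'N"
  assumes \<nu>: "ellipticity A > 0" and f: "f \<in> Lp 2" and h: "admissible_multipliers h"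
  shows "(\<lambda>m. Lp_norm 2 (\<lambda>z. (norm z)\<^sup>2 *\<^sub>R (approx_freq A f (h m) \<alpha> z - sol_freq A f \<alpha> z))) \<longlonglongrightarrow> 0"
proof -
  let ?c = "- 1 / (4 * pi\<^sup>2)"
  have hs: "schwartz (h m)" for m using h by (simp add: admissible_multipliers_def)
  have hae: "AE x in lebesgue. (\<forall>m. 0 \<le> h m x \<and> h m x \<le> 1 / (norm x)\<^sup>2) \<and> (\<lambda>m. h m x) \<longlonglongrightarrow> 1 / (norm x)\<^sup>2"
    using h by (simp add: admissible_multipliers_def)
  have ae: "AE z in lebesgue. z \<noteq> 0 \<and> (\<forall>m. 0 \<le> h m z \<and> h m z \<le> 1 / (norm z)\<^sup>2) \<and> (\<lambda>m. h m z) \<longlonglongrightarrow> 1 / (norm z)\<^sup>2"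
    using AE_nonzero hae by eventually_elim simp
  have diff: "(norm z)\<^sup>2 *\<^sub>R approx_freq A f (h m) \<alpha> z - (norm z)\<^sup>2 *\<^sub>R sol_freq A f \<alpha> z
      = of_real (?c * ((norm z)\<^sup>2 * h m z - 1)) * repr_symbol A f z $ \<alpha>" if "z \<noteq> 0" for z m
    using that by (simp add: approx_freq_def sol_freq_def scaleR_conv_of_real field_simps)
  have "(\<lambda>m. Lp_norm 2 (\<lambda>z. (norm z)\<^sup>2 *\<^sub>R approx_freq A f (h m) \<alpha> z - (norm z)\<^sup>2 *\<^sub>R sol_freq A f \<alpha> z)) \<longlonglongrightarrow> 0"
  proof (rule Lp2_tendsto_dominated[OF repr_symbol_Lp2(1)[OF \<nu> f]])
    show "(\<lambda>z. (norm z)\<^sup>2 *\<^sub>R approx_freq A f (h m) \<alpha> z) \<in> borel_measurable lebesgue" for m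
      using approx_freq_Lp(2)[OF \<nu> f hs] by (intro Lp2_measurable) (simp add: weighted_L2_def)
    show "(\<lambda>z. (norm z)\<^sup>2 *\<^sub>R sol_freq A f \<alpha> z) \<in> borel_measurable lebesgue"
      using sol_freq_weighted(1)[OF \<nu> f] by (intro Lp2_measurable) (simp add: weighted_L2_def)
    show "AE z in lebesgue. norm ((norm z)\<^sup>2 *\<^sub>R approx_freq A f (h m) \<alpha> z - (norm z)\<^sup>2 *\<^sub>R sol_freq A f \<alpha> z) \<le> norm (repr_symbol A f z $ \<alpha>)" for m
      using ae
    proof eventually_elim
      case (elim z)
      then have "0 \<le> (norm z)\<^sup>2 * h m z" "(norm z)\<^sup>2 * h m z \<le> 1" by (auto simp: field_simps)
      then have "\<bar>?c * ((norm z)\<^sup>2 * h m z - 1)\<bar> \<le> 1 * 1"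
        unfolding abs_mult by (intro mult_mono inverse_4_pi_squared) auto
      then have "\<bar>?c * ((norm z)\<^sup>2 * h m z - 1)\<bar> * norm (repr_symbol A f z $ \<alpha>) \<le> 1 * norm (repr_symbol A f z $ \<alpha>)"
        by (intro mult_right_mono) auto
      moreover have "z \<noteq> 0" using elim by blast
      ultimately show ?case unfolding diff[OF \<open>z \<noteq> 0\<close>] norm_mult norm_of_real by simp
    qed
    show "AE z in lebesgue. (\<lambda>m. (norm z)\<^sup>2 *\<^sub>R approx_freq A f (h m) \<alpha> z) \<longlonglongrightarrow> (norm z)\<^sup>2 *\<^sub>R sol_freq A f \<alpha> z"
      using ae
    proof eventually_elim
      case (elim z)
      then show ?case
        unfolding approx_freq_def sol_freq_def by (intro tendsto_intros) auto
    qed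
  qed
  then show ?thesis by (simp only: scaleR_right_diff_distrib)
qed

text \<open>The Sobolev inequality for the difference of the frequency functions turns
  \<open>approx_freq_tendsto\<close> into norm convergence in the critical space, of which both
  modes are consequences. The limit does not mention \<open>h\<close>, which is its independence of
  the multipliers.\<close>

lemma approx_solution_limit:
  fixes A :: "real^'n^'n^'N^'N"
  assumes n: "CARD('n) \<ge> 5" and \<nu>: "ellipticity A > 0" and f: "f \<in> Lp 2" and h: "admissible_multipliers h"
  shows "weakly_converges_Lp (crit_exp2 TYPE('n)) (\<lambda>m. approx_solution A f (h m)) (\<lambda>x. cvec (sol_part Re A f x))"
    and "ae_converges_subseq (\<lambda>m. approx_solution A f (h m)) (\<lambda>x. cvec (sol_part Re A f x))"
proof -
  let ?p = "crit_exp2 TYPE('n)"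
  let ?V = "\<lambda>m. approx_solution A f (h m)" and ?v = "\<lambda>x. cvec (sol_part Re A f x)"
  let ?g = "\<lambda>m \<alpha> z. approx_freq A f (h m) \<alpha> z - sol_freq A f \<alpha> z"
  have hs: "schwartz (h m)" for m using h by (simp add: admissible_multipliers_def)
  have p: "?p > 1" "?p > 0" using crit_exp_bounds[OF n] by auto
  have n4: "2 * 2 < CARD('n)" using n by simp
  obtain C where C': "C > 0" "\<forall>g :: real^'n \<Rightarrow> complex. weighted_L2 2 g \<longrightarrow> fourier_weighted g \<in> Lp ?p \<and>
       Lp_norm ?p (fourier_weighted g) \<le> C * Lp_norm 2 (\<lambda>z. (norm z)\<^sup>2 *\<^sub>R g z)"
    using sobolev_crit2[OF n] by blast
  note C = C'(1) C'(2)[rule_format]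
  note w = approx_freq_Lp(2)[OF \<nu> f hs] and ws = sol_freq_weighted(1)[OF \<nu> f]
  have wg: "weighted_L2 2 (?g m \<alpha>)" for m \<alpha> by (rule weighted_L2_diff[OF w ws])
  note Vm = approx_solution_fourier(1)[OF \<nu> f hs]
  have v2: "sol_part Re A f \<in> Lp ?p"
    using sol_part_W22_star[OF n \<nu> f bounded_linear_Re] by (simp add: W22_star_def)
  have vm: "(\<lambda>x. ?v x $ \<alpha>) \<in> borel_measurable lebesgue" for \<alpha>
    unfolding cvec_def vec_lambda_beta using v2
    by (intro of_real_measurable vec_comp_measurable) (simp add: Lp_def)
  have V: "?V m \<in> Lp ?p" for m
  proof (rule Lp_sum_bound(1)[of UNIV ?p "\<lambda>\<alpha> x. ?V m x $ \<alpha>"])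
    show "(\<lambda>x. ?V m x $ \<alpha>) \<in> Lp ?p" for \<alpha>
      by (rule Lp_cong_AE[OF p(2) conjunct1[OF C(2)[OF w]] Vm approx_solution_fourier(2)[OF \<nu> f hs]])
    show "?V m \<in> borel_measurable lebesgue" by (intro vec_measurable Vm)
    show "AE x in lebesgue. norm (?V m x) \<le> (\<Sum>\<alpha>\<in>UNIV. norm (?V m x $ \<alpha>))"
      by (intro AE_I2 norm_le_sum_components)
  qed (use p in auto)
  have v: "?v \<in> Lp ?p"
  proof (rule Lp_dominated[OF p(2) v2])
    show "?v \<in> borel_measurable lebesgue" by (intro vec_measurable vm)
    show "norm (?v x) \<le> norm (sol_part Re A f x)" for x
      by (simp add: norm_vec_def cvec_def L2_set_def)
  qed
  \<comment> \<open>The reality of the solution enters here: the approximations are compared with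
    the complex \<open>sol\<close>, which agrees with \<open>?v\<close> almost everywhere.\<close>
  have ae: "AE x in lebesgue. ?V m x $ \<alpha> - ?v x $ \<alpha> = fourier_weighted (?g m \<alpha>) x" for m \<alpha>
    using fourier_weighted_diff[OF w ws n4, of m \<alpha> \<alpha>] approx_solution_fourier(2)[OF \<nu> f hs, of m \<alpha>] sol_real[OF n \<nu> f]
    by eventually_elim (simp add: sol_def)
  have Dm: "(\<lambda>x. ?V m x $ \<alpha> - ?v x $ \<alpha>) \<in> borel_measurable lebesgue" for m \<alpha>
    by (intro borel_measurable_diff Vm vm)
  have D: "(\<lambda>x. ?V m x $ \<alpha> - ?v x $ \<alpha>) \<in> Lp ?p" for m \<alpha>
    by (rule Lp_cong_AE[OF p(2) conjunct1[OF C(2)[OF wg]] Dm ae])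
  have lim: "(\<lambda>m. Lp_norm ?p (\<lambda>x. ?V m x $ \<alpha> - ?v x $ \<alpha>)) \<longlonglongrightarrow> 0" for \<alpha>
  proof (rule tendsto_sandwich[OF always_eventually always_eventually tendsto_const])
    show "\<forall>m. 0 \<le> Lp_norm ?p (\<lambda>x. ?V m x $ \<alpha> - ?v x $ \<alpha>)" by (simp add: Lp_norm_nonneg)
    show "\<forall>m. Lp_norm ?p (\<lambda>x. ?V m x $ \<alpha> - ?v x $ \<alpha>) \<le> C * Lp_norm 2 (\<lambda>z. (norm z)\<^sup>2 *\<^sub>R ?g m \<alpha> z)"
    proof
      fix m
      have "fourier_weighted (?g m \<alpha>) \<in> borel_measurable lebesgue" using C(2)[OF wg] by (simp add: Lp_def)
      from Lp_norm_cong_AE[OF Dm this ae]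
      show "Lp_norm ?p (\<lambda>x. ?V m x $ \<alpha> - ?v x $ \<alpha>) \<le> C * Lp_norm 2 (\<lambda>z. (norm z)\<^sup>2 *\<^sub>R ?g m \<alpha> z)"
        using C(2)[OF wg] by simp
    qed
    show "(\<lambda>m. C * Lp_norm 2 (\<lambda>z. (norm z)\<^sup>2 *\<^sub>R ?g m \<alpha> z)) \<longlonglongrightarrow> 0"
      using tendsto_mult[OF tendsto_const[of C] approx_freq_tendsto[OF \<nu> f h, of \<alpha>]] by simp
  qed
  show "weakly_converges_Lp ?p ?V ?v" "ae_converges_subseq ?V ?v"
    by (intro Lp_limit_weak_and_ae[OF p(1) V v D lim])+
qed

text \<open>The two Sobolev bounds acquire the crude factors of \<open>Lp_sum_bound\<close> for
  \<open>CARD('N)\<close> and \<open>CARD('N \<times> 'n)\<close> components. The Hessian is bounded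
  by \<open>W22_star_estimate\<close> instead, which contributes
  \<open>1 / ellipticity A\<close>.\<close>

lemma sol_estimates:
  fixes A :: "real^'n^'n^'N^'N"
  assumes n: "CARD('n) \<ge> 5" and \<nu>: "ellipticity A > 0"
  obtains K where "K > 0" "\<And>f. f \<in> Lp 2 \<Longrightarrow>
    Lp_norm (crit_exp2 TYPE('n)) (sol_part Re A f) + Lp_norm (crit_exp1 TYPE('n)) (weak_grad (sol_part Re A f))
         + Lp_norm 2 (weak_hess (sol_part Re A f)) \<le> K * Lp_norm 2 f"
proof -
  let ?p2 = "crit_exp2 TYPE('n)" and ?p1 = "crit_exp1 TYPE('n)"
  have p: "?p2 > 0" "?p1 > 0" using crit_exp_bounds[OF n] by auto
  obtain C2 where C2: "C2 > 0" "\<forall>f \<alpha>. f \<in> Lp 2 \<longrightarrow> sol A f \<alpha> \<in> Lp ?p2 \<and>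
    Lp_norm ?p2 (sol A f \<alpha>) \<le> C2 * (symbol_constant A * Lp_norm 2 f)"
    using sol_Lp[OF n \<nu>] by blast
  obtain C1 where C1: "C1 > 0" "\<forall>f \<alpha> j. f \<in> Lp 2 \<longrightarrow> sol_grad A f \<alpha> j \<in> Lp ?p1 \<and>
    Lp_norm ?p1 (sol_grad A f \<alpha> j) \<le> C1 * (symbol_constant A * Lp_norm 2 f)"
    using sol_grad_Lp[OF n \<nu>] by blast
  have s: "symbol_constant A \<ge> 0" unfolding symbol_constant_def using \<nu> by simp
  define K2 where "K2 = real CARD('N) * real CARD('N) powr (1 / ?p2)"
  define K1 where "K1 = real CARD('N \<times> 'n) * real CARD('N \<times> 'n) powr (1 / ?p1)"
  have K: "K2 \<ge> 0" "K1 \<ge> 0" unfolding K1_def K2_def by simp_all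
  show ?thesis
  proof (rule that[of "K2 * (C2 * symbol_constant A) + K1 * (C1 * symbol_constant A) + 1 / ellipticity A"])
    show "K2 * (C2 * symbol_constant A) + K1 * (C1 * symbol_constant A) + 1 / ellipticity A > 0"
      using K C1(1) C2(1) s \<nu> by (intro add_nonneg_pos add_nonneg_nonneg mult_nonneg_nonneg) auto
    fix f :: "real^'n \<Rightarrow> real^'N" assume f: "f \<in> Lp 2"
    let ?u = "sol_part Re A f" and ?B2 = "C2 * (symbol_constant A * Lp_norm 2 f)" and ?B1 = "C1 * (symbol_constant A * Lp_norm 2 f)"
    have B0: "?B2 \<ge> 0" "?B1 \<ge> 0" using C1(1) C2(1) s by (auto intro!: mult_nonneg_nonneg simp: Lp_norm_nonneg)
    note d = sol_part_derivatives[OF n \<nu> f bounded_linear_Re]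
      and W = W22_star_weak_partials[OF sol_part_W22_star[OF n \<nu> f bounded_linear_Re]]
    have Pu: "(\<lambda>x. Re (sol A f \<alpha> x)) \<in> Lp ?p2" "Lp_norm ?p2 (\<lambda>x. Re (sol A f \<alpha> x)) \<le> ?B2" for \<alpha>
    proof -
      show *: "(\<lambda>x. Re (sol A f \<alpha> x)) \<in> Lp ?p2"
        using C2(2)[rule_format, OF f] by (intro Lp_bounded_linear bounded_linear_Re p) blast
      show "Lp_norm ?p2 (\<lambda>x. Re (sol A f \<alpha> x)) \<le> ?B2"
        using Lp_norm_nonexpansive[OF p(1) conjunct1[OF C2(2)[rule_format, OF f]] * abs_Re_le_cmod] C2(2)[rule_format, OF f, of \<alpha>] by linarith
    qed
    have Pg: "(\<lambda>x. Re (sol_grad A f \<alpha> j x)) \<in> Lp ?p1" "Lp_norm ?p1 (\<lambda>x. Re (sol_grad A f \<alpha> j x)) \<le> ?B1" for \<alpha> j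
    proof -
      show *: "(\<lambda>x. Re (sol_grad A f \<alpha> j x)) \<in> Lp ?p1"
        using C1(2)[rule_format, OF f] by (intro Lp_bounded_linear bounded_linear_Re p) blast
      show "Lp_norm ?p1 (\<lambda>x. Re (sol_grad A f \<alpha> j x)) \<le> ?B1"
        using Lp_norm_nonexpansive[OF p(2) conjunct1[OF C1(2)[rule_format, OF f]] * abs_Re_le_cmod] C1(2)[rule_format, OF f, of \<alpha> j] by linarith
    qed
    have "Lp_norm ?p2 ?u \<le> K2 * ?B2"
      unfolding K2_def
    proof (rule Lp_sum_bound(2)[of UNIV ?p2 "\<lambda>\<alpha> x. Re (sol A f \<alpha> x)"])
      show "?u \<in> borel_measurable lebesgue" using W(3) by (simp add: Lp_def)
      show "AE x in lebesgue. norm (?u x) \<le> (\<Sum>\<alpha>\<in>UNIV. norm (Re (sol A f \<alpha> x)))"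
        using norm_le_sum_components[of "?u _"] by (intro AE_I2) (simp add: sol_part_def)
    qed (use Pu p B0 in auto)
    moreover have "Lp_norm ?p1 (weak_grad ?u) \<le> K1 * ?B1"
      unfolding K1_def
    proof (rule Lp_sum_bound(2)[of "UNIV :: ('N \<times> 'n) set" ?p1 "\<lambda>q x. Re (sol_grad A f (fst q) (snd q) x)"])
      show "weak_grad ?u \<in> borel_measurable lebesgue" using W(4) by (simp add: Lp_def)
      have "AE x in lebesgue. \<forall>q. weak_grad ?u x $ fst q $ snd q = Re (sol_grad A f (fst q) (snd q) x)"
        unfolding AE_all_countable by (intro allI d)
      then show "AE x in lebesgue. norm (weak_grad ?u x) \<le> (\<Sum>q\<in>UNIV. norm (Re (sol_grad A f (fst q) (snd q) x)))"
      proof eventually_elim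
        case (elim x)
        have "norm (weak_grad ?u x) \<le> (\<Sum>\<alpha>\<in>UNIV. \<Sum>j\<in>UNIV. norm (weak_grad ?u x $ \<alpha> $ j))"
          by (intro order.trans[OF norm_le_sum_components] sum_mono norm_le_sum_components)
        also have "\<dots> = (\<Sum>q\<in>UNIV. norm (weak_grad ?u x $ fst q $ snd q))"
          by (simp add: sum.cartesian_product case_prod_unfold flip: UNIV_Times_UNIV)
        finally show ?case using elim by simp
      qed
    qed (use Pg p B0 in auto)
    moreover have "Lp_norm 2 (weak_hess ?u) \<le> 1 / ellipticity A * Lp_norm 2 f"
    proof -
      have "Lp_norm 2 (\<lambda>x. contract2 A (weak_hess ?u x)) = Lp_norm 2 f"
        using W(5) f sol_part_equation[OF n \<nu> f bounded_linear_Re]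
        by (intro Lp_norm_2_cong_AE vec_measurable Lp2_measurable contract2_Lp2) (auto simp: Lp2_iff)
      then show ?thesis
        using W22_star_estimate[OF \<nu> sol_part_W22_star[OF n \<nu> f bounded_linear_Re]] by simp
    qed
    ultimately have "Lp_norm ?p2 ?u + Lp_norm ?p1 (weak_grad ?u) + Lp_norm 2 (weak_hess ?u)
       \<le> K2 * ?B2 + K1 * ?B1 + 1 / ellipticity A * Lp_norm 2 f" by linarith
    also have "\<dots> = (K2 * (C2 * symbol_constant A) + K1 * (C1 * symbol_constant A) + 1 / ellipticity A) * Lp_norm 2 f"
      by (simp add: algebra_simps)
    finally show "Lp_norm ?p2 ?u + Lp_norm ?p1 (weak_grad ?u) + Lp_norm 2 (weak_hess ?u)
       \<le> (K2 * (C2 * symbol_constant A) + K1 * (C1 * symbol_constant A) + 1 / ellipticity A) * Lp_norm 2 f" .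
  qed
qed

theorem theorem11:
  fixes A :: "real^'n^'n^'N^'N"
  assumes "CARD('n) \<ge> 5"
    and "CARD('N) \<ge> 2"
    and "A \<in> sym_tensors"
    and "rank_one_positive A"
  shows "\<exists>C>0. \<forall>f :: real^'n \<Rightarrow> real^'N. f \<in> Lp 2 \<longrightarrow>
    (\<exists>u\<in>W22_star.
       (AE x in lebesgue. contract2 A (weak_hess u x) = f x) \<and>
       (\<forall>v\<in>W22_star. (AE x in lebesgue. contract2 A (weak_hess v x) = f x) \<longrightarrow>
          (AE x in lebesgue. v x = u x)) \<and>
       Lp_norm (crit_exp2 TYPE('n)) u + Lp_norm (crit_exp1 TYPE('n)) (weak_grad u)
         + Lp_norm 2 (weak_hess u) \<le> C * Lp_norm 2 f \<and>
       Lp_norm 2 (weak_hess u)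
         \<le> 1 / ellipticity A * Lp_norm 2 (\<lambda>x. contract2 A (weak_hess u x)) \<and>
       (\<forall>h. admissible_multipliers h \<longrightarrow>
          weakly_converges_Lp (crit_exp2 TYPE('n))
            (\<lambda>m. approx_solution A f (h m)) (\<lambda>x. cvec (u x)) \<and>
          ae_converges_subseq (\<lambda>m. approx_solution A f (h m)) (\<lambda>x. cvec (u x))))"
proof -
  note n = assms(1)
  have \<nu>: "ellipticity A > 0" using assms(4) by (simp add: rank_one_positive_def)
  \<comment> \<open>Fixed before \<open>f\<close>, so that it depends on \<open>A\<close> and the
    dimensions only.\<close>
  obtain K where K: "K > 0" "\<And>f. f \<in> Lp 2 \<Longrightarrow>
    Lp_norm (crit_exp2 TYPE('n)) (sol_part Re A f) + Lp_norm (crit_exp1 TYPE('n)) (weak_grad (sol_part Re A f))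
         + Lp_norm 2 (weak_hess (sol_part Re A f)) \<le> K * Lp_norm 2 f"
    using sol_estimates[OF n \<nu>] by blast
  show ?thesis
  proof (intro exI[of _ K] conjI K(1) allI impI)
    fix f :: "real^'n \<Rightarrow> real^'N" assume f: "f \<in> Lp 2"
    let ?u = "sol_part Re A f"
    have W: "?u \<in> W22_star" by (rule sol_part_W22_star[OF n \<nu> f bounded_linear_Re])
    have eq: "AE x in lebesgue. contract2 A (weak_hess ?u x) = f x"
      by (rule sol_part_equation[OF n \<nu> f bounded_linear_Re]) simp
    show "\<exists>u\<in>W22_star.
       (AE x in lebesgue. contract2 A (weak_hess u x) = f x) \<and>
       (\<forall>v\<in>W22_star. (AE x in lebesgue. contract2 A (weak_hess v x) = f x) \<longrightarrow>
          (AE x in lebesgue. v x = u x)) \<and>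
       Lp_norm (crit_exp2 TYPE('n)) u + Lp_norm (crit_exp1 TYPE('n)) (weak_grad u)
         + Lp_norm 2 (weak_hess u) \<le> K * Lp_norm 2 f \<and>
       Lp_norm 2 (weak_hess u)
         \<le> 1 / ellipticity A * Lp_norm 2 (\<lambda>x. contract2 A (weak_hess u x)) \<and>
       (\<forall>h. admissible_multipliers h \<longrightarrow>
          weakly_converges_Lp (crit_exp2 TYPE('n))
            (\<lambda>m. approx_solution A f (h m)) (\<lambda>x. cvec (u x)) \<and>
          ae_converges_subseq (\<lambda>m. approx_solution A f (h m)) (\<lambda>x. cvec (u x)))"
    proof (intro bexI[of _ ?u] conjI ballI allI impI W eq K(2) f W22_star_estimate[OF \<nu> W]
        approx_solution_limit[OF n \<nu> f])
      fix v assume v: "v \<in> W22_star" "AE x in lebesgue. contract2 A (weak_hess v x) = f x"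
      have "AE x in lebesgue. contract2 A (weak_hess v x) = contract2 A (weak_hess ?u x)"
        using v(2) eq by eventually_elim simp
      then show "AE x in lebesgue. v x = ?u x"
        by (rule W22_star_unique[OF n \<nu> W v(1)])
    qed
  qed
qed

end
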